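(* Let $(\mathscr{C},\mathbb{E},\mathfrak{s})$ be a small extriangulated category and let $\mathscr{S}$ be a set of morphisms of $\mathscr{C}$ satisfying (M0): $\mathscr{S}$ contains all isomorphisms of $\mathscr{C}$, is closed under composition, and is closed under finite direct sums (if $f_i\in\mathscr{S}(X_i,Y_i)$ for $i=1,2$, then $f_1\oplus f_2\in\mathscr{S}(X_1\oplus X_2,Y_1\oplus Y_2)$). Let $\mathcal{N}_{\mathscr{S}}$, $p\colon\mathscr{C}\to\overline{\mathscr{C}}=\mathscr{C}/[\mathcal{N}_{\mathscr{S}}]$, $\overline{f}=p(f)$ and $\overline{\mathscr{S}}$ be as defined in the context, and let $Q\colon\mathscr{C}\to\widetilde{\mathscr{C}}$ be the localization of $\mathscr{C}$ by $\mathscr{S}$. (1) Suppose that $\overline{\mathscr{S}}$ satisfies: (MR1) $\overline{\mathscr{S}}$ satisfies 2-out-of-3 with respect to compositions in $\overline{\mathscr{C}}$. (MR2) $\overline{\mathscr{S}}$ is a multiplicative system in $\overline{\mathscr{C}}$. (MR3) For any $\mathfrak{s}$-triangles $\langle A\xrightarrow{x}B\xrightarrow{y}C,\delta\rangle$ and $\langle A'\xrightarrow{x'}B'\xrightarrow{y'}C',\delta'\rangle$ and any $a\in\mathscr{C}(A,A')$, $c\in\mathscr{C}(C,C')$ with $a_*\delta=c^*\delta'$, if $\overline{a},\overline{c}\in\overline{\mathscr{S}}$, then there is $\mathbf{b}\in\overline{\mathscr{S}}(B,B')$ with $\mathbf{b}\circ\overline{x}=\overline{x'}\circ\overline{a}$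 and $\overline{c}\circ\overline{y}=\overline{y'}\circ\mathbf{b}$. Then there are a biadditive functor $\widetilde{\mathbb{E}}\colon\widetilde{\mathscr{C}}^{\mathrm{op}}\times\widetilde{\mathscr{C}}\to\mathrm{Ab}$ and a map $\widetilde{\mathfrak{s}}$ making $(\widetilde{\mathscr{C}},\widetilde{\mathbb{E}},\widetilde{\mathfrak{s}})$ a weakly extriangulated category, together with an exact functor $(Q,\mu)\colon(\mathscr{C},\mathbb{E},\mathfrak{s})\to(\widetilde{\mathscr{C}},\widetilde{\mathbb{E}},\widetilde{\mathfrak{s}})$. (2) The exact functor $(Q,\mu)$ obtained in (1) has, and is characterized by, the following universality. (i) For any exact functor $(F,\phi)\colon(\mathscr{C},\mathbb{E},\mathfrak{s})\to(\mathscr{D},\mathbb{F},\mathfrak{t})$ to a weakly extriangulated category such that $F(s)$ is an isomorphism for every $s\in\mathscr{S}$, there exists a unique exact functor $(\widetilde{F},\widetilde{\phi})\colon(\widetilde{\mathscr{C}},\widetilde{\mathbb{E}},\widetilde{\mathfrak{s}})\to(\mathscr{D},\mathbb{F},\mathfrak{t})$ with $(F,\phi)=(\widetilde{F},\widetilde{\phi})\circ(Q,\mu)$. (ii) For any pair of exact functors $(F,\phi),(G,\psi)\colon(\mathscr{C},\mathbb{E},\mathfrak{s})\to(\mathscr{D},\mathbb{F},\mathfrak{t})$ sending every $s\in\mathscr{S}$ to isomorphisms, with $(\widetilde{F},\widetilde{\phi}),(\widetilde{G},\widetilde{\psi})$ the exact functors obtained in (i), and any natural transformation $\eta\colon(F,\phi)\Rightarrow(G,\psi)$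 of exact functors, there uniquely exists a natural transformation of exact functors $\widetilde{\eta}\colon(\widetilde{F},\widetilde{\phi})\Rightarrow(\widetilde{G},\widetilde{\psi})$ satisfying $\eta=\widetilde{\eta}\circ(Q,\mu)$. (3) If $\overline{\mathscr{S}}$ satisfies (MR1), (MR2), (MR3) and moreover (MR4) $\overline{\mathcal{M}}_{\mathsf{inf}}=\{\mathbf{v}\circ\overline{x}\circ\mathbf{u}\mid x\text{ is an }\mathfrak{s}\text{-inflation},\ \mathbf{u},\mathbf{v}\in\overline{\mathscr{S}}\}$ is closed under composition in $\overline{\mathscr{C}}$ and, dually, $\overline{\mathcal{M}}_{\mathsf{def}}=\{\mathbf{v}\circ\overline{y}\circ\mathbf{u}\mid y\text{ is an }\mathfrak{s}\text{-deflation},\ \mathbf{u},\mathbf{v}\in\overline{\mathscr{S}}\}$ is closed under composition, then $(\widetilde{\mathscr{C}},\widetilde{\mathbb{E}},\widetilde{\mathfrak{s}})$ is extriangulated.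
   Context: Extriangulated categories. Let $\mathscr{C}$ be an additive category and $\mathbb{E}\colon\mathscr{C}^{\mathrm{op}}\times\mathscr{C}\to\mathrm{Ab}$ a biadditive functor. For $\delta\in\mathbb{E}(C,A)$, $a\in\mathscr{C}(A,A')$, $c\in\mathscr{C}(C',C)$ write $a_*\delta=\mathbb{E}(C,a)(\delta)$, $c^*\delta=\mathbb{E}(c,A)(\delta)$. Sequences $A\xrightarrow{x}B\xrightarrow{y}C$ and $A\xrightarrow{x'}B'\xrightarrow{y'}C$ are equivalent if there is an isomorphism $b\colon B\to B'$ with $bx=x'$ and $y'b=y$; $[A\xrightarrow{x}B\xrightarrow{y}C]$ denotes the equivalence class. Let $\mathfrak{s}$ be a map assigning to each $\delta\in\mathbb{E}(C,A)$ an equivalence class $\mathfrak{s}(\delta)=[A\xrightarrow{x}B\xrightarrow{y}C]$. In this situation $A\xrightarrow{x}B\xrightarrow{y}C$ is an $\mathfrak{s}$-conflation, $x$ an $\mathfrak{s}$-inflation, $y$ an $\mathfrak{s}$-deflation, and the pair $\langle A\xrightarrow{x}B\xrightarrow{y}C,\delta\rangle$ an $\mathfrak{s}$-triangle. A morphism of $\mathfrak{s}$-triangles from $\langle A\xrightarrow{x}B\xrightarrow{y}C,\delta\rangle$ to $\langle A'\xrightarrow{x'}B'\xrightarrow{y'}C',\delta'\rangle$ is a triple $(a,b,c)$ with $bx=x'a$, $cy=y'b$, $a_*\delta=c^*\delta'$. The triple $(\mathscr{C},\mathbb{E},\mathfrak{s})$ is weakly extriangulated if: (C1) for every $\mathfrak{s}$-triangle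 $\langle A\xrightarrow{x}B\xrightarrow{y}C,\delta\rangle$ and object $X$ the sequence $\mathscr{C}(X,A)\to\mathscr{C}(X,B)\to\mathscr{C}(X,C)\to\mathbb{E}(X,A)$ with maps $x\circ-$, $y\circ-$, $f\mapsto f^*\delta$ is exact; (C1') dually $\mathscr{C}(C,X)\to\mathscr{C}(B,X)\to\mathscr{C}(A,X)\to\mathbb{E}(C,X)$ with maps $-\circ y$, $-\circ x$, $g\mapsto g_*\delta$ is exact; (C2) $0\in\mathbb{E}(0,A)$ has $\mathfrak{s}(0)=[A\xrightarrow{\mathrm{id}}A\to0]$; (C2') $0\in\mathbb{E}(A,0)$ has $\mathfrak{s}(0)=[0\to A\xrightarrow{\mathrm{id}}A]$; (C3) for every $\mathfrak{s}$-triangle $\langle A\xrightarrow{x}B\xrightarrow{y}C,\delta\rangle$, every $a\in\mathscr{C}(A,A')$ and every $\mathfrak{s}$-triangle $\langle A'\xrightarrow{x'}B'\xrightarrow{y'}C,a_*\delta\rangle$ there is $b\colon B\to B'$ such that $(a,b,\mathrm{id}_C)$ is a morphism of $\mathfrak{s}$-triangles and $A\xrightarrow{\left[\begin{smallmatrix}x\\ a\end{smallmatrix}\right]}B\oplus A'\xrightarrow{[b\ -x']}B'$ with $y'^*\delta$ is an $\mathfrak{s}$-triangle; (C3') for every $\mathfrak{s}$-triangle $\langle A\xrightarrow{x}B\xrightarrow{y}C,\delta\rangle$, every $c\in\mathscr{C}(C',C)$ and every $\mathfrak{s}$-triangle $\langle A\xrightarrow{x'}B'\xrightarrow{y'}C',c^*\delta\rangle$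 there is $b\colon B'\to B$ such that $(\mathrm{id}_A,b,c)$ is a morphism of $\mathfrak{s}$-triangles and $B'\xrightarrow{\left[\begin{smallmatrix}-y'\\ b\end{smallmatrix}\right]}C'\oplus B\xrightarrow{[c\ y]}C$ with $x'_*\delta$ is an $\mathfrak{s}$-triangle. It is extriangulated if moreover $\mathfrak{s}$-inflations are closed under composition (C4) and $\mathfrak{s}$-deflations are closed under composition (C4'). Exact functors. An exact functor $(F,\phi)\colon(\mathscr{C},\mathbb{E},\mathfrak{s})\to(\mathscr{C}',\mathbb{E}',\mathfrak{s}')$ of weakly extriangulated categories is an additive functor $F$ with a natural transformation $\phi\colon\mathbb{E}\Rightarrow\mathbb{E}'\circ(F^{\mathrm{op}}\times F)$ such that $\mathfrak{s}'(\phi_{C,A}(\delta))=[F(A)\xrightarrow{F(x)}F(B)\xrightarrow{F(y)}F(C)]$ for every $\mathfrak{s}$-triangle $\langle A\xrightarrow{x}B\xrightarrow{y}C,\delta\rangle$. Composition: $(F',\phi')\circ(F,\phi)=(F'\circ F,(\phi'\circ(F^{\mathrm{op}}\times F))\cdot\phi)$. A natural transformation of exact functors $\eta\colon(F,\phi)\Rightarrow(G,\psi)$ is a natural transformation $\eta\colon F\Rightarrow G$ with $(\eta_A)_*\phi_{C,A}(\delta)=(\eta_C)^*\psi_{C,A}(\delta)$ for all $\delta\in\mathbb{E}(C,A)$. Then $\widetilde{\eta}\circ(Q,\mu)$ is the whiskering $\widetilde\eta\circ Q$. Notation for $\mathscr{S}$. $\mathscr{S}(X,Y)=\mathscr{S}\cap\mathscr{C}(X,Y)$.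 $\mathcal{N}_{\mathscr{S}}\subseteq\mathscr{C}$ is the full subcategory of objects $N$ such that both $N\to0$ and $0\to N$ belong to $\mathscr{S}$ (an additive subcategory). $p\colon\mathscr{C}\to\overline{\mathscr{C}}=\mathscr{C}/[\mathcal{N}_{\mathscr{S}}]$ is the ideal quotient by the ideal of morphisms factoring through an object of $\mathcal{N}_{\mathscr{S}}$, and $\overline{f}=p(f)$. $\overline{\mathscr{S}}$ is the closure of $p(\mathscr{S})$ under composition with isomorphisms of $\overline{\mathscr{C}}$, i.e. the set of morphisms $\beta\circ p(s)\circ\alpha$ with $s\in\mathscr{S}$ and $\alpha,\beta$ isomorphisms of $\overline{\mathscr{C}}$. A multiplicative system is a set $W$ of morphisms containing identities, closed under composition, such that (Ore) every $X'\xleftarrow{s}X\xrightarrow{f}Y$ with $s\in W$ can be completed to a commutative square $s'f=f's$ with $s'\in W$, and dually; and (cancellation) for parallel $f,g$: $fs=gs$ for some $s\in W$ if and only if $tf=tg$ for some $t\in W$. *)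

theory Defs
  imports "HOL-Algebra.Coset"
begin

section \<open>Categories, functors and localization\<close>

record ('o, 'm) cat =
  Ob :: "'o set"
  Mor :: "'m set"
  Dom :: "'m \<Rightarrow> 'o"
  Cod :: "'m \<Rightarrow> 'o"
  Idt :: "'o \<Rightarrow> 'm"
  Cmp :: "'m \<Rightarrow> 'm \<Rightarrow> 'm"  (infixr \<open>\<cdot>\<index>\<close> 70)

definition Hom :: "('o, 'm, 'z) cat_scheme \<Rightarrow> 'o \<Rightarrow> 'o \<Rightarrow> 'm set"
  where "Hom C X Y = {f \<in> Mor C. Dom C f = X \<and> Cod C f = Y}"

locale category =
  fixes C :: "('o, 'm, 'z) cat_scheme" (structure)
  assumes Dom_closed: "f \<in> Mor C \<Longrightarrow> Dom C f \<in> Ob C"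
    and Cod_closed: "f \<in> Mor C \<Longrightarrow> Cod C f \<in> Ob C"
    and Idt_closed: "X \<in> Ob C \<Longrightarrow> Idt C X \<in> Hom C X X"
    and Cmp_closed: "f \<in> Hom C X Y \<Longrightarrow> g \<in> Hom C Y Z \<Longrightarrow> g \<cdot> f \<in> Hom C X Z"
    and Cmp_Idt_left: "f \<in> Hom C X Y \<Longrightarrow> Idt C Y \<cdot> f = f"
    and Cmp_Idt_right: "f \<in> Hom C X Y \<Longrightarrow> f \<cdot> Idt C X = f"
    and Cmp_assoc: "f \<in> Hom C X Y \<Longrightarrow> g \<in> Hom C Y Z \<Longrightarrow> h \<in> Hom C Z W
                    \<Longrightarrow> (h \<cdot> g) \<cdot> f = h \<cdot> (g \<cdot> f)"

definition inverse_pair :: "('o, 'm, 'z) cat_scheme \<Rightarrow> 'm \<Rightarrow> 'm \<Rightarrow> bool"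
  where "inverse_pair C f g \<longleftrightarrow> f \<in> Mor C \<and> g \<in> Hom C (Cod C f) (Dom C f)
           \<and> g \<cdot>\<^bsub>C\<^esub> f = Idt C (Dom C f) \<and> f \<cdot>\<^bsub>C\<^esub> g = Idt C (Cod C f)"

definition isomorphism :: "('o, 'm, 'z) cat_scheme \<Rightarrow> 'm \<Rightarrow> bool"
  where "isomorphism C f \<longleftrightarrow> (\<exists>g. inverse_pair C f g)"

record ('o, 'm, 'p, 'n) cat_map =
  obj_map :: "'o \<Rightarrow> 'p"
  mor_map :: "'m \<Rightarrow> 'n"

definition is_functor ::
  "('o, 'm, 'z) cat_scheme \<Rightarrow> ('p, 'n, 'y) cat_scheme \<Rightarrow> ('o, 'm, 'p, 'n, 'x) cat_map_scheme \<Rightarrow> bool"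
  where "is_functor C D F \<longleftrightarrow>
    (\<forall>X\<in>Ob C. obj_map F X \<in> Ob D) \<and>
    (\<forall>f\<in>Mor C. mor_map F f \<in> Hom D (obj_map F (Dom C f)) (obj_map F (Cod C f))) \<and>
    (\<forall>X\<in>Ob C. mor_map F (Idt C X) = Idt D (obj_map F X)) \<and>
    (\<forall>X Y Z. \<forall>f\<in>Hom C X Y. \<forall>g\<in>Hom C Y Z.
        mor_map F (g \<cdot>\<^bsub>C\<^esub> f) = mor_map F g \<cdot>\<^bsub>D\<^esub> mor_map F f)"

definition inverts ::
  "('p, 'n, 'y) cat_scheme \<Rightarrow> ('o, 'm, 'p, 'n, 'x) cat_map_scheme \<Rightarrow> 'm set \<Rightarrow> bool"
  where "inverts D F S \<longleftrightarrow> (\<forall>s\<in>S. isomorphism D (mor_map F s))"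

text \<open>
  The localization of \<open>C\<close> by \<open>S\<close> is the category of zigzags: its objects are those of \<open>C\<close>, and its
  morphisms are the classes of composable words in the letters \<^term>\<open>Inl f\<close> (an arrow \<open>f\<close> of \<open>C\<close>) and
  \<^term>\<open>Inr s\<close> (a formal inverse of \<open>s \<in> S\<close>), modulo the congruence generated by the rules
  \<open>reduct\<close>. Words are read in diagrammatic order. Both ends of a class are recorded, because
  the empty word fits every object. The universal property is proved below as
  \<open>localization_universal\<close>.
\<close>

inductive zigzag :: "('o, 'm, 'z) cat_scheme \<Rightarrow> 'm set \<Rightarrow> 'o \<Rightarrow> ('m + 'm) list \<Rightarrow> 'o \<Rightarrow> bool"
  for C S where
  zigzag_Nil: "X \<in> Ob C \<Longrightarrow> zigzag C S X [] X"
| zigzag_fwd: "f \<in> Mor C \<Longrightarrow> zigzag C S (Cod C f) w Y \<Longrightarrow> zigzag C S (Dom C f) (Inl f # w) Y"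
| zigzag_bwd: "s \<in> S \<Longrightarrow> zigzag C S (Dom C s) w Y \<Longrightarrow> zigzag C S (Cod C s) (Inr s # w) Y"

inductive reduct :: "('o, 'm, 'z) cat_scheme \<Rightarrow> 'm set \<Rightarrow> ('m + 'm) list \<Rightarrow> ('m + 'm) list \<Rightarrow> bool"
  for C S where
  reduct_Cmp: "f \<in> Hom C X Y \<Longrightarrow> g \<in> Hom C Y Z \<Longrightarrow> reduct C S [Inl f, Inl g] [Inl (g \<cdot>\<^bsub>C\<^esub> f)]"
| reduct_Idt: "X \<in> Ob C \<Longrightarrow> reduct C S [Inl (Idt C X)] []"
| reduct_inv1: "s \<in> S \<Longrightarrow> reduct C S [Inl s, Inr s] []"
| reduct_inv2: "s \<in> S \<Longrightarrow> reduct C S [Inr s, Inl s] []"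

definition zz_step ::
  "('o, 'm, 'z) cat_scheme \<Rightarrow> 'm set \<Rightarrow> 'o \<Rightarrow> 'o \<Rightarrow> (('m + 'm) list \<times> ('m + 'm) list) set"
  where "zz_step C S X Y = {(u @ l @ v, u @ r @ v) | u l r v.
           reduct C S l r \<and> zigzag C S X (u @ l @ v) Y \<and> zigzag C S X (u @ r @ v) Y}"

definition zz_class ::
  "('o, 'm, 'z) cat_scheme \<Rightarrow> 'm set \<Rightarrow> 'o \<Rightarrow> ('m + 'm) list \<Rightarrow> 'o \<Rightarrow> ('m + 'm) list set"
  where "zz_class C S X w Y = (zz_step C S X Y \<union> (zz_step C S X Y)\<inverse>)\<^sup>* `` {w}"

type_synonym ('o, 'm) loc_mor = "'o \<times> ('m + 'm) list set \<times> 'o"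

definition localization :: "('o, 'm, 'z) cat_scheme \<Rightarrow> 'm set \<Rightarrow> ('o, ('o, 'm) loc_mor) cat"
  where "localization C S =
    \<lparr>Ob = Ob C,
     Mor = {(X, zz_class C S X w Y, Y) | X w Y. zigzag C S X w Y},
     Dom = (\<lambda>(X, U, Y). X),
     Cod = (\<lambda>(X, U, Y). Y),
     Idt = (\<lambda>X. (X, zz_class C S X [] X, X)),
     Cmp = (\<lambda>(Y', V, Z) (X, U, Y). (X, \<Union>u\<in>U. \<Union>v\<in>V. zz_class C S X (u @ v) Z, Z))\<rparr>"

definition loc_functor ::
  "('o, 'm, 'z) cat_scheme \<Rightarrow> 'm set \<Rightarrow> ('o, 'm, 'o, ('o, 'm) loc_mor) cat_map"
  where "loc_functor C S =
    \<lparr>obj_map = (\<lambda>X. X),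
     mor_map = (\<lambda>f. (Dom C f, zz_class C S (Dom C f) [Inl f] (Cod C f), Cod C f))\<rparr>"

subsection \<open>The universal property of the localization\<close>

lemma Hom_iff: "f \<in> Hom C X Y \<longleftrightarrow> f \<in> Mor C \<and> Dom C f = X \<and> Cod C f = Y"
  by (simp add: Hom_def)

lemma zigzag_append: "zigzag C S X u Y \<Longrightarrow> zigzag C S Y v Z \<Longrightarrow> zigzag C S X (u @ v) Z"
  by (induction rule: zigzag.induct) (auto intro: zigzag.intros)

inductive_cases zigzag_NilE: "zigzag C S X [] Y"
inductive_cases zigzag_fwdE: "zigzag C S X (Inl f # w) Y"
inductive_cases zigzag_bwdE: "zigzag C S X (Inr s # w) Y"

lemma zigzag_Cod_unique: "zigzag C S X w Y \<Longrightarrow> zigzag C S X w Y' \<Longrightarrow> Y' = Y"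
proof (induction arbitrary: Y' rule: zigzag.induct)
  case (zigzag_Nil X)
  then show ?case by (elim zigzag_NilE) simp
next
  case (zigzag_fwd f w Y)
  then show ?case by (elim zigzag_fwdE)
next
  case (zigzag_bwd s w Y)
  then show ?case by (elim zigzag_bwdE)
qed

lemma zigzag_split:
  "zigzag C S X (u @ v) Z \<Longrightarrow> category C \<Longrightarrow> S \<subseteq> Mor C \<Longrightarrow> \<exists>Y. zigzag C S X u Y \<and> zigzag C S Y v Z"
proof (induction u arbitrary: X)
  case Nil
  have "X \<in> Ob C" using Nil.prems
    by (cases rule: zigzag.cases) (auto intro: category.Dom_closed category.Cod_closed)
  then show ?case using Nil by (auto intro: zigzag_Nil)
next
  case (Cons a u)
  from Cons.prems(1) show ?case
  proof (cases rule: zigzag.cases)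
    case (zigzag_fwd f w)
    then show ?thesis using Cons by (fastforce intro: zigzag.intros)
  next
    case (zigzag_bwd s w)
    then show ?thesis using Cons by (fastforce intro: zigzag.intros)
  qed simp
qed

lemma zz_class_self: "w \<in> zz_class C S X w Y"
  by (simp add: zz_class_def)

lemma zz_class_eqI: "w' \<in> zz_class C S X w Y \<Longrightarrow> zz_class C S X w' Y = zz_class C S X w Y"
proof -
  let ?R = "(zz_step C S X Y \<union> (zz_step C S X Y)\<inverse>)\<^sup>*"
  assume "w' \<in> zz_class C S X w Y"
  then have 1: "(w, w') \<in> ?R" by (simp add: zz_class_def)
  have "sym ?R" by (rule sym_rtrancl) (rule sym_Un_converse)
  then have 2: "(w', w) \<in> ?R" using 1 by (blast dest: symD)
  show ?thesis unfolding zz_class_def using 1 2 by (auto intro: rtrancl_trans)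
qed

lemma zz_class_step: "(w, w') \<in> zz_step C S X Y \<Longrightarrow> zz_class C S X w' Y = zz_class C S X w Y"
  by (rule zz_class_eqI) (auto simp: zz_class_def)

lemma zz_class_zigzag: "w' \<in> zz_class C S X w Y \<Longrightarrow> zigzag C S X w Y \<Longrightarrow> zigzag C S X w' Y"
proof -
  assume "w' \<in> zz_class C S X w Y" "zigzag C S X w Y"
  then have "(w, w') \<in> (zz_step C S X Y \<union> (zz_step C S X Y)\<inverse>)\<^sup>*" by (simp add: zz_class_def)
  then show ?thesis using \<open>zigzag C S X w Y\<close>
    by (induction rule: rtrancl_induct) (auto simp: zz_step_def)
qed

lemma localization_simps [simp]:
  "Ob (localization C S) = Ob C"
  "Idt (localization C S) X = (X, zz_class C S X [] X, X)"
  "Dom (localization C S) (X, U, Y) = X"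
  "Cod (localization C S) (X, U, Y) = Y"
  by (simp_all add: localization_def)

lemma Hom_localization:
  "Hom (localization C S) X Y = {(X, zz_class C S X w Y, Y) | w. zigzag C S X w Y}"
  by (auto simp: localization_def Hom_def)

lemma zz_step_right:
  assumes "(y, z) \<in> zz_step C S X Y" "zigzag C S Y v Z"
  shows "(y @ v, z @ v) \<in> zz_step C S X Z"
proof -
  from assms(1) obtain a l r b where *: "y = a @ l @ b" "z = a @ r @ b" "reduct C S l r"
    "zigzag C S X (a @ l @ b) Y" "zigzag C S X (a @ r @ b) Y" by (auto simp: zz_step_def)
  show ?thesis unfolding zz_step_def
    using *(1-3) zigzag_append[OF *(4) assms(2)] zigzag_append[OF *(5) assms(2)]
    by (intro CollectI exI[of _ a] exI[of _ l] exI[of _ r] exI[of _ "b @ v"]) simp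
qed

lemma zz_step_left:
  assumes "(y, z) \<in> zz_step C S Y Z" "zigzag C S X u Y"
  shows "(u @ y, u @ z) \<in> zz_step C S X Z"
proof -
  from assms(1) obtain a l r b where *: "y = a @ l @ b" "z = a @ r @ b" "reduct C S l r"
    "zigzag C S Y (a @ l @ b) Z" "zigzag C S Y (a @ r @ b) Z" by (auto simp: zz_step_def)
  show ?thesis unfolding zz_step_def
    using *(1-3) zigzag_append[OF assms(2) *(4)] zigzag_append[OF assms(2) *(5)]
    by (intro CollectI exI[of _ "u @ a"] exI[of _ l] exI[of _ r] exI[of _ b]) simp
qed

lemma Cmp_localization:
  assumes "zigzag C S X u Y" "zigzag C S Y v Z"
  shows "(Y', zz_class C S Y v Z, Z) \<cdot>\<^bsub>localization C S\<^esub> (X, zz_class C S X u Y, Y')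
         = (X, zz_class C S X (u @ v) Z, Z)"
proof -
  have "zz_class C S X (u' @ v') Z = zz_class C S X (u @ v) Z"
    if "u' \<in> zz_class C S X u Y" "v' \<in> zz_class C S Y v Z" for u' v'
  proof -
    have v': "zigzag C S Y v' Z" using zz_class_zigzag that(2) assms(2) .
    have "u' @ v' \<in> zz_class C S X (u @ v') Z"
    proof -
      have "(u, u') \<in> (zz_step C S X Y \<union> (zz_step C S X Y)\<inverse>)\<^sup>*" using that(1) by (simp add: zz_class_def)
      then have "(u @ v', u' @ v') \<in> (zz_step C S X Z \<union> (zz_step C S X Z)\<inverse>)\<^sup>*"
      proof (induction rule: rtrancl_induct)
        case (step y z)
        have "(y @ v', z @ v') \<in> zz_step C S X Z \<union> (zz_step C S X Z)\<inverse>"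
          using step.hyps(2) zz_step_right[OF _ v'] by blast
        with step.IH show ?case by (rule rtrancl_into_rtrancl)
      qed simp
      then show ?thesis by (simp add: zz_class_def)
    qed
    moreover have "u @ v' \<in> zz_class C S X (u @ v) Z"
    proof -
      have "(v, v') \<in> (zz_step C S Y Z \<union> (zz_step C S Y Z)\<inverse>)\<^sup>*" using that(2) by (simp add: zz_class_def)
      then have "(u @ v, u @ v') \<in> (zz_step C S X Z \<union> (zz_step C S X Z)\<inverse>)\<^sup>*"
      proof (induction rule: rtrancl_induct)
        case (step y z)
        have "(u @ y, u @ z) \<in> zz_step C S X Z \<union> (zz_step C S X Z)\<inverse>"
          using step.hyps(2) zz_step_left[OF _ assms(1)] by blast
        with step.IH show ?case by (rule rtrancl_into_rtrancl)
      qed simp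
      then show ?thesis by (simp add: zz_class_def)
    qed
    ultimately show ?thesis by (metis zz_class_eqI)
  qed
  then have "(\<Union>u'\<in>zz_class C S X u Y. \<Union>v'\<in>zz_class C S Y v Z. zz_class C S X (u' @ v') Z)
             = zz_class C S X (u @ v) Z"
    using zz_class_self[of u C S X Y] zz_class_self[of v C S Y Z] by blast
  then show ?thesis by (simp add: localization_def)
qed

lemma zigzag_ends:
  assumes "category C" "S \<subseteq> Mor C" "zigzag C S X w Y"
  shows "X \<in> Ob C \<and> Y \<in> Ob C"
  using assms(3)
  by (induction rule: zigzag.induct)
    (use assms(1,2) in \<open>auto intro: category.Dom_closed category.Cod_closed\<close>)

lemma zigzag_single:
  "category C \<Longrightarrow> f \<in> Mor C \<Longrightarrow> zigzag C S (Dom C f) [Inl f] (Cod C f)"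
  "category C \<Longrightarrow> S \<subseteq> Mor C \<Longrightarrow> s \<in> S \<Longrightarrow> zigzag C S (Cod C s) [Inr s] (Dom C s)"
  by (auto intro!: zigzag.intros intro: category.Dom_closed category.Cod_closed)

lemma zigzag_Inl: "category C \<Longrightarrow> f \<in> Hom C X Y \<Longrightarrow> zigzag C S X [Inl f] Y"
  using zigzag_single(1) by (auto simp: Hom_iff)

lemma localization_category:
  assumes "category C" "S \<subseteq> Mor C"
  shows "category (localization C S)"
proof
  fix X assume "X \<in> Ob (localization C S)"
  then show "Idt (localization C S) X \<in> Hom (localization C S) X X"
    by (auto simp: Hom_localization intro: zigzag_Nil)
next
  fix f X Y g Z assume "f \<in> Hom (localization C S) X Y" "g \<in> Hom (localization C S) Y Z"
  then show "g \<cdot>\<^bsub>localization C S\<^esub> f \<in> Hom (localization C S) X Z"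
    by (auto simp: Hom_localization Cmp_localization intro: zigzag_append)
next
  fix f assume "f \<in> Mor (localization C S)"
  then show "Dom (localization C S) f \<in> Ob (localization C S)"
    "Cod (localization C S) f \<in> Ob (localization C S)"
    using zigzag_ends[OF assms] by (auto simp: localization_def)
next
  fix f X Y assume f: "f \<in> Hom (localization C S) X Y"
  then have "X \<in> Ob C" "Y \<in> Ob C" using zigzag_ends[OF assms] by (auto simp: Hom_localization)
  then show "Idt (localization C S) Y \<cdot>\<^bsub>localization C S\<^esub> f = f"
    "f \<cdot>\<^bsub>localization C S\<^esub> Idt (localization C S) X = f"
    using f by (auto simp: Hom_localization Cmp_localization zigzag_Nil)
next
  fix f X Y g Z h W
  assume "f \<in> Hom (localization C S) X Y" "g \<in> Hom (localization C S) Y Z"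
    "h \<in> Hom (localization C S) Z W"
  then show "(h \<cdot>\<^bsub>localization C S\<^esub> g) \<cdot>\<^bsub>localization C S\<^esub> f
             = h \<cdot>\<^bsub>localization C S\<^esub> g \<cdot>\<^bsub>localization C S\<^esub> f"
    by (auto simp: Hom_localization Cmp_localization zigzag_append)
qed

lemma zz_class_reduct:
  "reduct C S l r \<Longrightarrow> zigzag C S X l Y \<Longrightarrow> zigzag C S X r Y \<Longrightarrow> zz_class C S X l Y = zz_class C S X r Y"
proof -
  assume "reduct C S l r" "zigzag C S X l Y" "zigzag C S X r Y"
  then have "(l, r) \<in> zz_step C S X Y"
    unfolding zz_step_def mem_Collect_eq by (metis append_Nil append_Nil2)
  then show ?thesis by (simp add: zz_class_step)
qed

lemma loc_functor_functor:
  assumes "category C" "S \<subseteq> Mor C"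
  shows "is_functor C (localization C S) (loc_functor C S)"
  unfolding is_functor_def
proof (intro conjI ballI allI)
  fix X assume "X \<in> Ob C"
  then show "obj_map (loc_functor C S) X \<in> Ob (localization C S)" by (simp add: loc_functor_def)
  have "Idt C X \<in> Hom C X X" using assms(1) \<open>X \<in> Ob C\<close> by (rule category.Idt_closed)
  then have "zz_class C S X [Inl (Idt C X)] X = zz_class C S X [] X"
    using zigzag_single(1)[OF assms(1), of "Idt C X" S] \<open>X \<in> Ob C\<close>
    by (intro zz_class_reduct) (auto simp: Hom_iff intro: reduct.intros zigzag_Nil)
  then show "mor_map (loc_functor C S) (Idt C X) = Idt (localization C S) (obj_map (loc_functor C S) X)"
    using \<open>Idt C X \<in> Hom C X X\<close> by (simp add: loc_functor_def Hom_iff)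
next
  fix f assume "f \<in> Mor C"
  then show "mor_map (loc_functor C S) f
      \<in> Hom (localization C S) (obj_map (loc_functor C S) (Dom C f)) (obj_map (loc_functor C S) (Cod C f))"
    using zigzag_single(1)[OF assms(1), of f S] by (auto simp: loc_functor_def Hom_localization)
next
  fix X Y Z f g assume fg: "f \<in> Hom C X Y" "g \<in> Hom C Y Z"
  then have gf: "g \<cdot>\<^bsub>C\<^esub> f \<in> Hom C X Z" using assms(1) by (blast intro: category.Cmp_closed)
  have z: "zigzag C S X [Inl f] Y" "zigzag C S Y [Inl g] Z" "zigzag C S X [Inl (g \<cdot>\<^bsub>C\<^esub> f)] Z"
    using zigzag_Inl[OF assms(1)] fg gf by blast+
  then have "zz_class C S X [Inl f, Inl g] Z = zz_class C S X [Inl (g \<cdot>\<^bsub>C\<^esub> f)] Z"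
    using zigzag_append[OF z(1,2)] fg by (intro zz_class_reduct) (auto intro: reduct.intros)
  then show "mor_map (loc_functor C S) (g \<cdot>\<^bsub>C\<^esub> f)
      = mor_map (loc_functor C S) g \<cdot>\<^bsub>localization C S\<^esub> mor_map (loc_functor C S) f"
    using fg gf z by (simp add: loc_functor_def Hom_iff Cmp_localization)
qed

lemma loc_functor_inverse:
  assumes "category C" "S \<subseteq> Mor C" "s \<in> S"
  shows "inverse_pair (localization C S) (mor_map (loc_functor C S) s)
           (Cod C s, zz_class C S (Cod C s) [Inr s] (Dom C s), Dom C s)"
proof -
  have s: "s \<in> Mor C" using assms by auto
  note z = zigzag_single(1)[OF assms(1) s, of S] zigzag_single(2)[OF assms]
  have e: "Dom C s \<in> Ob C" "Cod C s \<in> Ob C"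
    using assms(1) s by (auto intro: category.Dom_closed category.Cod_closed)
  have "zz_class C S (Dom C s) [Inl s, Inr s] (Dom C s) = zz_class C S (Dom C s) [] (Dom C s)"
    using zigzag_append[OF z] e assms(3)
    by (intro zz_class_reduct) (auto intro: reduct.intros zigzag_Nil)
  moreover have "zz_class C S (Cod C s) [Inr s, Inl s] (Cod C s) = zz_class C S (Cod C s) [] (Cod C s)"
    using zigzag_append[OF z(2,1)] e assms(3)
    by (intro zz_class_reduct) (auto intro: reduct.intros zigzag_Nil)
  moreover have "mor_map (loc_functor C S) s \<in> Hom (localization C S) (Dom C s) (Cod C s)"
    using z by (auto simp: loc_functor_def Hom_localization)
  moreover have "(Cod C s, zz_class C S (Cod C s) [Inr s] (Dom C s), Dom C s)
      \<in> Hom (localization C S) (Cod C s) (Dom C s)"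
    using z by (auto simp: Hom_localization)
  ultimately show ?thesis using z
    by (simp add: inverse_pair_def Cmp_localization loc_functor_def Hom_iff)
qed

lemma inverse_pair_unique:
  assumes "category D" "inverse_pair D f g" "inverse_pair D f h"
  shows "g = h"
proof -
  interpret category D by fact
  have f: "f \<in> Hom D (Dom D f) (Cod D f)" using assms(2) by (simp add: inverse_pair_def Hom_iff)
  have g: "g \<in> Hom D (Cod D f) (Dom D f)" "h \<in> Hom D (Cod D f) (Dom D f)"
    using assms(2,3) by (auto simp: inverse_pair_def)
  have "g = g \<cdot>\<^bsub>D\<^esub> (f \<cdot>\<^bsub>D\<^esub> h)" using assms(3) g Cmp_Idt_right by (simp add: inverse_pair_def)
  also have "\<dots> = (g \<cdot>\<^bsub>D\<^esub> f) \<cdot>\<^bsub>D\<^esub> h" using Cmp_assoc f g by metis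
  also have "\<dots> = h" using assms(2) g Cmp_Idt_left by (simp add: inverse_pair_def)
  finally show ?thesis .
qed

lemma functor_inverse_pair:
  assumes "is_functor C D F" "category C" "inverse_pair C f g"
  shows "inverse_pair D (mor_map F f) (mor_map F g)"
proof -
  interpret category C by fact
  have f: "f \<in> Hom C (Dom C f) (Cod C f)" and g: "g \<in> Hom C (Cod C f) (Dom C f)"
    using assms(3) by (auto simp: inverse_pair_def Hom_iff)
  have o: "Dom C f \<in> Ob C" "Cod C f \<in> Ob C" using f Dom_closed Cod_closed by (auto simp: Hom_iff)
  have Ff: "mor_map F f \<in> Hom D (obj_map F (Dom C f)) (obj_map F (Cod C f))"
    "mor_map F g \<in> Hom D (obj_map F (Cod C f)) (obj_map F (Dom C f))"
    using assms(1) f g by (auto simp: is_functor_def Hom_iff)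
  have "mor_map F (g \<cdot>\<^bsub>C\<^esub> f) = mor_map F g \<cdot>\<^bsub>D\<^esub> mor_map F f"
    "mor_map F (f \<cdot>\<^bsub>C\<^esub> g) = mor_map F f \<cdot>\<^bsub>D\<^esub> mor_map F g"
    using assms(1) f g unfolding is_functor_def by blast+
  moreover have "mor_map F (Idt C X) = Idt D (obj_map F X)" if "X \<in> Ob C" for X
    using assms(1) that unfolding is_functor_def by blast
  ultimately show ?thesis using Ff o assms(3) by (simp add: inverse_pair_def Hom_iff)
qed

fun zz_eval :: "('o, 'm, 'z) cat_scheme \<Rightarrow> ('p, 'n, 'y) cat_scheme \<Rightarrow> ('o, 'm, 'p, 'n, 'x) cat_map_scheme
    \<Rightarrow> 'o \<Rightarrow> ('m + 'm) list \<Rightarrow> 'n" where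
  "zz_eval C D F X [] = Idt D (obj_map F X)"
| "zz_eval C D F X (Inl f # w) = zz_eval C D F (Cod C f) w \<cdot>\<^bsub>D\<^esub> mor_map F f"
| "zz_eval C D F X (Inr s # w) = zz_eval C D F (Dom C s) w \<cdot>\<^bsub>D\<^esub> (SOME g. inverse_pair D (mor_map F s) g)"

theorem localization_universal:
  fixes F :: "('o, 'm, 'p, 'n) cat_map"
  assumes "category C" "S \<subseteq> Mor C" "category D" "is_functor C D F" "inverts D F S"
  shows "\<exists>F' :: ('o, ('o, 'm) loc_mor, 'p, 'n) cat_map. is_functor (localization C S) D F' \<and>
     (\<forall>X\<in>Ob C. obj_map F' (obj_map (loc_functor C S) X) = obj_map F X) \<and>
     (\<forall>f\<in>Mor C. mor_map F' (mor_map (loc_functor C S) f) = mor_map F f) \<and>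
     (\<forall>F'' :: ('o, ('o, 'm) loc_mor, 'p, 'n) cat_map. is_functor (localization C S) D F'' \<and>
        (\<forall>X\<in>Ob C. obj_map F'' (obj_map (loc_functor C S) X) = obj_map F X) \<and>
        (\<forall>f\<in>Mor C. mor_map F'' (mor_map (loc_functor C S) f) = mor_map F f) \<longrightarrow>
        (\<forall>X\<in>Ob (localization C S). obj_map F'' X = obj_map F' X) \<and>
        (\<forall>f\<in>Mor (localization C S). mor_map F'' f = mor_map F' f))"
proof -
  interpret C: category C by fact
  interpret D: category D by fact
  let ?L = "localization C S" and ?Q = "loc_functor C S"
  let ?ev = "zz_eval C D F"
  have FOb: "obj_map F X \<in> Ob D" if "X \<in> Ob C" for X
    using assms(4) that by (auto simp: is_functor_def)
  have FId: "mor_map F (Idt C X) = Idt D (obj_map F X)" if "X \<in> Ob C" for X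
    using assms(4) that by (auto simp: is_functor_def)
  have FCmp: "mor_map F (g \<cdot>\<^bsub>C\<^esub> f) = mor_map F g \<cdot>\<^bsub>D\<^esub> mor_map F f"
    if "f \<in> Hom C X Y" "g \<in> Hom C Y Z" for f g X Y Z
    using assms(4) that unfolding is_functor_def by blast
  have FMor: "mor_map F f \<in> Hom D (obj_map F X) (obj_map F Y)" if "f \<in> Hom C X Y" for f X Y
    using assms(4) that by (auto simp: is_functor_def Hom_iff)
  define I where "I s = (SOME g. inverse_pair D (mor_map F s) g)" for s
  have I: "inverse_pair D (mor_map F s) (I s)" if "s \<in> S" for s
    using assms(5) that unfolding I_def inverts_def isomorphism_def by (metis someI_ex)
  have sHom: "s \<in> Hom C (Dom C s) (Cod C s)" if "s \<in> S" for s
    using assms(2) that by (auto simp: Hom_iff)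
  have IHom: "I s \<in> Hom D (obj_map F (Cod C s)) (obj_map F (Dom C s))" if "s \<in> S" for s
    using I[OF that] FMor[OF sHom[OF that]] by (auto simp: inverse_pair_def Hom_iff)
  have ev_Hom: "?ev X w \<in> Hom D (obj_map F X) (obj_map F Y)" if "zigzag C S X w Y" for X w Y
    using that
  proof (induction rule: zigzag.induct)
    case (zigzag_Nil X) then show ?case using FOb D.Idt_closed by simp
  next
    case (zigzag_fwd f w Y)
    then have "mor_map F f \<in> Hom D (obj_map F (Dom C f)) (obj_map F (Cod C f))"
      by (intro FMor) (simp add: Hom_iff)
    then show ?case using zigzag_fwd.IH D.Cmp_closed by simp
  next
    case (zigzag_bwd s w Y)
    then show ?case using IHom[OF zigzag_bwd.hyps(1)] D.Cmp_closed by (simp add: I_def)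
  qed
  have ev_append: "?ev X (u @ v) = ?ev Y v \<cdot>\<^bsub>D\<^esub> ?ev X u"
    if "zigzag C S X u Y" "zigzag C S Y v Z" for X u Y v Z
    using that
  proof (induction rule: zigzag.induct)
    case (zigzag_Nil X)
    then show ?case using ev_Hom D.Cmp_Idt_right by fastforce
  next
    case (zigzag_fwd f w Y)
    have "mor_map F f \<in> Hom D (obj_map F (Dom C f)) (obj_map F (Cod C f))"
      using zigzag_fwd by (intro FMor) (simp add: Hom_iff)
    then show ?case using zigzag_fwd ev_Hom[OF zigzag_fwd.hyps(2)] ev_Hom[OF zigzag_fwd.prems]
      by (simp add: D.Cmp_assoc)
  next
    case (zigzag_bwd s w Y)
    then show ?case
      using IHom[OF zigzag_bwd.hyps(1)] ev_Hom[OF zigzag_bwd.hyps(2)] ev_Hom[OF zigzag_bwd.prems]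
      by (simp add: D.Cmp_assoc I_def[symmetric])
  qed
  have ev_reduct: "?ev X l = ?ev X r" if "reduct C S l r" "zigzag C S X l Y" for l r X Y
    using that(1)
  proof cases
    case (reduct_Cmp f A B g Z)
    have X: "X = A" using that(2) reduct_Cmp by (auto elim!: zigzag_NilE zigzag_fwdE zigzag_bwdE simp: Hom_iff)
    have Z: "Z \<in> Ob C" using reduct_Cmp C.Cod_closed by (auto simp: Hom_iff)
    have gf: "g \<cdot>\<^bsub>C\<^esub> f \<in> Hom C A Z" using reduct_Cmp C.Cmp_closed by blast
    have c: "Cod C f = B" "Cod C g = Z" "Cod C (g \<cdot>\<^bsub>C\<^esub> f) = Z" using reduct_Cmp gf by (auto simp: Hom_iff)
    show ?thesis using reduct_Cmp(1,2) c
      D.Cmp_Idt_left[OF FMor[OF reduct_Cmp(4)]] D.Cmp_Idt_left[OF FMor[OF gf]] FCmp[OF reduct_Cmp(3,4)]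
      by simp
  next
    case (reduct_Idt A)
    have i: "Idt C A \<in> Hom C A A" using reduct_Idt C.Idt_closed by blast
    have X: "X = A" using that(2) reduct_Idt i by (auto elim!: zigzag_NilE zigzag_fwdE zigzag_bwdE simp: Hom_iff)
    have "Cod C (Idt C A) = A" using i by (simp add: Hom_iff)
    then show ?thesis using reduct_Idt X FId D.Cmp_Idt_left[OF D.Idt_closed[OF FOb]] by simp
  next
    case (reduct_inv1 s)
    have X: "X = Dom C s" using that(2) reduct_inv1 by (auto elim: zigzag_NilE zigzag_fwdE zigzag_bwdE)
    have "Idt D (obj_map F (Dom C s)) \<cdot>\<^bsub>D\<^esub> I s = I s" using IHom reduct_inv1 D.Cmp_Idt_left by blast
    moreover have "I s \<cdot>\<^bsub>D\<^esub> mor_map F s = Idt D (obj_map F (Dom C s))"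
      using I[of s] FMor[OF sHom[of s]] reduct_inv1 by (simp add: inverse_pair_def Hom_iff)
    ultimately show ?thesis using reduct_inv1 X by (simp add: I_def)
  next
    case (reduct_inv2 s)
    have X: "X = Cod C s" using that(2) reduct_inv2 by (auto elim: zigzag_NilE zigzag_fwdE zigzag_bwdE)
    have "Idt D (obj_map F (Cod C s)) \<cdot>\<^bsub>D\<^esub> mor_map F s = mor_map F s"
      using FMor[OF sHom[of s]] reduct_inv2 D.Cmp_Idt_left by blast
    moreover have "mor_map F s \<cdot>\<^bsub>D\<^esub> I s = Idt D (obj_map F (Cod C s))"
      using I[of s] FMor[OF sHom[of s]] reduct_inv2 by (simp add: inverse_pair_def Hom_iff)
    ultimately show ?thesis using reduct_inv2 X by (simp add: I_def)
  qed
  have ev_step: "?ev X w = ?ev X w'" if st: "(w, w') \<in> zz_step C S X Y" for X Y w w'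
  proof -
    from st obtain a l r b where *: "w = a @ l @ b" "w' = a @ r @ b" "reduct C S l r"
      "zigzag C S X (a @ l @ b) Y" "zigzag C S X (a @ r @ b) Y" by (auto simp: zz_step_def)
    obtain A where A: "zigzag C S X a A" "zigzag C S A (l @ b) Y"
      using zigzag_split[OF *(4) assms(1,2)] by blast
    obtain B where B: "zigzag C S A l B" "zigzag C S B b Y"
      using zigzag_split[OF A(2) assms(1,2)] by blast
    obtain A' where A': "zigzag C S X a A'" "zigzag C S A' (r @ b) Y"
      using zigzag_split[OF *(5) assms(1,2)] by blast
    have [simp]: "A' = A" using zigzag_Cod_unique A(1) A'(1) by metis
    have "zigzag C S A r B"
      using *(3)
    proof cases
      case (reduct_Cmp f P Q g Z)
      have gf: "zigzag C S P [Inl (g \<cdot>\<^bsub>C\<^esub> f)] Z"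
        using reduct_Cmp C.Cmp_closed zigzag_Inl[OF assms(1)] by blast
      have fg: "zigzag C S P [Inl f, Inl g] Z"
        using zigzag_append[OF zigzag_Inl[OF assms(1) reduct_Cmp(3)] zigzag_Inl[OF assms(1) reduct_Cmp(4)]]
        by simp
      have "A = P" using B(1) reduct_Cmp by (auto elim!: zigzag_fwdE simp: Hom_iff)
      then have "B = Z" using B(1) reduct_Cmp(1) zigzag_Cod_unique[OF fg] by blast
      then show ?thesis using gf \<open>A = P\<close> reduct_Cmp(2) by simp
    next
      case (reduct_Idt P)
      have i: "Idt C P \<in> Hom C P P" using reduct_Idt C.Idt_closed by blast
      have "A = P" using B(1) reduct_Idt i by (auto elim!: zigzag_NilE zigzag_fwdE zigzag_bwdE simp: Hom_iff)
      moreover have "B = P"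
        using zigzag_Cod_unique[OF zigzag_single(1)[OF assms(1), of "Idt C P" S]] B(1) reduct_Idt i
          \<open>A = P\<close> by (simp add: Hom_iff)
      ultimately show ?thesis using reduct_Idt by (simp add: zigzag_Nil)
    next
      case (reduct_inv1 s)
      have "A = Dom C s" using B(1) reduct_inv1 by (auto elim: zigzag_NilE zigzag_fwdE zigzag_bwdE)
      moreover have "zigzag C S (Dom C s) [Inl s, Inr s] (Dom C s)"
        using zigzag_append[OF zigzag_single(1)[OF assms(1), of s S] zigzag_single(2)[OF assms(1,2), of s]]
          reduct_inv1 assms(2) by auto
      moreover have "Dom C s \<in> Ob C" using reduct_inv1 assms(2) C.Dom_closed by auto
      ultimately show ?thesis using B(1) reduct_inv1 zigzag_Cod_unique zigzag_Nil by metis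
    next
      case (reduct_inv2 s)
      have "A = Cod C s" using B(1) reduct_inv2 by (auto elim: zigzag_NilE zigzag_fwdE zigzag_bwdE)
      moreover have "zigzag C S (Cod C s) [Inr s, Inl s] (Cod C s)"
        using zigzag_append[OF zigzag_single(2)[OF assms(1,2), of s] zigzag_single(1)[OF assms(1), of s S]]
          reduct_inv2 assms(2) by auto
      moreover have "Cod C s \<in> Ob C" using reduct_inv2 assms(2) C.Cod_closed by auto
      ultimately show ?thesis using B(1) reduct_inv2 zigzag_Cod_unique zigzag_Nil by metis
    qed
    then have "?ev A (l @ b) = ?ev A (r @ b)"
      using ev_append[OF B] ev_append[OF _ B(2)] ev_reduct[OF *(3) B(1)] by metis
    then show ?thesis using *(1,2) ev_append[OF A] ev_append[OF A'] by simp
  qed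
  have ev_class: "?ev X w' = ?ev X w" if "w' \<in> zz_class C S X w Y" for X w w' Y
  proof -
    have "(w, w') \<in> (zz_step C S X Y \<union> (zz_step C S X Y)\<inverse>)\<^sup>*" using that by (simp add: zz_class_def)
    then show ?thesis by (induction rule: rtrancl_induct) (auto dest: ev_step)
  qed
  define F' :: "('o, ('o, 'm) loc_mor, 'p, 'n) cat_map"
    where "F' = \<lparr>obj_map = obj_map F, mor_map = (\<lambda>(X, U, Y). ?ev X (SOME w. w \<in> U))\<rparr>"
  have F'm: "mor_map F' (X, zz_class C S X w Y, Z) = ?ev X w" for X w Y Z
    unfolding F'_def using ev_class[OF someI[of "\<lambda>v. v \<in> zz_class C S X w Y", OF zz_class_self]] by simp
  have F'o: "obj_map F' = obj_map F" by (simp add: F'_def)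
  have 1: "is_functor ?L D F'"
    unfolding is_functor_def
  proof (intro conjI ballI allI)
    fix X Y Z f g assume "f \<in> Hom ?L X Y" "g \<in> Hom ?L Y Z"
    then show "mor_map F' (g \<cdot>\<^bsub>?L\<^esub> f) = mor_map F' g \<cdot>\<^bsub>D\<^esub> mor_map F' f"
      by (auto simp: Hom_localization Cmp_localization F'm ev_append)
  next
    fix f assume "f \<in> Mor ?L"
    then show "mor_map F' f \<in> Hom D (obj_map F' (Dom ?L f)) (obj_map F' (Cod ?L f))"
      using ev_Hom by (auto simp: localization_def F'm F'o)
  qed (auto simp: F'm F'o FOb)
  have 2: "mor_map F' (mor_map ?Q f) = mor_map F f" if "f \<in> Mor C" for f
    using D.Cmp_Idt_left[OF FMor[of f "Dom C f" "Cod C f"]] that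
    by (simp add: loc_functor_def F'm Hom_iff)
  have 3: "(\<forall>X\<in>Ob ?L. obj_map F'' X = obj_map F' X) \<and> (\<forall>f\<in>Mor ?L. mor_map F'' f = mor_map F' f)"
    if F'': "is_functor ?L D F''" "\<forall>X\<in>Ob C. obj_map F'' (obj_map ?Q X) = obj_map F X"
      "\<forall>f\<in>Mor C. mor_map F'' (mor_map ?Q f) = mor_map F f"
    for F'' :: "('o, ('o, 'm) loc_mor, 'p, 'n) cat_map"
  proof
    show ob: "\<forall>X\<in>Ob ?L. obj_map F'' X = obj_map F' X"
      using F''(2) by (simp add: loc_functor_def F'o)
    have "mor_map F'' (X, zz_class C S X w Y, Y) = ?ev X w" if "zigzag C S X w Y" for X w Y
      using that
    proof (induction rule: zigzag.induct)
      case (zigzag_Nil X)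
      then show ?case using F''(1) ob by (auto simp: is_functor_def F'o)
    next
      case (zigzag_fwd f w Y)
      have z: "zigzag C S (Dom C f) [Inl f] (Cod C f)" by (rule zigzag_single(1)[OF assms(1) zigzag_fwd.hyps(1)])
      then have "(Dom C f, zz_class C S (Dom C f) (Inl f # w) Y, Y)
          = (Cod C f, zz_class C S (Cod C f) w Y, Y) \<cdot>\<^bsub>?L\<^esub> mor_map ?Q f"
        using zigzag_fwd by (simp add: loc_functor_def Cmp_localization)
      moreover have "mor_map ?Q f \<in> Hom ?L (Dom C f) (Cod C f)"
        "(Cod C f, zz_class C S (Cod C f) w Y, Y) \<in> Hom ?L (Cod C f) Y"
        using z zigzag_fwd by (auto simp: loc_functor_def Hom_localization)
      ultimately have "mor_map F'' (Dom C f, zz_class C S (Dom C f) (Inl f # w) Y, Y)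
          = mor_map F'' (Cod C f, zz_class C S (Cod C f) w Y, Y) \<cdot>\<^bsub>D\<^esub> mor_map F'' (mor_map ?Q f)"
        using F''(1) unfolding is_functor_def by metis
      then show ?case using F''(3) zigzag_fwd by simp
    next
      case (zigzag_bwd s w Y)
      let ?i = "(Cod C s, zz_class C S (Cod C s) [Inr s] (Dom C s), Dom C s)"
      have z: "zigzag C S (Cod C s) [Inr s] (Dom C s)" by (rule zigzag_single(2)[OF assms(1,2) zigzag_bwd.hyps(1)])
      then have "(Cod C s, zz_class C S (Cod C s) (Inr s # w) Y, Y)
          = (Dom C s, zz_class C S (Dom C s) w Y, Y) \<cdot>\<^bsub>?L\<^esub> ?i"
        using zigzag_bwd by (simp add: Cmp_localization)
      moreover have "?i \<in> Hom ?L (Cod C s) (Dom C s)"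
        "(Dom C s, zz_class C S (Dom C s) w Y, Y) \<in> Hom ?L (Dom C s) Y"
        using z zigzag_bwd by (auto simp: Hom_localization)
      ultimately have *: "mor_map F'' (Cod C s, zz_class C S (Cod C s) (Inr s # w) Y, Y)
          = mor_map F'' (Dom C s, zz_class C S (Dom C s) w Y, Y) \<cdot>\<^bsub>D\<^esub> mor_map F'' ?i"
        using F''(1) unfolding is_functor_def by metis
      have "inverse_pair D (mor_map F'' (mor_map ?Q s)) (mor_map F'' ?i)"
        using functor_inverse_pair[OF F''(1) localization_category[OF assms(1,2)]
            loc_functor_inverse[OF assms(1,2) zigzag_bwd.hyps(1)]] .
      moreover have "mor_map F'' (mor_map ?Q s) = mor_map F s" using F''(3) assms(2) zigzag_bwd by auto
      ultimately have "mor_map F'' ?i = I s"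
        using inverse_pair_unique[OF assms(3)] I[OF zigzag_bwd.hyps(1)] by metis
      then show ?case using * zigzag_bwd.IH by (simp add: I_def)
    qed
    then show "\<forall>f\<in>Mor ?L. mor_map F'' f = mor_map F' f" by (auto simp: localization_def F'm)
  qed
  have 4: "obj_map F' (obj_map ?Q X) = obj_map F X" for X by (simp add: F'o loc_functor_def)
  show ?thesis
    by (rule exI[of _ F'], intro conjI allI impI ballI 1 4, erule 2) (use 3 in \<open>blast+\<close>)
qed

section \<open>Additive categories\<close>

record ('o, 'm) add_cat = "('o, 'm) cat" +
  Add :: "'m \<Rightarrow> 'm \<Rightarrow> 'm"
  Zero :: "'o \<Rightarrow> 'o \<Rightarrow> 'm"

definition hom_grp :: "('o, 'm, 'z) add_cat_scheme \<Rightarrow> 'o \<Rightarrow> 'o \<Rightarrow> 'm monoid"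
  where "hom_grp C X Y = \<lparr>carrier = Hom C X Y, monoid.mult = Add C, one = Zero C X Y\<rparr>"

definition Neg :: "('o, 'm, 'z) add_cat_scheme \<Rightarrow> 'm \<Rightarrow> 'm"
  where "Neg C f = inv\<^bsub>hom_grp C (Dom C f) (Cod C f)\<^esub> f"

definition zero_object :: "('o, 'm, 'z) cat_scheme \<Rightarrow> 'o \<Rightarrow> bool"
  where "zero_object C Z \<longleftrightarrow> Z \<in> Ob C \<and>
           (\<forall>X\<in>Ob C. (\<exists>!f. f \<in> Hom C X Z) \<and> (\<exists>!f. f \<in> Hom C Z X))"

definition biproduct ::
  "('o, 'm, 'z) add_cat_scheme \<Rightarrow> 'o \<Rightarrow> 'o \<Rightarrow> 'o \<Rightarrow> 'm \<Rightarrow> 'm \<Rightarrow> 'm \<Rightarrow> 'm \<Rightarrow> bool"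
  where "biproduct C X Y P i\<^sub>1 i\<^sub>2 p\<^sub>1 p\<^sub>2 \<longleftrightarrow>
    i\<^sub>1 \<in> Hom C X P \<and> i\<^sub>2 \<in> Hom C Y P \<and> p\<^sub>1 \<in> Hom C P X \<and> p\<^sub>2 \<in> Hom C P Y \<and>
    p\<^sub>1 \<cdot>\<^bsub>C\<^esub> i\<^sub>1 = Idt C X \<and> p\<^sub>2 \<cdot>\<^bsub>C\<^esub> i\<^sub>2 = Idt C Y \<and>
    p\<^sub>1 \<cdot>\<^bsub>C\<^esub> i\<^sub>2 = Zero C Y X \<and> p\<^sub>2 \<cdot>\<^bsub>C\<^esub> i\<^sub>1 = Zero C X Y \<and>
    Add C (i\<^sub>1 \<cdot>\<^bsub>C\<^esub> p\<^sub>1) (i\<^sub>2 \<cdot>\<^bsub>C\<^esub> p\<^sub>2) = Idt C P"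

locale additive_category = category C
  for C :: "('o, 'm, 'z) add_cat_scheme" (structure) +
  assumes hom_grp: "X \<in> Ob C \<Longrightarrow> Y \<in> Ob C \<Longrightarrow> comm_group (hom_grp C X Y)"
    and Cmp_Add_left: "f \<in> Hom C X Y \<Longrightarrow> g \<in> Hom C Y Z \<Longrightarrow> g' \<in> Hom C Y Z
                       \<Longrightarrow> Add C g g' \<cdot> f = Add C (g \<cdot> f) (g' \<cdot> f)"
    and Cmp_Add_right: "f \<in> Hom C X Y \<Longrightarrow> f' \<in> Hom C X Y \<Longrightarrow> g \<in> Hom C Y Z
                        \<Longrightarrow> g \<cdot> Add C f f' = Add C (g \<cdot> f) (g \<cdot> f')"
    and ex_zero_object: "\<exists>Z. zero_object C Z"
    and ex_biproduct: "X \<in> Ob C \<Longrightarrow> Y \<in> Ob C \<Longrightarrow> \<exists>P i\<^sub>1 i\<^sub>2 p\<^sub>1 p\<^sub>2. biproduct C X Y P i\<^sub>1 i\<^sub>2 p\<^sub>1 p\<^sub>2"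

definition additive_functor ::
  "('o, 'm, 'z) add_cat_scheme \<Rightarrow> ('p, 'n, 'y) add_cat_scheme \<Rightarrow> ('o, 'm, 'p, 'n, 'x) cat_map_scheme \<Rightarrow> bool"
  where "additive_functor C D F \<longleftrightarrow> is_functor C D F \<and>
    (\<forall>X Y. \<forall>f\<in>Hom C X Y. \<forall>g\<in>Hom C X Y. mor_map F (Add C f g) = Add D (mor_map F f) (mor_map F g))"

section \<open>Extriangulated categories\<close>

text \<open>
  \<open>Ext C X A\<close> is the abelian group \<open>\<bbbE>(X, A)\<close>, in the multiplicative notation of HOL-Algebra, and
  \<open>ExtMap C c a\<close> is \<open>\<bbbE>(c, a)\<close>, contravariant in \<open>c\<close>. Groups at different pairs of objects may
  overlap, so \<open>push\<close> and \<open>pull\<close> take the object that stays fixed as an argument. \<open>Real C X A \<delta>\<close> is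
  the equivalence class \<open>\<ss>(\<delta>)\<close>, as a set of pairs \<open>(x, y)\<close>.
\<close>

record ('o, 'm, 'e) ext_cat = "('o, 'm) add_cat" +
  Ext :: "'o \<Rightarrow> 'o \<Rightarrow> 'e monoid"
  ExtMap :: "'m \<Rightarrow> 'm \<Rightarrow> 'e \<Rightarrow> 'e"
  Real :: "'o \<Rightarrow> 'o \<Rightarrow> 'e \<Rightarrow> ('m \<times> 'm) set"

definition push :: "('o, 'm, 'e, 'z) ext_cat_scheme \<Rightarrow> 'o \<Rightarrow> 'm \<Rightarrow> 'e \<Rightarrow> 'e"
  where "push C X a \<delta> = ExtMap C (Idt C X) a \<delta>"

definition pull :: "('o, 'm, 'e, 'z) ext_cat_scheme \<Rightarrow> 'o \<Rightarrow> 'm \<Rightarrow> 'e \<Rightarrow> 'e"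
  where "pull C A c \<delta> = ExtMap C c (Idt C A) \<delta>"

locale biadditive_Ext = additive_category C
  for C :: "('o, 'm, 'e, 'z) ext_cat_scheme" (structure) +
  assumes Ext_grp: "X \<in> Ob C \<Longrightarrow> A \<in> Ob C \<Longrightarrow> comm_group (Ext C X A)"
    and ExtMap_hom: "c \<in> Hom C X' X \<Longrightarrow> a \<in> Hom C A A' \<Longrightarrow> ExtMap C c a \<in> hom (Ext C X A) (Ext C X' A')"
    and ExtMap_Idt: "X \<in> Ob C \<Longrightarrow> A \<in> Ob C \<Longrightarrow> \<delta> \<in> carrier (Ext C X A)
                     \<Longrightarrow> ExtMap C (Idt C X) (Idt C A) \<delta> = \<delta>"
    and ExtMap_Cmp: "c \<in> Hom C X' X \<Longrightarrow> c' \<in> Hom C X'' X' \<Longrightarrow> a \<in> Hom C A A' \<Longrightarrow> a' \<in> Hom C A' A''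
                     \<Longrightarrow> \<delta> \<in> carrier (Ext C X A)
                     \<Longrightarrow> ExtMap C (c \<cdot> c') (a' \<cdot> a) \<delta> = ExtMap C c' a' (ExtMap C c a \<delta>)"
    and push_Add: "X \<in> Ob C \<Longrightarrow> a \<in> Hom C A A' \<Longrightarrow> a' \<in> Hom C A A' \<Longrightarrow> \<delta> \<in> carrier (Ext C X A)
                   \<Longrightarrow> push C X (Add C a a') \<delta> = push C X a \<delta> \<otimes>\<^bsub>Ext C X A'\<^esub> push C X a' \<delta>"
    and pull_Add: "A \<in> Ob C \<Longrightarrow> c \<in> Hom C X' X \<Longrightarrow> c' \<in> Hom C X' X \<Longrightarrow> \<delta> \<in> carrier (Ext C X A)
                   \<Longrightarrow> pull C A (Add C c c') \<delta> = pull C A c \<delta> \<otimes>\<^bsub>Ext C X' A\<^esub> pull C A c' \<delta>"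

definition seq_class :: "('o, 'm, 'z) cat_scheme \<Rightarrow> 'm \<Rightarrow> 'm \<Rightarrow> ('m \<times> 'm) set"
  where "seq_class C x y = {(x', y'). x' \<in> Mor C \<and> y' \<in> Hom C (Cod C x') (Cod C y) \<and> Dom C x' = Dom C x \<and>
           (\<exists>b\<in>Hom C (Cod C x) (Cod C x'). isomorphism C b \<and> b \<cdot>\<^bsub>C\<^esub> x = x' \<and> y' \<cdot>\<^bsub>C\<^esub> b = y)}"

text \<open>\<open>s_triangle C A B X x y \<delta>\<close> means that \<open>\<langle>A \<rightarrow> B \<rightarrow> X, \<delta>\<rangle>\<close>, with maps \<open>x\<close> and \<open>y\<close>, is an
  \<open>\<ss>\<close>-triangle.\<close>

definition s_triangle :: "('o, 'm, 'e, 'z) ext_cat_scheme \<Rightarrow> 'o \<Rightarrow> 'o \<Rightarrow> 'o \<Rightarrow> 'm \<Rightarrow> 'm \<Rightarrow> 'e \<Rightarrow> bool"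
  where "s_triangle C A B X x y \<delta> \<longleftrightarrow> x \<in> Hom C A B \<and> y \<in> Hom C B X \<and>
           \<delta> \<in> carrier (Ext C X A) \<and> Real C X A \<delta> = seq_class C x y"

definition inflation :: "('o, 'm, 'e, 'z) ext_cat_scheme \<Rightarrow> 'm \<Rightarrow> bool"
  where "inflation C x \<longleftrightarrow> (\<exists>A B X y \<delta>. s_triangle C A B X x y \<delta>)"

definition deflation :: "('o, 'm, 'e, 'z) ext_cat_scheme \<Rightarrow> 'm \<Rightarrow> bool"
  where "deflation C y \<longleftrightarrow> (\<exists>A B X x \<delta>. s_triangle C A B X x y \<delta>)"

locale weakly_extriangulated = biadditive_Ext C
  for C :: "('o, 'm, 'e, 'z) ext_cat_scheme" (structure) +
  assumes Real_class: "X \<in> Ob C \<Longrightarrow> A \<in> Ob C \<Longrightarrow> \<delta> \<in> carrier (Ext C X A)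
                       \<Longrightarrow> \<exists>B x y. s_triangle C A B X x y \<delta>"
    and C1: "s_triangle C A B X x y \<delta> \<Longrightarrow> W \<in> Ob C \<Longrightarrow>
        (\<lambda>f. x \<cdot> f) ` Hom C W A = kernel (hom_grp C W B) (hom_grp C W X) (\<lambda>f. y \<cdot> f) \<and>
        (\<lambda>f. y \<cdot> f) ` Hom C W B = kernel (hom_grp C W X) (Ext C W A) (\<lambda>f. pull C A f \<delta>)"
    and C1': "s_triangle C A B X x y \<delta> \<Longrightarrow> W \<in> Ob C \<Longrightarrow>
        (\<lambda>g. g \<cdot> y) ` Hom C X W = kernel (hom_grp C B W) (hom_grp C A W) (\<lambda>g. g \<cdot> x) \<and>
        (\<lambda>g. g \<cdot> x) ` Hom C B W = kernel (hom_grp C A W) (Ext C X W) (\<lambda>g. push C X g \<delta>)"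
    and C2: "A \<in> Ob C \<Longrightarrow> zero_object C Z
             \<Longrightarrow> Real C Z A \<one>\<^bsub>Ext C Z A\<^esub> = seq_class C (Idt C A) (Zero C A Z)"
    and C2': "A \<in> Ob C \<Longrightarrow> zero_object C Z
              \<Longrightarrow> Real C A Z \<one>\<^bsub>Ext C A Z\<^esub> = seq_class C (Zero C Z A) (Idt C A)"
    and C3: "s_triangle C A B X x y \<delta> \<Longrightarrow> a \<in> Hom C A A' \<Longrightarrow> s_triangle C A' B' X x' y' (push C X a \<delta>) \<Longrightarrow>
        \<exists>b\<in>Hom C B B'. b \<cdot> x = x' \<cdot> a \<and> y = y' \<cdot> b \<and>
          (\<forall>P i\<^sub>1 i\<^sub>2 p\<^sub>1 p\<^sub>2. biproduct C B A' P i\<^sub>1 i\<^sub>2 p\<^sub>1 p\<^sub>2 \<longrightarrow>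
             s_triangle C A P B' (Add C (i\<^sub>1 \<cdot> x) (i\<^sub>2 \<cdot> a)) (Add C (b \<cdot> p\<^sub>1) (Neg C x' \<cdot> p\<^sub>2)) (pull C A y' \<delta>))"
    and C3': "s_triangle C A B X x y \<delta> \<Longrightarrow> c \<in> Hom C X' X \<Longrightarrow> s_triangle C A B' X' x' y' (pull C A c \<delta>) \<Longrightarrow>
        \<exists>b\<in>Hom C B' B. b \<cdot> x' = x \<and> c \<cdot> y' = y \<cdot> b \<and>
          (\<forall>P i\<^sub>1 i\<^sub>2 p\<^sub>1 p\<^sub>2. biproduct C X' B P i\<^sub>1 i\<^sub>2 p\<^sub>1 p\<^sub>2 \<longrightarrow>
             s_triangle C B' P X (Add C (i\<^sub>1 \<cdot> Neg C y') (i\<^sub>2 \<cdot> b)) (Add C (c \<cdot> p\<^sub>1) (y \<cdot> p\<^sub>2)) (push C X x' \<delta>))"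

locale extriangulated = weakly_extriangulated C
  for C :: "('o, 'm, 'e, 'z) ext_cat_scheme" (structure) +
  assumes C4: "inflation C f \<Longrightarrow> inflation C g \<Longrightarrow> Cod C f = Dom C g \<Longrightarrow> inflation C (g \<cdot> f)"
    and C4': "deflation C f \<Longrightarrow> deflation C g \<Longrightarrow> Cod C f = Dom C g \<Longrightarrow> deflation C (g \<cdot> f)"

section \<open>Exact functors\<close>

record ('o, 'm, 'e, 'p, 'n, 'k) exact_map = "('o, 'm, 'p, 'n) cat_map" +
  ext_map :: "'o \<Rightarrow> 'o \<Rightarrow> 'e \<Rightarrow> 'k"

definition exact_functor ::
  "('o, 'm, 'e) ext_cat \<Rightarrow> ('p, 'n, 'k) ext_cat \<Rightarrow> ('o, 'm, 'e, 'p, 'n, 'k) exact_map \<Rightarrow> bool"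
  where "exact_functor C D F \<longleftrightarrow> additive_functor C D F \<and>
    (\<forall>X\<in>Ob C. \<forall>A\<in>Ob C. ext_map F X A \<in> hom (Ext C X A) (Ext D (obj_map F X) (obj_map F A))) \<and>
    (\<forall>X X' A A'. \<forall>c\<in>Hom C X' X. \<forall>a\<in>Hom C A A'. \<forall>\<delta>\<in>carrier (Ext C X A).
       ext_map F X' A' (ExtMap C c a \<delta>) = ExtMap D (mor_map F c) (mor_map F a) (ext_map F X A \<delta>)) \<and>
    (\<forall>A B X x y \<delta>. s_triangle C A B X x y \<delta> \<longrightarrow>
       s_triangle D (obj_map F A) (obj_map F B) (obj_map F X) (mor_map F x) (mor_map F y) (ext_map F X A \<delta>))"

text \<open>Equality of exact functors is agreement on the carriers.\<close>

definition exact_eq ::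
  "('o, 'm, 'e) ext_cat \<Rightarrow> ('o, 'm, 'e, 'p, 'n, 'k) exact_map \<Rightarrow> ('o, 'm, 'e, 'p, 'n, 'k) exact_map \<Rightarrow> bool"
  where "exact_eq C F G \<longleftrightarrow>
    (\<forall>X\<in>Ob C. obj_map F X = obj_map G X) \<and>
    (\<forall>f\<in>Mor C. mor_map F f = mor_map G f) \<and>
    (\<forall>X\<in>Ob C. \<forall>A\<in>Ob C. \<forall>\<delta>\<in>carrier (Ext C X A). ext_map F X A \<delta> = ext_map G X A \<delta>)"

definition exact_id :: "('o, 'm, 'e, 'o, 'm, 'e) exact_map"
  where "exact_id = \<lparr>obj_map = (\<lambda>X. X), mor_map = (\<lambda>f. f), ext_map = (\<lambda>X A \<delta>. \<delta>)\<rparr>"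

definition exact_comp ::
  "('p, 'n, 'k, 'q, 'r, 'l) exact_map \<Rightarrow> ('o, 'm, 'e, 'p, 'n, 'k) exact_map \<Rightarrow> ('o, 'm, 'e, 'q, 'r, 'l) exact_map"
  where "exact_comp G F =
    \<lparr>obj_map = (\<lambda>X. obj_map G (obj_map F X)),
     mor_map = (\<lambda>f. mor_map G (mor_map F f)),
     ext_map = (\<lambda>X A \<delta>. ext_map G (obj_map F X) (obj_map F A) (ext_map F X A \<delta>))\<rparr>"

definition exact_iso ::
  "('o, 'm, 'e) ext_cat \<Rightarrow> ('p, 'n, 'k) ext_cat \<Rightarrow> ('o, 'm, 'e, 'p, 'n, 'k) exact_map \<Rightarrow> bool"
  where "exact_iso C D F \<longleftrightarrow> exact_functor C D F \<and>
    (\<exists>G. exact_functor D C G \<and> exact_eq C (exact_comp G F) exact_id \<and> exact_eq D (exact_comp F G) exact_id)"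

definition exact_nat_trans ::
  "('o, 'm, 'e) ext_cat \<Rightarrow> ('p, 'n, 'k) ext_cat \<Rightarrow> ('o, 'm, 'e, 'p, 'n, 'k) exact_map
   \<Rightarrow> ('o, 'm, 'e, 'p, 'n, 'k) exact_map \<Rightarrow> ('o \<Rightarrow> 'n) \<Rightarrow> bool"
  where "exact_nat_trans C D F G \<eta> \<longleftrightarrow>
    (\<forall>X\<in>Ob C. \<eta> X \<in> Hom D (obj_map F X) (obj_map G X)) \<and>
    (\<forall>X Y. \<forall>f\<in>Hom C X Y. \<eta> Y \<cdot>\<^bsub>D\<^esub> mor_map F f = mor_map G f \<cdot>\<^bsub>D\<^esub> \<eta> X) \<and>
    (\<forall>X\<in>Ob C. \<forall>A\<in>Ob C. \<forall>\<delta>\<in>carrier (Ext C X A).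
       push D (obj_map F X) (\<eta> A) (ext_map F X A \<delta>) = pull D (obj_map G A) (\<eta> X) (ext_map G X A \<delta>))"

section \<open>The ideal quotient and the conditions on \<open>S\<close>\<close>

definition M0 :: "('o, 'm, 'z) add_cat_scheme \<Rightarrow> 'm set \<Rightarrow> bool"
  where "M0 C S \<longleftrightarrow> S \<subseteq> Mor C \<and>
    (\<forall>f. isomorphism C f \<longrightarrow> f \<in> S) \<and>
    (\<forall>f\<in>S. \<forall>g\<in>S. Cod C f = Dom C g \<longrightarrow> g \<cdot>\<^bsub>C\<^esub> f \<in> S) \<and>
    (\<forall>X\<^sub>1 X\<^sub>2 Y\<^sub>1 Y\<^sub>2 P i\<^sub>1 i\<^sub>2 p\<^sub>1 p\<^sub>2 R j\<^sub>1 j\<^sub>2 q\<^sub>1 q\<^sub>2. \<forall>f\<^sub>1\<in>S \<inter> Hom C X\<^sub>1 Y\<^sub>1. \<forall>f\<^sub>2\<in>S \<inter> Hom C X\<^sub>2 Y\<^sub>2.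
       biproduct C X\<^sub>1 X\<^sub>2 P i\<^sub>1 i\<^sub>2 p\<^sub>1 p\<^sub>2 \<longrightarrow> biproduct C Y\<^sub>1 Y\<^sub>2 R j\<^sub>1 j\<^sub>2 q\<^sub>1 q\<^sub>2 \<longrightarrow>
       Add C (j\<^sub>1 \<cdot>\<^bsub>C\<^esub> f\<^sub>1 \<cdot>\<^bsub>C\<^esub> p\<^sub>1) (j\<^sub>2 \<cdot>\<^bsub>C\<^esub> f\<^sub>2 \<cdot>\<^bsub>C\<^esub> p\<^sub>2) \<in> S)"

definition null_objects :: "('o, 'm, 'z) add_cat_scheme \<Rightarrow> 'm set \<Rightarrow> 'o set"
  where "null_objects C S = {N \<in> Ob C. \<exists>Z. zero_object C Z \<and> Zero C N Z \<in> S \<and> Zero C Z N \<in> S}"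

definition factors_through :: "('o, 'm, 'z) cat_scheme \<Rightarrow> 'o set \<Rightarrow> 'm \<Rightarrow> bool"
  where "factors_through C \<N> f \<longleftrightarrow>
           (\<exists>N\<in>\<N>. \<exists>u\<in>Hom C (Dom C f) N. \<exists>v\<in>Hom C N (Cod C f). f = v \<cdot>\<^bsub>C\<^esub> u)"

definition ideal_class :: "('o, 'm, 'z) add_cat_scheme \<Rightarrow> 'o set \<Rightarrow> 'm \<Rightarrow> 'm set"
  where "ideal_class C \<N> f =
           {g \<in> Hom C (Dom C f) (Cod C f). factors_through C \<N> (Add C g (Neg C f))}"

text \<open>Only the underlying category of the ideal quotient is needed.\<close>

definition ideal_quotient :: "('o, 'm, 'z) add_cat_scheme \<Rightarrow> 'o set \<Rightarrow> ('o, 'm set) cat"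
  where "ideal_quotient C \<N> =
    \<lparr>Ob = Ob C,
     Mor = ideal_class C \<N> ` Mor C,
     Dom = (\<lambda>F. the_elem (Dom C ` F)),
     Cod = (\<lambda>F. the_elem (Cod C ` F)),
     Idt = (\<lambda>X. ideal_class C \<N> (Idt C X)),
     Cmp = (\<lambda>G F. \<Union>g\<in>G. \<Union>f\<in>F. ideal_class C \<N> (g \<cdot>\<^bsub>C\<^esub> f))\<rparr>"

definition Cbar :: "('o, 'm, 'z) add_cat_scheme \<Rightarrow> 'm set \<Rightarrow> ('o, 'm set) cat"
  where "Cbar C S = ideal_quotient C (null_objects C S)"

definition bar :: "('o, 'm, 'z) add_cat_scheme \<Rightarrow> 'm set \<Rightarrow> 'm \<Rightarrow> 'm set"
  where "bar C S f = ideal_class C (null_objects C S) f"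

definition Sbar :: "('o, 'm, 'z) add_cat_scheme \<Rightarrow> 'm set \<Rightarrow> 'm set set"
  where "Sbar C S = {\<beta> \<cdot>\<^bsub>Cbar C S\<^esub> bar C S s \<cdot>\<^bsub>Cbar C S\<^esub> \<alpha> | \<beta> s \<alpha>.
           s \<in> S \<and> isomorphism (Cbar C S) \<alpha> \<and> isomorphism (Cbar C S) \<beta> \<and>
           Cod (Cbar C S) \<alpha> = Dom C s \<and> Dom (Cbar C S) \<beta> = Cod C s}"

definition two_out_of_three :: "('o, 'm, 'z) cat_scheme \<Rightarrow> 'm set \<Rightarrow> bool"
  where "two_out_of_three C W \<longleftrightarrow> (\<forall>X Y Z. \<forall>f\<in>Hom C X Y. \<forall>g\<in>Hom C Y Z.
    (f \<in> W \<and> g \<in> W \<longrightarrow> g \<cdot>\<^bsub>C\<^esub> f \<in> W) \<and>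
    (f \<in> W \<and> g \<cdot>\<^bsub>C\<^esub> f \<in> W \<longrightarrow> g \<in> W) \<and>
    (g \<in> W \<and> g \<cdot>\<^bsub>C\<^esub> f \<in> W \<longrightarrow> f \<in> W))"

definition closed_under_comp :: "('o, 'm, 'z) cat_scheme \<Rightarrow> 'm set \<Rightarrow> bool"
  where "closed_under_comp C W \<longleftrightarrow> (\<forall>f\<in>W. \<forall>g\<in>W. Cod C f = Dom C g \<longrightarrow> g \<cdot>\<^bsub>C\<^esub> f \<in> W)"

definition multiplicative_system :: "('o, 'm, 'z) cat_scheme \<Rightarrow> 'm set \<Rightarrow> bool"
  where "multiplicative_system C W \<longleftrightarrow> W \<subseteq> Mor C \<and>
    (\<forall>X\<in>Ob C. Idt C X \<in> W) \<and>
    closed_under_comp C W \<and>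
    (\<forall>X X' Y. \<forall>s\<in>W \<inter> Hom C X X'. \<forall>f\<in>Hom C X Y.
       \<exists>Y'. \<exists>s'\<in>W \<inter> Hom C Y Y'. \<exists>f'\<in>Hom C X' Y'. s' \<cdot>\<^bsub>C\<^esub> f = f' \<cdot>\<^bsub>C\<^esub> s) \<and>
    (\<forall>X X' Y. \<forall>s\<in>W \<inter> Hom C X' X. \<forall>f\<in>Hom C Y X.
       \<exists>Y'. \<exists>s'\<in>W \<inter> Hom C Y' Y. \<exists>f'\<in>Hom C Y' X'. f \<cdot>\<^bsub>C\<^esub> s' = s \<cdot>\<^bsub>C\<^esub> f') \<and>
    (\<forall>X Y. \<forall>f\<in>Hom C X Y. \<forall>g\<in>Hom C X Y.
       (\<exists>s\<in>W. Cod C s = X \<and> f \<cdot>\<^bsub>C\<^esub> s = g \<cdot>\<^bsub>C\<^esub> s) \<longleftrightarrow> (\<exists>t\<in>W. Dom C t = Y \<and> t \<cdot>\<^bsub>C\<^esub> f = t \<cdot>\<^bsub>C\<^esub> g))"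

definition MR1 :: "('o, 'm, 'z) add_cat_scheme \<Rightarrow> 'm set \<Rightarrow> bool"
  where "MR1 C S \<longleftrightarrow> two_out_of_three (Cbar C S) (Sbar C S)"

definition MR2 :: "('o, 'm, 'z) add_cat_scheme \<Rightarrow> 'm set \<Rightarrow> bool"
  where "MR2 C S \<longleftrightarrow> multiplicative_system (Cbar C S) (Sbar C S)"

definition MR3 :: "('o, 'm, 'e, 'z) ext_cat_scheme \<Rightarrow> 'm set \<Rightarrow> bool"
  where "MR3 C S \<longleftrightarrow> (\<forall>A B X x y \<delta> A' B' X' x' y' \<delta>'. \<forall>a\<in>Hom C A A'. \<forall>c\<in>Hom C X X'.
    s_triangle C A B X x y \<delta> \<longrightarrow> s_triangle C A' B' X' x' y' \<delta>' \<longrightarrow>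
    push C X a \<delta> = pull C A' c \<delta>' \<longrightarrow> bar C S a \<in> Sbar C S \<longrightarrow> bar C S c \<in> Sbar C S \<longrightarrow>
    (\<exists>b\<in>Sbar C S \<inter> Hom (Cbar C S) B B'.
       b \<cdot>\<^bsub>Cbar C S\<^esub> bar C S x = bar C S x' \<cdot>\<^bsub>Cbar C S\<^esub> bar C S a \<and>
       bar C S c \<cdot>\<^bsub>Cbar C S\<^esub> bar C S y = bar C S y' \<cdot>\<^bsub>Cbar C S\<^esub> b))"

definition Sbar_span :: "('o, 'm, 'z) add_cat_scheme \<Rightarrow> 'm set \<Rightarrow> 'm set \<Rightarrow> 'm set set"
  where "Sbar_span C S K = {v \<cdot>\<^bsub>Cbar C S\<^esub> bar C S x \<cdot>\<^bsub>Cbar C S\<^esub> u | v x u.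
           x \<in> K \<and> u \<in> Sbar C S \<and> v \<in> Sbar C S \<and>
           Cod (Cbar C S) u = Dom C x \<and> Dom (Cbar C S) v = Cod C x}"

definition MR4 :: "('o, 'm, 'e, 'z) ext_cat_scheme \<Rightarrow> 'm set \<Rightarrow> bool"
  where "MR4 C S \<longleftrightarrow>
    closed_under_comp (Cbar C S) (Sbar_span C S {x. inflation C x}) \<and>
    closed_under_comp (Cbar C S) (Sbar_span C S {y. deflation C y})"

section \<open>Localization of extriangulated categories\<close>

definition is_factorization ::
  "('o, 'm, 'e) ext_cat \<Rightarrow> ('o, 'm, 'e, 'p, 'n, 'k) exact_map \<Rightarrow> ('p, 'n, 'k) ext_cat
   \<Rightarrow> ('q, 'r, 'l) ext_cat \<Rightarrow> ('o, 'm, 'e, 'q, 'r, 'l) exact_map \<Rightarrow> ('p, 'n, 'k, 'q, 'r, 'l) exact_map \<Rightarrow> bool"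
  where "is_factorization C Q W D F F' \<longleftrightarrow> exact_functor W D F' \<and> exact_eq C F (exact_comp F' Q)"

text \<open>Universality of an exact functor \<open>Q\<close> from \<open>C\<close> to \<open>W\<close>, tested on the weakly extriangulated
  category \<open>D\<close>: part (i) is about exact functors, part (ii) about natural transformations.\<close>

definition universal_for ::
  "('o, 'm, 'e) ext_cat \<Rightarrow> 'm set \<Rightarrow> ('p, 'n, 'k) ext_cat \<Rightarrow> ('o, 'm, 'e, 'p, 'n, 'k) exact_map
   \<Rightarrow> ('q, 'r, 'l) ext_cat \<Rightarrow> bool"
  where "universal_for C S W Q D \<longleftrightarrow>
    (\<forall>F. exact_functor C D F \<and> inverts D F S \<longrightarrow>
       (\<exists>F'. is_factorization C Q W D F F' \<and>
          (\<forall>F''. is_factorization C Q W D F F'' \<longrightarrow> exact_eq W F'' F'))) \<and>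
    (\<forall>F G F' G' \<eta>. exact_functor C D F \<and> inverts D F S \<and> exact_functor C D G \<and> inverts D G S \<and>
       is_factorization C Q W D F F' \<and> is_factorization C Q W D G G' \<and> exact_nat_trans C D F G \<eta> \<longrightarrow>
       (\<exists>\<eta>'. exact_nat_trans W D F' G' \<eta>' \<and> (\<forall>X\<in>Ob C. \<eta> X = \<eta>' (obj_map Q X)) \<and>
          (\<forall>\<eta>''. exact_nat_trans W D F' G' \<eta>'' \<and> (\<forall>X\<in>Ob C. \<eta> X = \<eta>'' (obj_map Q X)) \<longrightarrow>
             (\<forall>Y\<in>Ob W. \<eta>'' Y = \<eta>' Y))))"

text \<open>
  HOL does not allow quantification over the types of the test category \<open>D\<close> inside a definition or
  under an existential quantifier. Here \<open>D\<close> ranges over the categories on the types of \<open>W\<close> itself,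
  which already determines \<open>(W, Q)\<close> up to unique isomorphism; universality for \<open>D\<close> on arbitrary
  types has to be claimed for every \<open>(W, Q)\<close> with this property. The type of the elements of the
  groups \<^term>\<open>Ext W X A\<close> is large enough for classes of fractions \<open>a\<^sub>*b\<^sup>*Q(\<delta>)\<close>, with \<open>a\<close> and \<open>b\<close>
  morphisms of the localization.
\<close>

type_synonym ('o, 'm, 'e) loc_ext = "(('o, 'm) loc_mor \<times> 'e \<times> ('o, 'm) loc_mor) set"

definition ext_localization ::
  "('o, 'm, 'e) ext_cat \<Rightarrow> 'm set \<Rightarrow> ('o, ('o, 'm) loc_mor, ('o, 'm, 'e) loc_ext) ext_cat
   \<Rightarrow> ('o, 'm, 'e, 'o, ('o, 'm) loc_mor, ('o, 'm, 'e) loc_ext) exact_map \<Rightarrow> bool"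
  where "ext_localization C S W Q \<longleftrightarrow>
    cat.truncate W = localization C S \<and> weakly_extriangulated W \<and>
    cat_map.truncate Q = loc_functor C S \<and> exact_functor C W Q \<and>
    (\<forall>D :: ('o, ('o, 'm) loc_mor, ('o, 'm, 'e) loc_ext) ext_cat.
       weakly_extriangulated D \<longrightarrow> universal_for C S W Q D)"

end

theory Submission
  imports Defs
begin

text \<open>Modulo the ideal \<open>[N]\<close> of morphisms through null objects, the localization is a category of fractions. Let \<open>W\<close>
  be the class of morphisms of \<open>C\<close> whose image in the ideal quotient lies in \<open>Sbar\<close>. Inverting \<open>S\<close> already
  inverts \<open>W\<close> and identifies morphisms that differ by an element of the ideal, because for a null object \<open>N\<close> the
  projection \<open>X \<oplus> N \<rightarrow> X\<close> lies in \<open>S\<close> and so its two sections \<open>(1, u)\<close> and \<open>(1, 0)\<close> become equal (\<open>q_W_iso\<close>,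
  \<open>q_ideal\<close>). By (MR1) and (MR2), \<open>W\<close> satisfies the Ore and cancellation conditions modulo the ideal. Hence every
  zigzag is a fraction \<open>s\<inverse>f\<close>, and \<open>q f = q g\<close> holds exactly if \<open>t f\<close> and \<open>t g\<close> agree modulo the ideal for some
  \<open>t \<in> W\<close> (\<open>ideal_localization_zigzag\<close>).

  An extension in the localization is a class of expressions \<open>a\<^sub>*b\<^sup>*\<mu>(\<delta>)\<close> with \<open>a\<close>, \<open>b\<close> morphisms of the
  localization. Two of them are compared after clearing denominators, and there \<open>\<delta>\<close> counts as zero if
  \<open>s\<^sub>*\<delta> = 0\<close> for some \<open>s \<in> W\<close>. Condition (MR3) makes this symmetric: then also \<open>t\<^sup>*\<delta> = 0\<close> for some \<open>t \<in> W\<close>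
  (\<open>killed_imp_pull\<close>). With fixed denominators one works in a group of \<open>C\<close>, so that hom sets and extension groups
  are directed unions of abelian groups (\<open>comm_group_union\<close>), and additivity is inherited from \<open>C\<close>.

  The localized triangles are the sequences isomorphic to images of triangles of \<open>C\<close>. The locale \<open>fraction_ext\<close>
  collects what this needs; its axioms are self-dual, so that of each axiom of a weakly extriangulated category
  only one half is proved. The image of a triangle \<open>A \<rightarrow> B \<rightarrow> X\<close> is exact: if \<open>y f\<close> vanishes in the
  localization, then \<open>y f t\<close> factors through a null object \<open>N\<close>, and over \<open>N\<close> the pulled back triangle has, by
  (MR3), a middle term isomorphic to \<open>A\<close> in the localization (\<open>q_triangle_exact\<close>). A morphism between the ends of
  two triangles extends to the middle: clear denominators, extend in \<open>C\<close>, and undo the denominators with (MR3)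
  (\<open>ex_loc_morphism\<close>). With the five lemma this shows that the realization is well defined (\<open>loc_tri_unique\<close>).
  Axiom (C3) is then (C3) of \<open>C\<close> for the numerators (\<open>L_C3\<close>).

  For universality, let \<open>(F, \<phi>)\<close> invert \<open>S\<close>. If \<open>t\<^sup>*s\<^sub>*\<epsilon> = \<mu>(\<delta>)\<close>, then \<open>\<epsilon>\<close> can only be sent to the unique \<open>\<zeta>\<close> with
  \<open>F(t)\<^sup>*F(s)\<^sub>*\<zeta> = \<phi>(\<delta>)\<close>, and this choice works (\<open>exact_functor_factor\<close>). Under (MR4) a composite
  \<open>q(x') q(s) q(x)\<close> of localized inflations can be rewritten as \<open>q(v) q(z) q(u)\<close> with an inflation \<open>z\<close>
  (\<open>inflation_L_comp\<close>, \<open>span_comp\<close>). All of this concerns one particular localization; every other one is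
  isomorphic to it by uniqueness, and the claims are carried over along the isomorphism (\<open>universal_transport\<close>).\<close>

abbreviation (input) Exts :: "('o, 'm, 'e, 'z) ext_cat_scheme => 'o => 'o => 'e set"
  where "Exts C X A \<equiv> carrier (Ext C X A)"

section \<open>Morphism calculus\<close>

definition inv_mor :: "('o, 'm, 'z) cat_scheme => 'm => 'm"
  where "inv_mor C f = (THE g. inverse_pair C f g)"

context category
begin

lemma Cmp_simps [simp]:
  assumes "f \<in> Mor C" "g \<in> Mor C" "Cod C f = Dom C g"
  shows "g \<cdot> f \<in> Mor C" "Dom C (g \<cdot> f) = Dom C f" "Cod C (g \<cdot> f) = Cod C g"
  using Cmp_closed[of f "Dom C f" "Cod C f" g "Cod C g"] assms by (auto simp: Hom_iff)

lemma Cmp_assoc_simp [simp]: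
  "f \<in> Mor C ==> g \<in> Mor C ==> h \<in> Mor C ==> Cod C f = Dom C g ==> Cod C g = Dom C h
   ==> (h \<cdot> g) \<cdot> f = h \<cdot> g \<cdot> f" using Cmp_assoc[of f "Dom C f" "Cod C f" g "Cod C g" h "Cod C h"] by (simp add: Hom_iff)

lemma Idt_simps [simp]:
  assumes "X \<in> Ob C"
  shows "Idt C X \<in> Mor C" "Dom C (Idt C X) = X" "Cod C (Idt C X) = X" using Idt_closed[OF assms] by (auto simp: Hom_iff)

lemma Ob_simps [simp]: "f \<in> Mor C ==> Dom C f \<in> Ob C" "f \<in> Mor C ==> Cod C f \<in> Ob C" by (auto intro: Dom_closed Cod_closed)

lemma Idt_Cmp [simp]: "f \<in> Mor C ==> Cod C f = Y ==> Idt C Y \<cdot> f = f"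
  and Cmp_Idt [simp]: "f \<in> Mor C ==> Dom C f = X ==> f \<cdot> Idt C X = f"
  using Cmp_Idt_left[of f "Dom C f" "Cod C f"] Cmp_Idt_right[of f "Dom C f" "Cod C f"] by (auto simp: Hom_iff)

lemma Hom_Ob: "f \<in> Hom C X Y ==> X \<in> Ob C \<and> Y \<in> Ob C" by (auto simp: Hom_iff)

text \<open>Composition associates to the right in normal forms, so an equation between composites does not rewrite
  inside a longer one. This lemma and the next supply the version with a tail.\<close>

lemma Cmp_cong_right:
  assumes "g \<cdot> f = g' \<cdot> f'" "f \<in> Mor C" "g \<in> Mor C" "f' \<in> Mor C" "g' \<in> Mor C" "Cod C f = Dom C g"
    "Cod C f' = Dom C g'" "h \<in> Mor C" "Cod C h = Dom C f"
  shows "g \<cdot> f \<cdot> h = g' \<cdot> f' \<cdot> h"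
proof -
  have "Dom C f' = Dom C f" using assms Cmp_simps by metis
  then show ?thesis using assms Cmp_assoc_simp[of h f g] Cmp_assoc_simp[of h f' g'] by simp
qed

lemma Cmp_collapse:
  assumes "g \<cdot> f = k" "f \<in> Mor C" "g \<in> Mor C" "Cod C f = Dom C g"
    "h \<in> Mor C" "Cod C h = Dom C f"
  shows "g \<cdot> f \<cdot> h = k \<cdot> h" using assms by (metis Cmp_assoc_simp)

lemma isomorphismI:
  "f \<in> Hom C X Y ==> g \<in> Hom C Y X ==> g \<cdot> f = Idt C X ==> f \<cdot> g = Idt C Y ==> isomorphism C f"
  unfolding isomorphism_def inverse_pair_def by (auto simp: Hom_iff)

lemma inverse_pair_inv_mor: "isomorphism C f ==> inverse_pair C f (inv_mor C f)"
  unfolding isomorphism_def inv_mor_def using inverse_pair_unique[OF category_axioms] by (metis theI')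

lemma isomorphism_Mor: "isomorphism C f ==> f \<in> Mor C" by (auto simp: isomorphism_def inverse_pair_def)

lemma inv_mor_simps [simp]:
  assumes "isomorphism C f"
  shows "inv_mor C f \<in> Mor C" "Dom C (inv_mor C f) = Cod C f" "Cod C (inv_mor C f) = Dom C f"
    "inv_mor C f \<cdot> f = Idt C (Dom C f)" "f \<cdot> inv_mor C f = Idt C (Cod C f)"
    "isomorphism C (inv_mor C f)"
proof -
  from inverse_pair_inv_mor[OF assms] have *: "inv_mor C f \<in> Hom C (Cod C f) (Dom C f)"
    "inv_mor C f \<cdot> f = Idt C (Dom C f)" "f \<cdot> inv_mor C f = Idt C (Cod C f)" "f \<in> Mor C" by (auto simp: inverse_pair_def)
  then show "inv_mor C f \<in> Mor C" "Dom C (inv_mor C f) = Cod C f" "Cod C (inv_mor C f) = Dom C f"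
    "inv_mor C f \<cdot> f = Idt C (Dom C f)" "f \<cdot> inv_mor C f = Idt C (Cod C f)" by (auto simp: Hom_iff)
  show "isomorphism C (inv_mor C f)" by (rule isomorphismI[OF *(1) _ *(3,2)]) (use * in \<open>auto simp: Hom_iff\<close>)
qed

lemma inv_mor_Cmp [simp]:
  assumes "isomorphism C f" "h \<in> Mor C"
  shows "Cod C h = Dom C f ==> inv_mor C f \<cdot> f \<cdot> h = h" "Cod C h = Cod C f ==> f \<cdot> inv_mor C f \<cdot> h = h"
proof -
  have f: "f \<in> Mor C" using assms isomorphism_Mor by blast
  show "inv_mor C f \<cdot> f \<cdot> h = h" if "Cod C h = Dom C f" using Cmp_collapse[OF inv_mor_simps(4)[OF assms(1)], of h] assms f that by simp
  show "f \<cdot> inv_mor C f \<cdot> h = h" if "Cod C h = Cod C f" using Cmp_collapse[OF inv_mor_simps(5)[OF assms(1)], of h] assms f that by simp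
qed

lemma isomorphism_Idt [simp]: "X \<in> Ob C ==> isomorphism C (Idt C X)" by (rule isomorphismI[of _ X X "Idt C X"]) (auto simp: Hom_iff)

lemma isomorphism_Cmp:
  assumes "isomorphism C f" "isomorphism C g" "Cod C f = Dom C g"
  shows "isomorphism C (g \<cdot> f)" by (rule isomorphismI[of _ "Dom C f" "Cod C g" "inv_mor C f \<cdot> inv_mor C g"])
    (use assms isomorphism_Mor[OF assms(1)] isomorphism_Mor[OF assms(2)] in \<open>auto simp: Hom_iff\<close>)

lemma isomorphism_left_right:
  assumes "f \<in> Hom C X Y" "g \<in> Hom C Y X" "h \<in> Hom C Y X" "g \<cdot> f = Idt C X" "f \<cdot> h = Idt C Y"
  shows "isomorphism C f"
proof -
  have "g = g \<cdot> (f \<cdot> h)" using assms(2,5) by (simp add: Hom_iff)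
  also have "... = (g \<cdot> f) \<cdot> h" using assms(1-3) by (simp add: Hom_iff)
  also have "... = h" using assms(3,4) by (simp add: Hom_iff)
  finally have "g = h" .
  then show ?thesis using assms isomorphismI by blast
qed

lemma isomorphism_cancel_left:
  assumes "isomorphism C f" "f \<cdot> g = f \<cdot> h" "g \<in> Mor C" "h \<in> Mor C" "Cod C g = Dom C f" "Cod C h = Dom C f"
  shows "g = h" by (metis assms inv_mor_Cmp(1))

lemma isomorphism_cancel_right:
  assumes "isomorphism C f" "g \<cdot> f = h \<cdot> f" "g \<in> Mor C" "h \<in> Mor C" "Dom C g = Cod C f" "Dom C h = Cod C f"
  shows "g = h"
proof -
  have "(g \<cdot> f) \<cdot> inv_mor C f = (h \<cdot> f) \<cdot> inv_mor C f" using assms(2) by simp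
  then show ?thesis using assms(1,3-) isomorphism_Mor[OF assms(1)] by simp
qed

lemma zero_object_maps:
  assumes "zero_object C Z"
  shows "f \<in> Mor C ==> g \<in> Mor C ==> Dom C f = Dom C g ==> Cod C f = Z ==> Cod C g = Z ==> f = g"
    "f \<in> Mor C ==> g \<in> Mor C ==> Cod C f = Cod C g ==> Dom C f = Z ==> Dom C g = Z ==> f = g" using assms unfolding zero_object_def
  by (metis Hom_iff Ob_simps(1)) (metis assms Hom_iff Ob_simps(2) zero_object_def)

lemma zero_object_Ob: "zero_object C Z ==> Z \<in> Ob C" by (simp add: zero_object_def)

end

context additive_category
begin

lemma hom_grp_simps [simp]: "carrier (hom_grp C X Y) = Hom C X Y"
  "monoid.mult (hom_grp C X Y) = Add C" "one (hom_grp C X Y) = Zero C X Y" by (simp_all add: hom_grp_def)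

lemma Zero_simps [simp]:
  assumes "X \<in> Ob C" "Y \<in> Ob C"
  shows "Zero C X Y \<in> Mor C" "Dom C (Zero C X Y) = X" "Cod C (Zero C X Y) = Y"
proof -
  interpret G: comm_group "hom_grp C X Y" using hom_grp assms .
  have "Zero C X Y \<in> Hom C X Y" using G.one_closed by simp
  then show "Zero C X Y \<in> Mor C" "Dom C (Zero C X Y) = X" "Cod C (Zero C X Y) = Y" by (auto simp: Hom_iff)
qed

lemma Add_simps [simp]:
  assumes "f \<in> Mor C" "g \<in> Mor C" "Dom C f = Dom C g" "Cod C f = Cod C g"
  shows "Add C f g \<in> Mor C" "Dom C (Add C f g) = Dom C g" "Cod C (Add C f g) = Cod C g"
proof -
  interpret G: comm_group "hom_grp C (Dom C g) (Cod C g)" using hom_grp assms by simp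
  have "Add C f g \<in> Hom C (Dom C g) (Cod C g)" using G.m_closed[of f g] assms by (simp add: Hom_iff)
  then show "Add C f g \<in> Mor C" "Dom C (Add C f g) = Dom C g" "Cod C (Add C f g) = Cod C g" by (auto simp: Hom_iff)
qed

lemma Neg_simps [simp]:
  assumes "f \<in> Mor C"
  shows "Neg C f \<in> Mor C" "Dom C (Neg C f) = Dom C f" "Cod C (Neg C f) = Cod C f"
    "Add C f (Neg C f) = Zero C (Dom C f) (Cod C f)" "Add C (Neg C f) f = Zero C (Dom C f) (Cod C f)"
    "Neg C (Neg C f) = f"
proof -
  interpret G: comm_group "hom_grp C (Dom C f) (Cod C f)" using hom_grp assms by simp
  have f: "f \<in> carrier (hom_grp C (Dom C f) (Cod C f))" using assms by (simp add: Hom_iff)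
  have *: "Neg C f \<in> Hom C (Dom C f) (Cod C f)" using G.inv_closed[OF f] by (simp add: Neg_def)
  then show "Neg C f \<in> Mor C" "Dom C (Neg C f) = Dom C f" "Cod C (Neg C f) = Cod C f" by (auto simp: Hom_iff)
  show "Add C f (Neg C f) = Zero C (Dom C f) (Cod C f)" "Add C (Neg C f) f = Zero C (Dom C f) (Cod C f)"
    using G.r_inv[OF f] G.l_inv[OF f] by (simp_all add: Neg_def)
  show "Neg C (Neg C f) = f" using G.inv_inv[OF f] * unfolding Neg_def[of C "Neg C f"] by (simp add: Neg_def Hom_iff)
qed

lemma Add_comm:
  "f \<in> Mor C ==> g \<in> Mor C ==> Dom C f = Dom C g ==> Cod C f = Cod C g ==> Add C f g = Add C g f"
  using comm_group.axioms(1)[OF hom_grp, of "Dom C g" "Cod C g"]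
    comm_monoid.m_comm[of "hom_grp C (Dom C g) (Cod C g)" f g] by (simp add: Hom_iff)

lemma Add_assoc:
  assumes "f \<in> Mor C" "g \<in> Mor C" "h \<in> Mor C" "Dom C f = Dom C g" "Cod C f = Cod C g"
    "Dom C g = Dom C h" "Cod C g = Cod C h"
  shows "Add C (Add C f g) h = Add C f (Add C g h)"
proof -
  interpret G: comm_group "hom_grp C (Dom C g) (Cod C g)" using hom_grp assms by simp
  show ?thesis using G.m_assoc[of f g h] assms by (simp add: Hom_iff)
qed

lemma Add_Zero [simp]:
  assumes "f \<in> Mor C" "Dom C f = X" "Cod C f = Y"
  shows "Add C f (Zero C X Y) = f" "Add C (Zero C X Y) f = f"
proof -
  interpret G: comm_group "hom_grp C (Dom C f) (Cod C f)" using hom_grp assms(1) by simp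
  show "Add C f (Zero C X Y) = f" "Add C (Zero C X Y) f = f" using G.r_one[of f] G.l_one[of f] assms by (simp_all add: Hom_iff)
qed

lemma Add_cancel:
  assumes "Add C f g = Add C f h" "f \<in> Mor C" "g \<in> Mor C" "h \<in> Mor C" "Dom C f = Dom C g" "Cod C f = Cod C g"
    "Dom C f = Dom C h" "Cod C f = Cod C h"
  shows "g = h"
proof -
  have "Add C (Neg C f) (Add C f g) = Add C (Neg C f) (Add C f h)" using assms by simp
  then have "Add C (Add C (Neg C f) f) g = Add C (Add C (Neg C f) f) h" using assms by (simp add: Add_assoc del: Neg_simps(4,5))
  then show ?thesis using assms by simp
qed

lemma Neg_unique:
  assumes "Add C f g = Zero C (Dom C f) (Cod C f)" "f \<in> Mor C" "g \<in> Mor C" "Dom C f = Dom C g" "Cod C f = Cod C g"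
  shows "g = Neg C f" by (rule Add_cancel[of f]) (use assms in auto)

lemma Cmp_Add [simp]:
  "f \<in> Mor C ==> f' \<in> Mor C ==> g \<in> Mor C ==> Dom C f = Dom C f' ==> Cod C f = Dom C g ==> Cod C f' = Dom C g
   ==> g \<cdot> Add C f f' = Add C (g \<cdot> f) (g \<cdot> f')"
  "f \<in> Mor C ==> g \<in> Mor C ==> g' \<in> Mor C ==> Cod C g = Cod C g' ==> Dom C g = Cod C f ==> Dom C g' = Cod C f
   ==> Add C g g' \<cdot> f = Add C (g \<cdot> f) (g' \<cdot> f)" using Cmp_Add_right[of f "Dom C f" "Cod C f" f' g "Cod C g"]
    Cmp_Add_left[of f "Dom C f" "Cod C f" g "Cod C g" g'] by (auto simp: Hom_iff)

lemma Cmp_Zero [simp]: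
  assumes "f \<in> Mor C" "Z \<in> Ob C"
  shows "Cod C f = Y ==> Zero C Y Z \<cdot> f = Zero C (Dom C f) Z" "Dom C f = Y ==> f \<cdot> Zero C Z Y = Zero C Z (Cod C f)"
proof -
  show "Zero C Y Z \<cdot> f = Zero C (Dom C f) Z" if [simp]: "Cod C f = Y"
  proof -
    have [simp]: "Y \<in> Ob C" using Ob_simps(2)[OF assms(1)] that by simp
    have "Add C (Zero C Y Z \<cdot> f) (Zero C Y Z \<cdot> f) = Add C (Zero C Y Z) (Zero C Y Z) \<cdot> f" using assms by (simp del: Add_Zero)
    also have "... = Add C (Zero C Y Z \<cdot> f) (Zero C (Dom C f) Z)" using assms by simp
    finally show ?thesis by (rule Add_cancel) (use assms in simp_all)
  qed
  show "f \<cdot> Zero C Z Y = Zero C Z (Cod C f)" if [simp]: "Dom C f = Y"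
  proof -
    have [simp]: "Y \<in> Ob C" using Ob_simps(1)[OF assms(1)] that by simp
    have "Add C (f \<cdot> Zero C Z Y) (f \<cdot> Zero C Z Y) = f \<cdot> Add C (Zero C Z Y) (Zero C Z Y)" using assms by (simp del: Add_Zero)
    also have "... = Add C (f \<cdot> Zero C Z Y) (Zero C Z (Cod C f))" using assms by simp
    finally show ?thesis by (rule Add_cancel) (use assms in simp_all)
  qed
qed

lemma Cmp_Neg [simp]:
  assumes "f \<in> Mor C" "g \<in> Mor C" "Cod C f = Dom C g"
  shows "Neg C g \<cdot> f = Neg C (g \<cdot> f)" "g \<cdot> Neg C f = Neg C (g \<cdot> f)"
proof -
  have "Add C (g \<cdot> f) (Neg C g \<cdot> f) = Add C g (Neg C g) \<cdot> f" using assms by (simp del: Neg_simps(4,5))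
  then show "Neg C g \<cdot> f = Neg C (g \<cdot> f)" using assms by (intro Neg_unique) auto
  have "Add C (g \<cdot> f) (g \<cdot> Neg C f) = g \<cdot> Add C f (Neg C f)" using assms by (simp del: Neg_simps(4,5))
  then show "g \<cdot> Neg C f = Neg C (g \<cdot> f)" using assms by (intro Neg_unique) auto
qed

lemma Neg_Zero [simp]: "X \<in> Ob C ==> Y \<in> Ob C ==> Neg C (Zero C X Y) = Zero C X Y" by (rule Neg_unique[symmetric]) auto

lemma Add_Neg_cancel:
  assumes "f \<in> Mor C" "g \<in> Mor C" "Dom C f = Dom C g" "Cod C f = Cod C g"
  shows "Add C (Add C f (Neg C g)) g = f" "Add C (Add C f g) (Neg C g) = f"
    "Add C g (Add C f (Neg C g)) = f"
proof -
  show 1: "Add C (Add C f (Neg C g)) g = f" using Add_assoc[of f "Neg C g" g] assms by simp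
  have "Add C (Add C f g) (Neg C g) = Add C f (Add C g (Neg C g))" by (rule Add_assoc) (use assms in simp_all)
  also have "... = f" by (simp add: assms)
  finally show "Add C (Add C f g) (Neg C g) = f" .
  have "Add C g (Add C f (Neg C g)) = Add C (Add C f (Neg C g)) g" by (rule Add_comm) (use assms in auto)
  then show "Add C g (Add C f (Neg C g)) = f" using 1 by simp
qed

lemma Neg_Add:
  assumes "f \<in> Mor C" "g \<in> Mor C" "Dom C f = Dom C g" "Cod C f = Cod C g"
  shows "Neg C (Add C f g) = Add C (Neg C f) (Neg C g)"
proof -
  interpret G: comm_group "hom_grp C (Dom C g) (Cod C g)" using hom_grp assms by simp
  show ?thesis using G.inv_mult[of f g] assms by (simp add: Hom_iff Neg_def[of C])
qed

lemma Add_Add_swap: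
  assumes "f \<in> Hom C X Y" "g \<in> Hom C X Y" "h \<in> Hom C X Y" "k \<in> Hom C X Y"
  shows "Add C (Add C f g) (Add C h k) = Add C (Add C f h) (Add C g k)"
proof -
  note * = assms[unfolded Hom_iff]
  have "Add C g (Add C h k) = Add C (Add C g h) k" using * by (simp add: Add_assoc)
  also have "... = Add C (Add C h g) k" using * Add_comm[of g h] by simp
  also have "... = Add C h (Add C g k)" using * by (simp add: Add_assoc)
  finally show ?thesis using * by (simp add: Add_assoc)
qed

lemma zero_object_iff: "zero_object C Z \<longleftrightarrow> Z \<in> Ob C \<and> Idt C Z = Zero C Z Z"
proof
  assume "zero_object C Z"
  then show "Z \<in> Ob C \<and> Idt C Z = Zero C Z Z" using zero_object_maps(1)[of Z "Idt C Z" "Zero C Z Z"] by (simp add: zero_object_Ob)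
next
  assume Z: "Z \<in> Ob C \<and> Idt C Z = Zero C Z Z"
  have 1: "f = Zero C X Z" if "f \<in> Hom C X Z" for f X
  proof -
    have "f = Zero C Z Z \<cdot> f" using Cmp_Idt_left[OF that] Z by simp
    then show ?thesis using that Z by (simp add: Hom_iff)
  qed
  have 2: "f = Zero C Z X" if "f \<in> Hom C Z X" for f X
  proof -
    have "f = f \<cdot> Zero C Z Z" using Cmp_Idt_right[OF that] Z by simp
    then show ?thesis using that Z by (simp add: Hom_iff)
  qed
  show "zero_object C Z" unfolding zero_object_def
  proof (intro conjI ballI ex1I)
    fix X assume "X \<in> Ob C"
    then show "Zero C X Z \<in> Hom C X Z" "Zero C Z X \<in> Hom C Z X" using Z by (simp_all add: Hom_iff)
  qed (use Z 1 2 in blast)+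
qed

lemma zero_object_Zero:
  assumes "zero_object C Z" "f \<in> Mor C"
  shows "Cod C f = Z ==> f = Zero C (Dom C f) Z" "Dom C f = Z ==> f = Zero C Z (Cod C f)"
proof -
  note Z = zero_object_Ob[OF assms(1)]
  show "f = Zero C (Dom C f) Z" if "Cod C f = Z" by (rule zero_object_maps(1)[OF assms(1)]) (use that assms(2) Z in simp_all)
  show "f = Zero C Z (Cod C f)" if "Dom C f = Z" by (rule zero_object_maps(2)[OF assms(1)]) (use that assms(2) Z in simp_all)
qed

lemma biproduct_simps:
  assumes "biproduct C X Y P i1 i2 p1 p2"
  shows "i1 \<in> Mor C" "i2 \<in> Mor C" "p1 \<in> Mor C" "p2 \<in> Mor C" "Dom C i1 = X" "Dom C i2 = Y" "Cod C i1 = P" "Cod C i2 = P"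
    "Dom C p1 = P" "Dom C p2 = P" "Cod C p1 = X" "Cod C p2 = Y" "X \<in> Ob C" "Y \<in> Ob C" "P \<in> Ob C"
    "p1 \<cdot> i1 = Idt C X" "p2 \<cdot> i2 = Idt C Y" "p1 \<cdot> i2 = Zero C Y X" "p2 \<cdot> i1 = Zero C X Y"
    "Add C (i1 \<cdot> p1) (i2 \<cdot> p2) = Idt C P"
    "\<And>f. f \<in> Mor C ==> Cod C f = X ==> p1 \<cdot> i1 \<cdot> f = f" "\<And>f. f \<in> Mor C ==> Cod C f = Y ==> p2 \<cdot> i2 \<cdot> f = f"
    "\<And>f. f \<in> Mor C ==> Cod C f = X ==> p2 \<cdot> i1 \<cdot> f = Zero C (Dom C f) Y"
    "\<And>f. f \<in> Mor C ==> Cod C f = Y ==> p1 \<cdot> i2 \<cdot> f = Zero C (Dom C f) X"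
proof -
  show *: "i1 \<in> Mor C" "i2 \<in> Mor C" "p1 \<in> Mor C" "p2 \<in> Mor C" "Dom C i1 = X" "Dom C i2 = Y" "Cod C i1 = P" "Cod C i2 = P"
    "Dom C p1 = P" "Dom C p2 = P" "Cod C p1 = X" "Cod C p2 = Y" "X \<in> Ob C" "Y \<in> Ob C" "P \<in> Ob C"
    using assms Ob_simps[of i1] Ob_simps[of i2] by (simp_all add: biproduct_def Hom_iff)
  show **: "p1 \<cdot> i1 = Idt C X" "p2 \<cdot> i2 = Idt C Y" "p1 \<cdot> i2 = Zero C Y X" "p2 \<cdot> i1 = Zero C X Y"
    "Add C (i1 \<cdot> p1) (i2 \<cdot> p2) = Idt C P" using assms by (simp_all add: biproduct_def)
  show "\<And>f. f \<in> Mor C ==> Cod C f = X ==> p1 \<cdot> i1 \<cdot> f = f" "\<And>f. f \<in> Mor C ==> Cod C f = Y ==> p2 \<cdot> i2 \<cdot> f = f"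
    "\<And>f. f \<in> Mor C ==> Cod C f = X ==> p2 \<cdot> i1 \<cdot> f = Zero C (Dom C f) Y"
    "\<And>f. f \<in> Mor C ==> Cod C f = Y ==> p1 \<cdot> i2 \<cdot> f = Zero C (Dom C f) X"
    by (simp_all add: * Cmp_collapse[OF **(1)] Cmp_collapse[OF **(2)] Cmp_collapse[OF **(3)] Cmp_collapse[OF **(4)])
qed

end

context biadditive_Ext
begin

lemma Ext_closed [simp]:
  "c \<in> Mor C ==> a \<in> Mor C ==> \<delta> \<in> Exts C (Cod C c) (Dom C a) ==> Dom C c = X ==> Cod C a = A
   ==> ExtMap C c a \<delta> \<in> Exts C X A" using ExtMap_hom[of c "Dom C c" "Cod C c" a "Dom C a" "Cod C a"] by (auto simp: hom_def Hom_iff Pi_iff)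

lemma ExtMap_ExtMap [simp]:
  "c \<in> Mor C ==> c' \<in> Mor C ==> a \<in> Mor C ==> a' \<in> Mor C ==> Cod C c' = Dom C c ==> Cod C a = Dom C a'
   ==> \<delta> \<in> Exts C (Cod C c) (Dom C a) ==> ExtMap C c' a' (ExtMap C c a \<delta>) = ExtMap C (c \<cdot> c') (a' \<cdot> a) \<delta>"
  using ExtMap_Cmp[of c "Dom C c" "Cod C c" c' "Dom C c'" a "Dom C a" "Cod C a" a' "Cod C a'" \<delta>] by (simp add: Hom_iff)

lemma ExtMap_Idt_simp [simp]:
  "\<delta> \<in> Exts C X A ==> X \<in> Ob C ==> A \<in> Ob C ==> ExtMap C (Idt C X) (Idt C A) \<delta> = \<delta>" by (rule ExtMap_Idt)

lemma ExtMap_group_hom: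
  "c \<in> Mor C ==> a \<in> Mor C ==> group_hom (Ext C (Cod C c) (Dom C a)) (Ext C (Dom C c) (Cod C a)) (ExtMap C c a)"
  using ExtMap_hom[of c "Dom C c" "Cod C c" a "Dom C a" "Cod C a"] Ext_grp by (auto simp: group_hom_def group_hom_axioms_def Hom_iff comm_group_def)

lemma Ext_group: "X \<in> Ob C ==> A \<in> Ob C ==> group (Ext C X A)" using Ext_grp by (simp add: comm_group_def)

lemma Ext_one [simp]: "X \<in> Ob C ==> A \<in> Ob C ==> \<one>\<^bsub>Ext C X A\<^esub> \<in> Exts C X A" by (simp add: Ext_group group.is_monoid monoid.one_closed)

lemma Ext_mult [simp]: "X \<in> Ob C ==> A \<in> Ob C ==> \<delta> \<in> Exts C X A ==> \<delta>' \<in> Exts C X A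
   ==> \<delta> \<otimes>\<^bsub>Ext C X A\<^esub> \<delta>' \<in> Exts C X A" by (simp add: Ext_group group.is_monoid monoid.m_closed)

lemma Ext_inv [simp]: "X \<in> Ob C ==> A \<in> Ob C ==> \<delta> \<in> Exts C X A
   ==> inv\<^bsub>Ext C X A\<^esub> \<delta> \<in> Exts C X A" by (simp add: Ext_group)

lemma ExtMap_one [simp]: "c \<in> Mor C ==> a \<in> Mor C ==> Cod C c = X ==> Dom C a = A
   ==> ExtMap C c a \<one>\<^bsub>Ext C X A\<^esub> = \<one>\<^bsub>Ext C (Dom C c) (Cod C a)\<^esub>" using group_hom.hom_one[OF ExtMap_group_hom] by blast

lemma ExtMap_mult: "c \<in> Mor C ==> a \<in> Mor C ==> Cod C c = X ==> Dom C a = A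
   ==> \<delta> \<in> Exts C X A ==> \<delta>' \<in> Exts C X A
   ==> ExtMap C c a (\<delta> \<otimes>\<^bsub>Ext C X A\<^esub> \<delta>') = ExtMap C c a \<delta> \<otimes>\<^bsub>Ext C (Dom C c) (Cod C a)\<^esub> ExtMap C c a \<delta>'"
  using group_hom.hom_mult[OF ExtMap_group_hom] by blast

lemma ExtMap_inv: "c \<in> Mor C ==> a \<in> Mor C ==> Cod C c = X ==> Dom C a = A
   ==> \<delta> \<in> Exts C X A
   ==> ExtMap C c a (inv\<^bsub>Ext C X A\<^esub> \<delta>) = inv\<^bsub>Ext C (Dom C c) (Cod C a)\<^esub> ExtMap C c a \<delta>" using group_hom.hom_inv[OF ExtMap_group_hom] by blast

lemma ExtMap_Add_right: 
  assumes "c \<in> Mor C" "a \<in> Mor C" "a' \<in> Mor C" "Dom C a = Dom C a'" "Cod C a = Cod C a'"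
    "\<delta> \<in> Exts C (Cod C c) (Dom C a')"
  shows "ExtMap C c (Add C a a') \<delta> = ExtMap C c a \<delta> \<otimes>\<^bsub>Ext C (Dom C c) (Cod C a')\<^esub> ExtMap C c a' \<delta>"
proof -
  let ?X = "Cod C c" and ?A = "Dom C a'" and ?A' = "Cod C a'"
  have "ExtMap C c (Add C a a') \<delta> = ExtMap C c (Idt C ?A') (push C ?X (Add C a a') \<delta>)" using assms by (simp add: push_def)
  also have "push C ?X (Add C a a') \<delta> = push C ?X a \<delta> \<otimes>\<^bsub>Ext C ?X ?A'\<^esub> push C ?X a' \<delta>" using assms by (intro push_Add) (auto simp: Hom_iff)
  also have "ExtMap C c (Idt C ?A') ... = ExtMap C c (Idt C ?A') (push C ?X a \<delta>) \<otimes>\<^bsub>Ext C (Dom C c) ?A'\<^esub> ExtMap C c (Idt C ?A') (push C ?X a' \<delta>)"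
    using assms ExtMap_mult[of c "Idt C ?A'" ?X ?A' "push C ?X a \<delta>" "push C ?X a' \<delta>"] by (simp add: push_def)
  finally show ?thesis using assms by (simp add: push_def)
qed

lemma ExtMap_Add_left: 
  assumes "a \<in> Mor C" "c \<in> Mor C" "c' \<in> Mor C" "Dom C c = Dom C c'" "Cod C c = Cod C c'"
    "\<delta> \<in> Exts C (Cod C c') (Dom C a)"
  shows "ExtMap C (Add C c c') a \<delta> = ExtMap C c a \<delta> \<otimes>\<^bsub>Ext C (Dom C c') (Cod C a)\<^esub> ExtMap C c' a \<delta>"
proof -
  let ?X = "Dom C c'" and ?A = "Dom C a"
  have "ExtMap C (Add C c c') a \<delta> = ExtMap C (Idt C ?X) a (pull C ?A (Add C c c') \<delta>)" using assms by (simp add: pull_def)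
  also have "pull C ?A (Add C c c') \<delta> = pull C ?A c \<delta> \<otimes>\<^bsub>Ext C ?X ?A\<^esub> pull C ?A c' \<delta>" using assms by (intro pull_Add) (auto simp: Hom_iff)
  also have "ExtMap C (Idt C ?X) a ... = ExtMap C (Idt C ?X) a (pull C ?A c \<delta>) \<otimes>\<^bsub>Ext C ?X (Cod C a)\<^esub> ExtMap C (Idt C ?X) a (pull C ?A c' \<delta>)"
    using assms ExtMap_mult[of "Idt C ?X" a ?X ?A "pull C ?A c \<delta>" "pull C ?A c' \<delta>"] by (simp add: pull_def)
  finally show ?thesis using assms by (simp add: pull_def)
qed

lemma ExtMap_Zero [simp]:
  assumes "c \<in> Mor C" "a \<in> Mor C"
  shows "A \<in> Ob C ==> B \<in> Ob C ==> \<delta> \<in> Exts C (Cod C c) A ==> ExtMap C c (Zero C A B) \<delta> = \<one>\<^bsub>Ext C (Dom C c) B\<^esub>"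
    "X \<in> Ob C ==> Y \<in> Ob C ==> \<delta> \<in> Exts C Y (Dom C a) ==> ExtMap C (Zero C X Y) a \<delta> = \<one>\<^bsub>Ext C X (Cod C a)\<^esub>"
proof -
  show "ExtMap C c (Zero C A B) \<delta> = \<one>\<^bsub>Ext C (Dom C c) B\<^esub>"
    if *: "A \<in> Ob C" "B \<in> Ob C" "\<delta> \<in> Exts C (Cod C c) A"
  proof -
    interpret G: group "Ext C (Dom C c) B" using assms * Ext_group by simp
    have 1: "ExtMap C c (Zero C A B) \<delta> \<in> Exts C (Dom C c) B" using assms * by simp
    have "ExtMap C c (Zero C A B) \<delta> = ExtMap C c (Zero C A B) \<delta> \<otimes>\<^bsub>Ext C (Dom C c) B\<^esub> ExtMap C c (Zero C A B) \<delta>"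
      using ExtMap_Add_right[of c "Zero C A B" "Zero C A B" \<delta>] assms * by simp
    then show ?thesis using 1 by (metis G.r_cancel_one')
  qed
  show "ExtMap C (Zero C X Y) a \<delta> = \<one>\<^bsub>Ext C X (Cod C a)\<^esub>"
    if *: "X \<in> Ob C" "Y \<in> Ob C" "\<delta> \<in> Exts C Y (Dom C a)"
  proof -
    interpret G: group "Ext C X (Cod C a)" using assms * Ext_group by simp
    have 1: "ExtMap C (Zero C X Y) a \<delta> \<in> Exts C X (Cod C a)" using assms * by simp
    have "ExtMap C (Zero C X Y) a \<delta> = ExtMap C (Zero C X Y) a \<delta> \<otimes>\<^bsub>Ext C X (Cod C a)\<^esub> ExtMap C (Zero C X Y) a \<delta>"
      using ExtMap_Add_left[of a "Zero C X Y" "Zero C X Y" \<delta>] assms * by simp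
    then show ?thesis using 1 by (metis G.r_cancel_one')
  qed
qed

lemma ExtMap_iso_one:
  assumes "isomorphism C c" "isomorphism C a" "\<delta> \<in> Exts C (Cod C c) (Dom C a)"
    "ExtMap C c a \<delta> = \<one>\<^bsub>Ext C (Dom C c) (Cod C a)\<^esub>"
  shows "\<delta> = \<one>\<^bsub>Ext C (Cod C c) (Dom C a)\<^esub>"
proof -
  note [simp] = isomorphism_Mor[OF assms(1)] isomorphism_Mor[OF assms(2)]
  have "ExtMap C (inv_mor C c) (inv_mor C a) (ExtMap C c a \<delta>) = \<delta>" using assms(1-3) by simp
  then show ?thesis using assms by simp
qed

lemma ExtMap_iso_inj:
  assumes "isomorphism C c" "isomorphism C a" "\<delta> \<in> Exts C (Cod C c) (Dom C a)"
    "\<delta>' \<in> Exts C (Cod C c) (Dom C a)" "ExtMap C c a \<delta> = ExtMap C c a \<delta>'"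
  shows "\<delta> = \<delta>'"
proof -
  note [simp] = isomorphism_Mor[OF assms(1)] isomorphism_Mor[OF assms(2)]
  have "ExtMap C (inv_mor C c) (inv_mor C a) (ExtMap C c a \<delta>) = \<delta>"
    "ExtMap C (inv_mor C c) (inv_mor C a) (ExtMap C c a \<delta>') = \<delta>'" using assms(1-4) by simp_all
  then show ?thesis using assms(5) by metis
qed

end

section \<open>Duality\<close>

text \<open>The dual of \<open>(C, \<bbbE>, \<ss>)\<close> has \<open>\<bbbE>(A, X)\<close> as its group at \<open>(X, A)\<close>, so that push and pull are exchanged; a
  triangle is read backwards with the same extension.\<close>

definition opposite :: "('o, 'm, 'e) ext_cat => ('o, 'm, 'e) ext_cat"
  where "opposite C = \<lparr>Ob = Ob C, Mor = Mor C, Dom = Cod C, Cod = Dom C, Idt = Idt C,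
    Cmp = (\<lambda>g f. f \<cdot>\<^bsub>C\<^esub> g), Add = Add C, Zero = (\<lambda>X Y. Zero C Y X),
    Ext = (\<lambda>X A. Ext C A X), ExtMap = (\<lambda>c a. ExtMap C a c),
    Real = (\<lambda>X A \<delta>. {(y, x). (x, y) \<in> Real C A X \<delta>})\<rparr>"

lemma opposite_simps [simp]:
  "Ob (opposite C) = Ob C" "Mor (opposite C) = Mor C" "Dom (opposite C) = Cod C"
  "Cod (opposite C) = Dom C" "Idt (opposite C) = Idt C" "g \<cdot>\<^bsub>opposite C\<^esub> f = f \<cdot>\<^bsub>C\<^esub> g"
  "Add (opposite C) = Add C" "Zero (opposite C) X Y = Zero C Y X" "Ext (opposite C) X A = Ext C A X"
  "ExtMap (opposite C) c a = ExtMap C a c"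
  "Real (opposite C) X A \<delta> = {(y, x). (x, y) \<in> Real C A X \<delta>}" by (simp_all add: opposite_def)

lemma Hom_opposite [simp]: "Hom (opposite C) X Y = Hom C Y X" by (auto simp: Hom_def)

lemma hom_grp_opposite [simp]: "hom_grp (opposite C) X Y = hom_grp C Y X" by (simp add: hom_grp_def)

lemma Neg_opposite [simp]: "Neg (opposite C) f = Neg C f" by (simp add: Neg_def)

lemma push_pull_opposite [simp]: "push (opposite C) = pull C" "pull (opposite C) = push C" by (auto simp: push_def pull_def fun_eq_iff)

lemma zero_object_opposite [simp]: "zero_object (opposite C) Z = zero_object C Z" by (auto simp: zero_object_def)

lemma inverse_pair_opposite [simp]: "inverse_pair (opposite C) f g = inverse_pair C f g" by (auto simp: inverse_pair_def)

lemma isomorphism_opposite [simp]: "isomorphism (opposite C) f = isomorphism C f" by (simp add: isomorphism_def)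

lemma inv_mor_opposite [simp]: "inv_mor (opposite C) f = inv_mor C f" by (simp add: inv_mor_def)

lemma opposite_opposite [simp]: "opposite (opposite C) = C" by (cases C) (simp add: opposite_def)

text \<open>(C3) and (C3') list the two summands of the middle term in opposite order. With the summands exchanged
  they are dual to each other, signs included.\<close>

lemma biproduct_swap:
  assumes "additive_category C" "biproduct C X Y P i1 i2 p1 p2"
  shows "biproduct C Y X P i2 i1 p2 p1"
proof -
  interpret additive_category C by fact
  note b = biproduct_simps[OF assms(2)]
  have "Add C (i2 \<cdot>\<^bsub>C\<^esub> p2) (i1 \<cdot>\<^bsub>C\<^esub> p1) = Add C (i1 \<cdot>\<^bsub>C\<^esub> p1) (i2 \<cdot>\<^bsub>C\<^esub> p2)" by (rule Add_comm) (simp_all add: b)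
  then show ?thesis unfolding biproduct_def by (simp add: b Hom_iff)
qed

lemma biproduct_opposite:
  "additive_category C ==> biproduct (opposite C) X Y P i1 i2 p1 p2 \<longleftrightarrow> biproduct C X Y P p1 p2 i1 i2" by (auto simp: biproduct_def)

context category
begin

lemma mem_seq_class:
  assumes "x \<in> Hom C A B" "y \<in> Hom C B X"
  shows "(x', y') \<in> seq_class C x y \<longleftrightarrow>
    (\<exists>b. isomorphism C b \<and> Dom C b = B \<and> x' = b \<cdot> x \<and> y' = y \<cdot> inv_mor C b)" (is "?L \<longleftrightarrow> ?R")
proof
  note * = assms[unfolded Hom_iff]
  assume ?L
  then obtain b where b: "b \<in> Hom C B (Cod C x')" "isomorphism C b" "b \<cdot> x = x'" "y' \<cdot> b = y"
    "y' \<in> Hom C (Cod C x') X" using * by (auto simp: seq_class_def)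
  have "y' = (y' \<cdot> b) \<cdot> inv_mor C b" using b(1,2,5) by (simp add: Hom_iff)
  then have "y' = y \<cdot> inv_mor C b" unfolding b(4) .
  then show ?R using b(1-3) by (auto simp: Hom_iff)
next
  note * = assms[unfolded Hom_iff]
  assume ?R
  then obtain b where b: "isomorphism C b" "Dom C b = B" "x' = b \<cdot> x" "y' = y \<cdot> inv_mor C b" by blast
  note b' = isomorphism_Mor[OF b(1)]
  have "y' \<cdot> b = y" using b(1,2) b' * unfolding b(4) by simp
  then show ?L unfolding seq_class_def using b b' * by (auto simp: Hom_iff intro!: bexI[of _ b])
qed

lemma inv_mor_unique:
  "g \<cdot> f = Idt C X ==> isomorphism C f ==> f \<in> Hom C X Y ==> g \<in> Hom C Y X ==> g = inv_mor C f"
  by (rule isomorphism_cancel_right[of f]) (auto simp: Hom_iff)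

lemma inv_mor_Idt [simp]: "X \<in> Ob C ==> inv_mor C (Idt C X) = Idt C X" by (rule inv_mor_unique[of _ _ X X, symmetric]) (auto simp: Hom_iff)

lemma seq_class_self:
  assumes "x \<in> Hom C A B" "y \<in> Hom C B X"
  shows "(x, y) \<in> seq_class C x y" unfolding mem_seq_class[OF assms] using assms Hom_Ob[OF assms(1)]
  by (intro exI[of _ "Idt C B"]) (auto simp: Hom_iff)

lemma inv_mor_inv_mor [simp]: "isomorphism C f ==> inv_mor C (inv_mor C f) = f" by (rule inv_mor_unique[of _ _ "Cod C f" "Dom C f", symmetric])
    (auto simp: Hom_iff isomorphism_Mor)

lemma inv_mor_comp:
  "isomorphism C f ==> isomorphism C g ==> Cod C f = Dom C g ==> inv_mor C (g \<cdot> f) = inv_mor C f \<cdot> inv_mor C g"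
  by (rule inv_mor_unique[of _ _ "Dom C f" "Cod C g", symmetric])
    (auto simp: Hom_iff isomorphism_Mor isomorphism_Cmp)

lemma seq_class_eqI:
  assumes "x \<in> Hom C A B" "y \<in> Hom C B X" "(x', y') \<in> seq_class C x y"
  shows "seq_class C x' y' = seq_class C x y"
proof -
  obtain b where b: "isomorphism C b" "Dom C b = B" "x' = b \<cdot> x" "y' = y \<cdot> inv_mor C b" using assms mem_seq_class by blast
  note [simp] = isomorphism_Mor[OF b(1)]
  note * = assms(1,2)[unfolded Hom_iff]
  have h: "x' \<in> Hom C A (Cod C b)" "y' \<in> Hom C (Cod C b) X" using b * by (auto simp: Hom_iff)
  have "(\<exists>d. isomorphism C d \<and> Dom C d = Cod C b \<and> u = d \<cdot> x' \<and> v = y' \<cdot> inv_mor C d)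
     \<longleftrightarrow> (\<exists>d. isomorphism C d \<and> Dom C d = B \<and> u = d \<cdot> x \<and> v = y \<cdot> inv_mor C d)" for u v
  proof
    assume "\<exists>d. isomorphism C d \<and> Dom C d = Cod C b \<and> u = d \<cdot> x' \<and> v = y' \<cdot> inv_mor C d"
    then obtain d where d: "isomorphism C d" "Dom C d = Cod C b" "u = d \<cdot> x'" "v = y' \<cdot> inv_mor C d" by blast
    note [simp] = isomorphism_Mor[OF d(1)]
    show "\<exists>d. isomorphism C d \<and> Dom C d = B \<and> u = d \<cdot> x \<and> v = y \<cdot> inv_mor C d"
      using b d * by (intro exI[of _ "d \<cdot> b"]) (simp add: isomorphism_Cmp inv_mor_comp)
  next
    assume "\<exists>d. isomorphism C d \<and> Dom C d = B \<and> u = d \<cdot> x \<and> v = y \<cdot> inv_mor C d"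
    then obtain d where d: "isomorphism C d" "Dom C d = B" "u = d \<cdot> x" "v = y \<cdot> inv_mor C d" by blast
    note [simp] = isomorphism_Mor[OF d(1)]
    show "\<exists>d. isomorphism C d \<and> Dom C d = Cod C b \<and> u = d \<cdot> x' \<and> v = y' \<cdot> inv_mor C d"
      using b d * by (intro exI[of _ "d \<cdot> inv_mor C b"]) (simp add: isomorphism_Cmp inv_mor_comp)
  qed
  then show ?thesis using mem_seq_class[OF h] mem_seq_class[OF assms(1,2)] by auto
qed

end

lemma category_opposite: "category C ==> category (opposite C)"
proof -
  assume "category C"
  then interpret category C .
  show ?thesis by unfold_locales (auto simp: Hom_iff)
qed

lemma additive_category_opposite: "additive_category C ==> additive_category (opposite C)"
proof -
  assume a: "additive_category C"
  then interpret additive_category C .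
  interpret o: category "opposite C" by (rule category_opposite) unfold_locales
  show ?thesis
  proof (rule additive_category.intro[OF o.category_axioms], rule additive_category_axioms.intro)
    show "\<exists>Z. zero_object (opposite C) Z" using ex_zero_object by simp
    show "\<exists>P i1 i2 p1 p2. biproduct (opposite C) X Y P i1 i2 p1 p2"
      if "X \<in> Ob (opposite C)" "Y \<in> Ob (opposite C)" for X Y using ex_biproduct[of X Y] that by (simp add: biproduct_opposite[OF a]) blast
  qed (auto simp: hom_grp Hom_iff)
qed

lemma biadditive_Ext_opposite: "biadditive_Ext C ==> biadditive_Ext (opposite C)"
proof -
  let ?O = "opposite C"
  assume a: "biadditive_Ext C"
  then interpret biadditive_Ext C .
  interpret o: additive_category "opposite C" by (rule additive_category_opposite) unfold_locales
  show ?thesis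
  proof (rule biadditive_Ext.intro[OF o.additive_category_axioms], rule biadditive_Ext_axioms.intro)
    fix c X' X a A A' assume "c \<in> Hom ?O X' X" "a \<in> Hom ?O A A'"
    then show "ExtMap ?O c a \<in> hom (Ext ?O X A) (Ext ?O X' A')" using ExtMap_hom by simp
  qed (auto simp: Ext_grp pull_Add push_Add Hom_iff)
qed

lemma seq_class_opposite:
  assumes "category C" "x \<in> Hom C A B" "y \<in> Hom C B X"
  shows "seq_class (opposite C) y x = {(y', x'). (x', y') \<in> seq_class C x y}"
proof -
  interpret category C by fact
  interpret o: category "opposite C" by (rule category_opposite) fact
  have h: "y \<in> Hom (opposite C) X B" "x \<in> Hom (opposite C) B A" using assms by auto
  have "(\<exists>b. isomorphism C b \<and> Cod C b = B \<and> v = y \<cdot>\<^bsub>C\<^esub> b \<and> u = inv_mor C b \<cdot>\<^bsub>C\<^esub> x)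
    \<longleftrightarrow> (\<exists>b. isomorphism C b \<and> Dom C b = B \<and> u = b \<cdot>\<^bsub>C\<^esub> x \<and> v = y \<cdot>\<^bsub>C\<^esub> inv_mor C b)" for u v by (metis inv_mor_inv_mor inv_mor_simps(2,3,6))
  then show ?thesis using mem_seq_class[OF assms(2,3)] o.mem_seq_class[OF h] by auto
qed

lemma s_triangle_opposite:
  assumes "category C"
  shows "s_triangle (opposite C) A B X x y \<delta> \<longleftrightarrow> s_triangle C X B A y x \<delta>"
proof -
  have "{(y, x). (x, y) \<in> R} = {(y, x). (x, y) \<in> T} \<longleftrightarrow> R = T" for R T :: "('b \<times> 'b) set" by auto
  then show ?thesis unfolding s_triangle_def using seq_class_opposite[OF assms, of y X B x A] by (auto 0 0)
qed

lemma inflation_opposite: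
  "category C ==> inflation (opposite C) f \<longleftrightarrow> deflation C f"
  "category C ==> deflation (opposite C) f \<longleftrightarrow> inflation C f" by (metis inflation_def deflation_def s_triangle_opposite)+

text \<open>The axioms of a weakly extriangulated category without the primed ones, which are the unprimed
  ones of the opposite category.\<close>

locale half_weakly_extriangulated = biadditive_Ext C
  for C :: "('o, 'm, 'e) ext_cat" (structure) +
  assumes ex_s_triangle: "X \<in> Ob C ==> A \<in> Ob C ==> \<delta> \<in> Exts C X A
                       ==> \<exists>B x y. s_triangle C A B X x y \<delta>"
    and half_C1: "s_triangle C A B X x y \<delta> ==> W \<in> Ob C ==>
        (\<lambda>f. x \<cdot> f) ` Hom C W A = kernel (hom_grp C W B) (hom_grp C W X) (\<lambda>f. y \<cdot> f) \<and>
        (\<lambda>f. y \<cdot> f) ` Hom C W B = kernel (hom_grp C W X) (Ext C W A) (\<lambda>f. pull C A f \<delta>)"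
    and half_C2: "A \<in> Ob C ==> zero_object C Z
             ==> Real C Z A \<one>\<^bsub>Ext C Z A\<^esub> = seq_class C (Idt C A) (Zero C A Z)"
    and half_C3: "s_triangle C A B X x y \<delta> ==> a \<in> Hom C A A' ==> s_triangle C A' B' X x' y' (push C X a \<delta>) ==>
        \<exists>b\<in>Hom C B B'. b \<cdot> x = x' \<cdot> a \<and> y = y' \<cdot> b \<and>
          (\<forall>P i1 i2 p1 p2. biproduct C B A' P i1 i2 p1 p2 -->
             s_triangle C A P B' (Add C (i1 \<cdot> x) (i2 \<cdot> a)) (Add C (b \<cdot> p1) (Neg C x' \<cdot> p2)) (pull C A y' \<delta>))"

lemma weakly_extriangulated_imp_half:
  "weakly_extriangulated C ==> half_weakly_extriangulated C"
  by (simp add: weakly_extriangulated_def weakly_extriangulated_axioms_def half_weakly_extriangulated_def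
      half_weakly_extriangulated_axioms_def)

lemma half_weakly_extriangulated_opposite:
  assumes "weakly_extriangulated C" shows "half_weakly_extriangulated (opposite C)"
proof -
  let ?O = "opposite C"
  interpret weakly_extriangulated C by fact
  interpret o: biadditive_Ext "opposite C" by (rule biadditive_Ext_opposite) unfold_locales
  note st = s_triangle_opposite[OF category_axioms]
  show ?thesis
  proof unfold_locales
    fix X A \<delta> assume "X \<in> Ob ?O" "A \<in> Ob ?O" "\<delta> \<in> Exts ?O X A"
    then show "\<exists>B x y. s_triangle ?O A B X x y \<delta>" using Real_class[of A X \<delta>] by (auto simp: st)
  next
    fix A B X x y \<delta> W assume "s_triangle ?O A B X x y \<delta>" "W \<in> Ob ?O"
    then show "(\<lambda>f. x \<cdot>\<^bsub>?O\<^esub> f) ` Hom ?O W A = kernel (hom_grp ?O W B) (hom_grp ?O W X) (\<lambda>f. y \<cdot>\<^bsub>?O\<^esub> f) \<and>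
        (\<lambda>f. y \<cdot>\<^bsub>?O\<^esub> f) ` Hom ?O W B = kernel (hom_grp ?O W X) (Ext ?O W A) (\<lambda>f. pull ?O A f \<delta>)"
      using C1'[of X B A y x \<delta> W] by (simp add: st)
  next
    fix A Z assume A: "A \<in> Ob ?O" "zero_object ?O Z"
    then have h: "Zero C Z A \<in> Hom C Z A" "Idt C A \<in> Hom C A A" using zero_object_Ob by (auto simp: Hom_iff)
    show "Real ?O Z A \<one>\<^bsub>Ext ?O Z A\<^esub> = seq_class ?O (Idt ?O A) (Zero ?O A Z)"
      using A C2'[of A Z] seq_class_opposite[OF category_axioms h] by simp
  next
    fix A B X x y \<delta> a A' B' x' y'
    assume t: "s_triangle ?O A B X x y \<delta>" "a \<in> Hom ?O A A'"
      "s_triangle ?O A' B' X x' y' (push ?O X a \<delta>)"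
    then obtain b where b: "b \<in> Hom C B' B" "b \<cdot>\<^bsub>C\<^esub> y' = y" "a \<cdot>\<^bsub>C\<^esub> x' = x \<cdot>\<^bsub>C\<^esub> b"
      and cone: "\<And>P i1 i2 p1 p2. biproduct C A' B P i1 i2 p1 p2 ==>
        s_triangle C B' P A (Add C (i1 \<cdot>\<^bsub>C\<^esub> Neg C x') (i2 \<cdot>\<^bsub>C\<^esub> b)) (Add C (a \<cdot>\<^bsub>C\<^esub> p1) (x \<cdot>\<^bsub>C\<^esub> p2)) (push C A y' \<delta>)"
      using C3'[of X B A y x \<delta> a A' B' y' x'] by (simp add: st) blast
    have h: "x \<in> Hom C B A" "a \<in> Hom C A' A" "x' \<in> Hom C B' A'" using t by (auto simp: s_triangle_def)
    show "\<exists>b\<in>Hom ?O B B'. b \<cdot>\<^bsub>?O\<^esub> x = x' \<cdot>\<^bsub>?O\<^esub> a \<and> y = y' \<cdot>\<^bsub>?O\<^esub> b \<and>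
          (\<forall>P i1 i2 p1 p2. biproduct ?O B A' P i1 i2 p1 p2 -->
             s_triangle ?O A P B' (Add ?O (i1 \<cdot>\<^bsub>?O\<^esub> x) (i2 \<cdot>\<^bsub>?O\<^esub> a))
               (Add ?O (b \<cdot>\<^bsub>?O\<^esub> p1) (Neg ?O x' \<cdot>\<^bsub>?O\<^esub> p2)) (pull ?O A y' \<delta>))"
    proof (intro bexI[of _ b] conjI allI impI)
      fix P i1 i2 p1 p2 assume "biproduct ?O B A' P i1 i2 p1 p2"
      then have bp: "biproduct C A' B P p2 p1 i2 i1"
        using biproduct_swap[OF additive_category_axioms iffD1[OF biproduct_opposite[OF additive_category_axioms]]] by simp
      note bs = biproduct_simps[OF bp]
      have "Add C (p2 \<cdot>\<^bsub>C\<^esub> Neg C x') (p1 \<cdot>\<^bsub>C\<^esub> b) = Add C (p1 \<cdot>\<^bsub>C\<^esub> b) (p2 \<cdot>\<^bsub>C\<^esub> Neg C x')"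
        by (rule Add_comm) (use b(1) h in \<open>simp_all add: bs Hom_iff\<close>)
      moreover have "Add C (a \<cdot>\<^bsub>C\<^esub> i2) (x \<cdot>\<^bsub>C\<^esub> i1) = Add C (x \<cdot>\<^bsub>C\<^esub> i1) (a \<cdot>\<^bsub>C\<^esub> i2)" by (rule Add_comm) (use b(1) h in \<open>simp_all add: bs Hom_iff\<close>)
      ultimately show "s_triangle ?O A P B' (Add ?O (i1 \<cdot>\<^bsub>?O\<^esub> x) (i2 \<cdot>\<^bsub>?O\<^esub> a))
               (Add ?O (b \<cdot>\<^bsub>?O\<^esub> p1) (Neg ?O x' \<cdot>\<^bsub>?O\<^esub> p2)) (pull ?O A y' \<delta>)"
        using cone[OF bp] by (simp only: st opposite_simps Neg_opposite push_pull_opposite)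
    qed (use b in auto)
  qed
qed

lemma weakly_extriangulated_opposite_if_half:
  assumes "half_weakly_extriangulated C" "half_weakly_extriangulated (opposite C)"
  shows "weakly_extriangulated (opposite C)"
proof -
  let ?O = "opposite C"
  interpret half_weakly_extriangulated C by fact
  interpret o: half_weakly_extriangulated "opposite C" by fact
  note st = s_triangle_opposite[OF category_axioms]
  show ?thesis
  proof unfold_locales
    fix A B X x y \<delta> W assume "s_triangle ?O A B X x y \<delta>" "W \<in> Ob ?O"
    then show "(\<lambda>g. g \<cdot>\<^bsub>?O\<^esub> y) ` Hom ?O X W = kernel (hom_grp ?O B W) (hom_grp ?O A W) (\<lambda>g. g \<cdot>\<^bsub>?O\<^esub> x) \<and>
        (\<lambda>g. g \<cdot>\<^bsub>?O\<^esub> x) ` Hom ?O B W = kernel (hom_grp ?O A W) (Ext ?O X W) (\<lambda>g. push ?O X g \<delta>)"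
      using half_C1[of X B A y x \<delta> W] by (simp add: st)
  next
    fix A Z assume A: "A \<in> Ob ?O" "zero_object ?O Z"
    then have h: "Idt C A \<in> Hom C A A" "Zero C A Z \<in> Hom C A Z" using zero_object_Ob by (auto simp: Hom_iff)
    show "Real ?O A Z \<one>\<^bsub>Ext ?O A Z\<^esub> = seq_class ?O (Zero ?O Z A) (Idt ?O A)"
      using A half_C2[of A Z] seq_class_opposite[OF category_axioms h] by simp
  next
    fix A B X x y \<delta> c X' B' x' y'
    assume t: "s_triangle ?O A B X x y \<delta>" "c \<in> Hom ?O X' X"
      "s_triangle ?O A B' X' x' y' (pull ?O A c \<delta>)"
    then obtain b where b: "b \<in> Hom C B B'" "b \<cdot>\<^bsub>C\<^esub> y = y' \<cdot>\<^bsub>C\<^esub> c" "x = x' \<cdot>\<^bsub>C\<^esub> b"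
      and cone: "\<And>P i1 i2 p1 p2. biproduct C B X' P i1 i2 p1 p2 ==>
        s_triangle C X P B' (Add C (i1 \<cdot>\<^bsub>C\<^esub> y) (i2 \<cdot>\<^bsub>C\<^esub> c)) (Add C (b \<cdot>\<^bsub>C\<^esub> p1) (Neg C y' \<cdot>\<^bsub>C\<^esub> p2)) (pull C X x' \<delta>)"
      using half_C3[of X B A y x \<delta> c X' B' y' x'] by (simp add: st) blast
    have h: "y \<in> Hom C X B" "c \<in> Hom C X X'" "y' \<in> Hom C X' B'" using t by (auto simp: s_triangle_def)
    show "\<exists>b\<in>Hom ?O B' B. b \<cdot>\<^bsub>?O\<^esub> x' = x \<and> c \<cdot>\<^bsub>?O\<^esub> y' = y \<cdot>\<^bsub>?O\<^esub> b \<and>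
          (\<forall>P i1 i2 p1 p2. biproduct ?O X' B P i1 i2 p1 p2 -->
             s_triangle ?O B' P X (Add ?O (i1 \<cdot>\<^bsub>?O\<^esub> Neg ?O y') (i2 \<cdot>\<^bsub>?O\<^esub> b))
               (Add ?O (c \<cdot>\<^bsub>?O\<^esub> p1) (y \<cdot>\<^bsub>?O\<^esub> p2)) (push ?O X x' \<delta>))"
    proof (intro bexI[of _ b] conjI allI impI)
      fix P i1 i2 p1 p2 assume "biproduct ?O X' B P i1 i2 p1 p2"
      then have bp: "biproduct C B X' P p2 p1 i2 i1"
        using biproduct_swap[OF additive_category_axioms iffD1[OF biproduct_opposite[OF additive_category_axioms]]] by simp
      note bs = biproduct_simps[OF bp]
      have "Add C (p2 \<cdot>\<^bsub>C\<^esub> y) (p1 \<cdot>\<^bsub>C\<^esub> c) = Add C (p1 \<cdot>\<^bsub>C\<^esub> c) (p2 \<cdot>\<^bsub>C\<^esub> y)" by (rule Add_comm) (use b(1) h in \<open>simp_all add: bs Hom_iff\<close>)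
      moreover have "Add C (b \<cdot>\<^bsub>C\<^esub> i2) (Neg C y' \<cdot>\<^bsub>C\<^esub> i1) = Add C (Neg C y' \<cdot>\<^bsub>C\<^esub> i1) (b \<cdot>\<^bsub>C\<^esub> i2)"
        by (rule Add_comm) (use b(1) h in \<open>simp_all add: bs Hom_iff\<close>)
      ultimately show "s_triangle ?O B' P X (Add ?O (i1 \<cdot>\<^bsub>?O\<^esub> Neg ?O y') (i2 \<cdot>\<^bsub>?O\<^esub> b))
               (Add ?O (c \<cdot>\<^bsub>?O\<^esub> p1) (y \<cdot>\<^bsub>?O\<^esub> p2)) (push ?O X x' \<delta>)"
        using cone[OF bp] by (simp only: st opposite_simps Neg_opposite push_pull_opposite)
    qed (use b in auto)
  qed (rule o.ex_s_triangle o.half_C1 o.half_C2 o.half_C3; assumption)+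
qed

lemma weakly_extriangulated_opposite:
  "weakly_extriangulated C ==> weakly_extriangulated (opposite C)"
  by (rule weakly_extriangulated_opposite_if_half[OF weakly_extriangulated_imp_half half_weakly_extriangulated_opposite])

lemma weakly_extriangulated_if_half:
  "half_weakly_extriangulated C ==> half_weakly_extriangulated (opposite C) ==> weakly_extriangulated C"
  using weakly_extriangulated_opposite_if_half[of "opposite C"] by simp

section \<open>Exact sequences of triangles and the five lemma\<close>

text \<open>Exactness of the covariant sequence in terms of elements: both composites vanish and kernels lie in
  images. In this form it can be transported and dualized without mentioning homomorphisms.\<close>

definition cov_exact :: "('o, 'm, 'e, 'z) ext_cat_scheme => 'o => 'o => 'o => 'm => 'm => 'e => bool"
  where "cov_exact C A B X x y \<delta> \<longleftrightarrow> y \<cdot>\<^bsub>C\<^esub> x = Zero C A X \<and> pull C A y \<delta> = \<one>\<^bsub>Ext C B A\<^esub> \<and>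
    (\<forall>f\<in>Mor C. Cod C f = B \<and> y \<cdot>\<^bsub>C\<^esub> f = Zero C (Dom C f) X --> (\<exists>g\<in>Hom C (Dom C f) A. f = x \<cdot>\<^bsub>C\<^esub> g)) \<and>
    (\<forall>f\<in>Mor C. Cod C f = X \<and> pull C A f \<delta> = \<one>\<^bsub>Ext C (Dom C f) A\<^esub> --> (\<exists>g\<in>Hom C (Dom C f) B. f = y \<cdot>\<^bsub>C\<^esub> g))"

definition tri_mor :: "('o, 'm, 'e, 'z) ext_cat_scheme => 'm => 'm => 'e => 'm => 'm => 'e => 'm => 'm => 'm => bool"
  where "tri_mor C x y \<delta> x' y' \<delta>' a b c \<longleftrightarrow>
    a \<in> Hom C (Dom C x) (Dom C x') \<and> b \<in> Hom C (Cod C x) (Cod C x') \<and> c \<in> Hom C (Cod C y) (Cod C y') \<and>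
    b \<cdot>\<^bsub>C\<^esub> x = x' \<cdot>\<^bsub>C\<^esub> a \<and> c \<cdot>\<^bsub>C\<^esub> y = y' \<cdot>\<^bsub>C\<^esub> b \<and> push C (Cod C y) a \<delta> = pull C (Dom C x') c \<delta>'"

context biadditive_Ext
begin

lemma cov_exact_iff_C1:
  assumes h: "x \<in> Hom C A B" "y \<in> Hom C B X" "\<delta> \<in> Exts C X A"
  shows "cov_exact C A B X x y \<delta> \<longleftrightarrow> (\<forall>W\<in>Ob C.
        (\<lambda>f. x \<cdot> f) ` Hom C W A = kernel (hom_grp C W B) (hom_grp C W X) (\<lambda>f. y \<cdot> f) \<and>
        (\<lambda>f. y \<cdot> f) ` Hom C W B = kernel (hom_grp C W X) (Ext C W A) (\<lambda>f. pull C A f \<delta>))" (is "?L \<longleftrightarrow> ?R")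
proof
  note * = h[unfolded Hom_iff]
  have [simp]: "A \<in> Ob C" "B \<in> Ob C" "X \<in> Ob C" using h Hom_Ob by auto
  assume L: ?L
  show ?R
  proof (intro ballI conjI)
    fix W assume W: "W \<in> Ob C"
    show "(\<lambda>f. x \<cdot> f) ` Hom C W A = kernel (hom_grp C W B) (hom_grp C W X) (\<lambda>f. y \<cdot> f)"
    proof (intro Set.set_eqI iffI)
      fix g assume "g \<in> (\<lambda>f. x \<cdot> f) ` Hom C W A"
      then obtain f where f: "f \<in> Mor C" "Dom C f = W" "Cod C f = A" "g = x \<cdot> f" by (auto simp: Hom_iff)
      have "y \<cdot> x \<cdot> f = Zero C A X \<cdot> f" by (rule Cmp_collapse) (use L f * in \<open>auto simp: cov_exact_def\<close>)
      then show "g \<in> kernel (hom_grp C W B) (hom_grp C W X) (\<lambda>f. y \<cdot> f)" using f * by (simp add: kernel_def Hom_iff)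
    next
      fix g assume "g \<in> kernel (hom_grp C W B) (hom_grp C W X) (\<lambda>f. y \<cdot> f)"
      then show "g \<in> (\<lambda>f. x \<cdot> f) ` Hom C W A" using L by (auto simp: kernel_def cov_exact_def Hom_iff)
    qed
    show "(\<lambda>f. y \<cdot> f) ` Hom C W B = kernel (hom_grp C W X) (Ext C W A) (\<lambda>f. pull C A f \<delta>)"
    proof (intro Set.set_eqI iffI)
      fix g assume "g \<in> (\<lambda>f. y \<cdot> f) ` Hom C W B"
      then obtain f where f: "f \<in> Mor C" "Dom C f = W" "Cod C f = B" "g = y \<cdot> f" by (auto simp: Hom_iff)
      have "pull C A g \<delta> = pull C A f (pull C A y \<delta>)" using f * by (simp add: pull_def)
      also have "... = \<one>\<^bsub>Ext C W A\<^esub>" using L f by (simp add: cov_exact_def) (simp add: pull_def)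
      finally show "g \<in> kernel (hom_grp C W X) (Ext C W A) (\<lambda>f. pull C A f \<delta>)" using f * by (simp add: kernel_def Hom_iff)
    next
      fix g assume "g \<in> kernel (hom_grp C W X) (Ext C W A) (\<lambda>f. pull C A f \<delta>)"
      then show "g \<in> (\<lambda>f. y \<cdot> f) ` Hom C W B" using L by (auto simp: kernel_def cov_exact_def Hom_iff)
    qed
  qed
next
  note * = h[unfolded Hom_iff]
  have [simp]: "A \<in> Ob C" "B \<in> Ob C" "X \<in> Ob C" using h Hom_Ob by auto
  assume R: ?R
  have 1: "(\<lambda>f. x \<cdot> f) ` Hom C W A = kernel (hom_grp C W B) (hom_grp C W X) (\<lambda>f. y \<cdot> f)"
    "(\<lambda>f. y \<cdot> f) ` Hom C W B = kernel (hom_grp C W X) (Ext C W A) (\<lambda>f. pull C A f \<delta>)" if "W \<in> Ob C" for W using R that by auto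
  have "x \<cdot> Idt C A \<in> (\<lambda>f. x \<cdot> f) ` Hom C A A" by (intro imageI) (simp add: Hom_iff)
  then have a: "y \<cdot> x = Zero C A X" using * unfolding 1(1)[OF \<open>A \<in> Ob C\<close>] by (simp add: kernel_def)
  have "y \<cdot> Idt C B \<in> (\<lambda>f. y \<cdot> f) ` Hom C B B" by (intro imageI) (simp add: Hom_iff)
  then have b: "pull C A y \<delta> = \<one>\<^bsub>Ext C B A\<^esub>" using * unfolding 1(2)[OF \<open>B \<in> Ob C\<close>] by (simp add: kernel_def)
  show ?L unfolding cov_exact_def
  proof (intro conjI ballI impI a b)
    fix f assume f: "f \<in> Mor C" "Cod C f = B \<and> y \<cdot> f = Zero C (Dom C f) X"
    then have "f \<in> (\<lambda>f. x \<cdot> f) ` Hom C (Dom C f) A" by (subst 1(1)) (auto simp: kernel_def Hom_iff)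
    then show "\<exists>g\<in>Hom C (Dom C f) A. f = x \<cdot> g" by auto
  next
    fix f assume f: "f \<in> Mor C" "Cod C f = X \<and> pull C A f \<delta> = \<one>\<^bsub>Ext C (Dom C f) A\<^esub>"
    then have "f \<in> (\<lambda>f. y \<cdot> f) ` Hom C (Dom C f) B" by (subst 1(2)) (auto simp: kernel_def Hom_iff)
    then show "\<exists>g\<in>Hom C (Dom C f) B. f = y \<cdot> g" by auto
  qed
qed

text \<open>The surjectivity half of the five lemma for \<open>Hom(B', -)\<close>, read off at the identity of \<open>B'\<close>: lift
  \<open>c\<inverse>y'\<close> through \<open>y\<close>, and correct the lift by a morphism that factors through \<open>x\<close>.\<close>

lemma five_lemma_right_inverse:
  assumes h: "x \<in> Hom C A B" "y \<in> Hom C B X" "\<delta> \<in> Exts C X A"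
    and h': "x' \<in> Hom C A' B'" "y' \<in> Hom C B' X'" "\<delta>' \<in> Exts C X' A'"
    and e: "cov_exact C A B X x y \<delta>" "cov_exact C A' B' X' x' y' \<delta>'"
    and m: "tri_mor C x y \<delta> x' y' \<delta>' a b c" "isomorphism C a" "isomorphism C c"
  shows "\<exists>r\<in>Hom C B' B. b \<cdot> r = Idt C B'"
proof -
  have o [simp]: "A \<in> Ob C" "B \<in> Ob C" "X \<in> Ob C" "A' \<in> Ob C" "B' \<in> Ob C" "X' \<in> Ob C" using h h' Hom_Ob by auto
  have s [simp]: "x \<in> Mor C" "Dom C x = A" "Cod C x = B" "y \<in> Mor C" "Dom C y = B" "Cod C y = X"
    "x' \<in> Mor C" "Dom C x' = A'" "Cod C x' = B'" "y' \<in> Mor C" "Dom C y' = B'" "Cod C y' = X'" using h h' by (auto simp: Hom_iff)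
  have sm [simp]: "a \<in> Mor C" "Dom C a = A" "Cod C a = A'" "b \<in> Mor C" "Dom C b = B" "Cod C b = B'"
    "c \<in> Mor C" "Dom C c = X" "Cod C c = X'" using m(1) by (auto simp: tri_mor_def Hom_iff)
  have m': "b \<cdot> x = x' \<cdot> a" "c \<cdot> y = y' \<cdot> b" "ExtMap C (Idt C X) a \<delta> = ExtMap C c (Idt C A') \<delta>'"
    using m(1) by (auto simp: tri_mor_def push_def pull_def)
  let ?f = "inv_mor C c \<cdot> y'"
  have f: "?f \<in> Mor C" "Dom C ?f = B'" "Cod C ?f = X" using m by auto
  have "ExtMap C (Idt C B') a (pull C A ?f \<delta>) = ExtMap C ?f (Idt C A') (ExtMap C (Idt C X) a \<delta>)" using m(2,3) h by (simp add: pull_def)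
  also have "... = pull C A' y' \<delta>'" unfolding m' using m(2,3) h' by (simp add: pull_def)
  also have "... = \<one>\<^bsub>Ext C B' A'\<^esub>" using e(2) by (simp add: cov_exact_def)
  finally have "ExtMap C (Idt C B') a (pull C A ?f \<delta>) = \<one>\<^bsub>Ext C B' A'\<^esub>" .
  then have "pull C A ?f \<delta> = \<one>\<^bsub>Ext C B' A\<^esub>" using ExtMap_iso_one[of "Idt C B'" a "pull C A ?f \<delta>"] m f h(3) by (simp add: pull_def)
  then obtain g where g: "g \<in> Hom C B' B" "?f = y \<cdot> g" using e(1) f unfolding cov_exact_def by metis
  have gs: "g \<in> Mor C" "Dom C g = B'" "Cod C g = B" using g by (auto simp: Hom_iff)
  have "y' \<cdot> b \<cdot> g = c \<cdot> y \<cdot> g" by (rule Cmp_cong_right) (use m' gs in auto)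
  also have "... = y'" using g(2)[symmetric] m by simp
  finally have 1: "y' \<cdot> b \<cdot> g = y'" .
  let ?d = "Add C (Idt C B') (Neg C (b \<cdot> g))"
  have d: "?d \<in> Mor C" "Dom C ?d = B'" "Cod C ?d = B'" using gs by auto
  have "y' \<cdot> ?d = Zero C B' X'" using gs 1 by simp
  then obtain k where k: "k \<in> Hom C B' A'" "?d = x' \<cdot> k" using e(2) d unfolding cov_exact_def by metis
  have ks: "k \<in> Mor C" "Dom C k = B'" "Cod C k = A'" using k by (auto simp: Hom_iff)
  let ?r = "Add C g (x \<cdot> inv_mor C a \<cdot> k)"
  have "b \<cdot> x \<cdot> inv_mor C a \<cdot> k = x' \<cdot> a \<cdot> inv_mor C a \<cdot> k" by (rule Cmp_cong_right) (use m m' ks in auto)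
  also have "... = ?d" using m ks k by simp
  finally have 2: "b \<cdot> x \<cdot> inv_mor C a \<cdot> k = ?d" .
  have "b \<cdot> ?r = Add C (b \<cdot> g) (b \<cdot> x \<cdot> inv_mor C a \<cdot> k)" using gs ks m by simp
  also have "... = Idt C B'" unfolding 2 using gs Add_Neg_cancel(3)[of "Idt C B'" "b \<cdot> g"] by simp
  finally show ?thesis using gs ks m by (intro bexI[of _ ?r]) (auto simp: Hom_iff)
qed

end

lemma tri_mor_opposite: "x \<in> Hom C A B ==> y \<in> Hom C B X ==> x' \<in> Hom C A' B' ==> y' \<in> Hom C B' X' ==>
  tri_mor (opposite C) y' x' \<delta>' y x \<delta> c b a \<longleftrightarrow> tri_mor C x y \<delta> x' y' \<delta>' a b c" by (auto simp: tri_mor_def Hom_iff)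

text \<open>A right inverse comes from the covariant sequences and a left inverse from the dual statement.\<close>

lemma five_lemma:
  assumes "biadditive_Ext C"
    and h: "x \<in> Hom C A B" "y \<in> Hom C B X" "\<delta> \<in> Exts C X A"
    and h': "x' \<in> Hom C A' B'" "y' \<in> Hom C B' X'" "\<delta>' \<in> Exts C X' A'"
    and e: "cov_exact C A B X x y \<delta>" "cov_exact C A' B' X' x' y' \<delta>'"
    and e': "cov_exact (opposite C) X B A y x \<delta>" "cov_exact (opposite C) X' B' A' y' x' \<delta>'"
    and m: "tri_mor C x y \<delta> x' y' \<delta>' a b c" "isomorphism C a" "isomorphism C c"
  shows "isomorphism C b"
proof -
  interpret biadditive_Ext C by fact
  interpret o: biadditive_Ext "opposite C" by (rule biadditive_Ext_opposite) fact
  have b: "b \<in> Hom C B B'" using m(1) h h' by (auto simp: tri_mor_def Hom_iff)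
  obtain r where r: "r \<in> Hom C B' B" "b \<cdot>\<^bsub>C\<^esub> r = Idt C B'" using five_lemma_right_inverse[OF h h' e m] by blast
  have "\<exists>l\<in>Hom (opposite C) B B'. b \<cdot>\<^bsub>opposite C\<^esub> l = Idt (opposite C) B" by (rule o.five_lemma_right_inverse[of y' X' B' x' A' \<delta>' y X B x A \<delta> c b a])
      (use h h' e' m tri_mor_opposite[OF h(1,2) h'(1,2)] in simp_all)
  then obtain l where "l \<in> Hom C B' B" "l \<cdot>\<^bsub>C\<^esub> b = Idt C B" by auto
  then show ?thesis using isomorphism_left_right[OF b _ r(1) _ r(2)] by blast
qed

context weakly_extriangulated
begin

lemma s_triangle_simps:
  assumes "s_triangle C A B X x y \<delta>"
  shows "x \<in> Hom C A B" "y \<in> Hom C B X" "\<delta> \<in> Exts C X A" "x \<in> Mor C" "Dom C x = A" "Cod C x = B"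
    "y \<in> Mor C" "Dom C y = B" "Cod C y = X" "A \<in> Ob C" "B \<in> Ob C" "X \<in> Ob C" using assms Hom_Ob by (auto simp: s_triangle_def Hom_iff)

lemma s_triangle_exact:
  assumes "s_triangle C A B X x y \<delta>" shows "cov_exact C A B X x y \<delta>" using C1[OF assms] cov_exact_iff_C1[OF s_triangle_simps(1-3)[OF assms]] by blast

text \<open>The pushout \<open>a\<^sub>*\<delta> = c\<^sup>*\<delta>'\<close> has a triangle of its own; (C3) maps the first triangle to it and (C3') maps
  it to the second.\<close>

lemma ex_middle_morphism:
  assumes t: "s_triangle C A B X x y \<delta>" "s_triangle C A' B' X' x' y' \<delta>'" "a \<in> Hom C A A'" "c \<in> Hom C X X'"
    "push C X a \<delta> = pull C A' c \<delta>'"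
  shows "\<exists>b. tri_mor C x y \<delta> x' y' \<delta>' a b c"
proof -
  note s = s_triangle_simps[OF t(1)] s_triangle_simps[OF t(2)]
  have "push C X a \<delta> \<in> Exts C X A'" using s t(3) by (simp add: push_def Hom_iff)
  then obtain B1 x1 y1 where t1: "s_triangle C A' B1 X x1 y1 (push C X a \<delta>)" using Real_class s Hom_Ob[OF t(3)] by metis
  note s1 = s_triangle_simps[OF t1]
  obtain b1 where b1: "b1 \<in> Hom C B B1" "b1 \<cdot> x = x1 \<cdot> a" "y = y1 \<cdot> b1" using C3[OF t(1,3) t1] by blast
  obtain b2 where b2: "b2 \<in> Hom C B1 B'" "b2 \<cdot> x1 = x'" "c \<cdot> y1 = y' \<cdot> b2" using C3'[OF t(2,4) t1[unfolded t(5)]] by blast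
  note bs = b1(1)[unfolded Hom_iff] b2(1)[unfolded Hom_iff] t(3,4)[unfolded Hom_iff]
  have "(b2 \<cdot> b1) \<cdot> x = b2 \<cdot> x1 \<cdot> a" using bs s s1 b1(2) by simp
  also have "... = x' \<cdot> a" using Cmp_collapse[OF b2(2), of a] bs s1 by simp
  finally have 1: "(b2 \<cdot> b1) \<cdot> x = x' \<cdot> a" .
  have "c \<cdot> y = (c \<cdot> y1) \<cdot> b1" unfolding b1(3) using bs s1 by simp
  also have "... = y' \<cdot> b2 \<cdot> b1" unfolding b2(3) using bs s by simp
  finally have 2: "c \<cdot> y = y' \<cdot> b2 \<cdot> b1" .
  show ?thesis using 1 2 bs s t(3-5) by (intro exI[of _ "b2 \<cdot> b1"]) (simp add: tri_mor_def Hom_iff)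
qed

end

lemma s_triangle_coexact:
  assumes "weakly_extriangulated C" "s_triangle C A B X x y \<delta>"
  shows "cov_exact (opposite C) X B A y x \<delta>"
proof -
  interpret weakly_extriangulated "opposite C" by (rule weakly_extriangulated_opposite) fact
  have "category C" using assms(1) by (simp add: weakly_extriangulated_def biadditive_Ext_def additive_category_def)
  then show ?thesis by (intro s_triangle_exact) (simp add: s_triangle_opposite assms)
qed

text \<open>A sequence isomorphic to a triangle is a triangle for the transported extension: the triangle that
  realizes this extension maps isomorphically to it by the five lemma.\<close>

lemma s_triangle_transport:
  fixes C :: "('o, 'm, 'e) ext_cat"
  assumes "weakly_extriangulated C" and t: "s_triangle C A B X x y \<delta>"
    and a: "isomorphism C a" "a \<in> Hom C A A'" and b: "isomorphism C b" "b \<in> Hom C B B'"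
    and c: "isomorphism C c" "c \<in> Hom C X X'"
    and x': "x' \<in> Hom C A' B'" "b \<cdot>\<^bsub>C\<^esub> x = x' \<cdot>\<^bsub>C\<^esub> a" and y': "y' \<in> Hom C B' X'" "c \<cdot>\<^bsub>C\<^esub> y = y' \<cdot>\<^bsub>C\<^esub> b"
    and d: "\<delta>' \<in> Exts C X' A'" "push C X a \<delta> = pull C A' c \<delta>'"
  shows "s_triangle C A' B' X' x' y' \<delta>'"
proof -
  interpret weakly_extriangulated C by fact
  note s = s_triangle_simps[OF t]
  note hs = a(2)[unfolded Hom_iff] b(2)[unfolded Hom_iff] c(2)[unfolded Hom_iff] x'(1)[unfolded Hom_iff] y'(1)[unfolded Hom_iff]
  obtain B1 x1 y1 where t1: "s_triangle C A' B1 X' x1 y1 \<delta>'" using Real_class d Hom_Ob[OF a(2)] Hom_Ob[OF c(2)] by metis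
  note s1 = s_triangle_simps[OF t1]
  obtain b1 where m: "tri_mor C x y \<delta> x1 y1 \<delta>' a b1 c" using ex_middle_morphism[OF t t1 a(2) c(2) d(2)] by blast
  have i: "isomorphism C b1" by (rule five_lemma[OF biadditive_Ext_axioms s(1-3) s1(1-3) s_triangle_exact[OF t] s_triangle_exact[OF t1]
       s_triangle_coexact[OF assms(1) t] s_triangle_coexact[OF assms(1) t1] m a(1) c(1)])
  have bm: "b1 \<in> Mor C" "Dom C b1 = B" "Cod C b1 = B1" "b1 \<cdot>\<^bsub>C\<^esub> x = x1 \<cdot>\<^bsub>C\<^esub> a" "c \<cdot>\<^bsub>C\<^esub> y = y1 \<cdot>\<^bsub>C\<^esub> b1"
    using m s s1 by (auto simp: tri_mor_def Hom_iff)
  let ?d = "b \<cdot>\<^bsub>C\<^esub> inv_mor C b1"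
  have di: "isomorphism C ?d" using i b bm hs by (intro isomorphism_Cmp) auto
  have "(?d \<cdot>\<^bsub>C\<^esub> x1) \<cdot>\<^bsub>C\<^esub> a = b \<cdot>\<^bsub>C\<^esub> inv_mor C b1 \<cdot>\<^bsub>C\<^esub> (x1 \<cdot>\<^bsub>C\<^esub> a)" using i bm(1-3) hs s1(4-6) by simp
  also have "... = b \<cdot>\<^bsub>C\<^esub> inv_mor C b1 \<cdot>\<^bsub>C\<^esub> b1 \<cdot>\<^bsub>C\<^esub> x" unfolding bm(4) ..
  also have "... = b \<cdot>\<^bsub>C\<^esub> x" using i bm(1-3) s(4-6) by simp
  also have "... = x' \<cdot>\<^bsub>C\<^esub> a" by (rule x'(2))
  finally have 1: "?d \<cdot>\<^bsub>C\<^esub> x1 = x'" by (rule isomorphism_cancel_right[OF a(1)]) (use i hs s1(4-6) bm(1-3) in simp_all)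
  have "(y1 \<cdot>\<^bsub>C\<^esub> inv_mor C ?d) \<cdot>\<^bsub>C\<^esub> b = y1 \<cdot>\<^bsub>C\<^esub> b1" using i b(1) hs s1(7,8) bm(1-3) by (simp add: inv_mor_comp)
  also have "... = y' \<cdot>\<^bsub>C\<^esub> b" using bm(5) y'(2) by simp
  finally have 2: "y1 \<cdot>\<^bsub>C\<^esub> inv_mor C ?d = y'" by (rule isomorphism_cancel_right[OF b(1)]) (use i hs s1(7-9) bm(1-3) di b(1) in simp_all)
  have "(x', y') \<in> seq_class C x1 y1"
    unfolding mem_seq_class[OF s1(1,2)] using 1[symmetric] 2[symmetric] di bm(1-3) hs i by (intro exI[of _ ?d] conjI) simp_all
  then have "seq_class C x' y' = seq_class C x1 y1" by (rule seq_class_eqI[OF s1(1,2)])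
  then show ?thesis using t1 x' y' d by (simp add: s_triangle_def)
qed

context additive_category
begin

lemma biproduct_iso:
  assumes P: "biproduct C X Y P i1 i2 p1 p2" and R: "biproduct C X' Y' R j1 j2 r1 r2"
    and u: "isomorphism C u" "u \<in> Hom C X X'" and v: "isomorphism C v" "v \<in> Hom C Y Y'"
  shows "isomorphism C (Add C (j1 \<cdot> u \<cdot> p1) (j2 \<cdot> v \<cdot> p2))"
    "inv_mor C (Add C (j1 \<cdot> u \<cdot> p1) (j2 \<cdot> v \<cdot> p2)) = Add C (i1 \<cdot> inv_mor C u \<cdot> r1) (i2 \<cdot> inv_mor C v \<cdot> r2)"
proof -
  note b = biproduct_simps[OF P] biproduct_simps[OF R] u[unfolded Hom_iff] v[unfolded Hom_iff]
  let ?t = "Add C (j1 \<cdot> u \<cdot> p1) (j2 \<cdot> v \<cdot> p2)"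
  let ?s = "Add C (i1 \<cdot> inv_mor C u \<cdot> r1) (i2 \<cdot> inv_mor C v \<cdot> r2)"
  have t: "?t \<in> Hom C P R" "?s \<in> Hom C R P" by (simp_all add: b Hom_iff)
  have 1: "?s \<cdot> ?t = Idt C P" by (simp add: b)
  have 2: "?t \<cdot> ?s = Idt C R" by (simp add: b)
  show i: "isomorphism C ?t" by (rule isomorphismI[OF t 1 2])
  show "inv_mor C ?t = ?s" by (rule inv_mor_unique[OF 1 i t, symmetric])
qed

end

context biadditive_Ext
begin

lemma tri_mor_comp:
  assumes "x \<in> Hom C A B" "y \<in> Hom C B X" "\<delta> \<in> Exts C X A"
    "x' \<in> Hom C A' B'" "y' \<in> Hom C B' X'" "\<delta>' \<in> Exts C X' A'"
    "x'' \<in> Hom C A'' B''" "y'' \<in> Hom C B'' X''" "\<delta>'' \<in> Exts C X'' A''"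
    and m: "tri_mor C x y \<delta> x' y' \<delta>' a b c" and m': "tri_mor C x' y' \<delta>' x'' y'' \<delta>'' a' b' c'"
  shows "tri_mor C x y \<delta> x'' y'' \<delta>'' (a' \<cdot> a) (b' \<cdot> b) (c' \<cdot> c)"
proof -
  have s: "x \<in> Mor C" "Dom C x = A" "Cod C x = B" "y \<in> Mor C" "Dom C y = B" "Cod C y = X"
    "x' \<in> Mor C" "Dom C x' = A'" "Cod C x' = B'" "y' \<in> Mor C" "Dom C y' = B'" "Cod C y' = X'"
    "x'' \<in> Mor C" "Dom C x'' = A''" "Cod C x'' = B''" "y'' \<in> Mor C" "Dom C y'' = B''" "Cod C y'' = X''"
    "A \<in> Ob C" "X \<in> Ob C" "A' \<in> Ob C" "X' \<in> Ob C" "A'' \<in> Ob C" "X'' \<in> Ob C" using assms Hom_Ob by (auto simp: Hom_iff)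
  have n: "a \<in> Mor C" "Dom C a = A" "Cod C a = A'" "b \<in> Mor C" "Dom C b = B" "Cod C b = B'"
    "c \<in> Mor C" "Dom C c = X" "Cod C c = X'" "a' \<in> Mor C" "Dom C a' = A'" "Cod C a' = A''"
    "b' \<in> Mor C" "Dom C b' = B'" "Cod C b' = B''" "c' \<in> Mor C" "Dom C c' = X'" "Cod C c' = X''" using m m' s by (auto simp: tri_mor_def Hom_iff)
  have e: "b \<cdot> x = x' \<cdot> a" "c \<cdot> y = y' \<cdot> b" "push C X a \<delta> = pull C A' c \<delta>'"
    "b' \<cdot> x' = x'' \<cdot> a'" "c' \<cdot> y' = y'' \<cdot> b'" "push C X' a' \<delta>' = pull C A'' c' \<delta>''" using m m' s by (auto simp: tri_mor_def)
  have 1: "(b' \<cdot> b) \<cdot> x = x'' \<cdot> a' \<cdot> a" using s n by (simp add: e(1)) (rule Cmp_cong_right, use e s n in auto)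
  have "(c' \<cdot> c) \<cdot> y = c' \<cdot> y' \<cdot> b" using s n by (simp add: e(2))
  also have "... = y'' \<cdot> b' \<cdot> b" by (rule Cmp_cong_right) (use e s n in auto)
  finally have 2: "(c' \<cdot> c) \<cdot> y = y'' \<cdot> b' \<cdot> b" .
  have "push C X (a' \<cdot> a) \<delta> = push C X a' (push C X a \<delta>)" using s n assms(3) by (simp add: push_def)
  also have "... = pull C A'' c (push C X' a' \<delta>')" unfolding e(3) using s n assms(6) by (simp add: push_def pull_def)
  also have "... = pull C A'' (c' \<cdot> c) \<delta>''" unfolding e(6) using s n assms(9) by (simp add: pull_def)
  finally have 3: "push C X (a' \<cdot> a) \<delta> = pull C A'' (c' \<cdot> c) \<delta>''" .
  show ?thesis unfolding tri_mor_def using 1 2 3 s n by (simp add: Hom_iff)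
qed

lemma tri_mor_inv:
  assumes "x \<in> Hom C A B" "y \<in> Hom C B X" "\<delta> \<in> Exts C X A"
    "x' \<in> Hom C A' B'" "y' \<in> Hom C B' X'" "\<delta>' \<in> Exts C X' A'"
    and m: "tri_mor C x y \<delta> x' y' \<delta>' a b c" and i: "isomorphism C a" "isomorphism C b" "isomorphism C c"
  shows "tri_mor C x' y' \<delta>' x y \<delta> (inv_mor C a) (inv_mor C b) (inv_mor C c)"
proof -
  have s: "x \<in> Mor C" "Dom C x = A" "Cod C x = B" "y \<in> Mor C" "Dom C y = B" "Cod C y = X"
    "x' \<in> Mor C" "Dom C x' = A'" "Cod C x' = B'" "y' \<in> Mor C" "Dom C y' = B'" "Cod C y' = X'"
    "A \<in> Ob C" "X \<in> Ob C" "A' \<in> Ob C" "X' \<in> Ob C" using assms Hom_Ob by (auto simp: Hom_iff)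
  have n: "a \<in> Mor C" "Dom C a = A" "Cod C a = A'" "b \<in> Mor C" "Dom C b = B" "Cod C b = B'"
    "c \<in> Mor C" "Dom C c = X" "Cod C c = X'"  using m s by (auto simp: tri_mor_def Hom_iff)
  have e: "b \<cdot> x = x' \<cdot> a" "c \<cdot> y = y' \<cdot> b" "push C X a \<delta> = pull C A' c \<delta>'" using m s by (auto simp: tri_mor_def)
  have "inv_mor C b \<cdot> x' = inv_mor C b \<cdot> (x' \<cdot> a) \<cdot> inv_mor C a" using s n i by simp
  also have "... = inv_mor C b \<cdot> (b \<cdot> x) \<cdot> inv_mor C a" unfolding e(1) ..
  also have "... = x \<cdot> inv_mor C a" using s n i by simp
  finally have 1: "inv_mor C b \<cdot> x' = x \<cdot> inv_mor C a" .
  have "inv_mor C c \<cdot> y' = inv_mor C c \<cdot> (y' \<cdot> b) \<cdot> inv_mor C b" using s n i by simp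
  also have "... = inv_mor C c \<cdot> (c \<cdot> y) \<cdot> inv_mor C b" unfolding e(2) ..
  also have "... = y \<cdot> inv_mor C b" using s n i by simp
  finally have 2: "inv_mor C c \<cdot> y' = y \<cdot> inv_mor C b" .
  have "push C X' (inv_mor C a) \<delta>' = ExtMap C (inv_mor C c) (inv_mor C a) (pull C A' c \<delta>')" using s n i assms(6) by (simp add: push_def pull_def)
  also have "... = pull C A (inv_mor C c) \<delta>" unfolding e(3)[symmetric] using s n i assms(3) by (simp add: push_def pull_def)
  finally have 3: "push C X' (inv_mor C a) \<delta>' = pull C A (inv_mor C c) \<delta>" .
  show ?thesis unfolding tri_mor_def using 1 2 3 s n i by (simp add: Hom_iff)
qed

lemma cov_exact_transport:
  assumes x: "x \<in> Hom C A B" "y \<in> Hom C B X" "\<delta> \<in> Exts C X A" "cov_exact C A B X x y \<delta>"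
    and a: "isomorphism C a" "a \<in> Hom C A' A" and b: "isomorphism C b" "b \<in> Hom C B B'"
    and c: "isomorphism C c" "c \<in> Hom C X X'"
    and e: "\<epsilon> \<in> Exts C X' A'" "ExtMap C c a \<epsilon> = \<delta>"
  shows "cov_exact C A' B' X' (b \<cdot> x \<cdot> a) (c \<cdot> y \<cdot> inv_mor C b) \<epsilon>"
proof -
  have o: "A \<in> Ob C" "X \<in> Ob C" "B \<in> Ob C" "A' \<in> Ob C" "X' \<in> Ob C" "B' \<in> Ob C" using x a b c Hom_Ob by auto
  note s = x(1,2)[unfolded Hom_iff] a[unfolded Hom_iff] b[unfolded Hom_iff] c[unfolded Hom_iff] o
  have E: "y \<cdot> x = Zero C A X" "pull C A y \<delta> = \<one>\<^bsub>Ext C B A\<^esub>"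
    "\<And>f. f \<in> Mor C ==> Cod C f = B ==> y \<cdot> f = Zero C (Dom C f) X ==> (\<exists>g\<in>Hom C (Dom C f) A. f = x \<cdot> g)"
    "\<And>f. f \<in> Mor C ==> Cod C f = X ==> pull C A f \<delta> = \<one>\<^bsub>Ext C (Dom C f) A\<^esub> ==> (\<exists>g\<in>Hom C (Dom C f) B. f = y \<cdot> g)"
    using x(4) unfolding cov_exact_def by blast+
  let ?y = "c \<cdot> y \<cdot> inv_mor C b"
  have y: "?y \<in> Mor C" "Dom C ?y = B'" "Cod C ?y = X'" using s by auto
  have pull: "ExtMap C (Idt C (Dom C f)) a (pull C A' f \<epsilon>) = pull C A (inv_mor C c \<cdot> f) \<delta>"
    if "f \<in> Mor C" "Cod C f = X'" for f unfolding e(2)[symmetric] using that s e(1) by (simp add: pull_def)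
  have pull1: "pull C A' f \<epsilon> = \<one>\<^bsub>Ext C (Dom C f) A'\<^esub> \<longleftrightarrow> pull C A (inv_mor C c \<cdot> f) \<delta> = \<one>\<^bsub>Ext C (Dom C f) A\<^esub>"
    if "f \<in> Mor C" "Cod C f = X'" for f
  proof
    assume "pull C A' f \<epsilon> = \<one>\<^bsub>Ext C (Dom C f) A'\<^esub>"
    then show "pull C A (inv_mor C c \<cdot> f) \<delta> = \<one>\<^bsub>Ext C (Dom C f) A\<^esub>" using pull[OF that] that s by simp
  next
    assume *: "pull C A (inv_mor C c \<cdot> f) \<delta> = \<one>\<^bsub>Ext C (Dom C f) A\<^esub>"
    have "pull C A' f \<epsilon> = \<one>\<^bsub>Ext C (Cod C (Idt C (Dom C f))) (Dom C a)\<^esub>"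
      by (rule ExtMap_iso_one) (use s that e pull[OF that] * in \<open>simp_all add: pull_def\<close>)
    then show "pull C A' f \<epsilon> = \<one>\<^bsub>Ext C (Dom C f) A'\<^esub>" using that s by simp
  qed
  show ?thesis unfolding cov_exact_def
  proof (intro conjI ballI impI; (elim conjE)?)
    have "?y \<cdot> b \<cdot> x \<cdot> a = c \<cdot> (y \<cdot> x) \<cdot> a" using s by simp
    also have "... = Zero C A' X'" unfolding E(1) using s by simp
    finally show "?y \<cdot> b \<cdot> x \<cdot> a = Zero C A' X'" .
    have "pull C A (inv_mor C c \<cdot> ?y) \<delta> = pull C A (inv_mor C b) (pull C A y \<delta>)" using s x(3) by (simp add: pull_def)
    also have "... = \<one>\<^bsub>Ext C B' A\<^esub>" unfolding E(2) using s by (simp add: pull_def)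
    finally show "pull C A' ?y \<epsilon> = \<one>\<^bsub>Ext C B' A'\<^esub>" using pull1[OF y(1,3)] y by simp
  next
    fix f assume f: "f \<in> Mor C" "Cod C f = B'" "?y \<cdot> f = Zero C (Dom C f) X'"
    have "c \<cdot> y \<cdot> inv_mor C b \<cdot> f = c \<cdot> Zero C (Dom C f) X" using f s by simp
    then have "y \<cdot> inv_mor C b \<cdot> f = Zero C (Dom C f) X" by (rule isomorphism_cancel_left[OF c(1)]) (use f s in simp_all)
    then obtain g where g: "g \<in> Hom C (Dom C f) A" "inv_mor C b \<cdot> f = x \<cdot> g" using E(3)[of "inv_mor C b \<cdot> f"] f(1,2) s by auto
    note g' = g(1)[unfolded Hom_iff]
    have "f = b \<cdot> inv_mor C b \<cdot> f" using f(1,2) s by simp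
    also have "... = (b \<cdot> x \<cdot> a) \<cdot> inv_mor C a \<cdot> g" unfolding g(2) using g' s by simp
    finally show "\<exists>g\<in>Hom C (Dom C f) A'. f = (b \<cdot> x \<cdot> a) \<cdot> g" by (rule bexI) (use g' s in \<open>simp_all add: Hom_iff\<close>)
  next
    fix f assume f: "f \<in> Mor C" "Cod C f = X'" "pull C A' f \<epsilon> = \<one>\<^bsub>Ext C (Dom C f) A'\<^esub>"
    then have "pull C A (inv_mor C c \<cdot> f) \<delta> = \<one>\<^bsub>Ext C (Dom C f) A\<^esub>" using pull1 by blast
    then obtain g where g: "g \<in> Hom C (Dom C f) B" "inv_mor C c \<cdot> f = y \<cdot> g" using E(4)[of "inv_mor C c \<cdot> f"] f(1,2) s by auto
    note g' = g(1)[unfolded Hom_iff]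
    have "f = c \<cdot> inv_mor C c \<cdot> f" using f(1,2) s by simp
    also have "... = ?y \<cdot> b \<cdot> g" unfolding g(2) using g' s by simp
    finally show "\<exists>g\<in>Hom C (Dom C f) B'. f = ?y \<cdot> g" by (rule bexI) (use g' s in \<open>simp_all add: Hom_iff\<close>)
  qed
qed

end

section \<open>Triangles of the localization\<close>

text \<open>A sequence and an extension in \<open>L\<close> that are isomorphic to the image of a triangle of \<open>C\<close>. The isomorphism is
  allowed to move all three objects.\<close>

definition loc_tri :: "('o, 'm, 'e) ext_cat => ('o, 'n, 'k) ext_cat => ('m => 'n) => ('o => 'o => 'e => 'k)
   => 'o => 'o => 'o => 'n => 'n => 'k => bool"
  where "loc_tri C L q mu A B X \<xi> \<eta> \<epsilon> \<longleftrightarrow>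
    (\<exists>A' B' X' x y \<delta> \<alpha> \<beta> \<gamma>. s_triangle C A' B' X' x y \<delta> \<and> isomorphism L \<alpha> \<and> \<alpha> \<in> Hom L A A' \<and>
       isomorphism L \<beta> \<and> \<beta> \<in> Hom L B' B \<and> isomorphism L \<gamma> \<and> \<gamma> \<in> Hom L X' X \<and>
       \<xi> = \<beta> \<cdot>\<^bsub>L\<^esub> q x \<cdot>\<^bsub>L\<^esub> \<alpha> \<and> \<eta> = \<gamma> \<cdot>\<^bsub>L\<^esub> q y \<cdot>\<^bsub>L\<^esub> inv_mor L \<beta> \<and> ExtMap L \<gamma> \<alpha> \<epsilon> = mu X' A' \<delta>)"

text \<open>What is used about the localization \<open>q\<close>, the groups \<open>Ext L\<close> and the map \<open>mu\<close>. No axiom prefers one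
  of the two sides, so that the opposite data satisfy the axioms again.\<close>

locale fraction_ext = C: weakly_extriangulated C + L: biadditive_Ext L
  for C :: "('o, 'm, 'e) ext_cat" (structure) and L :: "('o, 'n, 'k) ext_cat" +
  fixes W :: "'m set" and q :: "'m => 'n" and mu :: "'o => 'o => 'e => 'k"
  assumes Ob_L [simp]: "Ob L = Ob C"
    and W_Mor [simp]: "s \<in> W ==> s \<in> Mor C"
    and W_Idt [simp]: "X \<in> Ob C ==> Idt C X \<in> W"
    and W_Cmp: "s \<in> W ==> t \<in> W ==> Cod C s = Dom C t ==> t \<cdot> s \<in> W"
    and q_Hom: "f \<in> Mor C ==> q f \<in> Hom L (Dom C f) (Cod C f)"
    and q_Idt [simp]: "X \<in> Ob C ==> q (Idt C X) = Idt L X"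
    and q_Cmp: "f \<in> Mor C ==> g \<in> Mor C ==> Cod C f = Dom C g ==> q (g \<cdot> f) = q g \<cdot>\<^bsub>L\<^esub> q f"
    and q_Add: "f \<in> Mor C ==> g \<in> Mor C ==> Dom C f = Dom C g ==> Cod C f = Cod C g
                ==> q (Add C f g) = Add L (q f) (q g)"
    and q_W [simp]: "s \<in> W ==> isomorphism L (q s)"
    and frac_left: "\<phi> \<in> Mor L ==> \<exists>s\<in>W. \<exists>f\<in>Mor C. Dom C f = Dom L \<phi> \<and> Dom C s = Cod L \<phi> \<and> Cod C f = Cod C s
                    \<and> q s \<cdot>\<^bsub>L\<^esub> \<phi> = q f"
    and frac_right: "\<phi> \<in> Mor L ==> \<exists>s\<in>W. \<exists>f\<in>Mor C. Cod C f = Cod L \<phi> \<and> Cod C s = Dom L \<phi> \<and> Dom C f = Dom C s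
                     \<and> \<phi> \<cdot>\<^bsub>L\<^esub> q s = q f"
    and mu_hom: "X \<in> Ob C ==> A \<in> Ob C ==> mu X A \<in> hom (Ext C X A) (Ext L X A)"
    and mu_ExtMap: "c \<in> Mor C ==> a \<in> Mor C ==> \<delta> \<in> Exts C (Cod C c) (Dom C a)
                    ==> mu (Dom C c) (Cod C a) (ExtMap C c a \<delta>) = ExtMap L (q c) (q a) (mu (Cod C c) (Dom C a) \<delta>)"
    and mu_surj: "X \<in> Ob C ==> A \<in> Ob C ==> \<epsilon> \<in> Exts L X A ==>
       \<exists>s\<in>W. \<exists>t\<in>W. \<exists>\<delta>\<in>Exts C (Dom C t) (Cod C s). Dom C s = A \<and> Cod C t = X \<and>
          ExtMap L (q t) (q s) \<epsilon> = mu (Dom C t) (Cod C s) \<delta>"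
    and mu_one_push: "X \<in> Ob C ==> A \<in> Ob C ==> \<delta> \<in> Exts C X A ==> mu X A \<delta> = \<one>\<^bsub>Ext L X A\<^esub> ==>
       \<exists>s\<in>W. Dom C s = A \<and> ExtMap C (Idt C X) s \<delta> = \<one>\<^bsub>Ext C X (Cod C s)\<^esub>"
    and mu_one_pull: "X \<in> Ob C ==> A \<in> Ob C ==> \<delta> \<in> Exts C X A ==> mu X A \<delta> = \<one>\<^bsub>Ext L X A\<^esub> ==>
       \<exists>t\<in>W. Cod C t = X \<and> ExtMap C t (Idt C A) \<delta> = \<one>\<^bsub>Ext C (Dom C t) A\<^esub>"
    and q_zero_right: "f \<in> Mor C ==> q f = Zero L (Dom C f) (Cod C f) ==>
       \<exists>t\<in>W. \<exists>N Z. \<exists>u\<in>Hom C (Dom C t) N. \<exists>v\<in>Hom C N (Cod C f).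
         Cod C t = Dom C f \<and> f \<cdot> t = v \<cdot> u \<and> zero_object C Z \<and> Zero C N Z \<in> W \<and> Zero C Z N \<in> W"
    and q_zero_left: "f \<in> Mor C ==> q f = Zero L (Dom C f) (Cod C f) ==>
       \<exists>t\<in>W. \<exists>N Z. \<exists>u\<in>Hom C (Dom C f) N. \<exists>v\<in>Hom C N (Cod C t).
         Dom C t = Cod C f \<and> t \<cdot> f = v \<cdot> u \<and> zero_object C Z \<and> Zero C N Z \<in> W \<and> Zero C Z N \<in> W"
    and mid_iso: "s_triangle C A B X x y \<delta> ==> s_triangle C A' B' X' x' y' \<delta>' ==> a \<in> W ==> c \<in> W ==>
       a \<in> Hom C A A' ==> c \<in> Hom C X X' ==> push C X a \<delta> = pull C A' c \<delta>' ==>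
       \<exists>b. isomorphism L b \<and> b \<in> Hom L B B' \<and> b \<cdot>\<^bsub>L\<^esub> q x = q x' \<cdot>\<^bsub>L\<^esub> q a \<and> q c \<cdot>\<^bsub>L\<^esub> q y = q y' \<cdot>\<^bsub>L\<^esub> b"
    and Real_L: "X \<in> Ob C ==> A \<in> Ob C ==> \<epsilon> \<in> Exts L X A ==>
       Real L X A \<epsilon> = {(\<xi>, \<eta>). \<exists>B. loc_tri C L q mu A B X \<xi> \<eta> \<epsilon>}"
begin

abbreviation Cmp_L (infixr \<open>\<star>\<close> 70)
  where "\<psi> \<star> \<phi> \<equiv> \<psi> \<cdot>\<^bsub>L\<^esub> \<phi>"

lemma q_simps [simp]:
  assumes "f \<in> Mor C"
  shows "q f \<in> Mor L" "Dom L (q f) = Dom C f" "Cod L (q f) = Cod C f" using q_Hom[OF assms] by (auto simp: Hom_iff)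

lemma q_square: "g \<cdot> f = g' \<cdot> f' ==> f \<in> Mor C ==> g \<in> Mor C ==> f' \<in> Mor C ==> g' \<in> Mor C
   ==> Cod C f = Dom C g ==> Cod C f' = Dom C g' ==> q g \<star> q f = q g' \<star> q f'" by (metis q_Cmp)

lemma q_Zero [simp]:
  assumes "X \<in> Ob C" "Y \<in> Ob C"
  shows "q (Zero C X Y) = Zero L X Y"
proof -
  have "Add L (q (Zero C X Y)) (q (Zero C X Y)) = q (Add C (Zero C X Y) (Zero C X Y))" using assms by (subst q_Add) auto
  also have "... = Add L (q (Zero C X Y)) (Zero L X Y)" using assms by simp
  finally show ?thesis by (rule L.Add_cancel) (use assms in auto)
qed

lemma q_Neg: "f \<in> Mor C ==> q (Neg C f) = Neg L (q f)" by (rule L.Neg_unique) (auto simp: q_Add[symmetric])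

lemma q_biproduct:
  assumes "biproduct C X Y P i1 i2 p1 p2"
  shows "biproduct L X Y P (q i1) (q i2) (q p1) (q p2)"
proof -
  note b = C.biproduct_simps[OF assms]
  have "Add L (q i1 \<star> q p1) (q i2 \<star> q p2) = q (Add C (i1 \<cdot> p1) (i2 \<cdot> p2))" using b(1-15) by (simp add: q_Add q_Cmp)
  then show ?thesis unfolding biproduct_def using b by (simp add: Hom_iff q_Cmp[symmetric])
qed

lemma mu_closed [simp]: "\<delta> \<in> Exts C X A ==> X \<in> Ob C ==> A \<in> Ob C ==> mu X A \<delta> \<in> Exts L X A"
  using mu_hom[of X A] by (auto simp: hom_def)

lemma mu_group_hom: "X \<in> Ob C ==> A \<in> Ob C ==> group_hom (Ext C X A) (Ext L X A) (mu X A)"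
  using mu_hom by (simp add: group_hom_def group_hom_axioms_def C.Ext_group L.Ext_group)

lemma mu_one [simp]: "X \<in> Ob C ==> A \<in> Ob C ==> mu X A \<one>\<^bsub>Ext C X A\<^esub> = \<one>\<^bsub>Ext L X A\<^esub>" using group_hom.hom_one[OF mu_group_hom] by blast

lemma mu_ExtMap': "c \<in> Mor C ==> a \<in> Mor C ==> \<delta> \<in> Exts C X A ==> Cod C c = X ==> Dom C a = A
   ==> Dom C c = Y ==> Cod C a = B ==> mu Y B (ExtMap C c a \<delta>) = ExtMap L (q c) (q a) (mu X A \<delta>)" using mu_ExtMap by blast

lemma mu_eq_push:
  assumes "X \<in> Ob C" "A \<in> Ob C" "\<delta> \<in> Exts C X A" "\<delta>' \<in> Exts C X A" "mu X A \<delta> = mu X A \<delta>'"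
  shows "\<exists>s\<in>W. Dom C s = A \<and> ExtMap C (Idt C X) s \<delta> = ExtMap C (Idt C X) s \<delta>'"
proof -
  interpret h: group_hom "Ext C X A" "Ext L X A" "mu X A" by (rule mu_group_hom) fact+
  have "mu X A (\<delta> \<otimes>\<^bsub>Ext C X A\<^esub> inv\<^bsub>Ext C X A\<^esub> \<delta>') = \<one>\<^bsub>Ext L X A\<^esub>" using assms by simp
  then obtain s where s: "s \<in> W" "Dom C s = A" 
    "ExtMap C (Idt C X) s (\<delta> \<otimes>\<^bsub>Ext C X A\<^esub> inv\<^bsub>Ext C X A\<^esub> \<delta>') = \<one>\<^bsub>Ext C X (Cod C s)\<^esub>"
    using mu_one_push[of X A "\<delta> \<otimes>\<^bsub>Ext C X A\<^esub> inv\<^bsub>Ext C X A\<^esub> \<delta>'"] assms by auto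
  interpret g: group "Ext C X (Cod C s)" using C.Ext_group s assms by simp
  have "ExtMap C (Idt C X) s \<delta> \<otimes>\<^bsub>Ext C X (Cod C s)\<^esub> inv\<^bsub>Ext C X (Cod C s)\<^esub> ExtMap C (Idt C X) s \<delta>' = \<one>\<^bsub>Ext C X (Cod C s)\<^esub>"
    using s assms C.ExtMap_mult[of "Idt C X" s X A \<delta> "inv\<^bsub>Ext C X A\<^esub> \<delta>'"] C.ExtMap_inv[of "Idt C X" s X A \<delta>'] by simp
  then have "ExtMap C (Idt C X) s \<delta> = ExtMap C (Idt C X) s \<delta>'"
    using s assms g.inv_equality[of "ExtMap C (Idt C X) s \<delta>" "inv\<^bsub>Ext C X (Cod C s)\<^esub> ExtMap C (Idt C X) s \<delta>'"] by simp
  then show ?thesis using s by blast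
qed

lemma q_triangle:
  assumes "s_triangle C A B X x y \<delta>"
  shows "q x \<in> Hom L A B" "q y \<in> Hom L B X" "mu X A \<delta> \<in> Exts L X A" using C.s_triangle_simps[OF assms] by (auto simp: Hom_iff)

text \<open>Only the two statements about kernels need an argument. If \<open>y \<phi> = 0\<close>, then with \<open>\<phi> = q f q(t)\<inverse>\<close> some
  \<open>y f t'\<close> is \<open>v u\<close> with \<open>v\<close> defined on a null object \<open>N\<close>. The triangle \<open>A \<rightarrow> E \<rightarrow> N\<close> of \<open>v\<^sup>*\<delta>\<close> maps to the
  given one, \<open>f t'\<close> lifts to \<open>E\<close>, and \<open>A \<rightarrow> E\<close> becomes invertible since \<open>N\<close> is null. The kernel of the connecting
  map is dealt with by clearing the denominator and killing \<open>f\<^sup>*\<delta>\<close> by a pullback along \<open>W\<close>.\<close>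

lemma q_triangle_exact:
  assumes t: "s_triangle C A B X x y \<delta>"
  shows "cov_exact L A B X (q x) (q y) (mu X A \<delta>)"
proof -
  note s = C.s_triangle_simps[OF t]
  have E: "y \<cdot> x = Zero C A X" "pull C A y \<delta> = \<one>\<^bsub>Ext C B A\<^esub>"
    "\<And>f. f \<in> Mor C ==> Cod C f = B ==> y \<cdot> f = Zero C (Dom C f) X ==> (\<exists>g\<in>Hom C (Dom C f) A. f = x \<cdot> g)"
    "\<And>f. f \<in> Mor C ==> Cod C f = X ==> pull C A f \<delta> = \<one>\<^bsub>Ext C (Dom C f) A\<^esub> ==> (\<exists>g\<in>Hom C (Dom C f) B. f = y \<cdot> g)"
    using C.s_triangle_exact[OF t] unfolding cov_exact_def by blast+
  show ?thesis unfolding cov_exact_def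
  proof (intro conjI ballI impI; (elim conjE)?)
    show "q y \<star> q x = Zero L A X" using E(1) s by (simp add: q_Cmp[symmetric])
    show "pull L A (q y) (mu X A \<delta>) = \<one>\<^bsub>Ext L B A\<^esub>" using mu_ExtMap'[of y "Idt C A" \<delta> X A B A] E(2) s by (simp add: pull_def)
  next
    fix \<phi> assume f: "\<phi> \<in> Mor L" "Cod L \<phi> = B" "q y \<star> \<phi> = Zero L (Dom L \<phi>) X"
    have fo: "Dom L \<phi> \<in> Ob C" using L.Ob_simps(1)[OF f(1)] by simp
    obtain t f' where f': "t \<in> W" "f' \<in> Mor C" "Cod C f' = B" "Cod C t = Dom L \<phi>" "Dom C f' = Dom C t"
      "\<phi> \<star> q t = q f'" using frac_right[OF f(1)] f(2) by auto
    have "q (y \<cdot> f') = q y \<star> \<phi> \<star> q t" using f' s by (simp add: q_Cmp)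
    also have "... = (q y \<star> \<phi>) \<star> q t" using f(1,2) f'(1,4) s by simp
    also have "... = Zero L (Dom C (y \<cdot> f')) (Cod C (y \<cdot> f'))" unfolding f(3) using f'(1-5) s fo by simp
    finally obtain t' N Z u v where n: "t' \<in> W" "u \<in> Hom C (Dom C t') N" "v \<in> Hom C N X" "Cod C t' = Dom C f'"
      "(y \<cdot> f') \<cdot> t' = v \<cdot> u" "zero_object C Z" "Zero C N Z \<in> W" "Zero C Z N \<in> W" using q_zero_right[of "y \<cdot> f'"] f'(2,3) s by auto
    have no: "N \<in> Ob C" "Z \<in> Ob C" using n C.Hom_Ob C.zero_object_Ob by auto
    note ns = n(2,3)[unfolded Hom_iff] no
    have "pull C A v \<delta> \<in> Exts C N A" using ns s by (simp add: pull_def)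
    then obtain E1 x1 y1 where t1: "s_triangle C A E1 N x1 y1 (pull C A v \<delta>)" using C.Real_class[of N A] no s by blast
    note s1 = C.s_triangle_simps[OF t1]
    obtain b where b: "b \<in> Hom C E1 B" "b \<cdot> x1 = x" "v \<cdot> y1 = y \<cdot> b" using C.C3'[OF t n(3) t1] by blast
    note bs = b(1)[unfolded Hom_iff]
    have "pull C A u (pull C A v \<delta>) = pull C A (v \<cdot> u) \<delta>" using ns s by (simp add: pull_def)
    also have "... = pull C A (f' \<cdot> t') (pull C A y \<delta>)" unfolding n(5)[symmetric] using f'(2,3) n(1,4) s by (simp add: pull_def)
    also have "... = \<one>\<^bsub>Ext C (Dom C u) A\<^esub>" unfolding E(2) using f'(2,3) n(1,4) s ns by (simp add: pull_def)
    finally obtain g where g: "g \<in> Hom C (Dom C t') E1" "u = y1 \<cdot> g" using C.s_triangle_exact[OF t1] ns unfolding cov_exact_def by metis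
    note gs = g(1)[unfolded Hom_iff]
    have "y \<cdot> b \<cdot> g = v \<cdot> y1 \<cdot> g" by (rule C.Cmp_cong_right) (use b(3) bs s s1 ns gs in auto)
    also have "... = y \<cdot> f' \<cdot> t'" using n(5) g(2) f'(2,3) n(1,4) s by simp
    finally have 1: "y \<cdot> b \<cdot> g = y \<cdot> f' \<cdot> t'" .
    let ?d = "Add C (f' \<cdot> t') (Neg C (b \<cdot> g))"
    have "y \<cdot> ?d = Add C (y \<cdot> f' \<cdot> t') (Neg C (y \<cdot> b \<cdot> g))" using f'(2,3) n(1,4) s gs bs by simp
    also have "... = Zero C (Dom C ?d) X" unfolding 1 using f'(2,3) n(1,4) s gs bs by simp
    finally obtain h where h: "h \<in> Hom C (Dom C t') A" "?d = x \<cdot> h" using E(3)[of ?d] f'(2,3) n(1,4) s gs bs by auto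
    note hs = h(1)[unfolded Hom_iff]
    have z: "s_triangle C A A Z (Idt C A) (Zero C A Z) \<one>\<^bsub>Ext C Z A\<^esub>" unfolding s_triangle_def using C.C2[of A Z] n(6) s no by (auto simp: Hom_iff)
    have "push C Z (Idt C A) \<one>\<^bsub>Ext C Z A\<^esub> = pull C A (Zero C Z N) (pull C A v \<delta>)" using ns s by (simp add: push_def pull_def)
    then obtain b' where b': "isomorphism L b'" "b' \<in> Hom L A E1" "b' \<star> q (Idt C A) = q x1 \<star> q (Idt C A)"
      using mid_iso[OF z t1, of "Idt C A" "Zero C Z N"] n(8) s ns by (auto simp: Hom_iff)
    have "q x1 = b'" using b' s1 by (simp add: Hom_iff)
    then have i: "isomorphism L (q x1)" using b' by simp
    have "q b = (q b \<star> q x1) \<star> inv_mor L (q x1)" using bs s1 i by simp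
    then have qb: "q b = q x \<star> inv_mor L (q x1)" using b(2) bs s1 by (simp add: q_Cmp[symmetric])
    have "f' \<cdot> t' = Add C (b \<cdot> g) ?d" using C.Add_Neg_cancel(3)[of "f' \<cdot> t'" "b \<cdot> g"] f'(2,3) n(1,4) gs bs by simp
    then have "f' \<cdot> t' = Add C (b \<cdot> g) (x \<cdot> h)" unfolding h(2) .
    then have "q f' \<star> q t' = q (Add C (b \<cdot> g) (x \<cdot> h))" using f'(2) n(1,4) by (simp add: q_Cmp[symmetric])
    also have "... = q x \<star> Add L (inv_mor L (q x1) \<star> q g) (q h)" using gs hs bs s s1 i by (simp add: q_Add q_Cmp qb)
    finally have 2: "q f' \<star> q t' = q x \<star> Add L (inv_mor L (q x1) \<star> q g) (q h)" .
    let ?g = "Add L (inv_mor L (q x1) \<star> q g) (q h)"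
    have gg: "?g \<in> Mor L" "Dom L ?g = Dom C t'" "Cod L ?g = A" using gs hs s1 i by auto
    have "\<phi> = (q f' \<star> q t') \<star> inv_mor L (q t') \<star> inv_mor L (q t)" unfolding f'(6)[symmetric] using f(1,2) f'(1-5) n(1,4) by simp
    also have "... = q x \<star> ?g \<star> inv_mor L (q t') \<star> inv_mor L (q t)" unfolding 2 using gg f'(1-5) n(1,4) s by (simp del: L.Cmp_Add)
    finally show "\<exists>g\<in>Hom L (Dom L \<phi>) A. \<phi> = q x \<star> g" by (rule bexI) (use gg f'(1-5) n(1,4) in \<open>simp_all add: Hom_iff\<close>)
  next
    fix \<phi> assume f: "\<phi> \<in> Mor L" "Cod L \<phi> = X" "pull L A \<phi> (mu X A \<delta>) = \<one>\<^bsub>Ext L (Dom L \<phi>) A\<^esub>"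
    have fo: "Dom L \<phi> \<in> Ob C" using L.Ob_simps(1)[OF f(1)] by simp
    obtain t f' where f': "t \<in> W" "f' \<in> Mor C" "Cod C f' = X" "Cod C t = Dom L \<phi>" "Dom C f' = Dom C t"
      "\<phi> \<star> q t = q f'" using frac_right[OF f(1)] f(2) by auto
    have to: "Dom C t \<in> Ob C" using f'(1) by simp
    have d: "ExtMap C f' (Idt C A) \<delta> \<in> Exts C (Dom C t) A" using f' s by simp
    have "mu (Dom C t) A (ExtMap C f' (Idt C A) \<delta>) = ExtMap L (q f') (Idt L A) (mu X A \<delta>)"
      using mu_ExtMap'[of f' "Idt C A" \<delta> X A "Dom C t" A] f' s by simp
    also have "... = ExtMap L (q t) (Idt L A) (pull L A \<phi> (mu X A \<delta>))" unfolding f'(6)[symmetric] using f(1,2) f'(1,4) s by (simp add: pull_def)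
    also have "... = \<one>\<^bsub>Ext L (Dom C t) A\<^esub>" unfolding f(3) using f'(1,4) s by simp
    finally obtain t' where t': "t' \<in> W" "Cod C t' = Dom C t"
      "ExtMap C t' (Idt C A) (ExtMap C f' (Idt C A) \<delta>) = \<one>\<^bsub>Ext C (Dom C t') A\<^esub>" using mu_one_pull[OF to s(10) d] by blast
    have "pull C A (f' \<cdot> t') \<delta> = \<one>\<^bsub>Ext C (Dom C (f' \<cdot> t')) A\<^esub>" using t' f'(2,3,5) s by (simp add: pull_def)
    then obtain g where g: "g \<in> Hom C (Dom C t') B" "f' \<cdot> t' = y \<cdot> g" using E(4)[of "f' \<cdot> t'"] t'(1,2) f'(2,3,5) by auto
    note gs = g(1)[unfolded Hom_iff]
    have 2: "q f' \<star> q t' = q y \<star> q g" by (rule q_square) (use g(2) gs s t'(1,2) f' in auto)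
    have "\<phi> = (q f' \<star> q t') \<star> inv_mor L (q t') \<star> inv_mor L (q t)" unfolding f'(6)[symmetric] using f(1,2) f'(1-5) t'(1,2) by simp
    also have "... = q y \<star> q g \<star> inv_mor L (q t') \<star> inv_mor L (q t)" unfolding 2 using gs f'(1-5) t'(1,2) s by simp
    finally show "\<exists>g\<in>Hom L (Dom L \<phi>) B. \<phi> = q y \<star> g" by (rule bexI) (use gs f'(1-5) t'(1,2) in \<open>simp_all add: Hom_iff\<close>)
  qed
qed

end

section \<open>The realization in the localization\<close>

lemma loc_tri_opposite_aux:
  assumes "category C" "category L" "\<And>f. f \<in> Mor C ==> q f \<in> Hom L (Dom C f) (Cod C f)"
    "loc_tri C L q mu A B X \<xi> \<eta> \<epsilon>"
  shows "loc_tri (opposite C) (opposite L) q (\<lambda>X A. mu A X) X B A \<eta> \<xi> \<epsilon>"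
proof -
  interpret L: category L by fact
  obtain A' B' X' x y \<delta> \<alpha> \<beta> \<gamma> where t: "s_triangle C A' B' X' x y \<delta>" "isomorphism L \<alpha>" "\<alpha> \<in> Hom L A A'"
    "isomorphism L \<beta>" "\<beta> \<in> Hom L B' B" "isomorphism L \<gamma>" "\<gamma> \<in> Hom L X' X"
    "\<xi> = \<beta> \<cdot>\<^bsub>L\<^esub> q x \<cdot>\<^bsub>L\<^esub> \<alpha>" "\<eta> = \<gamma> \<cdot>\<^bsub>L\<^esub> q y \<cdot>\<^bsub>L\<^esub> inv_mor L \<beta>" "ExtMap L \<gamma> \<alpha> \<epsilon> = mu X' A' \<delta>" using assms(4) unfolding loc_tri_def by blast
  have xy: "q x \<in> Hom L A' B'" "q y \<in> Hom L B' X'" using t(1) assms(3)[of x] assms(3)[of y] by (auto simp: s_triangle_def Hom_iff)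
  show ?thesis unfolding loc_tri_def
    apply (rule exI[of _ X'], rule exI[of _ B'], rule exI[of _ A'], rule exI[of _ y], rule exI[of _ x], rule exI[of _ \<delta>],
      rule exI[of _ \<gamma>], rule exI[of _ "inv_mor L \<beta>"], rule exI[of _ \<alpha>]) using t xy assms(1) by (simp add: s_triangle_opposite Hom_iff)
qed

lemma loc_tri_opposite:
  assumes "category C" "category L" "\<And>f. f \<in> Mor C ==> q f \<in> Hom L (Dom C f) (Cod C f)"
  shows "loc_tri (opposite C) (opposite L) q (\<lambda>X A. mu A X) X B A \<eta> \<xi> \<epsilon> \<longleftrightarrow> loc_tri C L q mu A B X \<xi> \<eta> \<epsilon>"
  using loc_tri_opposite_aux[OF assms, of mu A B X \<xi> \<eta> \<epsilon>]
    loc_tri_opposite_aux[OF category_opposite[OF assms(1)] category_opposite[OF assms(2)], of q "\<lambda>X A. mu A X" X B A \<eta> \<xi> \<epsilon>]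
    assms(3) by auto

context fraction_ext
begin

lemma opposite_fraction_ext:
  "fraction_ext (opposite C) (opposite L) W q (\<lambda>X A. mu A X)"
proof -
  let ?P = "opposite L"
  let ?O = "opposite C"
  interpret oC: weakly_extriangulated "opposite C" by (rule weakly_extriangulated_opposite) unfold_locales
  interpret oL: biadditive_Ext "opposite L" by (rule biadditive_Ext_opposite) unfold_locales
  note st = s_triangle_opposite[OF C.category_axioms]
  note lt = loc_tri_opposite[OF C.category_axioms L.category_axioms q_Hom]
  show ?thesis
  proof unfold_locales
    show "\<exists>s\<in>W. \<exists>f\<in>Mor ?O. Dom ?O f = Dom ?P \<phi> \<and> Dom ?O s = Cod ?P \<phi> \<and>
      Cod ?O f = Cod ?O s \<and> q s \<cdot>\<^bsub>?P\<^esub> \<phi> = q f" if "\<phi> \<in> Mor ?P" for \<phi> using frac_right[of \<phi>] that by simp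
    show "\<exists>s\<in>W. \<exists>f\<in>Mor ?O. Cod ?O f = Cod ?P \<phi> \<and> Cod ?O s = Dom ?P \<phi> \<and>
      Dom ?O f = Dom ?O s \<and> \<phi> \<cdot>\<^bsub>?P\<^esub> q s = q f" if "\<phi> \<in> Mor ?P" for \<phi> using frac_left[of \<phi>] that by simp
    show "\<exists>s\<in>W. \<exists>t\<in>W. \<exists>\<delta>\<in>Exts ?O (Dom ?O t) (Cod ?O s). Dom ?O s = A \<and>
       Cod ?O t = X \<and> ExtMap ?P (q t) (q s) \<epsilon> = mu (Cod ?O s) (Dom ?O t) \<delta>"
      if "X \<in> Ob ?O" "A \<in> Ob ?O" "\<epsilon> \<in> Exts ?P X A" for X A \<epsilon> using mu_surj[of A X \<epsilon>] that by (simp) blast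
    show "\<exists>s\<in>W. Dom ?O s = A \<and> ExtMap ?O (Idt ?O X) s \<delta> = \<one>\<^bsub>Ext ?O X (Cod ?O s)\<^esub>"
      if "X \<in> Ob ?O" "A \<in> Ob ?O" "\<delta> \<in> Exts ?O X A" "mu A X \<delta> = \<one>\<^bsub>Ext ?P X A\<^esub>" for X A \<delta>
      using mu_one_pull[of A X \<delta>] that by simp
    show "\<exists>t\<in>W. Cod ?O t = X \<and> ExtMap ?O t (Idt ?O A) \<delta> = \<one>\<^bsub>Ext ?O (Dom ?O t) A\<^esub>"
      if "X \<in> Ob ?O" "A \<in> Ob ?O" "\<delta> \<in> Exts ?O X A" "mu A X \<delta> = \<one>\<^bsub>Ext ?P X A\<^esub>" for X A \<delta>
      using mu_one_push[of A X \<delta>] that by simp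
    show "\<exists>t\<in>W. \<exists>N Z. \<exists>u\<in>Hom ?O (Dom ?O t) N. \<exists>v\<in>Hom ?O N (Cod ?O f).
         Cod ?O t = Dom ?O f \<and> f \<cdot>\<^bsub>?O\<^esub> t = v \<cdot>\<^bsub>?O\<^esub> u \<and> zero_object ?O Z \<and>
         Zero ?O N Z \<in> W \<and> Zero ?O Z N \<in> W"
      if "f \<in> Mor ?O" "q f = Zero ?P (Dom ?O f) (Cod ?O f)" for f using q_zero_left[of f] that by simp blast
    show "\<exists>t\<in>W. \<exists>N Z. \<exists>u\<in>Hom ?O (Dom ?O f) N. \<exists>v\<in>Hom ?O N (Cod ?O t).
         Dom ?O t = Cod ?O f \<and> t \<cdot>\<^bsub>?O\<^esub> f = v \<cdot>\<^bsub>?O\<^esub> u \<and> zero_object ?O Z \<and>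
         Zero ?O N Z \<in> W \<and> Zero ?O Z N \<in> W"
      if "f \<in> Mor ?O" "q f = Zero ?P (Dom ?O f) (Cod ?O f)" for f using q_zero_right[of f] that by simp blast
  next
    fix A B X x y \<delta> A' B' X' x' y' \<delta>' a c
    assume h: "s_triangle ?O A B X x y \<delta>" "s_triangle ?O A' B' X' x' y' \<delta>'" "a \<in> W" "c \<in> W"
      "a \<in> Hom ?O A A'" "c \<in> Hom ?O X X'" "push ?O X a \<delta> = pull ?O A' c \<delta>'"
    then obtain b where b: "isomorphism L b" "b \<in> Hom L B' B" "b \<star> q y' = q y \<star> q c" "q a \<star> q x' = q x \<star> b"
      using mid_iso[of X' B' A' y' x' \<delta>' X B A y x \<delta> c a] by (auto simp: st)
    then show "\<exists>b. isomorphism ?P b \<and> b \<in> Hom ?P B B' \<and> b \<cdot>\<^bsub>?P\<^esub> q x = q x' \<cdot>\<^bsub>?P\<^esub> q a \<and>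
      q c \<cdot>\<^bsub>?P\<^esub> q y = q y' \<cdot>\<^bsub>?P\<^esub> b" by (intro exI[of _ b]) simp
  qed (auto simp: W_Cmp q_Cmp q_Add mu_hom mu_ExtMap q_Hom lt Real_L simp del: q_simps)
qed

lemma q_triangle_coexact:
  assumes "s_triangle C A B X x y \<delta>"
  shows "cov_exact (opposite L) X B A (q y) (q x) (mu X A \<delta>)" using fraction_ext.q_triangle_exact[OF opposite_fraction_ext, of X B A y x \<delta>] assms
  by (simp add: s_triangle_opposite C.category_axioms)

text \<open>Write \<open>\<alpha> = q(s)\<inverse>q(f)\<close> and \<open>\<gamma> = q(g)q(t)\<inverse>\<close>. After enlarging \<open>s\<close>, one has \<open>f\<^sub>*t\<^sup>*\<delta> = s\<^sub>*g\<^sup>*\<delta>'\<close> in \<open>C\<close>. The morphism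
  is then composed of four: from \<open>\<delta>\<close> back along \<open>t\<close> to \<open>t\<^sup>*\<delta>\<close>, along \<open>f\<close> to the common extension, back along \<open>s\<close>
  to \<open>g\<^sup>*\<delta>'\<close>, and along \<open>g\<close> to \<open>\<delta>'\<close>. The two that are traversed backwards are invertible in the middle.\<close>

lemma ex_loc_morphism:
  assumes t: "s_triangle C A B X x y \<delta>" and t': "s_triangle C A' B' X' x' y' \<delta>'"
    and \<alpha>: "\<alpha> \<in> Hom L A A'" and \<gamma>: "\<gamma> \<in> Hom L X X'"
    and eq: "push L X \<alpha> (mu X A \<delta>) = pull L A' \<gamma> (mu X' A' \<delta>')"
  shows "\<exists>\<beta>. tri_mor L (q x) (q y) (mu X A \<delta>) (q x') (q y') (mu X' A' \<delta>') \<alpha> \<beta> \<gamma>"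
proof -
  note s = C.s_triangle_simps[OF t] C.s_triangle_simps[OF t']
  note \<alpha>s = \<alpha>[unfolded Hom_iff] \<gamma>[unfolded Hom_iff]
  obtain s0 f0 where s0: "s0 \<in> W" "f0 \<in> Mor C" "Dom C f0 = A" "Dom C s0 = A'" "Cod C f0 = Cod C s0"
    "q s0 \<star> \<alpha> = q f0" using frac_left[of \<alpha>] \<alpha>s by auto
  obtain t0 g where t0: "t0 \<in> W" "g \<in> Mor C" "Cod C g = X'" "Cod C t0 = X" "Dom C g = Dom C t0"
    "\<gamma> \<star> q t0 = q g" using frac_right[of \<gamma>] \<alpha>s by auto
  let ?Y = "Dom C t0" and ?D = "Cod C s0"
  have o: "?Y \<in> Ob C" "?D \<in> Ob C" using s0(1) t0(1) by auto
  let ?l = "ExtMap C t0 f0 \<delta>" and ?r = "ExtMap C g s0 \<delta>'"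
  have lr: "?l \<in> Exts C ?Y ?D" "?r \<in> Exts C ?Y ?D" using s0(1-5) t0(1-5) s by simp_all
  have "mu ?Y ?D ?l = ExtMap L (q t0) (q s0) (push L X \<alpha> (mu X A \<delta>))"
    using mu_ExtMap'[of t0 f0 \<delta> X A ?Y ?D] s0(1-5) t0(1,4) s \<alpha>s by (simp add: push_def s0(6)[symmetric])
  also have "... = mu ?Y ?D ?r" unfolding eq using mu_ExtMap'[of g s0 \<delta>' X' A' ?Y ?D] s0(1,4) t0(1-5) s \<alpha>s by (simp add: pull_def t0(6)[symmetric])
  finally obtain w where w: "w \<in> W" "Dom C w = ?D" "ExtMap C (Idt C ?Y) w ?l = ExtMap C (Idt C ?Y) w ?r" using mu_eq_push[OF o lr] by blast
  let ?f = "w \<cdot> f0" and ?s = "w \<cdot> s0"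
  have fs: "?f \<in> Hom C A (Cod C w)" "?s \<in> Hom C A' (Cod C w)" "?s \<in> W" using s0(1-5) w(1,2) W_Cmp by (auto simp: Hom_iff)
  let ?d1 = "ExtMap C t0 (Idt C A) \<delta>" and ?d3 = "ExtMap C g (Idt C A') \<delta>'" and ?d2 = "ExtMap C t0 ?f \<delta>"
  have d2: "?d2 = ExtMap C g ?s \<delta>'" using w s0(1-5) t0(1-5) s by simp
  have car: "?d1 \<in> Exts C ?Y A" "?d3 \<in> Exts C ?Y A'" "?d2 \<in> Exts C ?Y (Cod C w)" using w(1,2) s0(1-5) t0(1-5) s by simp_all
  obtain B1 x1 y1 where t1: "s_triangle C A B1 ?Y x1 y1 ?d1" using C.Real_class[OF o(1) _ car(1)] s by blast
  obtain B2 x2 y2 where t2: "s_triangle C (Cod C w) B2 ?Y x2 y2 ?d2" using C.Real_class[OF o(1) _ car(3)] w(1) by auto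
  obtain B3 x3 y3 where t3: "s_triangle C A' B3 ?Y x3 y3 ?d3" using C.Real_class[OF o(1) _ car(2)] s by blast
  note s1 = C.s_triangle_simps[OF t1] C.s_triangle_simps[OF t2] C.s_triangle_simps[OF t3]
  have t0h: "t0 \<in> Hom C ?Y X" "g \<in> Hom C ?Y X'" using t0 by (auto simp: Hom_iff)
  obtain b1 where b1: "isomorphism L b1" "b1 \<in> Hom L B1 B" "b1 \<star> q x1 = q x \<star> q (Idt C A)" "q t0 \<star> q y1 = q y \<star> b1"
    using mid_iso[OF t1 t, of "Idt C A" t0] t0(1) t0h s car o by (auto simp: push_def pull_def Hom_iff)
  obtain b2 where b2: "tri_mor C x1 y1 ?d1 x2 y2 ?d2 ?f b2 (Idt C ?Y)"
    using C.ex_middle_morphism[OF t1 t2 fs(1), of "Idt C ?Y"] o s car w(1,2) s0(1-5) t0(1,4) by (auto simp: push_def pull_def Hom_iff)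
  obtain b3 where b3: "tri_mor C x3 y3 ?d3 x' y' \<delta>' (Idt C A') b3 g"
    using C.ex_middle_morphism[OF t3 t', of "Idt C A'" g] o s car t0h by (auto simp: push_def pull_def Hom_iff)
  obtain b4 where b4: "isomorphism L b4" "b4 \<in> Hom L B3 B2" "b4 \<star> q x3 = q x2 \<star> q ?s" "q (Idt C ?Y) \<star> q y3 = q y2 \<star> b4"
    using mid_iso[OF t3 t2 fs(3), of "Idt C ?Y"] o s car w(1,2) s0(1-5) t0(2-5) by (auto simp: push_def pull_def Hom_iff d2)
  note Q = q_triangle[OF t] q_triangle[OF t'] q_triangle[OF t1] q_triangle[OF t2] q_triangle[OF t3]
  have m1: "tri_mor L (q x1) (q y1) (mu ?Y A ?d1) (q x) (q y) (mu X A \<delta>) (Idt L A) b1 (q t0)"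
    unfolding tri_mor_def using b1 s s1 t0h mu_ExtMap'[of t0 "Idt C A" \<delta> X A ?Y A] by (auto simp: push_def pull_def Hom_iff)
  have m4: "tri_mor L (q x3) (q y3) (mu ?Y A' ?d3) (q x2) (q y2) (mu ?Y (Cod C w) ?d2) (q ?s) b4 (Idt L ?Y)"
    unfolding tri_mor_def using b4 s s1 w(1,2) s0(1-5) o mu_ExtMap'[of "Idt C ?Y" ?s ?d3 ?Y A' ?Y "Cod C w"] t0(2-5)
    by (auto simp: push_def pull_def Hom_iff d2)
  have qtri: "tri_mor L (q u) (q v) (mu E1 E2 d) (q u') (q v') (mu E1' E2' d') (q a) (q b) (q c)"
    if tt: "s_triangle C E2 F E1 u v d" "s_triangle C E2' F' E1' u' v' d'" and m: "tri_mor C u v d u' v' d' a b c"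
    for u v d u' v' d' a b c E1 E2 F E1' E2' F'
  proof -
    note ss = C.s_triangle_simps[OF tt(1)] C.s_triangle_simps[OF tt(2)]
    have e: "a \<in> Mor C" "Dom C a = E2" "Cod C a = E2'" "b \<in> Mor C" "Dom C b = F" "Cod C b = F'"
      "c \<in> Mor C" "Dom C c = E1" "Cod C c = E1'" "b \<cdot> u = u' \<cdot> a" "c \<cdot> v = v' \<cdot> b"
      "ExtMap C (Idt C E1) a d = ExtMap C c (Idt C E2') d'" using m ss by (auto simp: tri_mor_def push_def pull_def Hom_iff)
    have "q b \<star> q u = q u' \<star> q a" "q c \<star> q v = q v' \<star> q b" by (rule q_square; use e ss in simp)+
    moreover have "ExtMap L (Idt L E1) (q a) (mu E1 E2 d) = ExtMap L (q c) (Idt L E2') (mu E1' E2' d')"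
      using mu_ExtMap'[of "Idt C E1" a d E1 E2 E1 E2'] mu_ExtMap'[of c "Idt C E2'" d' E1' E2' E1 E2'] e ss by simp
    ultimately show ?thesis unfolding tri_mor_def using e(1-9) ss by (simp add: push_def pull_def Hom_iff)
  qed
  have m2: "tri_mor L (q x1) (q y1) (mu ?Y A ?d1) (q x2) (q y2) (mu ?Y (Cod C w) ?d2) (q ?f) (q b2) (Idt L ?Y)" using qtri[OF t1 t2 b2] o by simp
  have m3: "tri_mor L (q x3) (q y3) (mu ?Y A' ?d3) (q x') (q y') (mu X' A' \<delta>') (Idt L A') (q b3) (q g)" using qtri[OF t3 t' b3] s by simp
  have i: "isomorphism L (Idt L A)" "isomorphism L (q t0)" "isomorphism L (q ?s)" "isomorphism L (Idt L ?Y)" using s o t0(1) fs(3) by auto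
  note m1' = L.tri_mor_inv[OF Q(7-9) Q(1-3) m1 i(1) b1(1) i(2)]
  note m4' = L.tri_mor_inv[OF Q(13-15) Q(10-12) m4 i(3) b4(1) i(4)]
  note m12 = L.tri_mor_comp[OF Q(1-3) Q(7-9) Q(10-12) m1' m2]
  note m124 = L.tri_mor_comp[OF Q(1-3) Q(10-12) Q(13-15) m12 m4']
  note m = L.tri_mor_comp[OF Q(1-3) Q(13-15) Q(4-6) m124 m3]
  have "q ?s \<star> \<alpha> = q ?f" using s0 w(1,2) \<alpha>s by (simp add: q_Cmp)
  then have "inv_mor L (q ?s) \<star> q ?f = \<alpha>" using fs \<alpha>s i(3) L.inv_mor_Cmp(1)[OF i(3), of \<alpha>] by (simp add: Hom_iff)
  then have a: "Idt L A' \<star> inv_mor L (q ?s) \<star> q ?f \<star> inv_mor L (Idt L A) = \<alpha>" using fs(1) s \<alpha>s by (simp add: Hom_iff)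
  have c: "q g \<star> inv_mor L (Idt L ?Y) \<star> Idt L ?Y \<star> inv_mor L (q t0) = \<gamma>" unfolding t0(6)[symmetric] using t0(1,4) \<alpha>s o by simp
  show ?thesis using m[unfolded a c] by blast
qed

lemma loc_morphism_iso:
  assumes t: "s_triangle C A B X x y \<delta>" and t': "s_triangle C A' B' X' x' y' \<delta>'"
    and "tri_mor L (q x) (q y) (mu X A \<delta>) (q x') (q y') (mu X' A' \<delta>') \<alpha> \<beta> \<gamma>" "isomorphism L \<alpha>" "isomorphism L \<gamma>"
  shows "isomorphism L \<beta>" by (rule five_lemma[OF L.biadditive_Ext_axioms q_triangle[OF t] q_triangle[OF t'] q_triangle_exact[OF t]
    q_triangle_exact[OF t'] q_triangle_coexact[OF t] q_triangle_coexact[OF t'] assms(3-5)])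

lemma loc_tri_Hom:
  assumes "loc_tri C L q mu A B X \<xi> \<eta> \<epsilon>"
  shows "\<xi> \<in> Hom L A B" "\<eta> \<in> Hom L B X"
proof -
  obtain A' B' X' x y \<delta> \<alpha> \<beta> \<gamma> where t: "s_triangle C A' B' X' x y \<delta>" "isomorphism L \<alpha>" "\<alpha> \<in> Hom L A A'"
    "isomorphism L \<beta>" "\<beta> \<in> Hom L B' B" "isomorphism L \<gamma>" "\<gamma> \<in> Hom L X' X"
    "\<xi> = \<beta> \<star> q x \<star> \<alpha>" "\<eta> = \<gamma> \<star> q y \<star> inv_mor L \<beta>" using assms unfolding loc_tri_def by blast
  note s = C.s_triangle_simps[OF t(1)]
  show "\<xi> \<in> Hom L A B" "\<eta> \<in> Hom L B X" unfolding t(8,9) using t(2-7) s by (auto simp: Hom_iff)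
qed

text \<open>Two realizations of \<open>\<epsilon>\<close> come from two triangles of \<open>C\<close> whose ends are isomorphic in \<open>L\<close> compatibly
  with the extensions; such an isomorphism extends to the middle terms.\<close>

lemma loc_tri_unique:
  assumes "loc_tri C L q mu A B X \<xi> \<eta> \<epsilon>" "loc_tri C L q mu A B' X \<xi>' \<eta>' \<epsilon>" "\<epsilon> \<in> Exts L X A"
  shows "(\<xi>', \<eta>') \<in> seq_class L \<xi> \<eta>"
proof -
  obtain A1 B1 X1 x y \<delta> \<alpha> \<beta> \<gamma> where t: "s_triangle C A1 B1 X1 x y \<delta>" "isomorphism L \<alpha>" "\<alpha> \<in> Hom L A A1"
    "isomorphism L \<beta>" "\<beta> \<in> Hom L B1 B" "isomorphism L \<gamma>" "\<gamma> \<in> Hom L X1 X"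
    "\<xi> = \<beta> \<star> q x \<star> \<alpha>" "\<eta> = \<gamma> \<star> q y \<star> inv_mor L \<beta>" "ExtMap L \<gamma> \<alpha> \<epsilon> = mu X1 A1 \<delta>" using assms(1) unfolding loc_tri_def by blast
  obtain A2 B2 X2 x' y' \<delta>' \<alpha>' \<beta>' \<gamma>' where t': "s_triangle C A2 B2 X2 x' y' \<delta>'" "isomorphism L \<alpha>'" "\<alpha>' \<in> Hom L A A2"
    "isomorphism L \<beta>'" "\<beta>' \<in> Hom L B2 B'" "isomorphism L \<gamma>'" "\<gamma>' \<in> Hom L X2 X"
    "\<xi>' = \<beta>' \<star> q x' \<star> \<alpha>'" "\<eta>' = \<gamma>' \<star> q y' \<star> inv_mor L \<beta>'" "ExtMap L \<gamma>' \<alpha>' \<epsilon> = mu X2 A2 \<delta>'" using assms(2) unfolding loc_tri_def by blast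
  note s = C.s_triangle_simps[OF t(1)] C.s_triangle_simps[OF t'(1)]
  have n: "\<alpha> \<in> Mor L" "Dom L \<alpha> = A" "Cod L \<alpha> = A1" "\<beta> \<in> Mor L" "Dom L \<beta> = B1" "Cod L \<beta> = B" "\<gamma> \<in> Mor L" "Dom L \<gamma> = X1" "Cod L \<gamma> = X"
    "\<alpha>' \<in> Mor L" "Dom L \<alpha>' = A" "Cod L \<alpha>' = A2" "\<beta>' \<in> Mor L" "Dom L \<beta>' = B2" "Cod L \<beta>' = B'" "\<gamma>' \<in> Mor L" "Dom L \<gamma>' = X2" "Cod L \<gamma>' = X"
    "isomorphism L \<alpha>" "isomorphism L \<alpha>'" "isomorphism L \<beta>" "isomorphism L \<beta>'" "isomorphism L \<gamma>" "isomorphism L \<gamma>'" using t t' by (auto simp: Hom_iff)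
  let ?a = "\<alpha>' \<star> inv_mor L \<alpha>" and ?c = "inv_mor L \<gamma>' \<star> \<gamma>"
  have ac: "?a \<in> Hom L A1 A2" "?c \<in> Hom L X1 X2" "isomorphism L ?a" "isomorphism L ?c" using n by (auto simp: Hom_iff intro!: L.isomorphism_Cmp)
  have "push L X1 ?a (mu X1 A1 \<delta>) = ExtMap L \<gamma> \<alpha>' \<epsilon>" unfolding t(10)[symmetric] using n s assms(3) by (simp add: push_def)
  also have "... = pull L A2 ?c (mu X2 A2 \<delta>')" unfolding t'(10)[symmetric] using n s assms(3) by (simp add: pull_def)
  finally obtain b where m: "tri_mor L (q x) (q y) (mu X1 A1 \<delta>) (q x') (q y') (mu X2 A2 \<delta>') ?a b ?c"
    using ex_loc_morphism[OF t(1) t'(1) ac(1,2)] by blast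
  have i: "isomorphism L b" by (rule loc_morphism_iso[OF t(1) t'(1) m ac(3,4)])
  have bm: "b \<in> Mor L" "Dom L b = B1" "Cod L b = B2" and be: "b \<star> q x = q x' \<star> ?a" "?c \<star> q y = q y' \<star> b" using m s by (auto simp: tri_mor_def Hom_iff)
  let ?b = "\<beta>' \<star> b \<star> inv_mor L \<beta>"
  have ib: "isomorphism L (b \<star> inv_mor L \<beta>)" "isomorphism L ?b" using i n bm by (auto intro!: L.isomorphism_Cmp)
  have "?b \<star> \<xi> = \<beta>' \<star> (b \<star> q x) \<star> \<alpha>" unfolding t(8) using n bm s by simp
  also have "... = \<xi>'" unfolding be(1) t'(8) using n bm s by simp
  finally have 1: "\<xi>' = ?b \<star> \<xi>" ..
  have "\<eta> \<star> inv_mor L ?b = \<gamma> \<star> q y \<star> inv_mor L b \<star> inv_mor L \<beta>'" unfolding t(9) using n bm s i ib(1) by (simp add: L.inv_mor_comp)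
  also have "... = \<gamma>' \<star> (?c \<star> q y) \<star> inv_mor L b \<star> inv_mor L \<beta>'" using n bm s i by simp
  also have "... = \<eta>'" unfolding be(2) t'(9) using n bm s i by simp
  finally have 2: "\<eta>' = \<eta> \<star> inv_mor L ?b" ..
  show ?thesis unfolding L.mem_seq_class[OF loc_tri_Hom[OF assms(1)]] by (rule exI[of _ ?b]) (use 1 2 ib n bm in simp)
qed

lemma loc_tri_seq_class:
  assumes "loc_tri C L q mu A B X \<xi> \<eta> \<epsilon>" "(\<xi>', \<eta>') \<in> seq_class L \<xi> \<eta>"
  shows "\<exists>B'. loc_tri C L q mu A B' X \<xi>' \<eta>' \<epsilon>"
proof -
  obtain b where b: "isomorphism L b" "Dom L b = B" "\<xi>' = b \<star> \<xi>" "\<eta>' = \<eta> \<star> inv_mor L b"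
    using assms(2) L.mem_seq_class[OF loc_tri_Hom[OF assms(1)]] by blast
  note bm = L.isomorphism_Mor[OF b(1)]
  obtain A1 B1 X1 x y \<delta> \<alpha> \<beta> \<gamma> where t: "s_triangle C A1 B1 X1 x y \<delta>" "isomorphism L \<alpha>" "\<alpha> \<in> Hom L A A1"
    "isomorphism L \<beta>" "\<beta> \<in> Hom L B1 B" "isomorphism L \<gamma>" "\<gamma> \<in> Hom L X1 X"
    "\<xi> = \<beta> \<star> q x \<star> \<alpha>" "\<eta> = \<gamma> \<star> q y \<star> inv_mor L \<beta>" "ExtMap L \<gamma> \<alpha> \<epsilon> = mu X1 A1 \<delta>" using assms(1) unfolding loc_tri_def by blast
  note s = C.s_triangle_simps[OF t(1)]
  have i: "isomorphism L (b \<star> \<beta>)" using b t by (intro L.isomorphism_Cmp) (auto simp: Hom_iff)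
  show ?thesis unfolding loc_tri_def
    apply (rule exI[of _ "Cod L b"], rule exI[of _ A1], rule exI[of _ B1], rule exI[of _ X1], rule exI[of _ x], rule exI[of _ y], rule exI[of _ \<delta>],
      rule exI[of _ \<alpha>], rule exI[of _ "b \<star> \<beta>"], rule exI[of _ \<gamma>]) using t i b bm s by (simp add: Hom_iff L.inv_mor_comp)
qed

lemma s_triangle_L:
  "s_triangle L A B X \<xi> \<eta> \<epsilon> \<longleftrightarrow> A \<in> Ob C \<and> X \<in> Ob C \<and> loc_tri C L q mu A B X \<xi> \<eta> \<epsilon> \<and> \<epsilon> \<in> Exts L X A"
proof
  assume l: "s_triangle L A B X \<xi> \<eta> \<epsilon>"
  then have h: "\<xi> \<in> Hom L A B" "\<eta> \<in> Hom L B X" "\<epsilon> \<in> Exts L X A" "Real L X A \<epsilon> = seq_class L \<xi> \<eta>" by (auto simp: s_triangle_def)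
  have o: "A \<in> Ob C" "X \<in> Ob C" using L.Hom_Ob[OF h(1)] L.Hom_Ob[OF h(2)] by auto
  have "(\<xi>, \<eta>) \<in> Real L X A \<epsilon>" unfolding h(4) by (rule L.seq_class_self[OF h(1,2)])
  then obtain B' where B': "loc_tri C L q mu A B' X \<xi> \<eta> \<epsilon>" using Real_L[OF o(2,1) h(3)] by auto
  then have "B' = B" using loc_tri_Hom(1)[OF B'] h(1) by (simp add: Hom_iff)
  then show "A \<in> Ob C \<and> X \<in> Ob C \<and> loc_tri C L q mu A B X \<xi> \<eta> \<epsilon> \<and> \<epsilon> \<in> Exts L X A" using B' o h by simp
next
  assume r: "A \<in> Ob C \<and> X \<in> Ob C \<and> loc_tri C L q mu A B X \<xi> \<eta> \<epsilon> \<and> \<epsilon> \<in> Exts L X A"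
  then have l: "loc_tri C L q mu A B X \<xi> \<eta> \<epsilon>" by blast
  have "{(\<xi>', \<eta>'). \<exists>B. loc_tri C L q mu A B X \<xi>' \<eta>' \<epsilon>} = seq_class L \<xi> \<eta>" using loc_tri_unique[OF l] loc_tri_seq_class[OF l] r by auto
  then show "s_triangle L A B X \<xi> \<eta> \<epsilon>" unfolding s_triangle_def using r loc_tri_Hom[OF l] Real_L by auto
qed

lemma q_s_triangle:
  assumes "s_triangle C A B X x y \<delta>"
  shows "s_triangle L A B X (q x) (q y) (mu X A \<delta>)"
proof -
  note s = C.s_triangle_simps[OF assms]
  have "loc_tri C L q mu A B X (q x) (q y) (mu X A \<delta>)" unfolding loc_tri_def
    apply (rule exI[of _ A], rule exI[of _ B], rule exI[of _ X], rule exI[of _ x], rule exI[of _ y], rule exI[of _ \<delta>],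
      rule exI[of _ "Idt L A"], rule exI[of _ "Idt L B"], rule exI[of _ "Idt L X"]) using assms s by (simp add: Hom_iff)
  then show ?thesis unfolding s_triangle_L using s by simp
qed

lemma s_triangle_L_exact:
  assumes "s_triangle L A B X \<xi> \<eta> \<epsilon>"
  shows "cov_exact L A B X \<xi> \<eta> \<epsilon>"
proof -
  obtain A1 B1 X1 x y \<delta> \<alpha> \<beta> \<gamma> where t: "s_triangle C A1 B1 X1 x y \<delta>" "isomorphism L \<alpha>" "\<alpha> \<in> Hom L A A1"
    "isomorphism L \<beta>" "\<beta> \<in> Hom L B1 B" "isomorphism L \<gamma>" "\<gamma> \<in> Hom L X1 X"
    "\<xi> = \<beta> \<star> q x \<star> \<alpha>" "\<eta> = \<gamma> \<star> q y \<star> inv_mor L \<beta>" "ExtMap L \<gamma> \<alpha> \<epsilon> = mu X1 A1 \<delta>"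
    and e: "\<epsilon> \<in> Exts L X A" using assms unfolding s_triangle_L loc_tri_def by blast
  show ?thesis unfolding t(8,9) by (rule L.cov_exact_transport[OF q_triangle[OF t(1)] q_triangle_exact[OF t(1)] t(2-7) e t(10)])
qed

lemma ex_s_triangle_fraction:
  assumes "\<epsilon> \<in> Exts L X A" "X \<in> Ob C" "A \<in> Ob C"
  shows "\<exists>s t B x y \<delta>. s \<in> W \<and> t \<in> W \<and> s_triangle C (Cod C s) B (Dom C t) x y \<delta> \<and> Dom C s = A \<and> Cod C t = X \<and>
    s_triangle L A B X (q x \<star> q s) (q t \<star> q y) \<epsilon>"
proof -
  obtain s t \<delta> where *: "s \<in> W" "t \<in> W" "\<delta> \<in> Exts C (Dom C t) (Cod C s)" "Dom C s = A" "Cod C t = X"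
    "ExtMap L (q t) (q s) \<epsilon> = mu (Dom C t) (Cod C s) \<delta>" using mu_surj[OF assms(2,3,1)] by blast
  obtain B x y where t: "s_triangle C (Cod C s) B (Dom C t) x y \<delta>" using C.Real_class[OF _ _ *(3)] *(1,2) by auto
  note ss = C.s_triangle_simps[OF t]
  have "loc_tri C L q mu A B X (q x \<star> q s) (q t \<star> q y) \<epsilon>" unfolding loc_tri_def
    apply (rule exI[of _ "Cod C s"], rule exI[of _ B], rule exI[of _ "Dom C t"], rule exI[of _ x], rule exI[of _ y], rule exI[of _ \<delta>],
      rule exI[of _ "q s"], rule exI[of _ "Idt L B"], rule exI[of _ "q t"]) using * t ss by (simp add: Hom_iff)
  then show ?thesis using * t assms unfolding s_triangle_L by blast
qed

text \<open>In a triangle with zero third term the first map is invertible, by exactness on both sides.\<close>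

lemma L_C2:
  assumes A: "A \<in> Ob L" and Z: "zero_object L Z"
    and co: "\<And>B \<xi> \<eta> \<epsilon>. s_triangle L A B Z \<xi> \<eta> \<epsilon> ==> cov_exact (opposite L) Z B A \<eta> \<xi> \<epsilon>"
  shows "Real L Z A \<one>\<^bsub>Ext L Z A\<^esub> = seq_class L (Idt L A) (Zero L A Z)"
proof -
  have o: "A \<in> Ob C" "Z \<in> Ob C" using A L.zero_object_Ob[OF Z] by auto
  then obtain B \<xi> \<eta> where t: "s_triangle L A B Z \<xi> \<eta> \<one>\<^bsub>Ext L Z A\<^esub>" using ex_s_triangle_fraction[of "\<one>\<^bsub>Ext L Z A\<^esub>" Z A] by auto
  then have h: "\<xi> \<in> Hom L A B" "\<eta> \<in> Hom L B Z" "Real L Z A \<one>\<^bsub>Ext L Z A\<^esub> = seq_class L \<xi> \<eta>" by (auto simp: s_triangle_def)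
  have B: "B \<in> Ob L" using L.Hom_Ob[OF h(1)] by simp
  note hs = h(1,2)[unfolded Hom_iff]
  have "\<eta> = Zero L B Z" using L.zero_object_Zero(1)[OF Z, of \<eta>] hs by simp
  then have "\<eta> \<star> Idt L B = Zero L B Z" using hs B by simp
  then obtain g where g: "g \<in> Hom L B A" "Idt L B = \<xi> \<star> g" using s_triangle_L_exact[OF t] B unfolding cov_exact_def by (metis L.Idt_simps)
  have "\<exists>g\<in>Hom L B (Cod L f). f = g \<star> \<xi>"
    if "f \<in> Mor L" "Dom L f = A" "push L Z f \<one>\<^bsub>Ext L Z A\<^esub> = \<one>\<^bsub>Ext L Z (Cod L f)\<^esub>" for f using co[OF t] that unfolding cov_exact_def by simp
  from this[of "Idt L A"] obtain r where r: "r \<in> Hom L B A" "Idt L A = r \<star> \<xi>" using o A by (auto simp: push_def)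
  have i: "isomorphism L \<xi>" by (rule L.isomorphism_left_right[OF h(1) r(1) g(1)]) (use g r in simp_all)
  have "(Idt L A, Zero L A Z) \<in> seq_class L \<xi> \<eta>" unfolding L.mem_seq_class[OF h(1,2)]
  proof (rule exI[of _ "inv_mor L \<xi>"], intro conjI)
    have "\<eta> \<star> \<xi> = Zero L A Z" using L.zero_object_Zero(1)[OF Z, of "\<eta> \<star> \<xi>"] hs by simp
    then show "Zero L A Z = \<eta> \<star> inv_mor L (inv_mor L \<xi>)" using i by simp
  qed (use i hs in auto)
  then show ?thesis unfolding h(3) by (rule L.seq_class_eqI[OF h(1,2), symmetric])
qed

text \<open>Up to isomorphism the first triangle is the image of a triangle of \<open>C\<close>, and the given morphism is \<open>q f\<close> up
  to a denominator. Then (C3) of \<open>C\<close> applies to \<open>f\<close>. The second triangle is isomorphic to the image of the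
  pushout, and the isomorphism carries the cone of \<open>C\<close> to the required one.\<close>

lemma L_C3:
  assumes T: "s_triangle L A B X \<xi> \<eta> \<epsilon>" and a: "a \<in> Hom L A A'"
    and T': "s_triangle L A' B' X \<xi>' \<eta>' (push L X a \<epsilon>)"
  shows "\<exists>b\<in>Hom L B B'. b \<star> \<xi> = \<xi>' \<star> a \<and> \<eta> = \<eta>' \<star> b \<and>
          (\<forall>P i1 i2 p1 p2. biproduct L B A' P i1 i2 p1 p2 -->
             s_triangle L A P B' (Add L (i1 \<star> \<xi>) (i2 \<star> a)) (Add L (b \<star> p1) (Neg L \<xi>' \<star> p2)) (pull L A \<eta>' \<epsilon>))"
proof -
  obtain A0 B0 X0 x y \<delta> \<alpha> \<beta> \<gamma> where t: "s_triangle C A0 B0 X0 x y \<delta>" "isomorphism L \<alpha>" "\<alpha> \<in> Hom L A A0"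
    "isomorphism L \<beta>" "\<beta> \<in> Hom L B0 B" "isomorphism L \<gamma>" "\<gamma> \<in> Hom L X0 X"
    "\<xi> = \<beta> \<star> q x \<star> \<alpha>" "\<eta> = \<gamma> \<star> q y \<star> inv_mor L \<beta>" "ExtMap L \<gamma> \<alpha> \<epsilon> = mu X0 A0 \<delta>"
    and e: "\<epsilon> \<in> Exts L X A" and o: "A \<in> Ob C" "X \<in> Ob C" using T unfolding s_triangle_L loc_tri_def by blast
  have o': "A' \<in> Ob C" using L.Hom_Ob[OF a] by simp
  note s = C.s_triangle_simps[OF t(1)]
  have n: "\<alpha> \<in> Mor L" "Dom L \<alpha> = A" "Cod L \<alpha> = A0" "\<beta> \<in> Mor L" "Dom L \<beta> = B0" "Cod L \<beta> = B"
    "\<gamma> \<in> Mor L" "Dom L \<gamma> = X0" "Cod L \<gamma> = X" "a \<in> Mor L" "Dom L a = A" "Cod L a = A'"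
    "isomorphism L \<alpha>" "isomorphism L \<beta>" "isomorphism L \<gamma>" using t(2-7) a by (auto simp: Hom_iff)
  have h': "\<xi>' \<in> Hom L A' B'" "\<eta>' \<in> Hom L B' X" "Real L X A' (push L X a \<epsilon>) = seq_class L \<xi>' \<eta>'" using T' by (auto simp: s_triangle_def)
  note hs' = h'(1,2)[unfolded Hom_iff]
  have aa: "a \<star> inv_mor L \<alpha> \<in> Mor L" "Dom L (a \<star> inv_mor L \<alpha>) = A0" "Cod L (a \<star> inv_mor L \<alpha>) = A'" using n by auto
  obtain s' f where f: "s' \<in> W" "f \<in> Mor C" "Dom C f = A0" "Dom C s' = A'" "Cod C f = Cod C s'"
    "q s' \<star> (a \<star> inv_mor L \<alpha>) = q f" using frac_left[OF aa(1)] unfolding aa(2,3) by blast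
  let ?A1 = "Cod C s'"
  have fh: "f \<in> Hom C A0 ?A1" using f by (simp add: Hom_iff)
  have "q f \<star> \<alpha> = q s' \<star> a" unfolding f(6)[symmetric] using n f(1,4) by simp
  note qf = this
  have "push C X0 f \<delta> \<in> Exts C X0 ?A1" using f(2,3,5) s by (simp add: push_def)
  then obtain B1 x1 y1 where t1: "s_triangle C ?A1 B1 X0 x1 y1 (push C X0 f \<delta>)" using C.Real_class[of X0 ?A1] s(12) C.Hom_Ob[OF fh] by blast
  note s1 = C.s_triangle_simps[OF t1]
  obtain b where b: "b \<in> Hom C B0 B1" "b \<cdot> x = x1 \<cdot> f" "y = y1 \<cdot> b"
    and cone: "\<And>P i1 i2 p1 p2. biproduct C B0 ?A1 P i1 i2 p1 p2 ==>
             s_triangle C A0 P B1 (Add C (i1 \<cdot> x) (i2 \<cdot> f)) (Add C (b \<cdot> p1) (Neg C x1 \<cdot> p2)) (pull C A0 y1 \<delta>)" using C.C3[OF t(1) fh t1] by blast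
  note bs = b(1)[unfolded Hom_iff]
  have qb: "q b \<star> q x = q x1 \<star> q f" "q y = q y1 \<star> q b" using q_square[OF b(2)] bs s s1 f b(3) by (auto simp: q_Cmp)
  have "ExtMap L \<gamma> (q s') (push L X a \<epsilon>) = push L X0 (q f) (ExtMap L \<gamma> \<alpha> \<epsilon>)" using n f(1-5) e o s by (simp add: push_def qf)
  also have "... = mu X0 ?A1 (push C X0 f \<delta>)" unfolding t(10) using mu_ExtMap'[of "Idt C X0" f \<delta> X0 A0 X0 ?A1] f(2,3,5) s by (simp add: push_def)
  finally have E: "ExtMap L \<gamma> (q s') (push L X a \<epsilon>) = mu X0 ?A1 (push C X0 f \<delta>)" .
  have "loc_tri C L q mu A' B1 X (q x1 \<star> q s') (\<gamma> \<star> q y1) (push L X a \<epsilon>)" unfolding loc_tri_def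
    apply (rule exI[of _ ?A1], rule exI[of _ B1], rule exI[of _ X0], rule exI[of _ x1], rule exI[of _ y1], rule exI[of _ "push C X0 f \<delta>"],
      rule exI[of _ "q s'"], rule exI[of _ "Idt L B1"], rule exI[of _ \<gamma>]) using f(1-5) t1 s1(4-12) n E by (simp add: Hom_iff)
  then have T1: "s_triangle L A' B1 X (q x1 \<star> q s') (\<gamma> \<star> q y1) (push L X a \<epsilon>)" using T' unfolding s_triangle_L by blast
  then have h1: "q x1 \<star> q s' \<in> Hom L A' B1" "\<gamma> \<star> q y1 \<in> Hom L B1 X"
    "seq_class L (q x1 \<star> q s') (\<gamma> \<star> q y1) = seq_class L \<xi>' \<eta>'" using h'(3) by (auto simp: s_triangle_def)
  have "(\<xi>', \<eta>') \<in> seq_class L (q x1 \<star> q s') (\<gamma> \<star> q y1)" unfolding h1(3) by (rule L.seq_class_self[OF h'(1,2)])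
  then obtain \<beta>' where \<beta>': "isomorphism L \<beta>'" "Dom L \<beta>' = B1" "\<xi>' = \<beta>' \<star> q x1 \<star> q s'" "\<eta>' = (\<gamma> \<star> q y1) \<star> inv_mor L \<beta>'"
    unfolding L.mem_seq_class[OF h1(1,2)] by blast
  note \<beta>m = L.isomorphism_Mor[OF \<beta>'(1)]
  have \<beta>c: "Cod L \<beta>' = B'" using \<beta>'(2) hs' \<beta>m s1 f(1,4) unfolding \<beta>'(3) by simp
  let ?b = "\<beta>' \<star> q b \<star> inv_mor L \<beta>"
  have bb: "?b \<in> Mor L" "Dom L ?b = B" "Cod L ?b = B'" using \<beta>m \<beta>c \<beta>'(2) n bs by auto
  have "?b \<star> \<xi> = \<beta>' \<star> (q b \<star> q x) \<star> \<alpha>" unfolding t(8) using \<beta>m \<beta>'(2) n bs s by simp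
  also have "... = \<beta>' \<star> q x1 \<star> (q f \<star> \<alpha>)" unfolding qb(1) using \<beta>m \<beta>'(2) n s1 f(2,3,5) by simp
  also have "... = \<xi>' \<star> a" unfolding qf \<beta>'(3) using \<beta>m \<beta>'(2) n s1 f(1,4) by simp
  finally have 1: "?b \<star> \<xi> = \<xi>' \<star> a" .
  have 2: "\<eta> = \<eta>' \<star> ?b" unfolding t(9) \<beta>'(4) qb(2) using \<beta>m \<beta>'(1,2) n s1 bs by simp
  have 3: "s_triangle L A P B' (Add L (i1 \<star> \<xi>) (i2 \<star> a)) (Add L (?b \<star> p1) (Neg L \<xi>' \<star> p2)) (pull L A \<eta>' \<epsilon>)"
    if bp: "biproduct L B A' P i1 i2 p1 p2" for P i1 i2 p1 p2
  proof -
    obtain R j1 j2 r1 r2 where R: "biproduct C B0 ?A1 R j1 j2 r1 r2" using C.ex_biproduct[of B0 ?A1] s f(1) by auto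
    note cn = cone[OF R]
    note qR = q_biproduct[OF R]
    note bp1 = L.biproduct_simps[OF bp] and bp2 = L.biproduct_simps[OF qR] and bpC = C.biproduct_simps[OF R]
    have iso_s: "isomorphism L (inv_mor L (q s'))" "inv_mor L (q s') \<in> Hom L ?A1 A'" using f(1,4) by (auto simp: Hom_iff)
    (* compares the image of the biproduct in C with the given biproduct in L *)
    let ?t = "Add L (i1 \<star> \<beta> \<star> q r1) (i2 \<star> inv_mor L (q s') \<star> q r2)"
    note ti = L.biproduct_iso[OF qR bp t(4,5) iso_s]
    have tinv: "inv_mor L ?t = Add L (q j1 \<star> inv_mor L \<beta> \<star> p1) (q j2 \<star> q s' \<star> p2)" using ti(2) f(1) by simp
    have th: "?t \<in> Hom L R P" using bp1 bpC(1-15) n f(1,4) by (simp add: Hom_iff)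
    have e1: "Add L (i1 \<star> \<xi>) (i2 \<star> a) = ?t \<star> q (Add C (j1 \<cdot> x) (j2 \<cdot> f)) \<star> \<alpha>"
    proof -
      have "?t \<star> q (Add C (j1 \<cdot> x) (j2 \<cdot> f)) \<star> \<alpha>
        = Add L (i1 \<star> \<beta> \<star> q x \<star> \<alpha>) (i2 \<star> inv_mor L (q s') \<star> (q f \<star> \<alpha>))" using bp1(1-15) bpC(1-15) bp2 n f(1-5) s o by (simp add: q_Add q_Cmp)
      also have "... = Add L (i1 \<star> \<xi>) (i2 \<star> a)" unfolding qf t(8) using n f(1,4) by simp
      finally show ?thesis ..
    qed
    have e2: "Add L (?b \<star> p1) (Neg L \<xi>' \<star> p2) = \<beta>' \<star> q (Add C (b \<cdot> r1) (Neg C x1 \<cdot> r2)) \<star> inv_mor L ?t"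
      unfolding tinv \<beta>'(3) using bp1(1-15) bpC(1-15) bp2 n f(1-5) s s1 bs \<beta>m \<beta>'(2) by (simp add: q_Add q_Cmp q_Neg)
    have "ExtMap L \<beta>' \<alpha> (pull L A \<eta>' \<epsilon>) = ExtMap L (\<gamma> \<star> q y1) \<alpha> \<epsilon>" unfolding \<beta>'(4) using \<beta>'(1,2) \<beta>m n s1 e o by (simp add: pull_def)
    also have "... = pull L A0 (q y1) (ExtMap L \<gamma> \<alpha> \<epsilon>)" using n s1 e o s by (simp add: pull_def)
    also have "... = mu B1 A0 (pull C A0 y1 \<delta>)" unfolding t(10) using mu_ExtMap'[of y1 "Idt C A0" \<delta> X0 A0 B1 A0] s s1(7-12) by (simp add: pull_def)
    finally have e3: "ExtMap L \<beta>' \<alpha> (pull L A \<eta>' \<epsilon>) = mu B1 A0 (pull C A0 y1 \<delta>)" .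
    have "loc_tri C L q mu A P B' (Add L (i1 \<star> \<xi>) (i2 \<star> a)) (Add L (?b \<star> p1) (Neg L \<xi>' \<star> p2)) (pull L A \<eta>' \<epsilon>)" unfolding loc_tri_def
      by (rule exI[of _ A0], rule exI[of _ R], rule exI[of _ B1], rule exI[of _ "Add C (j1 \<cdot> x) (j2 \<cdot> f)"],
          rule exI[of _ "Add C (b \<cdot> r1) (Neg C x1 \<cdot> r2)"], rule exI[of _ "pull C A0 y1 \<delta>"],
          rule exI[of _ \<alpha>], rule exI[of _ ?t], rule exI[of _ \<beta>'], intro conjI cn t(2,3) ti(1) th e1 e2 e3 \<beta>'(1))
        (use \<beta>m \<beta>'(2) \<beta>c in \<open>simp add: Hom_iff\<close>)
    moreover have "pull L A \<eta>' \<epsilon> \<in> Exts L B' A" using hs' e o by (simp add: pull_def)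
    ultimately show ?thesis unfolding s_triangle_L using o L.Hom_Ob[OF h'(1)] by simp
  qed
  show ?thesis using 1 2 3 bb by (intro bexI[of _ ?b] conjI allI impI) (auto simp only: Hom_iff)
qed

lemma half_weakly_extriangulated_L:
  assumes co: "\<And>A B X \<xi> \<eta> \<epsilon>. s_triangle L A B X \<xi> \<eta> \<epsilon> ==> cov_exact (opposite L) X B A \<eta> \<xi> \<epsilon>"
  shows "half_weakly_extriangulated L"
proof unfold_locales
  fix X A \<epsilon> assume "X \<in> Ob L" "A \<in> Ob L" "\<epsilon> \<in> Exts L X A"
  then show "\<exists>B \<xi> \<eta>. s_triangle L A B X \<xi> \<eta> \<epsilon>" using ex_s_triangle_fraction[of \<epsilon> X A] by auto
next
  fix A B X \<xi> \<eta> \<epsilon> V assume t: "s_triangle L A B X \<xi> \<eta> \<epsilon>" "V \<in> Ob L"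
  then have "\<xi> \<in> Hom L A B" "\<eta> \<in> Hom L B X" "\<epsilon> \<in> Exts L X A" by (auto simp: s_triangle_def)
  from L.cov_exact_iff_C1[OF this] s_triangle_L_exact[OF t(1)] t(2)
  show "(\<lambda>f. \<xi> \<star> f) ` Hom L V A = kernel (hom_grp L V B) (hom_grp L V X) (\<lambda>f. \<eta> \<star> f) \<and>
        (\<lambda>f. \<eta> \<star> f) ` Hom L V B = kernel (hom_grp L V X) (Ext L V A) (\<lambda>f. pull L A f \<epsilon>)" by blast
next
  fix A Z assume "A \<in> Ob L" "zero_object L Z"
  then show "Real L Z A \<one>\<^bsub>Ext L Z A\<^esub> = seq_class L (Idt L A) (Zero L A Z)" by (rule L_C2[OF _ _ co])
qed (rule L_C3)

lemma s_triangle_L_coexact: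
  "s_triangle L A B X \<xi> \<eta> \<epsilon> ==> cov_exact (opposite L) X B A \<eta> \<xi> \<epsilon>" using fraction_ext.s_triangle_L_exact[OF opposite_fraction_ext, of X B A \<eta> \<xi> \<epsilon>]
  by (simp add: s_triangle_opposite L.category_axioms)

theorem weakly_extriangulated_L: "weakly_extriangulated L"
proof (rule weakly_extriangulated_if_half)
  show "half_weakly_extriangulated L" by (rule half_weakly_extriangulated_L[OF s_triangle_L_coexact])
  show "half_weakly_extriangulated (opposite L)" by (rule fraction_ext.half_weakly_extriangulated_L[OF opposite_fraction_ext])
      (simp add: s_triangle_opposite L.category_axioms s_triangle_L_exact)
qed

section \<open>Composition of localized inflations\<close>

lemma inflation_precompose_iso:
  assumes "inflation L \<xi>" "isomorphism L \<beta>" "Cod L \<beta> = Dom L \<xi>"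
  shows "inflation L (\<xi> \<star> \<beta>)"
proof -
  obtain A B X \<eta> \<epsilon> where t: "s_triangle L A B X \<xi> \<eta> \<epsilon>" using assms(1) unfolding inflation_def by blast
  note s = weakly_extriangulated.s_triangle_simps[OF weakly_extriangulated_L t]
  note \<beta>m = L.isomorphism_Mor[OF assms(2)]
  have "Dom L \<beta> \<in> Ob C" using L.Ob_simps(1)[OF \<beta>m] by simp
  have "s_triangle L (Dom L \<beta>) B X (\<xi> \<star> \<beta>) \<eta> (push L X (inv_mor L \<beta>) \<epsilon>)"
    by (rule s_triangle_transport[OF weakly_extriangulated_L t, of "inv_mor L \<beta>" "Dom L \<beta>" "Idt L B" B "Idt L X" X])
      (use assms(2,3) \<beta>m s \<open>Dom L \<beta> \<in> Ob C\<close> in \<open>simp_all add: Hom_iff push_def pull_def\<close>)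
  then show ?thesis unfolding inflation_def by blast
qed

lemma inflation_fraction:
  assumes "inflation L \<xi>"
  shows "\<exists>x s \<beta>. inflation C x \<and> s \<in> W \<and> isomorphism L \<beta> \<and> Dom C s = Dom L \<xi> \<and> Cod C s = Dom C x \<and> Cod C x = Dom L \<beta> \<and>
     Cod L \<beta> = Cod L \<xi> \<and> \<xi> = \<beta> \<star> q x \<star> q s"
proof -
  obtain A B X \<eta> \<epsilon> where t: "s_triangle L A B X \<xi> \<eta> \<epsilon>" using assms(1) unfolding inflation_def by blast
  note h = weakly_extriangulated.s_triangle_simps[OF weakly_extriangulated_L t]
  obtain s u B' x y \<delta> where *: "s \<in> W" "u \<in> W" "s_triangle C (Cod C s) B' (Dom C u) x y \<delta>" "Dom C s = A" "Cod C u = X"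
    "s_triangle L A B' X (q x \<star> q s) (q u \<star> q y) \<epsilon>" using ex_s_triangle_fraction[OF h(3)] h by auto
  note h' = weakly_extriangulated.s_triangle_simps[OF weakly_extriangulated_L *(6)]
  note sx = C.s_triangle_simps[OF *(3)]
  have "(\<xi>, \<eta>) \<in> seq_class L (q x \<star> q s) (q u \<star> q y)" using L.seq_class_self[OF h(1,2)] t *(6) by (simp add: s_triangle_def)
  then obtain \<beta> where \<beta>: "isomorphism L \<beta>" "Dom L \<beta> = B'" "\<xi> = \<beta> \<star> q x \<star> q s" unfolding L.mem_seq_class[OF h'(1,2)] by blast
  have d: "Dom L \<xi> = A" using h by simp
  have "Cod L \<xi> = Cod L \<beta>" unfolding \<beta>(3) using \<beta>(2) L.isomorphism_Mor[OF \<beta>(1)] sx *(1) by simp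
  moreover have "inflation C x" using *(3) unfolding inflation_def by blast
  ultimately show ?thesis using *(1,4) \<beta> sx d by (intro exI[of _ x] exI[of _ s] exI[of _ \<beta>]) simp
qed

lemma inflation_iso_q:
  assumes "inflation C x" "isomorphism L \<phi>" "isomorphism L \<psi>" "Cod L \<phi> = Dom C x" "Dom L \<psi> = Cod C x"
  shows "inflation L (\<psi> \<star> q x \<star> \<phi>)"
proof -
  obtain A B X y \<delta> where t: "s_triangle C A B X x y \<delta>" using assms(1) unfolding inflation_def by blast
  note s = C.s_triangle_simps[OF t]
  note m = L.isomorphism_Mor[OF assms(2)] L.isomorphism_Mor[OF assms(3)]
  have "loc_tri C L q mu (Dom L \<phi>) (Cod L \<psi>) X (\<psi> \<star> q x \<star> \<phi>) (Idt L X \<star> q y \<star> inv_mor L \<psi>) (push L X (inv_mor L \<phi>) (mu X A \<delta>))" unfolding loc_tri_def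
    apply (rule exI[of _ A], rule exI[of _ B], rule exI[of _ X], rule exI[of _ x], rule exI[of _ y], rule exI[of _ \<delta>],
      rule exI[of _ \<phi>], rule exI[of _ \<psi>], rule exI[of _ "Idt L X"]) using t s assms m by (simp add: Hom_iff push_def)
  moreover have "push L X (inv_mor L \<phi>) (mu X A \<delta>) \<in> Exts L X (Dom L \<phi>)" using s assms m by (simp add: push_def)
  moreover have "Dom L \<phi> \<in> Ob C" using L.Ob_simps(1)[OF m(1)] by simp
  ultimately have "s_triangle L (Dom L \<phi>) (Cod L \<psi>) X (\<psi> \<star> q x \<star> \<phi>) (Idt L X \<star> q y \<star> inv_mor L \<psi>) (push L X (inv_mor L \<phi>) (mu X A \<delta>))"
    unfolding s_triangle_L using s by blast
  then show ?thesis unfolding inflation_def by blast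
qed

text \<open>Up to isomorphisms of \<open>L\<close> on the outside, two localized inflations are \<open>q x\<close> and \<open>q x' q s\<close>: the isomorphism
  between them is absorbed by the second one, which is then written with a denominator. Hence the hypothesis about
  composites with one \<open>s \<in> W\<close> in the middle suffices.\<close>

lemma inflation_L_comp:
  assumes MR4: "\<And>x x' s. inflation C x ==> inflation C x' ==> s \<in> W ==> Cod C x = Dom C s ==> Cod C s = Dom C x' ==>
      \<exists>z \<phi> \<psi>. inflation C z \<and> isomorphism L \<phi> \<and> isomorphism L \<psi> \<and> Cod L \<phi> = Dom C z \<and> Dom L \<psi> = Cod C z \<and>
        q x' \<star> q s \<star> q x = \<psi> \<star> q z \<star> \<phi>"
    and f: "inflation L \<xi>" and g: "inflation L \<xi>'" and fg: "Cod L \<xi> = Dom L \<xi>'"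
  shows "inflation L (\<xi>' \<star> \<xi>)"
proof -
  obtain x s \<beta> where x: "inflation C x" "s \<in> W" "isomorphism L \<beta>" "Dom C s = Dom L \<xi>" "Cod C s = Dom C x" "Cod C x = Dom L \<beta>"
    "Cod L \<beta> = Cod L \<xi>" "\<xi> = \<beta> \<star> q x \<star> q s" using inflation_fraction[OF f] by blast
  have i: "inflation L (\<xi>' \<star> \<beta>)" using inflation_precompose_iso[OF g x(3)] x(7) fg by simp
  have \<xi>': "\<xi>' \<in> Mor L" using g by (auto simp: inflation_def s_triangle_def Hom_iff)
  note \<beta>m = L.isomorphism_Mor[OF x(3)]
  obtain x' s' \<beta>' where x': "inflation C x'" "s' \<in> W" "isomorphism L \<beta>'" "Dom C s' = Dom L (\<xi>' \<star> \<beta>)" "Cod C s' = Dom C x'" "Cod C x' = Dom L \<beta>'"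
    "\<xi>' \<star> \<beta> = \<beta>' \<star> q x' \<star> q s'" using inflation_fraction[OF i] by blast
  have "Dom C s' = Cod C x" using x'(4) x(6,7) fg \<xi>' \<beta>m by simp
  then obtain z \<phi> \<psi> where z: "inflation C z" "isomorphism L \<phi>" "isomorphism L \<psi>" "Cod L \<phi> = Dom C z" "Dom L \<psi> = Cod C z"
        "q x' \<star> q s' \<star> q x = \<psi> \<star> q z \<star> \<phi>" using MR4[OF x(1) x'(1,2)] x'(5) by metis
  have xm: "x \<in> Mor C" "x' \<in> Mor C" "z \<in> Mor C" using x(1) x'(1) z(1) by (auto simp: inflation_def s_triangle_def Hom_iff)
  note m = xm L.isomorphism_Mor[OF x'(3)] L.isomorphism_Mor[OF z(2)] L.isomorphism_Mor[OF z(3)] \<beta>m \<xi>' \<open>Dom C s' = Cod C x\<close>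
  have "Dom L (q x' \<star> q s' \<star> q x) = Dom L \<phi>" "Cod L (q x' \<star> q s' \<star> q x) = Cod L \<psi>" unfolding z(6) using m z(4,5) by simp_all
  then have zd: "Dom L \<phi> = Dom C x" "Cod L \<psi> = Cod C x'" using m x'(2,5) by simp_all
  have "\<xi>' \<star> \<xi> = (\<xi>' \<star> \<beta>) \<star> q x \<star> q s" unfolding x(8) using m x(2,5,6,7) fg by simp
  also have "... = \<beta>' \<star> (q x' \<star> q s' \<star> q x) \<star> q s" unfolding x'(7) using m x'(2,5,6) x(2,5) by simp
  also have "... = (\<beta>' \<star> \<psi>) \<star> q z \<star> (\<phi> \<star> q s)" unfolding z(6) using m z(4,5) zd x'(6) x(2,5) by simp
  finally show ?thesis using inflation_iso_q[OF z(1), of "\<phi> \<star> q s" "\<beta>' \<star> \<psi>"] m z(2-5) zd x'(3,6) x(2,5) by (simp add: L.isomorphism_Cmp)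
qed

end

section \<open>Ideals of an additive category\<close>

locale additive_ideal = additive_category C
  for C :: "('o, 'm, 'z) add_cat_scheme" (structure) +
  fixes I :: "'m set"
  assumes I_Mor: "f \<in> I ==> f \<in> Mor C"
    and I_Zero: "X \<in> Ob C ==> Y \<in> Ob C ==> Zero C X Y \<in> I"
    and I_Add: "f \<in> I ==> g \<in> I ==> Dom C f = Dom C g ==> Cod C f = Cod C g ==> Add C f g \<in> I"
    and I_Neg: "f \<in> I ==> Neg C f \<in> I"
    and I_left: "f \<in> I ==> g \<in> Mor C ==> Cod C f = Dom C g ==> g \<cdot> f \<in> I"
    and I_right: "f \<in> Mor C ==> g \<in> I ==> Cod C f = Dom C g ==> g \<cdot> f \<in> I"
begin

definition eqv :: "'m => 'm => bool"
  where "eqv f g \<longleftrightarrow> f \<in> Mor C \<and> g \<in> Mor C \<and> Dom C f = Dom C g \<and> Cod C f = Cod C g \<and> Add C f (Neg C g) \<in> I"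

lemma eqv_refl: "f \<in> Mor C ==> eqv f f" by (simp add: eqv_def I_Zero)

lemma eqv_sym: "eqv f g ==> eqv g f"
proof -
  assume a: "eqv f g"
  then have h: "f \<in> Mor C" "g \<in> Mor C" "Dom C f = Dom C g" "Cod C f = Cod C g" "Add C f (Neg C g) \<in> I" by (auto simp: eqv_def)
  have "Neg C (Add C f (Neg C g)) = Add C g (Neg C f)" using h(1-4) Add_comm[of g "Neg C f"] by (simp add: Neg_Add)
  then show "eqv g f" using I_Neg[OF h(5)] h by (simp add: eqv_def)
qed

lemma eqv_trans: "eqv f g ==> eqv g h ==> eqv f h"
proof -
  assume a: "eqv f g" "eqv g h"
  then have s: "f \<in> Mor C" "g \<in> Mor C" "h \<in> Mor C" "Dom C f = Dom C g" "Cod C f = Cod C g" "Dom C g = Dom C h" "Cod C g = Cod C h"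
    "Add C f (Neg C g) \<in> I" "Add C g (Neg C h) \<in> I" by (auto simp: eqv_def)
  have "Add C (Add C f (Neg C g)) (Add C g (Neg C h)) = Add C (Add C (Add C f (Neg C g)) g) (Neg C h)"
    using s(1-7) Add_assoc[of "Add C f (Neg C g)" g "Neg C h"] by simp
  also have "... = Add C f (Neg C h)" using s(1-7) Add_Neg_cancel(1)[of f g] by simp
  finally have "Add C f (Neg C h) \<in> I" using I_Add[OF s(8,9)] s(1-7) by simp
  then show ?thesis using s by (simp add: eqv_def)
qed

lemma eqv_left: "eqv f g ==> h \<in> Mor C ==> Dom C h = Cod C f ==> eqv (h \<cdot> f) (h \<cdot> g)" unfolding eqv_def using I_left[of "Add C f (Neg C g)" h] by auto

lemma eqv_right: "eqv f g ==> h \<in> Mor C ==> Cod C h = Dom C f ==> eqv (f \<cdot> h) (g \<cdot> h)"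
  unfolding eqv_def using I_right[of h "Add C f (Neg C g)"] by auto

lemma eqv_Add_right: "eqv f g ==> h \<in> Mor C ==> Dom C h = Dom C f ==> Cod C h = Cod C f ==> eqv (Add C f h) (Add C g h)"
proof -
  assume a: "eqv f g" and h: "h \<in> Mor C" "Dom C h = Dom C f" "Cod C h = Cod C f"
  have s: "f \<in> Mor C" "g \<in> Mor C" "Dom C f = Dom C g" "Cod C f = Cod C g" "Add C f (Neg C g) \<in> I" using a by (auto simp: eqv_def)
  have "Add C (Add C f h) (Neg C (Add C g h)) = Add C (Add C f h) (Add C (Neg C g) (Neg C h))" using s(1-4) h by (simp add: Neg_Add)
  also have "... = Add C (Add C f (Neg C g)) (Add C h (Neg C h))" by (rule Add_Add_swap) (use s(1-4) h in \<open>auto simp: Hom_iff\<close>)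
  also have "... = Add C f (Neg C g)" using s(1-4) h by simp
  finally have e: "Add C (Add C f h) (Neg C (Add C g h)) = Add C f (Neg C g)" .
  show ?thesis unfolding eqv_def e using s h by simp
qed

end

section \<open>Calculus of fractions modulo an ideal\<close>

text \<open>The Ore and cancellation conditions for \<open>W\<close> modulo the ideal \<open>I\<close> of morphisms through null objects.
  The quotient category does not occur: all its equations are congruences in \<open>C\<close>.\<close>

locale ideal_calculus = C: weakly_extriangulated C
  for C :: "('o, 'm, 'e) ext_cat" (structure) +
  fixes W I :: "'m set"
  assumes W_Mor [simp]: "s \<in> W ==> s \<in> Mor C"
    and W_Idt [simp]: "X \<in> Ob C ==> Idt C X \<in> W"
    and W_Cmp: "s \<in> W ==> t \<in> W ==> Cod C s = Dom C t ==> t \<cdot> s \<in> W"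
    and W_left: "f \<in> W ==> g \<in> Mor C ==> Cod C f = Dom C g ==> g \<cdot> f \<in> W ==> g \<in> W"
    and W_right: "f \<in> Mor C ==> g \<in> W ==> Cod C f = Dom C g ==> g \<cdot> f \<in> W ==> f \<in> W"
    and W_ideal: "f \<in> W ==> g \<in> Mor C ==> Dom C f = Dom C g ==> Cod C f = Cod C g ==> Add C f (Neg C g) \<in> I ==> g \<in> W"
    and I_Mor: "f \<in> I ==> f \<in> Mor C"
    and I_Zero: "X \<in> Ob C ==> Y \<in> Ob C ==> Zero C X Y \<in> I"
    and I_Add: "f \<in> I ==> g \<in> I ==> Dom C f = Dom C g ==> Cod C f = Cod C g ==> Add C f g \<in> I"
    and I_Neg: "f \<in> I ==> Neg C f \<in> I"
    and I_left: "f \<in> I ==> g \<in> Mor C ==> Cod C f = Dom C g ==> g \<cdot> f \<in> I"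
    and I_right: "f \<in> Mor C ==> g \<in> I ==> Cod C f = Dom C g ==> g \<cdot> f \<in> I"
    and Ore_left: "s \<in> W ==> f \<in> Mor C ==> Dom C s = Dom C f ==> \<exists>s'\<in>W. \<exists>f'\<in>Mor C. Dom C s' = Cod C f \<and>
       Dom C f' = Cod C s \<and> Cod C s' = Cod C f' \<and> Add C (s' \<cdot> f) (Neg C (f' \<cdot> s)) \<in> I"
    and Ore_right: "s \<in> W ==> f \<in> Mor C ==> Cod C s = Cod C f ==> \<exists>s'\<in>W. \<exists>f'\<in>Mor C. Cod C s' = Dom C f \<and>
       Cod C f' = Dom C s \<and> Dom C s' = Dom C f' \<and> Add C (f \<cdot> s') (Neg C (s \<cdot> f')) \<in> I"
    and cancel_left: "f \<in> Mor C ==> s \<in> W ==> Cod C s = Dom C f ==> f \<cdot> s \<in> I ==> \<exists>t\<in>W. Dom C t = Cod C f \<and> t \<cdot> f \<in> I"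
    and cancel_right: "f \<in> Mor C ==> t \<in> W ==> Dom C t = Cod C f ==> t \<cdot> f \<in> I ==> \<exists>s\<in>W. Cod C s = Dom C f \<and> f \<cdot> s \<in> I"
    and I_null: "f \<in> I ==> \<exists>N Z. \<exists>u\<in>Hom C (Dom C f) N. \<exists>v\<in>Hom C N (Cod C f).
       f = v \<cdot> u \<and> zero_object C Z \<and> Zero C N Z \<in> W \<and> Zero C Z N \<in> W"
    and middle: "s_triangle C A B X x y \<delta> ==> s_triangle C A' B' X' x' y' \<delta>' ==> a \<in> W ==> c \<in> W ==>
       a \<in> Hom C A A' ==> c \<in> Hom C X X' ==> push C X a \<delta> = pull C A' c \<delta>' ==>
       \<exists>b\<in>W. b \<in> Hom C B B' \<and> Add C (b \<cdot> x) (Neg C (x' \<cdot> a)) \<in> I \<and> Add C (c \<cdot> y) (Neg C (y' \<cdot> b)) \<in> I"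
begin

lemma opposite_ideal_calculus: "ideal_calculus (opposite C) W I"
proof -
  let ?O = "opposite C"
  interpret o: weakly_extriangulated "opposite C" by (rule weakly_extriangulated_opposite) unfold_locales
  show ?thesis
  proof (rule ideal_calculus.intro[OF o.weakly_extriangulated_axioms], rule ideal_calculus_axioms.intro)
    fix f assume "f \<in> I"
    then show "\<exists>N Z. \<exists>u\<in>Hom ?O (Dom ?O f) N. \<exists>v\<in>Hom ?O N (Cod ?O f).
       f = v \<cdot>\<^bsub>?O\<^esub> u \<and> zero_object ?O Z \<and> Zero ?O N Z \<in> W \<and> Zero ?O Z N \<in> W" using I_null[of f] by simp blast
  next
    fix A B X x y \<delta> A' B' X' x' y' \<delta>' a c
    assume h: "s_triangle ?O A B X x y \<delta>" "s_triangle ?O A' B' X' x' y' \<delta>'" "a \<in> W" "c \<in> W"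
      "a \<in> Hom ?O A A'" "c \<in> Hom ?O X X'" "push ?O X a \<delta> = pull ?O A' c \<delta>'"
    then have h': "s_triangle C X B A y x \<delta>" "s_triangle C X' B' A' y' x' \<delta>'" by (simp_all add: s_triangle_opposite C.category_axioms)
    note s = C.s_triangle_simps[OF h'(1)] C.s_triangle_simps[OF h'(2)]
    obtain b where b: "b \<in> W" "b \<in> Hom C B' B" "Add C (b \<cdot> y') (Neg C (y \<cdot> c)) \<in> I" "Add C (a \<cdot> x') (Neg C (x \<cdot> b)) \<in> I"
      using middle[OF h'(2,1), of c a] h(3-7) by auto
    have ac: "a \<in> Mor C" "Dom C a = A'" "Cod C a = A" "c \<in> Mor C" "Dom C c = X'" "Cod C c = X" "b \<in> Mor C" "Dom C b = B'" "Cod C b = B"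
      using h(5,6) b(2) by (auto simp: Hom_iff)
    have swap: "Add C g (Neg C f) \<in> I" if "Add C f (Neg C g) \<in> I" "f \<in> Hom C U V" "g \<in> Hom C U V" for f g U V
    proof -
      have "Neg C (Add C f (Neg C g)) = Add C g (Neg C f)" using that(2,3) C.Add_comm[of g "Neg C f"] by (simp add: Hom_iff C.Neg_Add)
      then show ?thesis using I_Neg[OF that(1)] by simp
    qed
    have 1: "Add C (x \<cdot> b) (Neg C (a \<cdot> x')) \<in> I" by (rule swap[OF b(4), of B' A]) (use s ac in \<open>auto simp: Hom_iff\<close>)
    have 2: "Add C (y \<cdot> c) (Neg C (b \<cdot> y')) \<in> I" by (rule swap[OF b(3), of X' B]) (use s ac in \<open>auto simp: Hom_iff\<close>)
    show "\<exists>b\<in>W. b \<in> Hom ?O B B' \<and> Add ?O (b \<cdot>\<^bsub>?O\<^esub> x) (Neg ?O (x' \<cdot>\<^bsub>?O\<^esub> a)) \<in> I \<and>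
      Add ?O (c \<cdot>\<^bsub>?O\<^esub> y) (Neg ?O (y' \<cdot>\<^bsub>?O\<^esub> b)) \<in> I" by (rule bexI[OF _ b(1)]) (use b(2) 1 2 in simp)
  next
    fix s f assume "s \<in> W" "f \<in> Mor ?O" "Dom ?O s = Dom ?O f"
    then show "\<exists>s'\<in>W. \<exists>f'\<in>Mor ?O. Dom ?O s' = Cod ?O f \<and>
       Dom ?O f' = Cod ?O s \<and> Cod ?O s' = Cod ?O f' \<and>
       Add ?O (s' \<cdot>\<^bsub>?O\<^esub> f) (Neg ?O (f' \<cdot>\<^bsub>?O\<^esub> s)) \<in> I" using Ore_right[of s f] by simp
  next
    fix s f assume "s \<in> W" "f \<in> Mor ?O" "Cod ?O s = Cod ?O f"
    then show "\<exists>s'\<in>W. \<exists>f'\<in>Mor ?O. Cod ?O s' = Dom ?O f \<and>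
       Cod ?O f' = Dom ?O s \<and> Dom ?O s' = Dom ?O f' \<and>
       Add ?O (f \<cdot>\<^bsub>?O\<^esub> s') (Neg ?O (s \<cdot>\<^bsub>?O\<^esub> f')) \<in> I" using Ore_left[of s f] by simp
  next
    fix f s assume "f \<in> Mor ?O" "s \<in> W" "Cod ?O s = Dom ?O f" "f \<cdot>\<^bsub>?O\<^esub> s \<in> I"
    then show "\<exists>t\<in>W. Dom ?O t = Cod ?O f \<and> t \<cdot>\<^bsub>?O\<^esub> f \<in> I" using cancel_right[of f s] by simp
  next
    fix f s assume "f \<in> Mor ?O" "s \<in> W" "Dom ?O s = Cod ?O f" "s \<cdot>\<^bsub>?O\<^esub> f \<in> I"
    then show "\<exists>t\<in>W. Cod ?O t = Dom ?O f \<and> f \<cdot>\<^bsub>?O\<^esub> t \<in> I" using cancel_left[of f s] by simp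
  next
    fix f g assume "f \<in> W" "g \<in> Mor ?O" "Cod ?O f = Dom ?O g" "g \<cdot>\<^bsub>?O\<^esub> f \<in> W"
    then show "g \<in> W" using W_right[of g f] by simp
  next
    fix f g assume "f \<in> Mor ?O" "g \<in> W" "Cod ?O f = Dom ?O g" "g \<cdot>\<^bsub>?O\<^esub> f \<in> W"
    then show "f \<in> W" using W_left[of g f] by simp
  next
    fix f g assume "f \<in> W" "g \<in> Mor ?O" "Dom ?O f = Dom ?O g" "Cod ?O f = Cod ?O g"
      "Add ?O f (Neg ?O g) \<in> I"
    then show "g \<in> W" using W_ideal[of f g] by simp
  qed (auto simp: W_Cmp I_Mor I_Zero I_Add I_Neg I_left I_right)
qed

text \<open>The morphisms that vanish in the localization. They form an ideal, and its congruence \<open>sim\<close> will turn out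
  to be equality after applying \<open>q\<close>; modulo \<open>sim\<close>, members of \<open>W\<close> can be cancelled on both sides.\<close>

definition J :: "'m set"
  where "J = {f \<in> Mor C. \<exists>t\<in>W. Dom C t = Cod C f \<and> t \<cdot> f \<in> I}"

lemma J_iff_right: "f \<in> J \<longleftrightarrow> f \<in> Mor C \<and> (\<exists>s\<in>W. Cod C s = Dom C f \<and> f \<cdot> s \<in> I)" using cancel_left[of f] cancel_right[of f] unfolding J_def by blast

lemma J_Mor: "f \<in> J ==> f \<in> Mor C" by (simp add: J_def)

lemma I_J: "f \<in> I ==> f \<in> J" unfolding J_def using I_Mor[of f] by (auto intro!: bexI[of _ "Idt C (Cod C f)"])

lemma J_right: "f \<in> Mor C ==> g \<in> J ==> Cod C f = Dom C g ==> g \<cdot> f \<in> J" unfolding J_def using I_right[of f] by (auto 0 3 simp flip: C.Cmp_assoc_simp)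

lemma J_left: "f \<in> J ==> g \<in> Mor C ==> Cod C f = Dom C g ==> g \<cdot> f \<in> J" unfolding J_iff_right using I_left[of _ g] by (auto 0 3)

lemma J_W_left: "f \<in> Mor C ==> t \<in> W ==> Cod C f = Dom C t ==> t \<cdot> f \<in> J ==> f \<in> J"
proof -
  assume h: "f \<in> Mor C" "t \<in> W" "Cod C f = Dom C t" "t \<cdot> f \<in> J"
  then obtain u where u: "u \<in> W" "Dom C u = Cod C t" "u \<cdot> t \<cdot> f \<in> I" unfolding J_def by auto
  then have "u \<cdot> t \<in> W" "(u \<cdot> t) \<cdot> f \<in> I" using h by (auto intro!: W_Cmp)
  then show ?thesis unfolding J_def using h u(1,2) by (auto intro!: bexI[of _ "u \<cdot> t"])
qed

lemma J_W_right: "f \<in> Mor C ==> s \<in> W ==> Cod C s = Dom C f ==> f \<cdot> s \<in> J ==> f \<in> J"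
proof -
  assume h: "f \<in> Mor C" "s \<in> W" "Cod C s = Dom C f" "f \<cdot> s \<in> J"
  then obtain u where u: "u \<in> W" "Cod C u = Dom C s" "(f \<cdot> s) \<cdot> u \<in> I" unfolding J_iff_right by auto
  then have "s \<cdot> u \<in> W" "f \<cdot> s \<cdot> u \<in> I" using h by (auto intro!: W_Cmp)
  then show ?thesis unfolding J_iff_right using h u(1,2) by (auto intro!: bexI[of _ "s \<cdot> u"])
qed

lemma J_Neg: "f \<in> J ==> Neg C f \<in> J"
proof -
  assume "f \<in> J"
  then obtain t where t: "f \<in> Mor C" "t \<in> W" "Dom C t = Cod C f" "t \<cdot> f \<in> I" unfolding J_def by blast
  then have "t \<cdot> Neg C f \<in> I" using I_Neg[OF t(4)] by simp
  then show ?thesis unfolding J_def using t by auto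
qed

lemma J_Add:
  assumes f: "f \<in> J" and g: "g \<in> J" and p: "Dom C f = Dom C g" "Cod C f = Cod C g"
  shows "Add C f g \<in> J"
proof -
  obtain t where t: "f \<in> Mor C" "t \<in> W" "Dom C t = Cod C f" "t \<cdot> f \<in> I" using f unfolding J_def by blast
  obtain t' where t': "g \<in> Mor C" "t' \<in> W" "Dom C t' = Cod C g" "t' \<cdot> g \<in> I" using g unfolding J_def by blast
  obtain u v where u: "u \<in> W" "v \<in> Mor C" "Dom C u = Cod C t" "Dom C v = Cod C t'" "Cod C u = Cod C v"
    "Add C (u \<cdot> t) (Neg C (v \<cdot> t')) \<in> I" using Ore_left[of t' t] t t' p by auto
  have 1: "u \<cdot> t \<cdot> f \<in> I" using I_left[OF t(4), of u] t u by simp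
  have 2: "v \<cdot> t' \<cdot> g \<in> I" using I_left[OF t'(4), of v] t' u by simp
  let ?d = "Add C (u \<cdot> t) (Neg C (v \<cdot> t'))"
  have "?d \<cdot> g \<in> I" by (rule I_right) (use u t t' p in auto)
  then have 3: "Add C (?d \<cdot> g) (v \<cdot> t' \<cdot> g) \<in> I" by (rule I_Add[OF _ 2]) (use u(1-5) t t' p in auto)
  have "Add C (?d \<cdot> g) (v \<cdot> t' \<cdot> g) = u \<cdot> t \<cdot> g" using C.Add_Neg_cancel(1)[of "u \<cdot> t \<cdot> g" "v \<cdot> t' \<cdot> g"] u(1-5) t t' p by simp
  then have "u \<cdot> t \<cdot> g \<in> I" using 3 by simp
  then have "Add C (u \<cdot> t \<cdot> f) (u \<cdot> t \<cdot> g) \<in> I" by (rule I_Add[OF 1]) (use u(1-5) t t' p in auto)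
  moreover have "(u \<cdot> t) \<cdot> Add C f g = Add C (u \<cdot> t \<cdot> f) (u \<cdot> t \<cdot> g)" using u(1-5) t t' p by simp
  moreover have "u \<cdot> t \<in> W" using u t by (intro W_Cmp) auto
  ultimately show ?thesis unfolding J_def using u(1-5) t t' p by (auto intro!: bexI[of _ "u \<cdot> t"])
qed

sublocale J: additive_ideal C J by unfold_locales (auto simp: J_Mor J_Neg J_Add J_left J_right I_J I_Zero)

abbreviation sim :: "'m => 'm => bool"
  where "sim \<equiv> J.eqv"

lemmas sim_def = J.eqv_def
lemmas sim_refl = J.eqv_refl
lemmas sim_sym = J.eqv_sym
lemmas sim_trans = J.eqv_trans
lemmas sim_left = J.eqv_left
lemmas sim_right = J.eqv_right
lemmas sim_Add_right = J.eqv_Add_right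

lemma sim_cancel_left: "sim (t \<cdot> f) (t \<cdot> g) ==> t \<in> W ==> f \<in> Mor C ==> g \<in> Mor C ==> Dom C f = Dom C g
   ==> Cod C f = Dom C t ==> Cod C g = Dom C t ==> sim f g"
proof -
  assume a: "sim (t \<cdot> f) (t \<cdot> g)" and h: "t \<in> W" "f \<in> Mor C" "g \<in> Mor C" "Dom C f = Dom C g" "Cod C f = Dom C t" "Cod C g = Dom C t"
  have "t \<cdot> Add C f (Neg C g) = Add C (t \<cdot> f) (Neg C (t \<cdot> g))" using h by simp
  then have "t \<cdot> Add C f (Neg C g) \<in> J" using a by (simp add: sim_def)
  then have "Add C f (Neg C g) \<in> J" by (rule J_W_left[rotated 3]) (use h in simp_all)
  then show "sim f g" using h by (simp add: sim_def)
qed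

lemma sim_cancel_right: "sim (f \<cdot> t) (g \<cdot> t) ==> t \<in> W ==> f \<in> Mor C ==> g \<in> Mor C ==> Cod C f = Cod C g
   ==> Dom C f = Cod C t ==> Dom C g = Cod C t ==> sim f g"
proof -
  assume a: "sim (f \<cdot> t) (g \<cdot> t)" and h: "t \<in> W" "f \<in> Mor C" "g \<in> Mor C" "Cod C f = Cod C g" "Dom C f = Cod C t" "Dom C g = Cod C t"
  have "Add C f (Neg C g) \<cdot> t = Add C (f \<cdot> t) (Neg C (g \<cdot> t))" using h by simp
  then have "Add C f (Neg C g) \<cdot> t \<in> J" using a by (simp add: sim_def)
  then have "Add C f (Neg C g) \<in> J" by (rule J_W_right[rotated 3]) (use h in simp_all)
  then show "sim f g" using h by (simp add: sim_def)
qed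

lemma W_sim: "f \<in> W ==> sim f g ==> g \<in> W"
proof -
  assume f: "f \<in> W" and g: "sim f g"
  have s: "f \<in> Mor C" "g \<in> Mor C" "Dom C f = Dom C g" "Cod C f = Cod C g" "Add C f (Neg C g) \<in> J" using g by (auto simp: sim_def)
  then obtain t where t: "t \<in> W" "Dom C t = Cod C f" "t \<cdot> Add C f (Neg C g) \<in> I" unfolding J_def by auto
  have "t \<cdot> g \<in> W" by (rule W_ideal[of "t \<cdot> f"]) (use s(1-4) t f W_Cmp[OF f t(1)] in auto)
  then show "g \<in> W" using W_right[of g t] s t by simp
qed

lemma sim_ideal: "f \<in> Mor C ==> g \<in> Mor C ==> Dom C f = Dom C g ==> Cod C f = Cod C g ==> Add C f (Neg C g) \<in> I ==> sim f g"
  by (simp add: sim_def I_J)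

lemma Ore_left_sim:
  assumes "s \<in> W" "f \<in> Mor C" "Dom C s = Dom C f"
  shows "\<exists>s'\<in>W. \<exists>f'\<in>Mor C. Dom C s' = Cod C f \<and> Dom C f' = Cod C s \<and> Cod C s' = Cod C f' \<and> sim (s' \<cdot> f) (f' \<cdot> s)"
proof -
  obtain s' f' where u: "s' \<in> W" "f' \<in> Mor C" "Dom C s' = Cod C f" "Dom C f' = Cod C s" "Cod C s' = Cod C f'"
    "Add C (s' \<cdot> f) (Neg C (f' \<cdot> s)) \<in> I" using Ore_left[OF assms] by blast
  have "sim (s' \<cdot> f) (f' \<cdot> s)" by (rule sim_ideal) (use u assms in auto)
  then show ?thesis using u(1-5) by blast
qed

lemma Ore_right_sim:
  assumes "s \<in> W" "f \<in> Mor C" "Cod C s = Cod C f"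
  shows "\<exists>s'\<in>W. \<exists>f'\<in>Mor C. Cod C s' = Dom C f \<and> Cod C f' = Dom C s \<and> Dom C s' = Dom C f' \<and> sim (f \<cdot> s') (s \<cdot> f')"
proof -
  obtain s' f' where u: "s' \<in> W" "f' \<in> Mor C" "Cod C s' = Dom C f" "Cod C f' = Dom C s" "Dom C s' = Dom C f'"
    "Add C (f \<cdot> s') (Neg C (s \<cdot> f')) \<in> I" using Ore_right[OF assms] by blast
  have "sim (f \<cdot> s') (s \<cdot> f')" by (rule sim_ideal) (use u assms in auto)
  then show ?thesis using u(1-5) by blast
qed

subsection \<open>Extensions killed by the localization\<close>

text \<open>The extensions that vanish in the localization.\<close>

definition killed :: "'o => 'o => 'e => bool"
  where "killed X A \<delta> \<longleftrightarrow> (\<exists>s\<in>W. Dom C s = A \<and> ExtMap C (Idt C X) s \<delta> = \<one>\<^bsub>Ext C X (Cod C s)\<^esub>)"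

text \<open>If \<open>s\<^sub>*\<delta> = 0\<close>, then its triangle splits by some \<open>\<sigma>\<close>, and (MR3) provides \<open>b \<in> W\<close> from the triangle of \<open>\<delta>\<close>
  to the split one. The Ore condition replaces \<open>\<sigma>\<close> by a fraction: \<open>\<sigma> u\<close> and \<open>b f\<close> agree modulo \<open>J\<close> with \<open>u \<in> W\<close>.
  Hence so do \<open>u\<close> and \<open>y f\<close>, so that \<open>y f \<in> W\<close>, and \<open>(y f)\<^sup>*\<delta> = f\<^sup>*y\<^sup>*\<delta> = 0\<close>.\<close>

lemma killed_imp_pull:
  assumes "killed X A \<delta>" "\<delta> \<in> Exts C X A" "X \<in> Ob C" "A \<in> Ob C"
  shows "\<exists>t\<in>W. Cod C t = X \<and> ExtMap C t (Idt C A) \<delta> = \<one>\<^bsub>Ext C (Dom C t) A\<^esub>"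
proof -
  obtain s where s: "s \<in> W" "Dom C s = A" "ExtMap C (Idt C X) s \<delta> = \<one>\<^bsub>Ext C X (Cod C s)\<^esub>" using assms(1) unfolding killed_def by blast
  let ?A = "Cod C s"
  have A: "?A \<in> Ob C" using s by simp
  obtain B x y where t: "s_triangle C A B X x y \<delta>" using C.Real_class[OF assms(3,4,2)] by blast
  (* the triangle of the extension 0; it splits because the identity of X pulls 0 back to 0 *)
  obtain B' x' y' where t': "s_triangle C ?A B' X x' y' \<one>\<^bsub>Ext C X ?A\<^esub>" using C.Real_class[OF assms(3) A C.Ext_one[OF assms(3) A]] by blast
  note m = C.s_triangle_simps[OF t] C.s_triangle_simps[OF t']
  have "pull C ?A (Idt C X) \<one>\<^bsub>Ext C X ?A\<^esub> = \<one>\<^bsub>Ext C (Dom C (Idt C X)) ?A\<^esub>" using assms(3) A by (simp add: pull_def)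
  then obtain \<sigma> where \<sigma>: "\<sigma> \<in> Hom C X B'" "Idt C X = y' \<cdot> \<sigma>" using C.s_triangle_exact[OF t'] assms(3) unfolding cov_exact_def by (metis C.Idt_simps)
  note \<sigma>m = \<sigma>(1)[unfolded Hom_iff]
  obtain b where b: "b \<in> W" "b \<in> Hom C B B'" "Add C (Idt C X \<cdot> y) (Neg C (y' \<cdot> b)) \<in> I"
    using middle[OF t t', of s "Idt C X"] s assms(3) A by (auto simp: Hom_iff push_def pull_def)
  note bm = b(2)[unfolded Hom_iff]
  have 1: "sim y (y' \<cdot> b)" by (rule sim_ideal) (use b m bm in auto)
  obtain u f where u: "u \<in> W" "f \<in> Mor C" "Cod C u = X" "Cod C f = B" "Dom C u = Dom C f" "sim (\<sigma> \<cdot> u) (b \<cdot> f)"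
    using Ore_right_sim[of b \<sigma>] b(1) bm \<sigma>m by auto
  have "sim (y' \<cdot> \<sigma> \<cdot> u) (y' \<cdot> b \<cdot> f)" using sim_left[OF u(6), of y'] u m \<sigma>m by simp
  moreover have "y' \<cdot> \<sigma> \<cdot> u = u" using C.Cmp_collapse[OF \<sigma>(2)[symmetric], of u] u \<sigma>m m by simp
  moreover have "sim (y \<cdot> f) (y' \<cdot> b \<cdot> f)" using sim_right[OF 1, of f] u m bm by simp
  ultimately have "sim u (y \<cdot> f)" using sim_sym sim_trans by metis
  then have w: "y \<cdot> f \<in> W" using W_sim u(1) by blast
  have "ExtMap C (y \<cdot> f) (Idt C A) \<delta> = ExtMap C f (Idt C A) (pull C A y \<delta>)" using u m by (simp add: pull_def)
  also have "pull C A y \<delta> = \<one>\<^bsub>Ext C B A\<^esub>" using C.s_triangle_exact[OF t] by (simp add: cov_exact_def)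
  also have "ExtMap C f (Idt C A) \<one>\<^bsub>Ext C B A\<^esub> = \<one>\<^bsub>Ext C (Dom C f) A\<^esub>" using u m by simp
  finally show ?thesis using w u m by (intro bexI[of _ "y \<cdot> f"]) auto
qed

lemma killed_iff_pull:
  assumes "\<delta> \<in> Exts C X A" "X \<in> Ob C" "A \<in> Ob C"
  shows "killed X A \<delta> \<longleftrightarrow> (\<exists>t\<in>W. Cod C t = X \<and> ExtMap C t (Idt C A) \<delta> = \<one>\<^bsub>Ext C (Dom C t) A\<^esub>)"
proof
  show "killed X A \<delta> ==> \<exists>t\<in>W. Cod C t = X \<and> ExtMap C t (Idt C A) \<delta> = \<one>\<^bsub>Ext C (Dom C t) A\<^esub>" using killed_imp_pull assms by blast
  assume "\<exists>t\<in>W. Cod C t = X \<and> ExtMap C t (Idt C A) \<delta> = \<one>\<^bsub>Ext C (Dom C t) A\<^esub>"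
  then show "killed X A \<delta>" using ideal_calculus.killed_imp_pull[OF opposite_ideal_calculus, of A X \<delta>] assms
    by (simp add: killed_def ideal_calculus.killed_def[OF opposite_ideal_calculus])
qed

lemma killed_one: "X \<in> Ob C ==> A \<in> Ob C ==> killed X A \<one>\<^bsub>Ext C X A\<^esub>" unfolding killed_def by (intro bexI[of _ "Idt C A"]) auto

lemma killed_push_iff:
  assumes "\<delta> \<in> Exts C X A" "X \<in> Ob C" "s \<in> W" "Dom C s = A" "killed X (Cod C s) (ExtMap C (Idt C X) s \<delta>)"
  shows "killed X A \<delta>"
proof -
  obtain w where w: "w \<in> W" "Dom C w = Cod C s" "ExtMap C (Idt C X) w (ExtMap C (Idt C X) s \<delta>) = \<one>\<^bsub>Ext C X (Cod C w)\<^esub>"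
    using assms(5) unfolding killed_def by blast
  have "w \<cdot> s \<in> W" using W_Cmp[of s w] w assms by simp
  moreover have "ExtMap C (Idt C X) (w \<cdot> s) \<delta> = \<one>\<^bsub>Ext C X (Cod C w)\<^esub>" using w assms(1-4) by simp
  ultimately show ?thesis unfolding killed_def using w(1,2) assms(3,4) by (intro bexI[of _ "w \<cdot> s"]) auto
qed

lemma killed_pull_iff:
  assumes "\<delta> \<in> Exts C X A" "A \<in> Ob C" "t \<in> W" "Cod C t = X" "killed (Dom C t) A (ExtMap C t (Idt C A) \<delta>)"
  shows "killed X A \<delta>"
proof -
  have o: "X \<in> Ob C" "Dom C t \<in> Ob C" using assms(3,4) by auto
  have c: "ExtMap C t (Idt C A) \<delta> \<in> Exts C (Dom C t) A" using assms(1-4) by simp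
  obtain w where w: "w \<in> W" "Cod C w = Dom C t" "ExtMap C w (Idt C A) (ExtMap C t (Idt C A) \<delta>) = \<one>\<^bsub>Ext C (Dom C w) A\<^esub>"
    using assms(5) unfolding killed_iff_pull[OF c o(2) assms(2)] by blast
  have "t \<cdot> w \<in> W" using W_Cmp[of w t] w assms by simp
  moreover have "ExtMap C (t \<cdot> w) (Idt C A) \<delta> = \<one>\<^bsub>Ext C (Dom C w) A\<^esub>" using w assms(1-4) by simp
  ultimately show ?thesis unfolding killed_iff_pull[OF assms(1) o(1) assms(2)] using w(1,2) assms(3,4) by (intro bexI[of _ "t \<cdot> w"]) auto
qed

text \<open>Being killed by a push is inherited by pullbacks, and being killed by a pull is inherited by pushes; the two
  descriptions are equivalent.\<close>

lemma killed_ExtMap: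
  assumes k: "killed X A \<delta>" and d: "\<delta> \<in> Exts C X A" and c: "c \<in> Mor C" "Cod C c = X" and a: "a \<in> Mor C" "Dom C a = A"
  shows "killed (Dom C c) (Cod C a) (ExtMap C c a \<delta>)"
proof -
  have o: "X \<in> Ob C" "A \<in> Ob C" using c a by auto
  obtain t where t: "t \<in> W" "Cod C t = X" "ExtMap C t (Idt C A) \<delta> = \<one>\<^bsub>Ext C (Dom C t) A\<^esub>" using k killed_iff_pull[OF d o] by blast
  let ?e = "ExtMap C (Idt C X) a \<delta>"
  have e: "?e \<in> Exts C X (Cod C a)" using d a o by simp
  have "ExtMap C t (Idt C (Cod C a)) ?e = ExtMap C (Idt C (Dom C t)) a (ExtMap C t (Idt C A) \<delta>)" using t(1,2) d a o by simp
  also have "... = \<one>\<^bsub>Ext C (Dom C t) (Cod C a)\<^esub>" unfolding t(3) using t(1,2) a by simp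
  finally have "killed X (Cod C a) ?e" using killed_iff_pull[OF e o(1)] t(1,2) a by auto
  then obtain s where s: "s \<in> W" "Dom C s = Cod C a" "ExtMap C (Idt C X) s ?e = \<one>\<^bsub>Ext C X (Cod C s)\<^esub>" unfolding killed_def by blast
  have "ExtMap C (Idt C (Dom C c)) s (ExtMap C c a \<delta>) = ExtMap C c (Idt C (Cod C s)) (ExtMap C (Idt C X) s ?e)" using s(1,2) d a c o by simp
  also have "... = \<one>\<^bsub>Ext C (Dom C c) (Cod C s)\<^esub>" unfolding s(3) using s(1) c by simp
  finally show ?thesis unfolding killed_def using s by blast
qed

lemma killed_mult:
  assumes k: "killed X A \<delta>" "killed X A \<delta>'" and d: "\<delta> \<in> Exts C X A" "\<delta>' \<in> Exts C X A" and o: "X \<in> Ob C" "A \<in> Ob C"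
  shows "killed X A (\<delta> \<otimes>\<^bsub>Ext C X A\<^esub> \<delta>')"
proof -
  obtain t where t: "t \<in> W" "Cod C t = X" "ExtMap C t (Idt C A) \<delta> = \<one>\<^bsub>Ext C (Dom C t) A\<^esub>" using k(1) killed_iff_pull[OF d(1) o] by blast
  have T: "Dom C t \<in> Ob C" using t by simp
  interpret g: group "Ext C (Dom C t) A" using C.Ext_group T o by simp
  have "ExtMap C t (Idt C A) (\<delta> \<otimes>\<^bsub>Ext C X A\<^esub> \<delta>') = ExtMap C t (Idt C A) \<delta>'" using C.ExtMap_mult[of t "Idt C A" X A \<delta> \<delta>'] t d o by simp
  moreover have "killed (Dom C t) A (ExtMap C t (Idt C A) \<delta>')" using killed_ExtMap[OF k(2) d(2), of t "Idt C A"] t o by simp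
  ultimately show ?thesis using killed_pull_iff[of "\<delta> \<otimes>\<^bsub>Ext C X A\<^esub> \<delta>'" X A t] d o t(1,2) by simp
qed

lemma killed_inv:
  assumes k: "killed X A \<delta>" and d: "\<delta> \<in> Exts C X A" and o: "X \<in> Ob C" "A \<in> Ob C"
  shows "killed X A (inv\<^bsub>Ext C X A\<^esub> \<delta>)"
proof -
  obtain s where s: "s \<in> W" "Dom C s = A" "ExtMap C (Idt C X) s \<delta> = \<one>\<^bsub>Ext C X (Cod C s)\<^esub>" using k unfolding killed_def by blast
  interpret g: group "Ext C X (Cod C s)" using C.Ext_group s o by simp
  have "ExtMap C (Idt C X) s (inv\<^bsub>Ext C X A\<^esub> \<delta>) = \<one>\<^bsub>Ext C X (Cod C s)\<^esub>" using C.ExtMap_inv[of "Idt C X" s X A \<delta>] s d o by simp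
  then show ?thesis unfolding killed_def using s by blast
qed

text \<open>After a denominator \<open>f\<close> factors through a null object \<open>N\<close>, and every extension by \<open>N\<close> is killed by
  \<open>N \<rightarrow> 0\<close>.\<close>

lemma killed_push_ideal:
  assumes f: "f \<in> J" and d: "\<delta> \<in> Exts C X (Dom C f)" and o: "X \<in> Ob C"
  shows "killed X (Cod C f) (ExtMap C (Idt C X) f \<delta>)"
proof -
  obtain t where t: "f \<in> Mor C" "t \<in> W" "Dom C t = Cod C f" "t \<cdot> f \<in> I" using f unfolding J_def by blast
  obtain N Z u v where n: "u \<in> Hom C (Dom C f) N" "v \<in> Hom C N (Cod C t)" "t \<cdot> f = v \<cdot> u" "zero_object C Z" "Zero C N Z \<in> W"
    using I_null[OF t(4)] t by auto
  have Z: "Z \<in> Ob C" "N \<in> Ob C" using n C.zero_object_Ob C.Hom_Ob by auto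
  note nm = n(1,2)[unfolded Hom_iff]
  have c: "ExtMap C (Idt C X) u \<delta> \<in> Exts C X N" using nm d o by simp
  have "ExtMap C (Idt C X) (Zero C N Z) (ExtMap C (Idt C X) u \<delta>) = \<one>\<^bsub>Ext C X Z\<^esub>"
    using C.ExtMap_Zero(1)[of "Idt C X" "Idt C X" N Z "ExtMap C (Idt C X) u \<delta>"] c Z o by simp
  then have "killed X N (ExtMap C (Idt C X) u \<delta>)" unfolding killed_def using n(5) Z by (intro bexI[of _ "Zero C N Z"]) auto
  then have "killed X (Cod C t) (ExtMap C (Idt C X) v (ExtMap C (Idt C X) u \<delta>))" using killed_ExtMap[OF _ c, of "Idt C X" v] nm o by simp
  also have "ExtMap C (Idt C X) v (ExtMap C (Idt C X) u \<delta>) = ExtMap C (Idt C X) (t \<cdot> f) \<delta>" using nm d o n(3) by simp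
  also have "... = ExtMap C (Idt C X) t (ExtMap C (Idt C X) f \<delta>)" using t d o by simp
  finally show ?thesis using killed_push_iff[of "ExtMap C (Idt C X) f \<delta>" X "Cod C f" t] t d o by simp
qed

lemma killed_opposite: "\<delta> \<in> Exts C X A ==> X \<in> Ob C ==> A \<in> Ob C ==>
  ideal_calculus.killed (opposite C) W A X \<delta> \<longleftrightarrow> killed X A \<delta>" unfolding ideal_calculus.killed_def[OF opposite_ideal_calculus] killed_iff_pull by simp

lemma J_opposite: "ideal_calculus.J (opposite C) W I = J" unfolding ideal_calculus.J_def[OF opposite_ideal_calculus] using J_iff_right by auto

lemma killed_pull_ideal:
  assumes "f \<in> J" "\<delta> \<in> Exts C (Cod C f) A" "A \<in> Ob C"
  shows "killed (Dom C f) A (ExtMap C f (Idt C A) \<delta>)"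
proof -
  have "ideal_calculus.killed (opposite C) W A (Dom C f) (ExtMap C f (Idt C A) \<delta>)"
    using ideal_calculus.killed_push_ideal[OF opposite_ideal_calculus, of f \<delta> A] assms J_opposite by simp
  then show ?thesis using killed_opposite[of "ExtMap C f (Idt C A) \<delta>" "Dom C f" A] assms J_Mor[OF assms(1)] by simp
qed

definition keq :: "'o => 'o => 'e => 'e => bool"
  where "keq X A \<delta> \<delta>' \<longleftrightarrow> X \<in> Ob C \<and> A \<in> Ob C \<and> \<delta> \<in> Exts C X A \<and> \<delta>' \<in> Exts C X A \<and>
    killed X A (\<delta> \<otimes>\<^bsub>Ext C X A\<^esub> inv\<^bsub>Ext C X A\<^esub> \<delta>')"

lemma keq_refl: "X \<in> Ob C ==> A \<in> Ob C ==> \<delta> \<in> Exts C X A ==> keq X A \<delta> \<delta>"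
  unfolding keq_def by (simp add: group.r_inv C.Ext_group killed_one)

lemma keq_sym: "keq X A \<delta> \<delta>' ==> keq X A \<delta>' \<delta>"
proof -
  assume k: "keq X A \<delta> \<delta>'"
  then have h: "X \<in> Ob C" "A \<in> Ob C" "\<delta> \<in> Exts C X A" "\<delta>' \<in> Exts C X A"
    "killed X A (\<delta> \<otimes>\<^bsub>Ext C X A\<^esub> inv\<^bsub>Ext C X A\<^esub> \<delta>')" by (auto simp: keq_def)
  interpret g: comm_group "Ext C X A" using C.Ext_grp h by simp
  have "inv\<^bsub>Ext C X A\<^esub> (\<delta> \<otimes>\<^bsub>Ext C X A\<^esub> inv\<^bsub>Ext C X A\<^esub> \<delta>') = \<delta>' \<otimes>\<^bsub>Ext C X A\<^esub> inv\<^bsub>Ext C X A\<^esub> \<delta>" using h by (simp add: g.inv_mult g.m_comm)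
  then show ?thesis using killed_inv[OF h(5)] h by (simp add: keq_def)
qed

lemma keq_trans: "keq X A \<delta> \<delta>' ==> keq X A \<delta>' \<delta>'' ==> keq X A \<delta> \<delta>''"
proof -
  assume k: "keq X A \<delta> \<delta>'" "keq X A \<delta>' \<delta>''"
  then have h: "X \<in> Ob C" "A \<in> Ob C" "\<delta> \<in> Exts C X A" "\<delta>' \<in> Exts C X A" "\<delta>'' \<in> Exts C X A"
    "killed X A (\<delta> \<otimes>\<^bsub>Ext C X A\<^esub> inv\<^bsub>Ext C X A\<^esub> \<delta>')" "killed X A (\<delta>' \<otimes>\<^bsub>Ext C X A\<^esub> inv\<^bsub>Ext C X A\<^esub> \<delta>'')" by (auto simp: keq_def)
  interpret g: comm_group "Ext C X A" using C.Ext_grp h by simp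
  have "inv\<^bsub>Ext C X A\<^esub> \<delta>' \<otimes>\<^bsub>Ext C X A\<^esub> (\<delta>' \<otimes>\<^bsub>Ext C X A\<^esub> inv\<^bsub>Ext C X A\<^esub> \<delta>'') = inv\<^bsub>Ext C X A\<^esub> \<delta>''" using h by (simp add: g.m_assoc[symmetric])
  then have "(\<delta> \<otimes>\<^bsub>Ext C X A\<^esub> inv\<^bsub>Ext C X A\<^esub> \<delta>') \<otimes>\<^bsub>Ext C X A\<^esub> (\<delta>' \<otimes>\<^bsub>Ext C X A\<^esub> inv\<^bsub>Ext C X A\<^esub> \<delta>'') = \<delta> \<otimes>\<^bsub>Ext C X A\<^esub> inv\<^bsub>Ext C X A\<^esub> \<delta>''"
    using h by (simp add: g.m_assoc)
  then show ?thesis using killed_mult[OF h(6,7)] h by (simp add: keq_def)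
qed

lemma keq_mult: "keq X A \<delta> \<delta>' ==> \<theta> \<in> Exts C X A ==> keq X A (\<delta> \<otimes>\<^bsub>Ext C X A\<^esub> \<theta>) (\<delta>' \<otimes>\<^bsub>Ext C X A\<^esub> \<theta>)"
proof -
  assume k: "keq X A \<delta> \<delta>'" "\<theta> \<in> Exts C X A"
  then have h: "X \<in> Ob C" "A \<in> Ob C" "\<delta> \<in> Exts C X A" "\<delta>' \<in> Exts C X A"
    "killed X A (\<delta> \<otimes>\<^bsub>Ext C X A\<^esub> inv\<^bsub>Ext C X A\<^esub> \<delta>')" by (auto simp: keq_def)
  interpret g: comm_group "Ext C X A" using C.Ext_grp h by simp
  have "\<theta> \<otimes>\<^bsub>Ext C X A\<^esub> (inv\<^bsub>Ext C X A\<^esub> \<theta> \<otimes>\<^bsub>Ext C X A\<^esub> inv\<^bsub>Ext C X A\<^esub> \<delta>') = inv\<^bsub>Ext C X A\<^esub> \<delta>'" using h k(2) by (simp add: g.m_assoc[symmetric])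
  then have "(\<delta> \<otimes>\<^bsub>Ext C X A\<^esub> \<theta>) \<otimes>\<^bsub>Ext C X A\<^esub> inv\<^bsub>Ext C X A\<^esub> (\<delta>' \<otimes>\<^bsub>Ext C X A\<^esub> \<theta>) = \<delta> \<otimes>\<^bsub>Ext C X A\<^esub> inv\<^bsub>Ext C X A\<^esub> \<delta>'"
    using h k(2) by (simp add: g.inv_mult_group g.m_assoc)
  then show ?thesis using h k(2) by (simp add: keq_def)
qed

lemma ExtMap_diff:
  assumes "c \<in> Mor C" "a \<in> Mor C" "Cod C c = X" "Dom C a = A" "\<delta> \<in> Exts C X A" "\<delta>' \<in> Exts C X A"
  shows "ExtMap C c a (\<delta> \<otimes>\<^bsub>Ext C X A\<^esub> inv\<^bsub>Ext C X A\<^esub> \<delta>') =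
    ExtMap C c a \<delta> \<otimes>\<^bsub>Ext C (Dom C c) (Cod C a)\<^esub> inv\<^bsub>Ext C (Dom C c) (Cod C a)\<^esub> ExtMap C c a \<delta>'"
proof -
  have o: "X \<in> Ob C" "A \<in> Ob C" using assms by auto
  show ?thesis using C.ExtMap_mult[OF assms(1-5), of "inv\<^bsub>Ext C X A\<^esub> \<delta>'"] C.ExtMap_inv[OF assms(1-4,6)] assms(6) o by simp
qed

lemma keq_ExtMap:
  assumes k: "keq X A \<delta> \<delta>'" and c: "c \<in> Mor C" "Cod C c = X" and a: "a \<in> Mor C" "Dom C a = A"
  shows "keq (Dom C c) (Cod C a) (ExtMap C c a \<delta>) (ExtMap C c a \<delta>')"
proof -
  have h: "X \<in> Ob C" "A \<in> Ob C" "\<delta> \<in> Exts C X A" "\<delta>' \<in> Exts C X A"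
    "killed X A (\<delta> \<otimes>\<^bsub>Ext C X A\<^esub> inv\<^bsub>Ext C X A\<^esub> \<delta>')" using k by (auto simp: keq_def)
  show ?thesis unfolding keq_def ExtMap_diff[OF c(1) a(1) c(2) a(2) h(3,4), symmetric] using killed_ExtMap[OF h(5) _ c a] h c a by simp
qed

text \<open>Denominators can be cancelled, because killing by \<open>W\<close> already allows for further denominators.\<close>

lemma keq_reflect:
  assumes k: "keq (Dom C t) (Cod C s) (ExtMap C t s \<delta>) (ExtMap C t s \<delta>')" and w: "s \<in> W" "t \<in> W" "Cod C t = X" "Dom C s = A"
    and d: "\<delta> \<in> Exts C X A" "\<delta>' \<in> Exts C X A"
  shows "keq X A \<delta> \<delta>'"
proof -
  have o: "X \<in> Ob C" "A \<in> Ob C" "Cod C s \<in> Ob C" using w by auto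
  let ?e = "\<delta> \<otimes>\<^bsub>Ext C X A\<^esub> inv\<^bsub>Ext C X A\<^esub> \<delta>'"
  have e: "?e \<in> Exts C X A" using d o by simp
  have "killed (Dom C t) (Cod C s) (ExtMap C t s ?e)" using k ExtMap_diff[of t s X A \<delta> \<delta>'] w d by (simp add: keq_def)
  moreover have "ExtMap C t s ?e = ExtMap C t (Idt C (Cod C s)) (ExtMap C (Idt C X) s ?e)" using e w o by simp
  ultimately have k': "killed (Dom C t) (Cod C s) (ExtMap C t (Idt C (Cod C s)) (ExtMap C (Idt C X) s ?e))" by metis
  have "ExtMap C (Idt C X) s ?e \<in> Exts C X (Cod C s)" using e w o by simp
  then have "killed X (Cod C s) (ExtMap C (Idt C X) s ?e)" by (rule killed_pull_iff[OF _ o(3) w(2,3) k'])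
  then have "killed X A ?e" using killed_push_iff[OF e o(1) w(1,4)] by simp
  then show ?thesis using d o by (simp add: keq_def)
qed

lemma ExtMap_Neg:
  assumes "c \<in> Mor C" "a \<in> Mor C" "\<delta> \<in> Exts C (Cod C c) (Dom C a)"
  shows "ExtMap C c (Neg C a) \<delta> = inv\<^bsub>Ext C (Dom C c) (Cod C a)\<^esub> ExtMap C c a \<delta>"
    "ExtMap C (Neg C c) a \<delta> = inv\<^bsub>Ext C (Dom C c) (Cod C a)\<^esub> ExtMap C c a \<delta>"
proof -
  interpret G: group "Ext C (Dom C c) (Cod C a)" using C.Ext_group assms by simp
  show "ExtMap C c (Neg C a) \<delta> = inv\<^bsub>Ext C (Dom C c) (Cod C a)\<^esub> ExtMap C c a \<delta>"
  proof (rule G.inv_equality[symmetric])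
    show "ExtMap C c (Neg C a) \<delta> \<otimes>\<^bsub>Ext C (Dom C c) (Cod C a)\<^esub> ExtMap C c a \<delta> = \<one>\<^bsub>Ext C (Dom C c) (Cod C a)\<^esub>"
      using C.ExtMap_Add_right[of c "Neg C a" a \<delta>, symmetric] assms by simp
  qed (use assms in simp_all)
  show "ExtMap C (Neg C c) a \<delta> = inv\<^bsub>Ext C (Dom C c) (Cod C a)\<^esub> ExtMap C c a \<delta>"
  proof (rule G.inv_equality[symmetric])
    show "ExtMap C (Neg C c) a \<delta> \<otimes>\<^bsub>Ext C (Dom C c) (Cod C a)\<^esub> ExtMap C c a \<delta> = \<one>\<^bsub>Ext C (Dom C c) (Cod C a)\<^esub>"
      using C.ExtMap_Add_left[of a "Neg C c" c \<delta>, symmetric] assms C.ExtMap_Zero(2)[of a a "Dom C c" "Cod C c" \<delta>] by simp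
  qed (use assms in simp_all)
qed

lemma keq_push_sim:
  assumes f: "sim f f'" and d: "\<delta> \<in> Exts C X (Dom C f)" and o: "X \<in> Ob C"
  shows "keq X (Cod C f) (ExtMap C (Idt C X) f \<delta>) (ExtMap C (Idt C X) f' \<delta>)"
proof -
  have s: "f \<in> Mor C" "f' \<in> Mor C" "Dom C f' = Dom C f" "Cod C f' = Cod C f" "Add C f (Neg C f') \<in> J" using f by (auto simp: sim_def)
  have "killed X (Cod C f) (ExtMap C (Idt C X) (Add C f (Neg C f')) \<delta>)" using killed_push_ideal[OF s(5), of \<delta> X] s(1-4) d o by simp
  also have "ExtMap C (Idt C X) (Add C f (Neg C f')) \<delta> =
      ExtMap C (Idt C X) f \<delta> \<otimes>\<^bsub>Ext C X (Cod C f)\<^esub> inv\<^bsub>Ext C X (Cod C f)\<^esub> ExtMap C (Idt C X) f' \<delta>"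
    using C.ExtMap_Add_right[of "Idt C X" f "Neg C f'" \<delta>] ExtMap_Neg(1)[of "Idt C X" f' \<delta>] s(1-4) d o by simp
  finally show ?thesis unfolding keq_def using s(1-4) d o by simp
qed

lemma keq_pull_sim:
  assumes g: "sim g g'" and d: "\<delta> \<in> Exts C (Cod C g) A" and o: "A \<in> Ob C"
  shows "keq (Dom C g) A (ExtMap C g (Idt C A) \<delta>) (ExtMap C g' (Idt C A) \<delta>)"
proof -
  have s: "g \<in> Mor C" "g' \<in> Mor C" "Dom C g' = Dom C g" "Cod C g' = Cod C g" "Add C g (Neg C g') \<in> J" using g by (auto simp: sim_def)
  have "killed (Dom C g) A (ExtMap C (Add C g (Neg C g')) (Idt C A) \<delta>)" using killed_pull_ideal[OF s(5), of \<delta> A] s(1-4) d o by simp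
  also have "ExtMap C (Add C g (Neg C g')) (Idt C A) \<delta> =
      ExtMap C g (Idt C A) \<delta> \<otimes>\<^bsub>Ext C (Dom C g) A\<^esub> inv\<^bsub>Ext C (Dom C g) A\<^esub> ExtMap C g' (Idt C A) \<delta>"
    using C.ExtMap_Add_left[of "Idt C A" g "Neg C g'" \<delta>] ExtMap_Neg(2)[of g' "Idt C A" \<delta>] s(1-4) d o by simp
  finally show ?thesis unfolding keq_def using s(1-4) d o by simp
qed

text \<open>Congruent morphisms act equally on extensions up to killed ones. This is what makes the comparison of
  representatives independent of the numerators.\<close>

lemma keq_sim:
  assumes f: "sim f f'" and g: "sim g g'" and d: "\<delta> \<in> Exts C (Cod C g) (Dom C f)"
  shows "keq (Dom C g) (Cod C f) (ExtMap C g f \<delta>) (ExtMap C g' f' \<delta>)"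
proof -
  have s: "f \<in> Mor C" "f' \<in> Mor C" "Dom C f' = Dom C f" "Cod C f' = Cod C f"
    "g \<in> Mor C" "g' \<in> Mor C" "Dom C g' = Dom C g" "Cod C g' = Cod C g" using f g by (auto simp: sim_def)
  let ?X = "Cod C g" and ?Y = "Dom C g" and ?B = "Cod C f"
  have e: "ExtMap C (Idt C ?X) f' \<delta> \<in> Exts C ?X ?B" using s d by simp
  have "keq ?Y ?B (ExtMap C g (Idt C ?B) (ExtMap C (Idt C ?X) f \<delta>)) (ExtMap C g (Idt C ?B) (ExtMap C (Idt C ?X) f' \<delta>))"
    using keq_ExtMap[OF keq_push_sim[OF f d], of g "Idt C ?B"] s by simp
  moreover have "ExtMap C g (Idt C ?B) (ExtMap C (Idt C ?X) f \<delta>) = ExtMap C g f \<delta>" using s d by simp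
  moreover have "ExtMap C g (Idt C ?B) (ExtMap C (Idt C ?X) f' \<delta>) = ExtMap C g f' \<delta>" using s d by simp
  ultimately have 1: "keq ?Y ?B (ExtMap C g f \<delta>) (ExtMap C g f' \<delta>)" by metis
  have "keq ?Y ?B (ExtMap C g (Idt C ?B) (ExtMap C (Idt C ?X) f' \<delta>)) (ExtMap C g' (Idt C ?B) (ExtMap C (Idt C ?X) f' \<delta>))"
    by (rule keq_pull_sim[OF g e]) (use s in simp)
  moreover have "ExtMap C g (Idt C ?B) (ExtMap C (Idt C ?X) f' \<delta>) = ExtMap C g f' \<delta>" using s d by simp
  moreover have "ExtMap C g' (Idt C ?B) (ExtMap C (Idt C ?X) f' \<delta>) = ExtMap C g' f' \<delta>" using s d by simp
  ultimately have "keq ?Y ?B (ExtMap C g f' \<delta>) (ExtMap C g' f' \<delta>)" by metis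
  then show ?thesis by (rule keq_trans[OF 1])
qed

lemma keq_one: "keq X A \<delta> \<one>\<^bsub>Ext C X A\<^esub> ==> killed X A \<delta>"
proof -
  assume k: "keq X A \<delta> \<one>\<^bsub>Ext C X A\<^esub>"
  then have h: "X \<in> Ob C" "A \<in> Ob C" "\<delta> \<in> Exts C X A"
    "killed X A (\<delta> \<otimes>\<^bsub>Ext C X A\<^esub> inv\<^bsub>Ext C X A\<^esub> \<one>\<^bsub>Ext C X A\<^esub>)" by (auto simp: keq_def)
  interpret g: group "Ext C X A" using C.Ext_group h by simp
  show ?thesis using h by simp
qed

end

section \<open>Directed unions of abelian groups\<close>

text \<open>In a directed union of groups two elements are multiplied in any group that contains representatives of
  both.\<close>

definition union_mult :: "'i set => ('i => 'a monoid) => ('i => 'a => 'b) => 'b => 'b => 'b"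
  where "union_mult Ix G rho m m' = (THE n. \<exists>i\<in>Ix. \<exists>g\<in>carrier (G i). \<exists>h\<in>carrier (G i).
           m = rho i g \<and> m' = rho i h \<and> n = rho i (g \<otimes>\<^bsub>G i\<^esub> h))"

text \<open>The structure maps \<open>rho\<close> are not assumed to be homomorphisms into a group; \<open>cong\<close> says that their
  fibres form a congruence, so that the multiplication descends.\<close>

locale directed_union =
  fixes Ix :: "'i set" and G :: "'i => 'a monoid" and rho :: "'i => 'a => 'b" and M :: "'b set"
  assumes grp: "i \<in> Ix ==> comm_group (G i)"
    and rho_M: "i \<in> Ix ==> g \<in> carrier (G i) ==> rho i g \<in> M"
    and surj: "m \<in> M ==> \<exists>i\<in>Ix. \<exists>g\<in>carrier (G i). m = rho i g"
    and dir: "i \<in> Ix ==> j \<in> Ix ==> \<exists>k\<in>Ix. \<exists>u\<in>hom (G i) (G k). \<exists>v\<in>hom (G j) (G k).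
       (\<forall>g\<in>carrier (G i). rho k (u g) = rho i g) \<and> (\<forall>g\<in>carrier (G j). rho k (v g) = rho j g)"
    and cong: "i \<in> Ix ==> g \<in> carrier (G i) ==> g' \<in> carrier (G i) ==> h \<in> carrier (G i) ==> rho i g = rho i g'
       ==> rho i (g \<otimes>\<^bsub>G i\<^esub> h) = rho i (g' \<otimes>\<^bsub>G i\<^esub> h)"
begin

lemma cong2:
  assumes "i \<in> Ix" "g \<in> carrier (G i)" "g' \<in> carrier (G i)" "h \<in> carrier (G i)" "h' \<in> carrier (G i)"
    "rho i g = rho i g'" "rho i h = rho i h'"
  shows "rho i (g \<otimes>\<^bsub>G i\<^esub> h) = rho i (g' \<otimes>\<^bsub>G i\<^esub> h')"
proof -
  interpret g: comm_group "G i" using grp assms(1) .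
  have "rho i (g \<otimes>\<^bsub>G i\<^esub> h) = rho i (g' \<otimes>\<^bsub>G i\<^esub> h)" by (rule cong) (use assms in auto)
  also have "... = rho i (h \<otimes>\<^bsub>G i\<^esub> g')" using assms by (simp add: g.m_comm)
  also have "... = rho i (h' \<otimes>\<^bsub>G i\<^esub> g')" by (rule cong) (use assms in auto)
  also have "... = rho i (g' \<otimes>\<^bsub>G i\<^esub> h')" using assms by (simp add: g.m_comm)
  finally show ?thesis .
qed

lemma mult_well_defined:
  assumes i: "i \<in> Ix" "g \<in> carrier (G i)" "h \<in> carrier (G i)" and j: "j \<in> Ix" "g' \<in> carrier (G j)" "h' \<in> carrier (G j)"
    and e: "rho i g = rho j g'" "rho i h = rho j h'"
  shows "rho i (g \<otimes>\<^bsub>G i\<^esub> h) = rho j (g' \<otimes>\<^bsub>G j\<^esub> h')"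
proof -
  obtain k u v where k: "k \<in> Ix" "u \<in> hom (G i) (G k)" "v \<in> hom (G j) (G k)"
    "\<forall>g\<in>carrier (G i). rho k (u g) = rho i g" "\<forall>g\<in>carrier (G j). rho k (v g) = rho j g" using dir[OF i(1) j(1)] by blast
  interpret gi: comm_group "G i" using grp i(1) .
  interpret gj: comm_group "G j" using grp j(1) .
  have uv: "u g \<in> carrier (G k)" "u h \<in> carrier (G k)" "v g' \<in> carrier (G k)" "v h' \<in> carrier (G k)"
    "u (g \<otimes>\<^bsub>G i\<^esub> h) = u g \<otimes>\<^bsub>G k\<^esub> u h" "v (g' \<otimes>\<^bsub>G j\<^esub> h') = v g' \<otimes>\<^bsub>G k\<^esub> v h'" using k(2,3) i j by (auto simp: hom_def)
  have "rho i (g \<otimes>\<^bsub>G i\<^esub> h) = rho k (u g \<otimes>\<^bsub>G k\<^esub> u h)" using k(4) i uv(5) by (metis gi.m_closed)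
  also have "... = rho k (v g' \<otimes>\<^bsub>G k\<^esub> v h')" by (rule cong2) (use k i j e uv in auto)
  also have "... = rho j (g' \<otimes>\<^bsub>G j\<^esub> h')" using k(5) j uv(6) by (metis gj.m_closed)
  finally show ?thesis .
qed

lemma union_mult_rho:
  assumes i: "i \<in> Ix" "g \<in> carrier (G i)" "h \<in> carrier (G i)"
  shows "union_mult Ix G rho (rho i g) (rho i h) = rho i (g \<otimes>\<^bsub>G i\<^esub> h)" unfolding union_mult_def
proof (rule the_equality)
  show "\<exists>j\<in>Ix. \<exists>g'\<in>carrier (G j). \<exists>h'\<in>carrier (G j). rho i g = rho j g' \<and> rho i h = rho j h' \<and>
     rho i (g \<otimes>\<^bsub>G i\<^esub> h) = rho j (g' \<otimes>\<^bsub>G j\<^esub> h')" using i by blast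
  fix n assume "\<exists>j\<in>Ix. \<exists>g'\<in>carrier (G j). \<exists>h'\<in>carrier (G j). rho i g = rho j g' \<and> rho i h = rho j h' \<and> n = rho j (g' \<otimes>\<^bsub>G j\<^esub> h')"
  then show "n = rho i (g \<otimes>\<^bsub>G i\<^esub> h)" using mult_well_defined[OF i] by metis
qed

lemma common_index:
  assumes "m \<in> M" "m' \<in> M"
  shows "\<exists>i\<in>Ix. \<exists>g\<in>carrier (G i). \<exists>h\<in>carrier (G i). m = rho i g \<and> m' = rho i h"
proof -
  obtain i g where i: "i \<in> Ix" "g \<in> carrier (G i)" "m = rho i g" using surj[OF assms(1)] by blast
  obtain j h where j: "j \<in> Ix" "h \<in> carrier (G j)" "m' = rho j h" using surj[OF assms(2)] by blast
  obtain k u v where k: "k \<in> Ix" "u \<in> hom (G i) (G k)" "v \<in> hom (G j) (G k)"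
    "\<forall>g\<in>carrier (G i). rho k (u g) = rho i g" "\<forall>g\<in>carrier (G j). rho k (v g) = rho j g" using dir[OF i(1) j(1)] by blast
  show ?thesis using k i j by (intro bexI[of _ k] bexI[of _ "u g"] bexI[of _ "v h"]) (auto simp: hom_def)
qed

lemma common_index3:
  assumes "m \<in> M" "m' \<in> M" "m'' \<in> M"
  shows "\<exists>i\<in>Ix. \<exists>g\<in>carrier (G i). \<exists>h\<in>carrier (G i). \<exists>l\<in>carrier (G i). m = rho i g \<and> m' = rho i h \<and> m'' = rho i l"
proof -
  obtain i g h where i: "i \<in> Ix" "g \<in> carrier (G i)" "h \<in> carrier (G i)" "m = rho i g" "m' = rho i h" using common_index[OF assms(1,2)] by blast
  obtain j l where j: "j \<in> Ix" "l \<in> carrier (G j)" "m'' = rho j l" using surj[OF assms(3)] by blast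
  obtain k u v where k: "k \<in> Ix" "u \<in> hom (G i) (G k)" "v \<in> hom (G j) (G k)"
    "\<forall>g\<in>carrier (G i). rho k (u g) = rho i g" "\<forall>g\<in>carrier (G j). rho k (v g) = rho j g" using dir[OF i(1) j(1)] by blast
  show ?thesis using k i j by (intro bexI[of _ k] bexI[of _ "u g"] bexI[of _ "u h"] bexI[of _ "v l"]) (auto simp: hom_def)
qed

lemma rho_one: "i \<in> Ix ==> j \<in> Ix ==> rho i \<one>\<^bsub>G i\<^esub> = rho j \<one>\<^bsub>G j\<^esub>"
proof -
  assume i: "i \<in> Ix" and j: "j \<in> Ix"
  obtain k u v where k: "k \<in> Ix" "u \<in> hom (G i) (G k)" "v \<in> hom (G j) (G k)"
    "\<forall>g\<in>carrier (G i). rho k (u g) = rho i g" "\<forall>g\<in>carrier (G j). rho k (v g) = rho j g" using dir[OF i j] by blast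
  interpret gi: comm_group "G i" using grp i .
  interpret gj: comm_group "G j" using grp j .
  interpret gk: comm_group "G k" using grp k(1) .
  have "u \<one>\<^bsub>G i\<^esub> = \<one>\<^bsub>G k\<^esub>" "v \<one>\<^bsub>G j\<^esub> = \<one>\<^bsub>G k\<^esub>" using hom_one[OF k(2)] hom_one[OF k(3)] gi.group_axioms gj.group_axioms gk.group_axioms by auto
  then show ?thesis using k(4,5) by (metis gi.one_closed gj.one_closed)
qed

lemma comm_group_union:
  assumes i0: "i0 \<in> Ix" and e: "e = rho i0 \<one>\<^bsub>G i0\<^esub>"
  shows "comm_group \<lparr>carrier = M, monoid.mult = union_mult Ix G rho, one = e\<rparr>"
proof (rule comm_groupI; simp)
  have e': "e = rho i \<one>\<^bsub>G i\<^esub>" if "i \<in> Ix" for i using rho_one[OF i0 that] e by simp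
  have cl: "g \<otimes>\<^bsub>G i\<^esub> h \<in> carrier (G i)" "\<one>\<^bsub>G i\<^esub> \<in> carrier (G i)" if "i \<in> Ix" "g \<in> carrier (G i)" "h \<in> carrier (G i)" for i g h
  proof -
    interpret g: comm_group "G i" using grp that(1) .
    show "g \<otimes>\<^bsub>G i\<^esub> h \<in> carrier (G i)" "\<one>\<^bsub>G i\<^esub> \<in> carrier (G i)" using that by auto
  qed
  {
    fix x y assume xy: "x \<in> M" "y \<in> M"
    obtain i g h where i: "i \<in> Ix" "g \<in> carrier (G i)" "h \<in> carrier (G i)" "x = rho i g" "y = rho i h" using common_index[OF xy] by blast
    interpret g: comm_group "G i" using grp i(1) .
    show "union_mult Ix G rho x y \<in> M" using union_mult_rho[OF i(1-3)] rho_M[OF i(1) cl(1)[OF i(1-3)]] i(4,5) by simp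
    show "union_mult Ix G rho x y = union_mult Ix G rho y x" using union_mult_rho[OF i(1-3)] union_mult_rho[OF i(1,3,2)] i by (simp add: g.m_comm)
  }
  show "e \<in> M" unfolding e using rho_M[OF i0] group.is_monoid[OF comm_group.axioms(2)[OF grp[OF i0]]] by (simp add: monoid.one_closed)
  {
    fix x y z assume xyz: "x \<in> M" "y \<in> M" "z \<in> M"
    obtain i g h l where i: "i \<in> Ix" "g \<in> carrier (G i)" "h \<in> carrier (G i)" "l \<in> carrier (G i)" "x = rho i g" "y = rho i h" "z = rho i l"
      using common_index3[OF xyz] by blast
    interpret g: comm_group "G i" using grp i(1) .
    show "union_mult Ix G rho (union_mult Ix G rho x y) z = union_mult Ix G rho x (union_mult Ix G rho y z)"
      unfolding i(5-7) using i(1-4) by (simp add: union_mult_rho g.m_assoc)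
  }
  {
    fix x assume x: "x \<in> M"
    obtain i g where i: "i \<in> Ix" "g \<in> carrier (G i)" "x = rho i g" using surj[OF x] by blast
    interpret g: comm_group "G i" using grp i(1) .
    show "union_mult Ix G rho e x = x" unfolding e'[OF i(1)] i(3) using i(1,2) by (simp add: union_mult_rho)
    have "union_mult Ix G rho (rho i (inv\<^bsub>G i\<^esub> g)) x = e" unfolding e'[OF i(1)] i(3) using i(1,2) by (simp add: union_mult_rho)
    then show "\<exists>y\<in>M. union_mult Ix G rho y x = e" using rho_M[OF i(1), of "inv\<^bsub>G i\<^esub> g"] i(2) by auto
  }
qed

end

context ideal_calculus
begin

text \<open>The Ore condition alone yields one leg in \<open>W\<close>; the other one then lies in \<open>W\<close> by two out of three.\<close>

lemma common_W_left:
  assumes "s \<in> W" "s' \<in> W" "Dom C s = Dom C s'"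
  shows "\<exists>u\<in>W. \<exists>u'\<in>W. Dom C u = Cod C s \<and> Dom C u' = Cod C s' \<and> Cod C u = Cod C u' \<and> sim (u \<cdot> s) (u' \<cdot> s')"
proof -
  obtain u f where u: "u \<in> W" "f \<in> Mor C" "Dom C u = Cod C s" "Dom C f = Cod C s'" "Cod C u = Cod C f" "sim (u \<cdot> s) (f \<cdot> s')"
    using Ore_left_sim[OF assms(2), of s] assms by auto
  have "f \<cdot> s' \<in> W" using W_sim[OF _ u(6)] W_Cmp[OF assms(1) u(1)] u(3) by simp
  then have "f \<in> W" using W_left[OF assms(2) u(2)] u(4) by simp
  then show ?thesis using u by blast
qed

lemma common_W_right:
  assumes "s \<in> W" "s' \<in> W" "Cod C s = Cod C s'"
  shows "\<exists>u\<in>W. \<exists>u'\<in>W. Cod C u = Dom C s \<and> Cod C u' = Dom C s' \<and> Dom C u = Dom C u' \<and> sim (s \<cdot> u) (s' \<cdot> u')"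
proof -
  obtain u f where u: "u \<in> W" "f \<in> Mor C" "Cod C u = Dom C s" "Cod C f = Dom C s'" "Dom C u = Dom C f" "sim (s \<cdot> u) (s' \<cdot> f)"
    using Ore_right_sim[OF assms(2), of s] assms by auto
  have "s' \<cdot> f \<in> W" using W_sim[OF _ u(6)] W_Cmp[OF u(1) assms(1)] u(3) by simp
  then have "f \<in> W" using W_right[OF u(2) assms(2)] u(4) by simp
  then show ?thesis using u by blast
qed

end

section \<open>The hom groups of the localization\<close>

text \<open>A category in which \<open>W\<close> is inverted, every morphism is a fraction on both sides, and equality is the
  congruence of \<open>J\<close>. Only the category is given here; the rest of the structure is constructed.\<close>

locale ideal_localization = ideal_calculus C W I + L: category L
  for C :: "('o, 'm, 'e) ext_cat" (structure) and W I :: "'m set" and L :: "('o, 'n) cat" +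
  fixes q :: "'m => 'n"
  assumes Ob_L [simp]: "Ob L = Ob C"
    and q_Hom: "f \<in> Mor C ==> q f \<in> Hom L (Dom C f) (Cod C f)"
    and q_Idt [simp]: "X \<in> Ob C ==> q (Idt C X) = Idt L X"
    and q_Cmp: "f \<in> Mor C ==> g \<in> Mor C ==> Cod C f = Dom C g ==> q (g \<cdot> f) = q g \<cdot>\<^bsub>L\<^esub> q f"
    and q_W [simp]: "s \<in> W ==> isomorphism L (q s)"
    and frac_left: "\<phi> \<in> Mor L ==> \<exists>s\<in>W. \<exists>f\<in>Mor C. Dom C f = Dom L \<phi> \<and> Dom C s = Cod L \<phi> \<and> Cod C f = Cod C s
                    \<and> q s \<cdot>\<^bsub>L\<^esub> \<phi> = q f"
    and frac_right: "\<phi> \<in> Mor L ==> \<exists>s\<in>W. \<exists>f\<in>Mor C. Cod C f = Cod L \<phi> \<and> Cod C s = Dom L \<phi> \<and> Dom C f = Dom C s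
                     \<and> \<phi> \<cdot>\<^bsub>L\<^esub> q s = q f"
    and q_eq: "f \<in> Mor C ==> g \<in> Mor C ==> Dom C f = Dom C g ==> Cod C f = Cod C g ==> q f = q g \<longleftrightarrow> sim f g"
begin

abbreviation Cmp_L (infixr \<open>\<star>\<close> 70)
  where "\<psi> \<star> \<phi> \<equiv> \<psi> \<cdot>\<^bsub>L\<^esub> \<phi>"

lemma q_simps [simp]:
  assumes "f \<in> Mor C"
  shows "q f \<in> Mor L" "Dom L (q f) = Dom C f" "Cod L (q f) = Cod C f" using q_Hom[OF assms] by (auto simp: Hom_iff)

lemma Ob_simps_L [simp]: "\<phi> \<in> Mor L ==> Dom L \<phi> \<in> Ob C" "\<phi> \<in> Mor L ==> Cod L \<phi> \<in> Ob C" using L.Ob_simps by auto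

lemma sim_q: "sim f g ==> q f = q g" using q_eq[of f g] by (auto simp: sim_def)

lemma common_left:
  assumes "\<phi> \<in> Mor L" "\<psi> \<in> Mor L" "Cod L \<phi> = Cod L \<psi>"
  shows "\<exists>s\<in>W. \<exists>f\<in>Mor C. \<exists>g\<in>Mor C. Dom C s = Cod L \<phi> \<and> Dom C f = Dom L \<phi> \<and> Dom C g = Dom L \<psi> \<and> Cod C f = Cod C s \<and>
    Cod C g = Cod C s \<and> q s \<star> \<phi> = q f \<and> q s \<star> \<psi> = q g"
proof -
  obtain s f where s: "s \<in> W" "f \<in> Mor C" "Dom C f = Dom L \<phi>" "Dom C s = Cod L \<phi>" "Cod C f = Cod C s" "q s \<star> \<phi> = q f"
    using frac_left[OF assms(1)] by blast
  obtain s' g where s': "s' \<in> W" "g \<in> Mor C" "Dom C g = Dom L \<psi>" "Dom C s' = Cod L \<psi>" "Cod C g = Cod C s'" "q s' \<star> \<psi> = q g"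
    using frac_left[OF assms(2)] by blast
  obtain u u' where u: "u \<in> W" "u' \<in> W" "Dom C u = Cod C s" "Dom C u' = Cod C s'" "Cod C u = Cod C u'" "sim (u \<cdot> s) (u' \<cdot> s')"
    using common_W_left[OF s(1) s'(1)] s(4) s'(4) assms(3) by auto
  have w: "u \<cdot> s \<in> W" using W_Cmp u s by simp
  have 1: "q (u \<cdot> s) \<star> \<phi> = q (u \<cdot> f)" using s(1-5) u(1-5) assms by (simp add: q_Cmp s(6))
  have "q (u \<cdot> s) \<star> \<psi> = q (u' \<cdot> s') \<star> \<psi>" using sim_q[OF u(6)] by simp
  also have "... = q (u' \<cdot> g)" using s'(1-5) u(1-5) assms by (simp add: q_Cmp s'(6))
  finally have 2: "q (u \<cdot> s) \<star> \<psi> = q (u' \<cdot> g)" .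
  show ?thesis by (rule bexI[OF _ w], rule bexI[of _ "u \<cdot> f"], rule bexI[of _ "u' \<cdot> g"]) (use 1 2 s(1-5) s'(1-5) u(1-5) assms in simp_all)
qed

lemma common_right:
  assumes "\<phi> \<in> Mor L" "\<psi> \<in> Mor L" "Dom L \<phi> = Dom L \<psi>"
  shows "\<exists>s\<in>W. \<exists>f\<in>Mor C. \<exists>g\<in>Mor C. Cod C s = Dom L \<phi> \<and> Cod C f = Cod L \<phi> \<and> Cod C g = Cod L \<psi> \<and> Dom C f = Dom C s \<and>
    Dom C g = Dom C s \<and> \<phi> \<star> q s = q f \<and> \<psi> \<star> q s = q g"
proof -
  obtain s f where s: "s \<in> W" "f \<in> Mor C" "Cod C f = Cod L \<phi>" "Cod C s = Dom L \<phi>" "Dom C f = Dom C s" "\<phi> \<star> q s = q f"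
    using frac_right[OF assms(1)] by blast
  obtain s' g where s': "s' \<in> W" "g \<in> Mor C" "Cod C g = Cod L \<psi>" "Cod C s' = Dom L \<psi>" "Dom C g = Dom C s'" "\<psi> \<star> q s' = q g"
    using frac_right[OF assms(2)] by blast
  obtain u u' where u: "u \<in> W" "u' \<in> W" "Cod C u = Dom C s" "Cod C u' = Dom C s'" "Dom C u = Dom C u'" "sim (s \<cdot> u) (s' \<cdot> u')"
    using common_W_right[OF s(1) s'(1)] s(4) s'(4) assms(3) by auto
  have w: "s \<cdot> u \<in> W" using W_Cmp u s by simp
  have "\<phi> \<star> q (s \<cdot> u) = (\<phi> \<star> q s) \<star> q u" using s(1-5) u(1-5) assms by (simp add: q_Cmp)
  also have "... = q (f \<cdot> u)" unfolding s(6) using s(1-5) u(1-5) by (simp add: q_Cmp)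
  finally have 1: "\<phi> \<star> q (s \<cdot> u) = q (f \<cdot> u)" .
  have "\<psi> \<star> q (s \<cdot> u) = \<psi> \<star> q (s' \<cdot> u')" using sim_q[OF u(6)] by simp
  also have "... = (\<psi> \<star> q s') \<star> q u'" using s'(1-5) u(1-5) assms by (simp add: q_Cmp)
  also have "... = q (g \<cdot> u')" unfolding s'(6) using s'(1-5) u(1-5) by (simp add: q_Cmp)
  finally have 2: "\<psi> \<star> q (s \<cdot> u) = q (g \<cdot> u')" .
  show ?thesis by (rule bexI[OF _ w], rule bexI[of _ "f \<cdot> u"], rule bexI[of _ "g \<cdot> u'"]) (use 1 2 s(1-5) s'(1-5) u(1-5) assms in simp_all)
qed

subsection \<open>Addition of fractions\<close>

definition lfrac :: "'m => 'm => 'n"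
  where "lfrac s f = inv_mor L (q s) \<star> q f"

lemma lfrac_simps [simp]:
  assumes "s \<in> W" "f \<in> Mor C" "Cod C f = Cod C s"
  shows "lfrac s f \<in> Mor L" "Dom L (lfrac s f) = Dom C f" "Cod L (lfrac s f) = Dom C s" "q s \<star> lfrac s f = q f"
  using assms by (simp_all add: lfrac_def)

lemma lfrac_eqI:
  assumes "s \<in> W" "\<phi> \<in> Mor L" "Dom C s = Cod L \<phi>" "q s \<star> \<phi> = q f"
  shows "\<phi> = lfrac s f" unfolding lfrac_def assms(4)[symmetric] using assms(1-3) by simp

lemma lfrac_scale:
  assumes "s \<in> W" "f \<in> Mor C" "Cod C f = Cod C s" "u \<in> W" "Dom C u = Cod C s"
  shows "lfrac (u \<cdot> s) (u \<cdot> f) = lfrac s f" by (rule lfrac_eqI[symmetric]) (use assms W_Cmp in \<open>simp_all add: q_Cmp\<close>)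

lemma lfrac_sim: "sim s s' ==> lfrac s f = lfrac s' f" using sim_q by (simp add: lfrac_def)

text \<open>For a fixed denominator \<open>s\<close> the fractions \<open>s\<inverse>f\<close> form a copy of a quotient of \<open>Hom(X, Cod s)\<close>, and common
  denominators make the union directed.\<close>

lemma hom_union:
  assumes o: "X \<in> Ob C" "Y \<in> Ob C"
  shows "directed_union {s \<in> W. Dom C s = Y} (\<lambda>s. hom_grp C X (Cod C s)) lfrac (Hom L X Y)"
proof (rule directed_union.intro)
  fix s assume "s \<in> {s \<in> W. Dom C s = Y}"
  then have s: "s \<in> W" "Dom C s = Y" by auto
  show "comm_group (hom_grp C X (Cod C s))" using C.hom_grp o s by simp
  fix f assume "f \<in> carrier (hom_grp C X (Cod C s))"
  then have f: "f \<in> Mor C" "Dom C f = X" "Cod C f = Cod C s" by (auto simp: Hom_iff)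
  show "lfrac s f \<in> Hom L X Y" using s f by (simp add: Hom_iff)
  fix f' g assume "f' \<in> carrier (hom_grp C X (Cod C s))" "g \<in> carrier (hom_grp C X (Cod C s))" and e: "lfrac s f = lfrac s f'"
  then have f': "f' \<in> Mor C" "Dom C f' = X" "Cod C f' = Cod C s" "g \<in> Mor C" "Dom C g = X" "Cod C g = Cod C s" by (auto simp: Hom_iff)
  have "q f = q f'" using e lfrac_simps(4)[OF s(1) f(1,3)] lfrac_simps(4)[OF s(1) f'(1,3)] by simp
  then have "sim f f'" using q_eq f f' by simp
  then have "sim (Add C f g) (Add C f' g)" using sim_Add_right f f' by simp
  then show "lfrac s (f \<otimes>\<^bsub>hom_grp C X (Cod C s)\<^esub> g) = lfrac s (f' \<otimes>\<^bsub>hom_grp C X (Cod C s)\<^esub> g)" using sim_q by (simp add: lfrac_def)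
next
  fix m assume "m \<in> Hom L X Y"
  then have m: "m \<in> Mor L" "Dom L m = X" "Cod L m = Y" by (auto simp: Hom_iff)
  obtain s f where s: "s \<in> W" "f \<in> Mor C" "Dom C f = X" "Dom C s = Y" "Cod C f = Cod C s" "q s \<star> m = q f" using frac_left[OF m(1)] m by auto
  then show "\<exists>s\<in>{s \<in> W. Dom C s = Y}. \<exists>g\<in>carrier (hom_grp C X (Cod C s)). m = lfrac s g"
    using lfrac_eqI[OF s(1) m(1) _ s(6)] m by (intro bexI[of _ s] bexI[of _ f]) (simp_all add: Hom_iff)
next
  fix s s' assume "s \<in> {s \<in> W. Dom C s = Y}" "s' \<in> {s \<in> W. Dom C s = Y}"
  then have s: "s \<in> W" "Dom C s = Y" "s' \<in> W" "Dom C s' = Y" by auto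
  then obtain u u' where u: "u \<in> W" "u' \<in> W" "Dom C u = Cod C s" "Dom C u' = Cod C s'" "Cod C u = Cod C u'" "sim (u \<cdot> s) (u' \<cdot> s')"
    using common_W_left[of s s'] by auto
  let ?k = "u \<cdot> s"
  have k: "?k \<in> W" "Dom C ?k = Y" "Cod C ?k = Cod C u" using W_Cmp[OF s(1) u(1)] u s by auto
  have h: "(\<lambda>f. u \<cdot> f) \<in> hom (hom_grp C X (Cod C s)) (hom_grp C X (Cod C ?k))"
    "(\<lambda>f. u' \<cdot> f) \<in> hom (hom_grp C X (Cod C s')) (hom_grp C X (Cod C ?k))" using u k by (auto simp: hom_def Hom_iff)
  have "lfrac ?k (u' \<cdot> f) = lfrac s' f" if "f \<in> Hom C X (Cod C s')" for f
    using lfrac_sim[OF u(6)] lfrac_scale[of s' f u'] that s u by (simp add: Hom_iff)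
  moreover have "lfrac ?k (u \<cdot> f) = lfrac s f" if "f \<in> Hom C X (Cod C s)" for f using lfrac_scale[of s f u] that s u by (simp add: Hom_iff)
  ultimately show "\<exists>k\<in>{s \<in> W. Dom C s = Y}. \<exists>u\<in>hom (hom_grp C X (Cod C s)) (hom_grp C X (Cod C k)).
     \<exists>v\<in>hom (hom_grp C X (Cod C s')) (hom_grp C X (Cod C k)).
       (\<forall>g\<in>carrier (hom_grp C X (Cod C s)). lfrac k (u g) = lfrac s g) \<and> (\<forall>g\<in>carrier (hom_grp C X (Cod C s')). lfrac k (v g) = lfrac s' g)"
    using k h by (intro bexI[of _ ?k] bexI[OF _ h(1)] bexI[OF _ h(2)]) auto
qed

definition addL :: "'n => 'n => 'n"
  where "addL \<phi> \<psi> = union_mult {s \<in> W. Dom C s = Cod L \<phi>} (\<lambda>s. hom_grp C (Dom L \<phi>) (Cod C s)) lfrac \<phi> \<psi>"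

lemma addL_lfrac:
  assumes "s \<in> W" "f \<in> Mor C" "g \<in> Mor C" "Dom C f = Dom C g" "Cod C f = Cod C s" "Cod C g = Cod C s"
  shows "addL (lfrac s f) (lfrac s g) = lfrac s (Add C f g)"
proof -
  interpret u: directed_union "{t \<in> W. Dom C t = Dom C s}" "\<lambda>s. hom_grp C (Dom C f) (Cod C s)" lfrac "Hom L (Dom C f) (Dom C s)"
    by (rule hom_union) (use assms in auto)
  show ?thesis using u.union_mult_rho[of s f g] assms by (simp add: addL_def Hom_iff)
qed

lemma q_lfrac: "f \<in> Mor C ==> q f = lfrac (Idt C (Cod C f)) f" by (rule lfrac_eqI) auto

lemma q_addL: "f \<in> Mor C ==> g \<in> Mor C ==> Dom C f = Dom C g ==> Cod C f = Cod C g ==> q (Add C f g) = addL (q f) (q g)"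
  using addL_lfrac[of "Idt C (Cod C g)" f g] q_lfrac[of f] q_lfrac[of g] q_lfrac[of "Add C f g"] by simp

lemma common_lfrac:
  assumes "\<phi> \<in> Hom L X Y" "\<psi> \<in> Hom L X Y"
  shows "\<exists>s f g. s \<in> W \<and> Dom C s = Y \<and> f \<in> Hom C X (Cod C s) \<and> g \<in> Hom C X (Cod C s) \<and> \<phi> = lfrac s f \<and> \<psi> = lfrac s g"
proof -
  note h = assms[unfolded Hom_iff]
  obtain s f g where s: "s \<in> W" "f \<in> Mor C" "g \<in> Mor C" "Dom C s = Y" "Dom C f = X" "Dom C g = X" "Cod C f = Cod C s"
    "Cod C g = Cod C s" "q s \<star> \<phi> = q f" "q s \<star> \<psi> = q g" using common_left[of \<phi> \<psi>] h by auto
  then show ?thesis using lfrac_eqI[OF s(1) _ _ s(9)] lfrac_eqI[OF s(1) _ _ s(10)] h by (auto simp: Hom_iff)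
qed

lemma addL_closed: "\<phi> \<in> Hom L X Y ==> \<psi> \<in> Hom L X Y ==> addL \<phi> \<psi> \<in> Hom L X Y"
proof -
  assume "\<phi> \<in> Hom L X Y" "\<psi> \<in> Hom L X Y"
  then obtain s f g where s: "s \<in> W" "Dom C s = Y" "f \<in> Hom C X (Cod C s)" "g \<in> Hom C X (Cod C s)" "\<phi> = lfrac s f" "\<psi> = lfrac s g"
    using common_lfrac by blast
  then show ?thesis using addL_lfrac[of s f g] by (simp add: Hom_iff)
qed

lemma addL_Cmp_left:
  assumes "\<phi> \<in> Hom L X Y" "\<psi> \<in> Hom L X Y" "\<chi> \<in> Hom L Y Z"
  shows "\<chi> \<star> addL \<phi> \<psi> = addL (\<chi> \<star> \<phi>) (\<chi> \<star> \<psi>)"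
proof -
  obtain s f g where s: "s \<in> W" "Dom C s = Y" "f \<in> Hom C X (Cod C s)" "g \<in> Hom C X (Cod C s)" "\<phi> = lfrac s f" "\<psi> = lfrac s g"
    using common_lfrac assms by blast
  note c = assms(3)[unfolded Hom_iff] s(3,4)[unfolded Hom_iff]
  have m: "\<chi> \<star> inv_mor L (q s) \<in> Mor L" "Dom L (\<chi> \<star> inv_mor L (q s)) = Cod C s" "Cod L (\<chi> \<star> inv_mor L (q s)) = Z" using c s(1,2) by auto
  obtain r h where r: "r \<in> W" "h \<in> Mor C" "Dom C h = Cod C s" "Dom C r = Z" "Cod C h = Cod C r" "q r \<star> (\<chi> \<star> inv_mor L (q s)) = q h"
    using frac_left[OF m(1)] m by auto
  have e: "\<chi> \<star> lfrac s k = lfrac r (h \<cdot> k)" if "k \<in> Hom C X (Cod C s)" for k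
  proof (rule lfrac_eqI)
    have "q r \<star> \<chi> \<star> lfrac s k = (q r \<star> (\<chi> \<star> inv_mor L (q s))) \<star> q k" using that c r(1,4) s(1,2) by (simp add: lfrac_def Hom_iff)
    also have "... = q (h \<cdot> k)" unfolding r(6) using that r(2,3) by (simp add: q_Cmp Hom_iff)
    finally show "q r \<star> \<chi> \<star> lfrac s k = q (h \<cdot> k)" .
  qed (use that c r(1,4) s(1,2) in \<open>simp_all add: Hom_iff\<close>)
  have "\<chi> \<star> addL \<phi> \<psi> = \<chi> \<star> lfrac s (Add C f g)" using s addL_lfrac[of s f g] by (simp add: Hom_iff)
  also have "... = lfrac r (h \<cdot> Add C f g)" by (rule e) (use c in \<open>simp add: Hom_iff\<close>)
  also have "... = addL (lfrac r (h \<cdot> f)) (lfrac r (h \<cdot> g))" using addL_lfrac[of r "h \<cdot> f" "h \<cdot> g"] r(1-5) c by simp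
  also have "... = addL (\<chi> \<star> \<phi>) (\<chi> \<star> \<psi>)" using e[OF s(3)] e[OF s(4)] s(5,6) by simp
  finally show ?thesis .
qed

lemma addL_Cmp_q:
  assumes "\<phi> \<in> Hom L Y Z" "\<psi> \<in> Hom L Y Z" "h \<in> Hom C X Y"
  shows "addL \<phi> \<psi> \<star> q h = addL (\<phi> \<star> q h) (\<psi> \<star> q h)"
proof -
  obtain s f g where s: "s \<in> W" "Dom C s = Z" "f \<in> Hom C Y (Cod C s)" "g \<in> Hom C Y (Cod C s)" "\<phi> = lfrac s f" "\<psi> = lfrac s g"
    using common_lfrac assms by blast
  note c = assms(3)[unfolded Hom_iff] s(3,4)[unfolded Hom_iff]
  have e: "lfrac s k \<star> q h = lfrac s (k \<cdot> h)" if "k \<in> Hom C Y (Cod C s)" for k using that c s(1) by (simp add: lfrac_def q_Cmp Hom_iff)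
  have a: "Add C f g \<in> Hom C Y (Cod C s)" using c by (simp add: Hom_iff)
  have "addL \<phi> \<psi> \<star> q h = lfrac s (Add C f g) \<star> q h" unfolding s(5,6) using addL_lfrac[of s f g] s(1) c by simp
  also have "... = lfrac s (Add C (f \<cdot> h) (g \<cdot> h))" unfolding e[OF a] using c by simp
  also have "... = addL (lfrac s (f \<cdot> h)) (lfrac s (g \<cdot> h))" using addL_lfrac[of s "f \<cdot> h" "g \<cdot> h"] s(1) c by simp
  also have "... = addL (\<phi> \<star> q h) (\<psi> \<star> q h)" unfolding s(5,6) e[OF s(3)] e[OF s(4)] ..
  finally show ?thesis .
qed

text \<open>Composition with \<open>q h\<close> is computed on numerators. A general \<open>\<chi>\<close> satisfies \<open>\<chi> q t = q h\<close> with \<open>t \<in> W\<close>,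
  and \<open>q t\<close> may be cancelled.\<close>

lemma addL_Cmp_right:
  assumes "\<phi> \<in> Hom L Y Z" "\<psi> \<in> Hom L Y Z" "\<chi> \<in> Hom L X Y"
  shows "addL \<phi> \<psi> \<star> \<chi> = addL (\<phi> \<star> \<chi>) (\<psi> \<star> \<chi>)"
proof -
  note c = assms[unfolded Hom_iff]
  obtain t h where t: "t \<in> W" "h \<in> Mor C" "Cod C h = Y" "Cod C t = X" "Dom C h = Dom C t" "\<chi> \<star> q t = q h" using frac_right[of \<chi>] c by auto
  have d: "addL \<phi> \<psi> \<in> Hom L Y Z" "addL (\<phi> \<star> \<chi>) (\<psi> \<star> \<chi>) \<in> Hom L X Z"
    using addL_closed[OF assms(1,2)] addL_closed[of "\<phi> \<star> \<chi>" X Z "\<psi> \<star> \<chi>"] c by (simp_all add: Hom_iff)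
  note d' = d[unfolded Hom_iff]
  have "addL (\<phi> \<star> \<chi>) (\<psi> \<star> \<chi>) \<star> q t = addL ((\<phi> \<star> \<chi>) \<star> q t) ((\<psi> \<star> \<chi>) \<star> q t)" by (rule addL_Cmp_q) (use c t in \<open>auto simp: Hom_iff\<close>)
  also have "... = addL (\<phi> \<star> q h) (\<psi> \<star> q h)" using c t(1,4) by (simp add: t(6))
  also have "... = addL \<phi> \<psi> \<star> q h" by (rule addL_Cmp_q[symmetric, OF assms(1,2)]) (use t in \<open>auto simp: Hom_iff\<close>)
  also have "... = (addL \<phi> \<psi> \<star> \<chi>) \<star> q t" unfolding t(6)[symmetric] using c t(1,4) d' by simp
  finally have "addL (\<phi> \<star> \<chi>) (\<psi> \<star> \<chi>) = addL \<phi> \<psi> \<star> \<chi>" by (rule L.isomorphism_cancel_right[OF q_W[OF t(1)]]) (use c t(1,4) d' in simp_all)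
  then show ?thesis ..
qed

end

section \<open>The extension groups of the localization\<close>

context ideal_localization
begin

text \<open>The pair \<open>(s, t)\<close> clears the denominators of \<open>a\<close> and \<open>b\<close>, with numerators \<open>f\<close> and \<open>g\<close>. Then
  \<open>t\<^sup>*s\<^sub>*(a\<^sub>*b\<^sup>*\<mu>(\<delta>))\<close> is the image of \<open>g\<^sup>*f\<^sub>*\<delta>\<close>.\<close>

definition clear :: "'m => 'm => 'n => 'n => 'm => 'm => bool"
  where "clear s t a b f g \<longleftrightarrow> a \<in> Mor L \<and> b \<in> Mor L \<and> s \<in> W \<and> t \<in> W \<and> f \<in> Mor C \<and> g \<in> Mor C \<and>
    Dom C s = Cod L a \<and> Cod C t = Dom L b \<and> Dom C f = Dom L a \<and> Cod C f = Cod C s \<and> Cod C g = Cod L b \<and> Dom C g = Dom C t \<and>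
    q s \<star> a = q f \<and> b \<star> q t = q g"

lemma clear_extend:
  assumes c: "clear s t a b f g" and u: "u \<in> W" "Dom C u = Cod C s" and v: "v \<in> W" "Cod C v = Dom C t"
  shows "clear (u \<cdot> s) (t \<cdot> v) a b (u \<cdot> f) (g \<cdot> v)"
proof -
  have h: "a \<in> Mor L" "b \<in> Mor L" "s \<in> W" "t \<in> W" "f \<in> Mor C" "g \<in> Mor C"
    "Dom C s = Cod L a" "Cod C t = Dom L b" "Dom C f = Dom L a" "Cod C f = Cod C s" "Cod C g = Cod L b" "Dom C g = Dom C t"
    and e: "q s \<star> a = q f" "b \<star> q t = q g" using c by (auto simp: clear_def)
  have w: "u \<cdot> s \<in> W" "t \<cdot> v \<in> W" using W_Cmp h u v by auto
  have 1: "q (u \<cdot> s) \<star> a = q (u \<cdot> f)" using h u by (simp add: q_Cmp e)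
  have "b \<star> q (t \<cdot> v) = (b \<star> q t) \<star> q v" using h v by (simp add: q_Cmp)
  also have "... = q (g \<cdot> v)" unfolding e(2) using h v by (simp add: q_Cmp)
  finally have 2: "b \<star> q (t \<cdot> v) = q (g \<cdot> v)" .
  show ?thesis unfolding clear_def using h u v w 1 2 by simp
qed

lemma clear_change:
  assumes c: "clear s t a b f g" and s: "sim s s'" and t: "sim t t'"
  shows "clear s' t' a b f g" using c sim_q[OF s] sim_q[OF t] W_sim[OF _ s] W_sim[OF _ t] s t unfolding clear_def sim_def by metis

lemma clear_sim:
  assumes "clear s t a b f g" "clear s t a b f' g'"
  shows "sim f f'" "sim g g'" using assms q_eq[of f f'] q_eq[of g g'] by (simp_all add: clear_def)

lemma clear_ex2:
  assumes "a \<in> Mor L" "a' \<in> Mor L" "Cod L a = Cod L a'" "b \<in> Mor L" "b' \<in> Mor L" "Dom L b = Dom L b'"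
  shows "\<exists>s t f g f' g'. clear s t a b f g \<and> clear s t a' b' f' g'"
proof -
  obtain s f f' where s: "s \<in> W" "f \<in> Mor C" "f' \<in> Mor C" "Dom C s = Cod L a" "Dom C f = Dom L a" "Dom C f' = Dom L a'" "Cod C f = Cod C s"
    "Cod C f' = Cod C s" "q s \<star> a = q f" "q s \<star> a' = q f'" using common_left[OF assms(1-3)] by blast
  obtain t g g' where t: "t \<in> W" "g \<in> Mor C" "g' \<in> Mor C" "Cod C t = Dom L b" "Cod C g = Cod L b" "Cod C g' = Cod L b'" "Dom C g = Dom C t"
    "Dom C g' = Dom C t" "b \<star> q t = q g" "b' \<star> q t = q g'" using common_right[OF assms(4-6)] by blast
  have "clear s t a b f g" "clear s t a' b' f' g'" using s t assms by (simp_all add: clear_def)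
  then show ?thesis by blast
qed

text \<open>The triple \<open>(a, \<delta>, b)\<close> stands for the extension \<open>a\<^sub>*b\<^sup>*\<mu>(\<delta>)\<close> from \<open>X\<close> to \<open>A\<close>.\<close>

definition Tset :: "'o => 'o => ('n \<times> 'e \<times> 'n) set"
  where "Tset X A = {(a, \<delta>, b). a \<in> Mor L \<and> Cod L a = A \<and> b \<in> Mor L \<and> Dom L b = X \<and> \<delta> \<in> Exts C (Cod L b) (Dom L a)}"

definition trel :: "'n \<times> 'e \<times> 'n => 'n \<times> 'e \<times> 'n => bool"
  where "trel = (\<lambda>(a, \<delta>, b) (a', \<delta>', b'). \<exists>s t f g f' g'. clear s t a b f g \<and> clear s t a' b' f' g' \<and>
           keq (Dom C t) (Cod C s) (ExtMap C g f \<delta>) (ExtMap C g' f' \<delta>'))"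

lemma clear_common:
  assumes "clear s t a b f g" "clear s' t' a' b' f' g'" "Cod L a = Cod L a'" "Dom L b = Dom L b'"
  shows "\<exists>u u' v v'. u \<in> W \<and> u' \<in> W \<and> v \<in> W \<and> v' \<in> W \<and> Dom C u = Cod C s \<and> Dom C u' = Cod C s' \<and> Cod C u = Cod C u' \<and>
     Cod C v = Dom C t \<and> Cod C v' = Dom C t' \<and> Dom C v = Dom C v' \<and> sim (u \<cdot> s) (u' \<cdot> s') \<and> sim (t \<cdot> v) (t' \<cdot> v')"
  using common_W_left[of s s'] common_W_right[of t t'] assms unfolding clear_def by metis

lemma clear_keq_ext:
  assumes c: "clear s t a b f g" "clear s t a' b' f' g'"
    and d: "\<delta> \<in> Exts C (Cod L b) (Dom L a)" "\<delta>' \<in> Exts C (Cod L b') (Dom L a')"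
    and k: "keq (Dom C t) (Cod C s) (ExtMap C g f \<delta>) (ExtMap C g' f' \<delta>')"
    and u: "u \<in> Mor C" "Dom C u = Cod C s" and v: "v \<in> Mor C" "Cod C v = Dom C t"
  shows "keq (Dom C v) (Cod C u) (ExtMap C (g \<cdot> v) (u \<cdot> f) \<delta>) (ExtMap C (g' \<cdot> v) (u \<cdot> f') \<delta>')"
proof -
  have e: "ExtMap C v u (ExtMap C g f \<delta>) = ExtMap C (g \<cdot> v) (u \<cdot> f) \<delta>"
    "ExtMap C v u (ExtMap C g' f' \<delta>') = ExtMap C (g' \<cdot> v) (u \<cdot> f') \<delta>'" using c d u v by (auto simp: clear_def)
  show ?thesis using keq_ExtMap[OF k v(1,2) u(1,2)] unfolding e .
qed

lemma clear_keq_same: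
  assumes c: "clear s t a b f g" "clear s t a b f' g'" and d: "\<delta> \<in> Exts C (Cod L b) (Dom L a)"
  shows "keq (Dom C t) (Cod C s) (ExtMap C g f \<delta>) (ExtMap C g' f' \<delta>)" using keq_sim[OF clear_sim[OF c], of \<delta>] c(1) d by (simp add: clear_def)

text \<open>The comparison of two triples does not depend on the denominators that were used to clear them, because
  any two choices have a common refinement and \<open>keq_reflect\<close> cancels it. Transitivity rests on this.\<close>

lemma trel_all:
  assumes r: "trel (a, \<delta>, b) (a', \<delta>', b')" and m: "(a, \<delta>, b) \<in> Tset X A" "(a', \<delta>', b') \<in> Tset X A"
    and c: "clear s t a b f g" "clear s t a' b' f' g'"
  shows "keq (Dom C t) (Cod C s) (ExtMap C g f \<delta>) (ExtMap C g' f' \<delta>')"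
proof -
  obtain s1 t1 f1 g1 f1' g1' where c1: "clear s1 t1 a b f1 g1" "clear s1 t1 a' b' f1' g1'"
    and k: "keq (Dom C t1) (Cod C s1) (ExtMap C g1 f1 \<delta>) (ExtMap C g1' f1' \<delta>')" using r unfolding trel_def by auto
  have d: "\<delta> \<in> Exts C (Cod L b) (Dom L a)" "\<delta>' \<in> Exts C (Cod L b') (Dom L a')" using m by (auto simp: Tset_def)
  obtain u u1 v v1 where u: "u \<in> W" "u1 \<in> W" "v \<in> W" "v1 \<in> W" "Dom C u = Cod C s" "Dom C u1 = Cod C s1" "Cod C u = Cod C u1"
    "Cod C v = Dom C t" "Cod C v1 = Dom C t1" "Dom C v = Dom C v1" "sim (u \<cdot> s) (u1 \<cdot> s1)" "sim (t \<cdot> v) (t1 \<cdot> v1)"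
    using clear_common[OF c(1) c1(1)] by auto
  let ?s = "u \<cdot> s" and ?t = "t \<cdot> v"
  note e = clear_extend[OF c(1) u(1,5) u(3,8)] clear_extend[OF c(2) u(1,5) u(3,8)]
  have e1: "clear ?s ?t a b (u1 \<cdot> f1) (g1 \<cdot> v1)" "clear ?s ?t a' b' (u1 \<cdot> f1') (g1' \<cdot> v1)"
    using clear_change[OF clear_extend[OF c1(1) u(2,6) u(4,9)] sim_sym[OF u(11)] sim_sym[OF u(12)]]
      clear_change[OF clear_extend[OF c1(2) u(2,6) u(4,9)] sim_sym[OF u(11)] sim_sym[OF u(12)]] by auto
  have st: "Dom C ?t = Dom C v" "Cod C ?s = Cod C u" using u c by (auto simp: clear_def)
  have k1: "keq (Dom C v) (Cod C u) (ExtMap C (g1 \<cdot> v1) (u1 \<cdot> f1) \<delta>) (ExtMap C (g1' \<cdot> v1) (u1 \<cdot> f1') \<delta>')"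
    using clear_keq_ext[OF c1 d k, of u1 v1] u by simp
  have k2: "keq (Dom C v) (Cod C u) (ExtMap C (g \<cdot> v) (u \<cdot> f) \<delta>) (ExtMap C (g1 \<cdot> v1) (u1 \<cdot> f1) \<delta>)"
    "keq (Dom C v) (Cod C u) (ExtMap C (g1' \<cdot> v1) (u1 \<cdot> f1') \<delta>') (ExtMap C (g' \<cdot> v) (u \<cdot> f') \<delta>')"
    using clear_keq_same[OF e(1) e1(1) d(1)] clear_keq_same[OF e1(2) e(2) d(2)] st by auto
  have k3: "keq (Dom C v) (Cod C u) (ExtMap C (g \<cdot> v) (u \<cdot> f) \<delta>) (ExtMap C (g' \<cdot> v) (u \<cdot> f') \<delta>')" by (rule keq_trans[OF keq_trans[OF k2(1) k1] k2(2)])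
  have x: "ExtMap C v u (ExtMap C g f \<delta>) = ExtMap C (g \<cdot> v) (u \<cdot> f) \<delta>"
    "ExtMap C v u (ExtMap C g' f' \<delta>') = ExtMap C (g' \<cdot> v) (u \<cdot> f') \<delta>'" using c d u by (auto simp: clear_def)
  have cr: "ExtMap C g f \<delta> \<in> Exts C (Dom C t) (Cod C s)" "ExtMap C g' f' \<delta>' \<in> Exts C (Dom C t) (Cod C s)"
    using c d by (auto simp: clear_def)
  show ?thesis by (rule keq_reflect[OF k3[folded x] u(1,3,8,5) cr])
qed

lemma trelI:
  "clear s t a b f g ==> clear s t a' b' f' g' ==> keq (Dom C t) (Cod C s) (ExtMap C g f \<delta>) (ExtMap C g' f' \<delta>')
   ==> trel (a, \<delta>, b) (a', \<delta>', b')" unfolding trel_def prod.case by blast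

lemma trel_refl: "\<tau> \<in> Tset X A ==> trel \<tau> \<tau>"
proof -
  obtain a \<delta> b where t: "\<tau> = (a, \<delta>, b)" by (cases \<tau>)
  assume "\<tau> \<in> Tset X A"
  then have m: "a \<in> Mor L" "b \<in> Mor L" "\<delta> \<in> Exts C (Cod L b) (Dom L a)" unfolding t by (auto simp: Tset_def)
  obtain s u f g where c: "clear s u a b f g" using clear_ex2[of a a b b] m by blast
  show ?thesis unfolding t by (rule trelI[OF c c clear_keq_same[OF c c m(3)]])
qed

lemma trel_sym: "trel \<tau> \<tau>' ==> trel \<tau>' \<tau>" unfolding trel_def by (cases \<tau>; cases \<tau>'; simp only: prod.case) (metis keq_sym)

lemma trel_trans:
  assumes r: "trel \<tau> \<tau>'" "trel \<tau>' \<tau>''" and m: "\<tau> \<in> Tset X A" "\<tau>' \<in> Tset X A" "\<tau>'' \<in> Tset X A"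
  shows "trel \<tau> \<tau>''"
proof -
  obtain a \<delta> b where t: "\<tau> = (a, \<delta>, b)" by (cases \<tau>)
  obtain a' \<delta>' b' where t': "\<tau>' = (a', \<delta>', b')" by (cases \<tau>')
  obtain a'' \<delta>'' b'' where t'': "\<tau>'' = (a'', \<delta>'', b'')" by (cases \<tau>'')
  obtain s u f g f' g' where c: "clear s u a b f g" "clear s u a' b' f' g'"
    and k: "keq (Dom C u) (Cod C s) (ExtMap C g f \<delta>) (ExtMap C g' f' \<delta>')" using r(1) unfolding trel_def t t' by auto
  obtain s1 u1 f1' g1' f1'' g1'' where c1: "clear s1 u1 a' b' f1' g1'" "clear s1 u1 a'' b'' f1'' g1''"
    and k1: "keq (Dom C u1) (Cod C s1) (ExtMap C g1' f1' \<delta>') (ExtMap C g1'' f1'' \<delta>'')" using r(2) unfolding trel_def t' t'' by auto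
  have d: "\<delta> \<in> Exts C (Cod L b) (Dom L a)" "\<delta>' \<in> Exts C (Cod L b') (Dom L a')"
    "\<delta>'' \<in> Exts C (Cod L b'') (Dom L a'')" using m unfolding t t' t'' by (auto simp: Tset_def)
  obtain w w1 v v1 where u: "w \<in> W" "w1 \<in> W" "v \<in> W" "v1 \<in> W" "Dom C w = Cod C s" "Dom C w1 = Cod C s1" "Cod C w = Cod C w1"
    "Cod C v = Dom C u" "Cod C v1 = Dom C u1" "Dom C v = Dom C v1" "sim (w \<cdot> s) (w1 \<cdot> s1)" "sim (u \<cdot> v) (u1 \<cdot> v1)"
    using clear_common[OF c(2) c1(1)] by auto
  let ?s = "w \<cdot> s" and ?t = "u \<cdot> v"
  note e = clear_extend[OF c(1) u(1,5) u(3,8)] clear_extend[OF c(2) u(1,5) u(3,8)]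
  have e1: "clear ?s ?t a' b' (w1 \<cdot> f1') (g1' \<cdot> v1)" "clear ?s ?t a'' b'' (w1 \<cdot> f1'') (g1'' \<cdot> v1)"
    using clear_change[OF clear_extend[OF c1(1) u(2,6) u(4,9)] sim_sym[OF u(11)] sim_sym[OF u(12)]]
      clear_change[OF clear_extend[OF c1(2) u(2,6) u(4,9)] sim_sym[OF u(11)] sim_sym[OF u(12)]] by auto
  have st: "Dom C ?t = Dom C v" "Cod C ?s = Cod C w" using u c by (auto simp: clear_def)
  have 1: "keq (Dom C v) (Cod C w) (ExtMap C (g \<cdot> v) (w \<cdot> f) \<delta>) (ExtMap C (g' \<cdot> v) (w \<cdot> f') \<delta>')" using clear_keq_ext[OF c d(1,2) k, of w v] u by simp
  have 2: "keq (Dom C v) (Cod C w) (ExtMap C (g' \<cdot> v) (w \<cdot> f') \<delta>') (ExtMap C (g1' \<cdot> v1) (w1 \<cdot> f1') \<delta>')"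
    using clear_keq_same[OF e(2) e1(1) d(2)] st by simp
  have 3: "keq (Dom C v) (Cod C w) (ExtMap C (g1' \<cdot> v1) (w1 \<cdot> f1') \<delta>') (ExtMap C (g1'' \<cdot> v1) (w1 \<cdot> f1'') \<delta>'')"
    using clear_keq_ext[OF c1 d(2,3) k1, of w1 v1] u by simp
  have "keq (Dom C ?t) (Cod C ?s) (ExtMap C (g \<cdot> v) (w \<cdot> f) \<delta>) (ExtMap C (g1'' \<cdot> v1) (w1 \<cdot> f1'') \<delta>'')"
    unfolding st by (rule keq_trans[OF keq_trans[OF 1 2] 3])
  then show ?thesis unfolding t t'' by (rule trelI[OF e(1) e1(2)])
qed

definition ecl :: "'o => 'o => 'n \<times> 'e \<times> 'n => ('n \<times> 'e \<times> 'n) set"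
  where "ecl X A \<tau> = {\<tau>' \<in> Tset X A. trel \<tau> \<tau>'}"

lemma ecl_eq_iff: "\<tau> \<in> Tset X A ==> \<tau>' \<in> Tset X A ==> ecl X A \<tau> = ecl X A \<tau>' \<longleftrightarrow> trel \<tau> \<tau>'"
  unfolding ecl_def using trel_refl[of _ X A] trel_sym trel_trans[of _ _ _ X A] by blast

text \<open>The choice of the triple does not matter, by \<open>trel_compose\<close>.\<close>

definition ExtMapL :: "'n => 'n => ('n \<times> 'e \<times> 'n) set => ('n \<times> 'e \<times> 'n) set"
  where "ExtMapL c a \<epsilon> = (case (SOME \<tau>. \<tau> \<in> \<epsilon>) of (a0, \<delta>, b0) => ecl (Dom L c) (Cod L a) (a \<star> a0, \<delta>, b0 \<star> c))"

lemma clear_compose: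
  assumes cl: "clear s t a b f g" and x: "x \<in> Mor L" "Dom L x = Cod L a" and y: "y \<in> Mor L" "Cod L y = Dom L b"
    and h: "s' \<in> W" "h \<in> Mor C" "Dom C h = Cod C s" "Dom C s' = Cod L x" "Cod C h = Cod C s'" "q s' \<star> x \<star> inv_mor L (q s) = q h"
    and k: "t' \<in> W" "k \<in> Mor C" "Cod C k = Dom C t" "Cod C t' = Dom L y" "Dom C k = Dom C t'" "inv_mor L (q t) \<star> y \<star> q t' = q k"
  shows "clear s' t' (x \<star> a) (b \<star> y) (h \<cdot> f) (g \<cdot> k)"
proof -
  have m: "a \<in> Mor L" "b \<in> Mor L" "s \<in> W" "t \<in> W" "f \<in> Mor C" "g \<in> Mor C"
    "Dom C s = Cod L a" "Cod C t = Dom L b" "Dom C f = Dom L a" "Cod C f = Cod C s" "Cod C g = Cod L b" "Dom C g = Dom C t"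
    and e: "q s \<star> a = q f" "b \<star> q t = q g" using cl by (auto simp: clear_def)
  have "q (h \<cdot> f) = (q s' \<star> x \<star> inv_mor L (q s)) \<star> (q s \<star> a)" unfolding h(6) e using m h(1-5) by (simp add: q_Cmp)
  also have "... = q s' \<star> x \<star> a" using m h(1-5) x by simp
  finally have 1: "q s' \<star> x \<star> a = q (h \<cdot> f)" ..
  have "q (g \<cdot> k) = (b \<star> q t) \<star> (inv_mor L (q t) \<star> y \<star> q t')" unfolding k(6) e using m k(1-5) by (simp add: q_Cmp)
  also have "... = (b \<star> y) \<star> q t'" using m k(1-5) y by simp
  finally have 2: "(b \<star> y) \<star> q t' = q (g \<cdot> k)" ..
  show ?thesis unfolding clear_def using m h(1-5) k(1-5) x y 1 2 by simp
qed

lemma move_left: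
  assumes "s \<in> W" "x \<in> Mor L" "Dom L x = Dom C s"
  shows "\<exists>s' h. s' \<in> W \<and> h \<in> Mor C \<and> Dom C h = Cod C s \<and> Dom C s' = Cod L x \<and> Cod C h = Cod C s' \<and> q s' \<star> x \<star> inv_mor L (q s) = q h"
  using frac_left[of "x \<star> inv_mor L (q s)"] assms by auto

lemma move_right:
  assumes "t \<in> W" "y \<in> Mor L" "Cod L y = Cod C t"
  shows "\<exists>t' k. t' \<in> W \<and> k \<in> Mor C \<and> Cod C k = Dom C t \<and> Cod C t' = Dom L y \<and> Dom C k = Dom C t' \<and> inv_mor L (q t) \<star> y \<star> q t' = q k"
proof -
  have m: "inv_mor L (q t) \<star> y \<in> Mor L" "Dom L (inv_mor L (q t) \<star> y) = Dom L y" "Cod L (inv_mor L (q t) \<star> y) = Dom C t" using assms by auto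
  obtain t' k where k: "t' \<in> W" "k \<in> Mor C" "Cod C k = Dom C t" "Cod C t' = Dom L y" "Dom C k = Dom C t'"
    "(inv_mor L (q t) \<star> y) \<star> q t' = q k" using frac_right[OF m(1)] m by auto
  have "inv_mor L (q t) \<star> y \<star> q t' = q k" unfolding k(6)[symmetric] using assms k(1,4) by simp
  then show ?thesis using k(1-5) by blast
qed

lemma trel_compose:
  assumes r: "trel (a, \<delta>, b) (a', \<delta>', b')" and m: "(a, \<delta>, b) \<in> Tset X A" "(a', \<delta>', b') \<in> Tset X A"
    and x: "x \<in> Mor L" "Dom L x = A" and y: "y \<in> Mor L" "Cod L y = X"
  shows "trel (x \<star> a, \<delta>, b \<star> y) (x \<star> a', \<delta>', b' \<star> y)"
proof -
  obtain s t f g f' g' where c: "clear s t a b f g" "clear s t a' b' f' g'"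
    and kq: "keq (Dom C t) (Cod C s) (ExtMap C g f \<delta>) (ExtMap C g' f' \<delta>')" using r unfolding trel_def by auto
  have d: "\<delta> \<in> Exts C (Cod L b) (Dom L a)" "\<delta>' \<in> Exts C (Cod L b') (Dom L a')"
    and e: "Cod L a = A" "Cod L a' = A" "Dom L b = X" "Dom L b' = X" using m by (auto simp: Tset_def)
  have st: "s \<in> W" "t \<in> W" "Dom C s = A" "Cod C t = X" using c(1) e by (auto simp: clear_def)
  obtain s' h where h: "s' \<in> W" "h \<in> Mor C" "Dom C h = Cod C s" "Dom C s' = Cod L x" "Cod C h = Cod C s'" "q s' \<star> x \<star> inv_mor L (q s) = q h"
    using move_left[of s x] x st by auto
  obtain t' k where k: "t' \<in> W" "k \<in> Mor C" "Cod C k = Dom C t" "Cod C t' = Dom L y" "Dom C k = Dom C t'" "inv_mor L (q t) \<star> y \<star> q t' = q k"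
    using move_right[of t y] y st by auto
  have "keq (Dom C t') (Cod C s') (ExtMap C (g \<cdot> k) (h \<cdot> f) \<delta>) (ExtMap C (g' \<cdot> k) (h \<cdot> f') \<delta>')"
    using clear_keq_ext[OF c d kq h(2,3) k(2,3)] h(5) k(5) by simp
  then show ?thesis using trelI[OF clear_compose[OF c(1) _ _ _ _ h k] clear_compose[OF c(2) _ _ _ _ h k]] x y e by simp
qed

lemma Tset_compose: "(a, \<delta>, b) \<in> Tset X A ==> x \<in> Mor L ==> Dom L x = A ==> y \<in> Mor L ==> Cod L y = X
   ==> (x \<star> a, \<delta>, b \<star> y) \<in> Tset (Dom L y) (Cod L x)" by (auto simp: Tset_def)

lemma ExtMapL_ecl:
  assumes m: "(a, \<delta>, b) \<in> Tset X A" and x: "x \<in> Mor L" "Dom L x = A" and y: "y \<in> Mor L" "Cod L y = X"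
  shows "ExtMapL y x (ecl X A (a, \<delta>, b)) = ecl (Dom L y) (Cod L x) (x \<star> a, \<delta>, b \<star> y)"
proof -
  have "(a, \<delta>, b) \<in> ecl X A (a, \<delta>, b)" using m trel_refl[OF m] by (simp add: ecl_def)
  then have "(SOME \<tau>. \<tau> \<in> ecl X A (a, \<delta>, b)) \<in> ecl X A (a, \<delta>, b)" by (rule someI)
  moreover obtain a' \<delta>' b' where e: "(SOME \<tau>. \<tau> \<in> ecl X A (a, \<delta>, b)) = (a', \<delta>', b')" by (cases "SOME \<tau>. \<tau> \<in> ecl X A (a, \<delta>, b)")
  ultimately have m': "(a', \<delta>', b') \<in> Tset X A" and r: "trel (a, \<delta>, b) (a', \<delta>', b')" by (auto simp: ecl_def)
  have "ecl (Dom L y) (Cod L x) (x \<star> a, \<delta>, b \<star> y) = ecl (Dom L y) (Cod L x) (x \<star> a', \<delta>', b' \<star> y)"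
    using ecl_eq_iff[OF Tset_compose[OF m x y] Tset_compose[OF m' x y]] trel_compose[OF r m m' x y] by simp
  then show ?thesis unfolding ExtMapL_def e by simp
qed

definition muL :: "'o => 'o => 'e => ('n \<times> 'e \<times> 'n) set"
  where "muL X A \<delta> = ecl X A (Idt L A, \<delta>, Idt L X)"

definition eset :: "'o => 'o => ('n \<times> 'e \<times> 'n) set set"
  where "eset X A = ecl X A ` Tset X A"

text \<open>The extension \<open>(s\<inverse>)\<^sub>*(t\<inverse>)\<^sup>*\<mu>(\<delta>)\<close>. For fixed \<open>(s, t)\<close> these form a quotient of a group of \<open>C\<close>,
  and this is how the sum of two classes is defined.\<close>

definition efrac :: "'m \<times> 'm => 'e => ('n \<times> 'e \<times> 'n) set"
  where "efrac = (\<lambda>(s, t) \<delta>. ExtMapL (inv_mor L (q t)) (inv_mor L (q s)) (muL (Dom C t) (Cod C s) \<delta>))"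

definition extL :: "'o => 'o => ('n \<times> 'e \<times> 'n) set monoid"
  where "extL X A = \<lparr>carrier = eset X A,
     monoid.mult = union_mult {(s, t). s \<in> W \<and> t \<in> W \<and> Dom C s = A \<and> Cod C t = X} (\<lambda>(s, t). Ext C (Dom C t) (Cod C s)) efrac,
     one = muL X A \<one>\<^bsub>Ext C X A\<^esub>\<rparr>"

lemma Tset_Idt: "\<delta> \<in> Exts C X A ==> X \<in> Ob C ==> A \<in> Ob C ==> (Idt L A, \<delta>, Idt L X) \<in> Tset X A" by (simp add: Tset_def)

lemma ecl_muL:
  assumes m: "(a, \<delta>, b) \<in> Tset X A"
  shows "ecl X A (a, \<delta>, b) = ExtMapL b a (muL (Cod L b) (Dom L a) \<delta>)"
proof -
  have h: "a \<in> Mor L" "Cod L a = A" "b \<in> Mor L" "Dom L b = X" "\<delta> \<in> Exts C (Cod L b) (Dom L a)" using m by (auto simp: Tset_def)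
  show ?thesis unfolding muL_def using ExtMapL_ecl[OF Tset_Idt[OF h(5)], of a b] h by simp
qed

lemma eset_cases:
  assumes "\<epsilon> \<in> eset X A"
  obtains a \<delta> b where "(a, \<delta>, b) \<in> Tset X A" "\<epsilon> = ecl X A (a, \<delta>, b)" using assms unfolding eset_def by auto

lemma ExtMapL_closed: "\<epsilon> \<in> eset X A ==> x \<in> Mor L ==> Dom L x = A ==> y \<in> Mor L ==> Cod L y = X
   ==> ExtMapL y x \<epsilon> \<in> eset (Dom L y) (Cod L x)" by (elim eset_cases) (simp add: ExtMapL_ecl, simp add: eset_def Tset_compose)

lemma ExtMapL_ExtMapL:
  assumes "\<epsilon> \<in> eset X A" and x: "x \<in> Mor L" "Dom L x = A" and y: "y \<in> Mor L" "Cod L y = X"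
    and x': "x' \<in> Mor L" "Dom L x' = Cod L x" and y': "y' \<in> Mor L" "Cod L y' = Dom L y"
  shows "ExtMapL y' x' (ExtMapL y x \<epsilon>) = ExtMapL (y \<star> y') (x' \<star> x) \<epsilon>"
proof -
  obtain a \<delta> b where m: "(a, \<delta>, b) \<in> Tset X A" "\<epsilon> = ecl X A (a, \<delta>, b)" using assms(1) by (rule eset_cases)
  have ab: "a \<in> Mor L" "Cod L a = A" "b \<in> Mor L" "Dom L b = X" using m by (auto simp: Tset_def)
  have "ExtMapL (y \<star> y') (x' \<star> x) \<epsilon> = ecl (Dom L y') (Cod L x') ((x' \<star> x) \<star> a, \<delta>, b \<star> y \<star> y')"
    unfolding m(2) using ExtMapL_ecl[OF m(1), of "x' \<star> x" "y \<star> y'"] x y x' y' by simp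
  moreover have "ExtMapL y' x' (ExtMapL y x \<epsilon>) = ecl (Dom L y') (Cod L x') (x' \<star> x \<star> a, \<delta>, (b \<star> y) \<star> y')"
    unfolding m(2) using ExtMapL_ecl[OF m(1) x y] ExtMapL_ecl[OF Tset_compose[OF m(1) x y] x' y'] by simp
  ultimately show ?thesis using ab x y x' y' by simp
qed

lemma ExtMapL_Idt: "\<epsilon> \<in> eset X A ==> X \<in> Ob C ==> A \<in> Ob C ==> ExtMapL (Idt L X) (Idt L A) \<epsilon> = \<epsilon>"
  by (elim eset_cases) (auto simp: ExtMapL_ecl Tset_def)

lemma muL_closed: "\<delta> \<in> Exts C X A ==> X \<in> Ob C ==> A \<in> Ob C ==> muL X A \<delta> \<in> eset X A" by (simp add: muL_def eset_def Tset_Idt)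

lemma clear_Idt: "a = q f ==> b = q g ==> f \<in> Mor C ==> g \<in> Mor C ==> clear (Idt C (Cod C f)) (Idt C (Dom C g)) a b f g" by (simp add: clear_def)

text \<open>The kernel of the canonical map consists of the killed extensions: identities have themselves as
  numerators, so no denominator needs clearing.\<close>

lemma muL_eq_iff:
  assumes "\<delta> \<in> Exts C X A" "\<delta>' \<in> Exts C X A" "X \<in> Ob C" "A \<in> Ob C"
  shows "muL X A \<delta> = muL X A \<delta>' \<longleftrightarrow> keq X A \<delta> \<delta>'"
proof -
  have c: "clear (Idt C A) (Idt C X) (Idt L A) (Idt L X) (Idt C A) (Idt C X)"
    using clear_Idt[of "Idt L A" "Idt C A" "Idt L X" "Idt C X"] assms by simp
  have "trel (Idt L A, \<delta>, Idt L X) (Idt L A, \<delta>', Idt L X) \<longleftrightarrow> keq X A \<delta> \<delta>'"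
    using trel_all[OF _ Tset_Idt[OF assms(1,3,4)] Tset_Idt[OF assms(2,3,4)] c c] trelI[OF c c, of \<delta> \<delta>'] assms by auto
  then show ?thesis unfolding muL_def using ecl_eq_iff[OF Tset_Idt Tset_Idt] assms by blast
qed

lemma muL_ExtMap:
  assumes "c \<in> Mor C" "a \<in> Mor C" "\<delta> \<in> Exts C (Cod C c) (Dom C a)"
  shows "muL (Dom C c) (Cod C a) (ExtMap C c a \<delta>) = ExtMapL (q c) (q a) (muL (Cod C c) (Dom C a) \<delta>)"
proof -
  have m: "(Idt L (Dom C a), \<delta>, Idt L (Cod C c)) \<in> Tset (Cod C c) (Dom C a)" using Tset_Idt assms by simp
  have 1: "ExtMapL (q c) (q a) (muL (Cod C c) (Dom C a) \<delta>) = ecl (Dom C c) (Cod C a) (q a, \<delta>, q c)"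
    unfolding muL_def using ExtMapL_ecl[OF m, of "q a" "q c"] assms by simp
  have c: "clear (Idt C (Cod C a)) (Idt C (Dom C c)) (q a) (q c) a c"
    "clear (Idt C (Cod C a)) (Idt C (Dom C c)) (Idt L (Cod C a)) (Idt L (Dom C c)) (Idt C (Cod C a)) (Idt C (Dom C c))"
    using assms by (simp_all add: clear_def)
  have k: "ExtMap C c a \<delta> \<in> Exts C (Dom C c) (Cod C a)" using assms by simp
  have "trel (Idt L (Cod C a), ExtMap C c a \<delta>, Idt L (Dom C c)) (q a, \<delta>, q c)" by (rule trelI[OF c(2,1)]) (use assms k in \<open>simp add: keq_refl\<close>)
  then show ?thesis unfolding 1 unfolding muL_def using ecl_eq_iff[OF Tset_Idt[OF k], of "(q a, \<delta>, q c)"] assms by (simp add: Tset_def)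
qed

lemma muL_surj:
  assumes "\<epsilon> \<in> eset X A" "X \<in> Ob C" "A \<in> Ob C"
  shows "\<exists>s\<in>W. \<exists>t\<in>W. \<exists>\<delta>\<in>Exts C (Dom C t) (Cod C s). Dom C s = A \<and> Cod C t = X \<and>
          ExtMapL (q t) (q s) \<epsilon> = muL (Dom C t) (Cod C s) \<delta>"
proof -
  obtain a \<delta> b where m: "(a, \<delta>, b) \<in> Tset X A" "\<epsilon> = ecl X A (a, \<delta>, b)" using assms(1) by (rule eset_cases)
  have ab: "a \<in> Mor L" "Cod L a = A" "b \<in> Mor L" "Dom L b = X" "\<delta> \<in> Exts C (Cod L b) (Dom L a)" using m by (auto simp: Tset_def)
  obtain s t f g where c: "clear s t a b f g" using clear_ex2[of a a b b] ab by blast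
  then have h: "s \<in> W" "t \<in> W" "f \<in> Mor C" "g \<in> Mor C"
    "Dom C s = A" "Cod C t = X" "Dom C f = Dom L a" "Cod C f = Cod C s" "Cod C g = Cod L b" "Dom C g = Dom C t"
    "q s \<star> a = q f" "b \<star> q t = q g" using ab by (auto simp: clear_def)
  have "ExtMapL (q t) (q s) \<epsilon> = ecl (Dom C t) (Cod C s) (q f, \<delta>, q g)" unfolding m(2) using ExtMapL_ecl[OF m(1), of "q s" "q t"] h by simp
  also have "... = ExtMapL (q g) (q f) (muL (Cod C g) (Dom C f) \<delta>)" using ecl_muL[of "q f" \<delta> "q g" "Dom C t" "Cod C s"] h ab by (simp add: Tset_def)
  also have "... = muL (Dom C t) (Cod C s) (ExtMap C g f \<delta>)" using muL_ExtMap[of g f \<delta>] h ab by simp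
  finally show ?thesis using h ab by (intro bexI[of _ s] bexI[of _ t] bexI[of _ "ExtMap C g f \<delta>"]) simp_all
qed

lemma efrac_closed: "s \<in> W ==> t \<in> W ==> \<delta> \<in> Exts C (Dom C t) (Cod C s) ==> efrac (s, t) \<delta> \<in> eset (Cod C t) (Dom C s)"
  unfolding efrac_def using ExtMapL_closed[OF muL_closed, of \<delta> "Dom C t" "Cod C s" "inv_mor L (q s)" "inv_mor L (q t)"] by simp

lemma efrac_eqI:
  assumes "s \<in> W" "t \<in> W" "\<epsilon> \<in> eset X A" "Dom C s = A" "Cod C t = X" "ExtMapL (q t) (q s) \<epsilon> = muL (Dom C t) (Cod C s) \<delta>"
  shows "\<epsilon> = efrac (s, t) \<delta>"
proof -
  have o: "X \<in> Ob C" "A \<in> Ob C" using assms by auto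
  have "efrac (s, t) \<delta> = ExtMapL (inv_mor L (q t)) (inv_mor L (q s)) (ExtMapL (q t) (q s) \<epsilon>)" by (simp add: efrac_def assms(6))
  also have "... = \<epsilon>" using ExtMapL_ExtMapL[OF assms(3), of "q s" "q t" "inv_mor L (q s)" "inv_mor L (q t)"]
      ExtMapL_Idt[OF assms(3) o] assms(1,2,4,5) by simp
  finally show ?thesis ..
qed

lemma ExtMapL_efrac:
  assumes "s \<in> W" "t \<in> W" "\<delta> \<in> Exts C (Dom C t) (Cod C s)"
  shows "ExtMapL (q t) (q s) (efrac (s, t) \<delta>) = muL (Dom C t) (Cod C s) \<delta>"
proof -
  have m: "muL (Dom C t) (Cod C s) \<delta> \<in> eset (Dom C t) (Cod C s)" using muL_closed assms by simp
  show ?thesis unfolding efrac_def using ExtMapL_ExtMapL[OF m, of "inv_mor L (q s)" "inv_mor L (q t)" "q s" "q t"] ExtMapL_Idt[OF m] assms by simp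
qed

text \<open>A morphism that acts on a fraction is moved past the denominators \<open>s\<close>, \<open>t\<close> with \<open>move_left\<close> and
  \<open>move_right\<close>; on the new fraction it acts through morphisms of \<open>C\<close>.\<close>

lemma ExtMapL_efrac_fraction:
  assumes s: "s \<in> W" "t \<in> W" "\<delta> \<in> Exts C (Dom C t) (Cod C s)" and x: "x \<in> Mor L" "Dom L x = Dom C s"
    and y: "y \<in> Mor L" "Cod L y = Cod C t"
    and h: "s' \<in> W" "h \<in> Mor C" "Dom C h = Cod C s" "Dom C s' = Cod L x" "Cod C h = Cod C s'" "q s' \<star> x \<star> inv_mor L (q s) = q h"
    and k: "t' \<in> W" "k \<in> Mor C" "Cod C k = Dom C t" "Cod C t' = Dom L y" "Dom C k = Dom C t'" "inv_mor L (q t) \<star> y \<star> q t' = q k"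
  shows "ExtMapL y x (efrac (s, t) \<delta>) = efrac (s', t') (ExtMap C k h \<delta>)"
proof (rule efrac_eqI[OF h(1) k(1)])
  have e: "efrac (s, t) \<delta> \<in> eset (Cod C t) (Dom C s)" using efrac_closed s by simp
  then show "ExtMapL y x (efrac (s, t) \<delta>) \<in> eset (Dom L y) (Cod L x)" using ExtMapL_closed x y by simp
  have m: "muL (Dom C t) (Cod C s) \<delta> \<in> eset (Dom C t) (Cod C s)" using muL_closed s by simp
  have "ExtMapL (q t') (q s') (ExtMapL y x (efrac (s, t) \<delta>)) = ExtMapL (y \<star> q t') (q s' \<star> x) (efrac (s, t) \<delta>)"
    by (rule ExtMapL_ExtMapL[OF e]) (use x y h(1-5) k(1-5) in simp_all)
  also have "... = ExtMapL (inv_mor L (q t) \<star> y \<star> q t') ((q s' \<star> x) \<star> inv_mor L (q s)) (muL (Dom C t) (Cod C s) \<delta>)"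
    unfolding efrac_def prod.case by (rule ExtMapL_ExtMapL[OF m]) (use s(1,2) x y h(1-5) k(1-5) in simp_all)
  also have "(q s' \<star> x) \<star> inv_mor L (q s) = q h" using h x s(1) by simp
  also have "ExtMapL (inv_mor L (q t) \<star> y \<star> q t') (q h) (muL (Dom C t) (Cod C s) \<delta>) = muL (Dom C t') (Cod C s') (ExtMap C k h \<delta>)"
    unfolding k(6) using muL_ExtMap[of k h \<delta>] s h(2,3,5) k(2,3,5) by simp
  finally show "ExtMapL (q t') (q s') (ExtMapL y x (efrac (s, t) \<delta>)) = muL (Dom C t') (Cod C s') (ExtMap C k h \<delta>)" .
qed (use h(4) k(4) in simp_all)

lemma efrac_sim: "sim s s' ==> sim t t' ==> efrac (s, t) \<delta> = efrac (s', t') \<delta>" using sim_q[of s s'] sim_q[of t t'] by (simp add: efrac_def sim_def)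

lemma efrac_scale:
  assumes s: "s \<in> W" "t \<in> W" "\<delta> \<in> Exts C (Dom C t) (Cod C s)" and u: "u \<in> W" "Dom C u = Cod C s" and v: "v \<in> W" "Cod C v = Dom C t"
  shows "efrac (u \<cdot> s, t \<cdot> v) (ExtMap C v u \<delta>) = efrac (s, t) \<delta>"
proof -
  have e: "efrac (s, t) \<delta> \<in> eset (Cod C t) (Dom C s)" using efrac_closed s by simp
  have "ExtMapL (Idt L (Cod C t)) (Idt L (Dom C s)) (efrac (s, t) \<delta>) = efrac (u \<cdot> s, t \<cdot> v) (ExtMap C v u \<delta>)"
    by (rule ExtMapL_efrac_fraction[OF s]) (use s u v W_Cmp in \<open>simp_all add: q_Cmp\<close>)
  then show ?thesis using ExtMapL_Idt[OF e] s by simp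
qed

lemma ext_union:
  assumes o: "X \<in> Ob C" "A \<in> Ob C"
  shows "directed_union {(s, t). s \<in> W \<and> t \<in> W \<and> Dom C s = A \<and> Cod C t = X} (\<lambda>(s, t). Ext C (Dom C t) (Cod C s)) efrac (eset X A)"
    (is "directed_union ?I ?G _ _")
proof (rule directed_union.intro)
  fix i assume i: "i \<in> ?I"
  then obtain s t where s: "i = (s, t)" "s \<in> W" "t \<in> W" "Dom C s = A" "Cod C t = X" by auto
  show "comm_group (?G i)" unfolding s(1) using C.Ext_grp s by simp
  fix \<delta> assume "\<delta> \<in> carrier (?G i)"
  then have d: "\<delta> \<in> Exts C (Dom C t) (Cod C s)" unfolding s(1) by simp
  show "efrac i \<delta> \<in> eset X A" using efrac_closed[OF s(2,3) d] s by simp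
  fix \<delta>' \<theta> assume "\<delta>' \<in> carrier (?G i)" "\<theta> \<in> carrier (?G i)" and e: "efrac i \<delta> = efrac i \<delta>'"
  then have d': "\<delta>' \<in> Exts C (Dom C t) (Cod C s)" "\<theta> \<in> Exts C (Dom C t) (Cod C s)" unfolding s(1) by auto
  have st: "Dom C t \<in> Ob C" "Cod C s \<in> Ob C" using s by auto
  have "muL (Dom C t) (Cod C s) \<delta> = muL (Dom C t) (Cod C s) \<delta>'"
    using ExtMapL_efrac[OF s(2,3) d] ExtMapL_efrac[OF s(2,3) d'(1)] e unfolding s(1) by metis
  then have "keq (Dom C t) (Cod C s) \<delta> \<delta>'" using muL_eq_iff[OF d d'(1) st] by simp
  then have "keq (Dom C t) (Cod C s) (\<delta> \<otimes>\<^bsub>Ext C (Dom C t) (Cod C s)\<^esub> \<theta>) (\<delta>' \<otimes>\<^bsub>Ext C (Dom C t) (Cod C s)\<^esub> \<theta>)" by (rule keq_mult[OF _ d'(2)])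
  then have "muL (Dom C t) (Cod C s) (\<delta> \<otimes>\<^bsub>Ext C (Dom C t) (Cod C s)\<^esub> \<theta>) = muL (Dom C t) (Cod C s) (\<delta>' \<otimes>\<^bsub>Ext C (Dom C t) (Cod C s)\<^esub> \<theta>)"
    using muL_eq_iff[of "\<delta> \<otimes>\<^bsub>Ext C (Dom C t) (Cod C s)\<^esub> \<theta>" "Dom C t" "Cod C s" "\<delta>' \<otimes>\<^bsub>Ext C (Dom C t) (Cod C s)\<^esub> \<theta>"] d d' st by simp
  then show "efrac i (\<delta> \<otimes>\<^bsub>?G i\<^esub> \<theta>) = efrac i (\<delta>' \<otimes>\<^bsub>?G i\<^esub> \<theta>)" unfolding s(1) by (simp add: efrac_def)
next
  fix m assume m: "m \<in> eset X A"
  obtain s t \<delta> where s: "s \<in> W" "t \<in> W" "\<delta> \<in> Exts C (Dom C t) (Cod C s)" "Dom C s = A" "Cod C t = X"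
    "ExtMapL (q t) (q s) m = muL (Dom C t) (Cod C s) \<delta>" using muL_surj[OF m o] by blast
  then show "\<exists>i\<in>?I. \<exists>g\<in>carrier (?G i). m = efrac i g" using efrac_eqI[OF s(1,2) m s(4,5,6)] by (intro bexI[of _ "(s, t)"] bexI[of _ \<delta>]) auto
next
  fix i j assume "i \<in> ?I" "j \<in> ?I"
  then obtain s t s' t' where s: "i = (s, t)" "s \<in> W" "t \<in> W" "Dom C s = A" "Cod C t = X"
    and s': "j = (s', t')" "s' \<in> W" "t' \<in> W" "Dom C s' = A" "Cod C t' = X" by auto
  obtain u u' where u: "u \<in> W" "u' \<in> W" "Dom C u = Cod C s" "Dom C u' = Cod C s'" "Cod C u = Cod C u'" "sim (u \<cdot> s) (u' \<cdot> s')"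
    using common_W_left[of s s'] s s' by auto
  obtain v v' where v: "v \<in> W" "v' \<in> W" "Cod C v = Dom C t" "Cod C v' = Dom C t'" "Dom C v = Dom C v'" "sim (t \<cdot> v) (t' \<cdot> v')"
    using common_W_right[of t t'] s s' by auto
  let ?k = "(u \<cdot> s, t \<cdot> v)"
  have k: "?k \<in> ?I" using W_Cmp u v s by simp
  have h: "ExtMap C v u \<in> hom (?G i) (?G ?k)" "ExtMap C v' u' \<in> hom (?G j) (?G ?k)"
    using C.ExtMap_hom[of v "Dom C v" "Dom C t" u "Cod C s" "Cod C u"] C.ExtMap_hom[of v' "Dom C v" "Dom C t'" u' "Cod C s'" "Cod C u"]
      s s' u v by (simp_all add: Hom_iff)
  have "efrac ?k (ExtMap C v u g) = efrac i g" if "g \<in> carrier (?G i)" for g using efrac_scale[of s t g u v] that s u v by simp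
  moreover have "efrac ?k (ExtMap C v' u' g) = efrac j g" if "g \<in> carrier (?G j)" for g
    using efrac_scale[of s' t' g u' v'] efrac_sim[OF u(6) v(6)] that s' u v by simp
  ultimately show "\<exists>k\<in>?I. \<exists>u\<in>hom (?G i) (?G k). \<exists>v\<in>hom (?G j) (?G k).
       (\<forall>g\<in>carrier (?G i). efrac k (u g) = efrac i g) \<and> (\<forall>g\<in>carrier (?G j). efrac k (v g) = efrac j g)"
    by (intro bexI[OF _ k] bexI[OF _ h(1)] bexI[OF _ h(2)]) blast
qed

lemma efrac_Idt: "X \<in> Ob C ==> A \<in> Ob C ==> \<delta> \<in> Exts C X A ==> efrac (Idt C A, Idt C X) \<delta> = muL X A \<delta>"
  using ExtMapL_Idt[OF muL_closed, of \<delta> X A] by (simp add: efrac_def)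

lemma extL_group: "X \<in> Ob C ==> A \<in> Ob C ==> comm_group (extL X A)" unfolding extL_def
  by (rule directed_union.comm_group_union[OF ext_union, of _ _ "(Idt C A, Idt C X)"]) (simp_all add: efrac_Idt)

lemma extL_mult:
  assumes "s \<in> W" "t \<in> W" "\<delta> \<in> Exts C (Dom C t) (Cod C s)" "\<delta>' \<in> Exts C (Dom C t) (Cod C s)"
  shows "efrac (s, t) \<delta> \<otimes>\<^bsub>extL (Cod C t) (Dom C s)\<^esub> efrac (s, t) \<delta>' = efrac (s, t) (\<delta> \<otimes>\<^bsub>Ext C (Dom C t) (Cod C s)\<^esub> \<delta>')"
  unfolding extL_def using directed_union.union_mult_rho[OF ext_union, of "Cod C t" "Dom C s" "(s, t)" \<delta> \<delta>'] assms by simp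

lemma eset_common:
  assumes "\<epsilon> \<in> eset X A" "\<epsilon>' \<in> eset X A" "X \<in> Ob C" "A \<in> Ob C"
  shows "\<exists>s t \<delta> \<delta>'. s \<in> W \<and> t \<in> W \<and> Dom C s = A \<and> Cod C t = X \<and> \<delta> \<in> Exts C (Dom C t) (Cod C s) \<and>
     \<delta>' \<in> Exts C (Dom C t) (Cod C s) \<and> \<epsilon> = efrac (s, t) \<delta> \<and> \<epsilon>' = efrac (s, t) \<delta>'"
  using directed_union.common_index[OF ext_union[OF assms(3,4)] assms(1,2)] by auto

end

section \<open>The extriangulated structure on the category of fractions\<close>

lemma comm_group_cong:
  assumes "comm_group G" "carrier H = carrier G" "\<one>\<^bsub>H\<^esub> = \<one>\<^bsub>G\<^esub>"
    "\<And>x y. x \<in> carrier G ==> y \<in> carrier G ==> x \<otimes>\<^bsub>H\<^esub> y = x \<otimes>\<^bsub>G\<^esub> y"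
  shows "comm_group H"
proof -
  interpret G: comm_group G by fact
  show ?thesis by (rule comm_groupI) (auto simp: assms(2-4) G.m_ac intro: bexI[of _ "inv\<^bsub>G\<^esub> _"])
qed

context ideal_localization
begin

text \<open>The realization is a parameter, because the realization of \<open>loc_cat\<close> is stated by means of the
  remaining structure of the same record.\<close>

definition ext_cat_of :: "('o => 'o => ('n \<times> 'e \<times> 'n) set => ('n \<times> 'n) set) => ('o, 'n, ('n \<times> 'e \<times> 'n) set) ext_cat"
  where "ext_cat_of r = \<lparr>Ob = Ob L, Mor = Mor L, Dom = Dom L, Cod = Cod L, Idt = Idt L, Cmp = Cmp L,
    Add = addL, Zero = (\<lambda>X Y. q (Zero C X Y)), Ext = extL, ExtMap = ExtMapL, Real = r\<rparr>"

definition loc_cat :: "('o, 'n, ('n \<times> 'e \<times> 'n) set) ext_cat"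
  where "loc_cat = ext_cat_of (\<lambda>X A \<epsilon>. {(\<xi>, \<eta>). \<exists>B. loc_tri C (ext_cat_of (\<lambda>_ _ _. {})) q muL A B X \<xi> \<eta> \<epsilon>})"

lemma loc_cat_simps [simp]:
  "Ob loc_cat = Ob C" "Mor loc_cat = Mor L" "Dom loc_cat = Dom L" "Cod loc_cat = Cod L" "Idt loc_cat = Idt L"
  "Cmp loc_cat = Cmp L" "Add loc_cat = addL" "Zero loc_cat X Y = q (Zero C X Y)" "Ext loc_cat = extL" "ExtMap loc_cat = ExtMapL"
  by (simp_all add: loc_cat_def ext_cat_of_def)

lemma Hom_loc_cat [simp]: "Hom loc_cat X Y = Hom L X Y" by (simp add: Hom_def)

lemma isomorphism_loc_cat [simp]: "isomorphism loc_cat f = isomorphism L f" "inv_mor loc_cat f = inv_mor L f"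
  by (simp_all add: isomorphism_def inverse_pair_def inv_mor_def)

lemma loc_tri_loc_cat: "loc_tri C (ext_cat_of (\<lambda>_ _ _. {})) q muL = loc_tri C loc_cat q muL"
  by (simp add: fun_eq_iff loc_tri_def isomorphism_def inverse_pair_def inv_mor_def Hom_def ext_cat_of_def loc_cat_def)

lemma Real_loc_cat: "Real loc_cat X A \<epsilon> = {(\<xi>, \<eta>). \<exists>B. loc_tri C loc_cat q muL A B X \<xi> \<eta> \<epsilon>}"
  unfolding loc_tri_loc_cat[symmetric] by (simp add: loc_cat_def ext_cat_of_def)

lemma category_loc_cat: "category loc_cat"
proof
  show "f \<in> Hom loc_cat X Y ==> g \<in> Hom loc_cat Y Z ==> h \<in> Hom loc_cat Z V
     ==> (h \<cdot>\<^bsub>loc_cat\<^esub> g) \<cdot>\<^bsub>loc_cat\<^esub> f = h \<cdot>\<^bsub>loc_cat\<^esub> g \<cdot>\<^bsub>loc_cat\<^esub> f" for f g h X Y Z V by (simp add: Hom_iff)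
qed (auto simp: Hom_iff)

lemma hom_grp_loc_cat: "X \<in> Ob C ==> Y \<in> Ob C ==> comm_group (hom_grp loc_cat X Y)"
proof -
  assume o: "X \<in> Ob C" "Y \<in> Ob C"
  have z: "q (Zero C X Y) = lfrac (Idt C Y) \<one>\<^bsub>hom_grp C X (Cod C (Idt C Y))\<^esub>" using q_lfrac[of "Zero C X Y"] o by simp
  have "comm_group \<lparr>carrier = Hom L X Y,
      monoid.mult = union_mult {s \<in> W. Dom C s = Y} (\<lambda>s. hom_grp C X (Cod C s)) lfrac, one = q (Zero C X Y)\<rparr>"
    by (rule directed_union.comm_group_union[OF hom_union[OF o] _ z]) (use o in simp)
  then show ?thesis by (rule comm_group_cong) (auto simp: hom_grp_def addL_def Hom_iff)
qed

lemma additive_category_loc_cat: "additive_category loc_cat"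
proof -
  interpret K: category loc_cat by (rule category_loc_cat)
  show ?thesis
  proof (rule additive_category.intro[OF K.category_axioms], rule additive_category_axioms.intro)
    obtain Z where Z: "zero_object C Z" using C.ex_zero_object by blast
    then have z: "Z \<in> Ob C" "Idt C Z = Zero C Z Z" using C.zero_object_iff by auto
    have "f = q (Zero C X Z)" if f: "f \<in> Hom L X Z" for f X
    proof -
      note h = f[unfolded Hom_iff]
      obtain s g where s: "s \<in> W" "g \<in> Mor C" "Cod C g = Z" "Cod C s = X" "Dom C g = Dom C s" "f \<star> q s = q g" using frac_right[of f] h by auto
      have "g = Zero C X Z \<cdot> s" using C.zero_object_maps(1)[OF Z, of g "Zero C X Z \<cdot> s"] s z h by auto
      then have "f \<star> q s = q (Zero C X Z) \<star> q s" using q_Cmp[of s "Zero C X Z"] s(1,4,6) z h by auto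
      then show ?thesis by (rule L.isomorphism_cancel_right[OF q_W[OF s(1)]]) (use h s(1,4) z in auto)
    qed
    moreover have "f = q (Zero C Z X)" if f: "f \<in> Hom L Z X" for f X
    proof -
      note h = f[unfolded Hom_iff]
      obtain s g where s: "s \<in> W" "g \<in> Mor C" "Dom C g = Z" "Dom C s = X" "Cod C g = Cod C s" "q s \<star> f = q g" using frac_left[of f] h by auto
      have "g = s \<cdot> Zero C Z X" using C.zero_object_maps(2)[OF Z, of g "s \<cdot> Zero C Z X"] s z h by auto
      then have "q s \<star> f = q s \<star> q (Zero C Z X)" using q_Cmp[of "Zero C Z X" s] s(1,4,6) z h by auto
      then show ?thesis by (rule L.isomorphism_cancel_left[OF q_W[OF s(1)]]) (use h s(1,4) z in auto)
    qed
    moreover have "q (Zero C X Z) \<in> Hom L X Z" "q (Zero C Z X) \<in> Hom L Z X" if "X \<in> Ob C" for X using that z by (auto simp: Hom_iff)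
    ultimately have "zero_object loc_cat Z" unfolding zero_object_def using z(1) by (simp, metis)
    then show "\<exists>Z. zero_object loc_cat Z" by blast
  next
    fix X Y assume "X \<in> Ob loc_cat" "Y \<in> Ob loc_cat"
    then obtain P i1 i2 p1 p2 where b: "biproduct C X Y P i1 i2 p1 p2" using C.ex_biproduct[of X Y] by auto
    note bs = C.biproduct_simps[OF b]
    have "addL (q i1 \<star> q p1) (q i2 \<star> q p2) = q (Add C (i1 \<cdot> p1) (i2 \<cdot> p2))" using bs(1-15) by (simp add: q_addL q_Cmp)
    then have "biproduct loc_cat X Y P (q i1) (q i2) (q p1) (q p2)" unfolding biproduct_def using bs by (simp add: Hom_iff q_Cmp[symmetric])
    then show "\<exists>P i1 i2 p1 p2. biproduct loc_cat X Y P i1 i2 p1 p2" by blast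
  qed (simp_all add: hom_grp_loc_cat addL_Cmp_left addL_Cmp_right)
qed

lemma extL_simps [simp]: "carrier (extL X A) = eset X A" "\<one>\<^bsub>extL X A\<^esub> = muL X A \<one>\<^bsub>Ext C X A\<^esub>" by (simp_all add: extL_def)

lemma ExtMapL_hom:
  assumes c: "c \<in> Hom L X' X" and a: "a \<in> Hom L A A'"
  shows "ExtMapL c a \<in> hom (extL X A) (extL X' A')" unfolding hom_def
proof (intro CollectI conjI ballI Pi_I)
  note h = c[unfolded Hom_iff] a[unfolded Hom_iff]
  have o: "X \<in> Ob C" "A \<in> Ob C" using h by auto
  fix \<epsilon> assume e: "\<epsilon> \<in> carrier (extL X A)"
  then show "ExtMapL c a \<epsilon> \<in> carrier (extL X' A')" using ExtMapL_closed[of \<epsilon> X A a c] h by simp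
  fix \<epsilon>' assume e': "\<epsilon>' \<in> carrier (extL X A)"
  obtain s t \<delta> \<delta>' where s: "s \<in> W" "t \<in> W" "Dom C s = A" "Cod C t = X" "\<delta> \<in> Exts C (Dom C t) (Cod C s)"
     "\<delta>' \<in> Exts C (Dom C t) (Cod C s)" "\<epsilon> = efrac (s, t) \<delta>" "\<epsilon>' = efrac (s, t) \<delta>'" using eset_common[of \<epsilon> X A \<epsilon>'] e e' o by auto
  obtain s' f where f: "s' \<in> W" "f \<in> Mor C" "Dom C f = Cod C s" "Dom C s' = Cod L a" "Cod C f = Cod C s'" "q s' \<star> a \<star> inv_mor L (q s) = q f"
    using move_left[OF s(1), of a] h s(3) by auto
  obtain t' k where k: "t' \<in> W" "k \<in> Mor C" "Cod C k = Dom C t" "Cod C t' = Dom L c" "Dom C k = Dom C t'" "inv_mor L (q t) \<star> c \<star> q t' = q k"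
    using move_right[OF s(2), of c] h s(4) by auto
  have st: "Dom C t \<in> Ob C" "Cod C s \<in> Ob C" using s(1,2) by auto
  have m: "ExtMapL c a (efrac (s, t) d) = efrac (s', t') (ExtMap C k f d)" if "d \<in> Exts C (Dom C t) (Cod C s)" for d
    by (rule ExtMapL_efrac_fraction[OF s(1,2) that _ _ _ _ f k]) (use h s(3,4) in auto)
  have "ExtMapL c a (\<epsilon> \<otimes>\<^bsub>extL X A\<^esub> \<epsilon>') = ExtMapL c a (efrac (s, t) (\<delta> \<otimes>\<^bsub>Ext C (Dom C t) (Cod C s)\<^esub> \<delta>'))"
    using extL_mult[OF s(1,2,5,6)] s(3,4,7,8) by simp
  also have "... = efrac (s', t') (ExtMap C k f \<delta> \<otimes>\<^bsub>Ext C (Dom C t') (Cod C s')\<^esub> ExtMap C k f \<delta>')"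
    using m[of "\<delta> \<otimes>\<^bsub>Ext C (Dom C t) (Cod C s)\<^esub> \<delta>'"] C.ExtMap_mult[of k f "Dom C t" "Cod C s" \<delta> \<delta>'] s(5,6) st f(2,3,5) k(2,3,5) by simp
  also have "... = ExtMapL c a \<epsilon> \<otimes>\<^bsub>extL X' A'\<^esub> ExtMapL c a \<epsilon>'"
    using extL_mult[OF f(1) k(1), of "ExtMap C k f \<delta>" "ExtMap C k f \<delta>'"] m[OF s(5)] m[OF s(6)] s(5-8) h f(2-5) k(2-5) by simp
  finally show "ExtMapL c a (\<epsilon> \<otimes>\<^bsub>extL X A\<^esub> \<epsilon>') = ExtMapL c a \<epsilon> \<otimes>\<^bsub>extL X' A'\<^esub> ExtMapL c a \<epsilon>'" .
qed

lemma ExtMapL_add_right: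
  assumes X: "X \<in> Ob C" and a: "a \<in> Hom L A A'" "a' \<in> Hom L A A'" and e: "\<epsilon> \<in> eset X A"
  shows "ExtMapL (Idt L X) (addL a a') \<epsilon> = ExtMapL (Idt L X) a \<epsilon> \<otimes>\<^bsub>extL X A'\<^esub> ExtMapL (Idt L X) a' \<epsilon>"
proof -
  note h = a[unfolded Hom_iff]
  have o: "A \<in> Ob C" using h by auto
  obtain s t \<delta> where s: "s \<in> W" "t \<in> W" "Dom C s = A" "Cod C t = X" "\<delta> \<in> Exts C (Dom C t) (Cod C s)" "\<epsilon> = efrac (s, t) \<delta>"
    using eset_common[OF e e X o] by blast
  have m: "x \<star> inv_mor L (q s) \<in> Hom L (Cod C s) A'" if "x \<in> Hom L A A'" for x using that s(1,3) by (auto simp: Hom_iff)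
  obtain s' f f' where f: "s' \<in> W" "Dom C s' = A'" "f \<in> Mor C" "f' \<in> Mor C" "Dom C f = Cod C s" "Dom C f' = Cod C s" "Cod C f = Cod C s'" "Cod C f' = Cod C s'"
    "q s' \<star> a \<star> inv_mor L (q s) = q f" "q s' \<star> a' \<star> inv_mor L (q s) = q f'"
    using common_left[of "a \<star> inv_mor L (q s)" "a' \<star> inv_mor L (q s)"] m[OF a(1)] m[OF a(2)] by (auto simp: Hom_iff)
  have aa: "addL a a' \<in> Hom L A A'" by (rule addL_closed[OF a])
  have si: "inv_mor L (q s) \<in> Hom L (Cod C s) A" "q s' \<in> Hom L A' (Cod C s')" using s(1,3) f(1,2) by (auto simp: Hom_iff)
  have "q s' \<star> addL a a' \<star> inv_mor L (q s) = addL (q f) (q f')"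
    unfolding addL_Cmp_right[OF a si(1)] addL_Cmp_left[OF m[OF a(1)] m[OF a(2)] si(2)] f(9,10) ..
  then have f3: "q s' \<star> addL a a' \<star> inv_mor L (q s) = q (Add C f f')" using q_addL[of f f'] f(3-8) by simp
  have T: "Dom C t \<in> Ob C" using s(2) by simp
  have push: "ExtMapL (Idt L X) x \<epsilon> = efrac (s', t) (ExtMap C (Idt C (Dom C t)) g \<delta>)"
    if "x \<in> Hom L A A'" "g \<in> Mor C" "Dom C g = Cod C s" "Cod C g = Cod C s'" "q s' \<star> x \<star> inv_mor L (q s) = q g" for x g
    unfolding s(6) by (rule ExtMapL_efrac_fraction[OF s(1,2,5) _ _ _ _ f(1) that(2,3) _ that(4,5) s(2)])
      (use that(1) s(1-4) f(2) X T in \<open>auto simp: Hom_iff\<close>)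
  have "ExtMapL (Idt L X) (addL a a') \<epsilon> = efrac (s', t) (ExtMap C (Idt C (Dom C t)) (Add C f f') \<delta>)"
    by (rule push[OF aa _ _ _ f3]) (use f(3-8) in auto)
  also have "ExtMap C (Idt C (Dom C t)) (Add C f f') \<delta> = ExtMap C (Idt C (Dom C t)) f \<delta> \<otimes>\<^bsub>Ext C (Dom C t) (Cod C s')\<^esub> ExtMap C (Idt C (Dom C t)) f' \<delta>"
    using C.ExtMap_Add_right[of "Idt C (Dom C t)" f f' \<delta>] f(3-8) s(5) T by simp
  also have "efrac (s', t) ... = ExtMapL (Idt L X) a \<epsilon> \<otimes>\<^bsub>extL X A'\<^esub> ExtMapL (Idt L X) a' \<epsilon>"
    using extL_mult[OF f(1) s(2), of "ExtMap C (Idt C (Dom C t)) f \<delta>" "ExtMap C (Idt C (Dom C t)) f' \<delta>"]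
      push[OF a(1) f(3,5,7,9)] push[OF a(2) f(4,6,8,10)] f(2-8) s(4,5) T by simp
  finally show ?thesis .
qed

lemma ExtMapL_add_left:
  assumes A: "A \<in> Ob C" and c: "c \<in> Hom L X' X" "c' \<in> Hom L X' X" and e: "\<epsilon> \<in> eset X A"
  shows "ExtMapL (addL c c') (Idt L A) \<epsilon> = ExtMapL c (Idt L A) \<epsilon> \<otimes>\<^bsub>extL X' A\<^esub> ExtMapL c' (Idt L A) \<epsilon>"
proof -
  note h = c[unfolded Hom_iff]
  have o: "X \<in> Ob C" using h by auto
  obtain s t \<delta> where s: "s \<in> W" "t \<in> W" "Dom C s = A" "Cod C t = X" "\<delta> \<in> Exts C (Dom C t) (Cod C s)" "\<epsilon> = efrac (s, t) \<delta>"
    using eset_common[OF e e o A] by blast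
  have m: "inv_mor L (q t) \<star> x \<in> Hom L X' (Dom C t)" if "x \<in> Hom L X' X" for x using that s(2,4) by (auto simp: Hom_iff)
  note mc = m[OF c(1), unfolded Hom_iff] m[OF c(2), unfolded Hom_iff]
  obtain t' k k' where k: "t' \<in> W" "Cod C t' = X'" "k \<in> Mor C" "k' \<in> Mor C" "Cod C k = Dom C t" "Cod C k' = Dom C t" "Dom C k = Dom C t'" "Dom C k' = Dom C t'"
    "(inv_mor L (q t) \<star> c) \<star> q t' = q k" "(inv_mor L (q t) \<star> c') \<star> q t' = q k'"
    using common_right[of "inv_mor L (q t) \<star> c" "inv_mor L (q t) \<star> c'"] mc by auto
  have cc: "addL c c' \<in> Hom L X' X" by (rule addL_closed[OF c])
  have ti: "inv_mor L (q t) \<in> Hom L X (Dom C t)" "q t' \<in> Hom L (Dom C t') X'" using s(2,4) k(1,2) by (auto simp: Hom_iff)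
  have "(inv_mor L (q t) \<star> addL c c') \<star> q t' = addL (q k) (q k')"
    unfolding addL_Cmp_left[OF c ti(1)] addL_Cmp_right[OF m[OF c(1)] m[OF c(2)] ti(2)] k(9,10) ..
  then have k3: "(inv_mor L (q t) \<star> addL c c') \<star> q t' = q (Add C k k')" using q_addL[of k k'] k(3-8) by simp
  have T: "Cod C s \<in> Ob C" using s(1) by simp
  have pull: "ExtMapL x (Idt L A) \<epsilon> = efrac (s, t') (ExtMap C g (Idt C (Cod C s)) \<delta>)"
    if "x \<in> Hom L X' X" "g \<in> Mor C" "Cod C g = Dom C t" "Dom C g = Dom C t'" "(inv_mor L (q t) \<star> x) \<star> q t' = q g" for x g
  proof -
    have "inv_mor L (q t) \<star> x \<star> q t' = q g" unfolding that(5)[symmetric] using that(1) s(2,4) k(1,2) by (simp add: Hom_iff)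
    then show ?thesis unfolding s(6) by (intro ExtMapL_efrac_fraction[OF s(1,2,5) _ _ _ _ s(1) _ _ _ _ _ k(1) that(2,3) _ that(4)])
        (use that(1) s(1-4) k(2) A T in \<open>auto simp: Hom_iff\<close>)
  qed
  have "ExtMapL (addL c c') (Idt L A) \<epsilon> = efrac (s, t') (ExtMap C (Add C k k') (Idt C (Cod C s)) \<delta>)"
    by (rule pull[OF cc _ _ _ k3]) (use k(3-8) in auto)
  also have "ExtMap C (Add C k k') (Idt C (Cod C s)) \<delta> = ExtMap C k (Idt C (Cod C s)) \<delta> \<otimes>\<^bsub>Ext C (Dom C t') (Cod C s)\<^esub> ExtMap C k' (Idt C (Cod C s)) \<delta>"
    using C.ExtMap_Add_left[of "Idt C (Cod C s)" k k' \<delta>] k(3-8) s(5) T by simp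
  also have "efrac (s, t') ... = ExtMapL c (Idt L A) \<epsilon> \<otimes>\<^bsub>extL X' A\<^esub> ExtMapL c' (Idt L A) \<epsilon>"
    using extL_mult[OF s(1) k(1), of "ExtMap C k (Idt C (Cod C s)) \<delta>" "ExtMap C k' (Idt C (Cod C s)) \<delta>"]
      pull[OF c(1) k(3,5,7,9)] pull[OF c(2) k(4,6,8,10)] k(2-8) s(3,5) T by simp
  finally show ?thesis .
qed

lemma biadditive_Ext_loc_cat: "biadditive_Ext loc_cat"
proof -
  interpret K: additive_category loc_cat by (rule additive_category_loc_cat)
  show ?thesis
  proof (rule biadditive_Ext.intro[OF K.additive_category_axioms], rule biadditive_Ext_axioms.intro)
    fix c X' X c' X'' a A A' a' A'' \<delta>
    assume "c \<in> Hom loc_cat X' X" "c' \<in> Hom loc_cat X'' X'" "a \<in> Hom loc_cat A A'" "a' \<in> Hom loc_cat A' A''"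
      "\<delta> \<in> Exts loc_cat X A"
    then show "ExtMap loc_cat (c \<cdot>\<^bsub>loc_cat\<^esub> c') (a' \<cdot>\<^bsub>loc_cat\<^esub> a) \<delta> = ExtMap loc_cat c' a' (ExtMap loc_cat c a \<delta>)"
      using ExtMapL_ExtMapL[of \<delta> X A a c a' c'] by (simp add: Hom_iff)
  qed (simp_all add: extL_group ExtMapL_hom ExtMapL_Idt ExtMapL_add_right ExtMapL_add_left push_def pull_def)
qed

lemma muL_hom: "X \<in> Ob C ==> A \<in> Ob C ==> muL X A \<in> hom (Ext C X A) (extL X A)"
proof -
  assume o: "X \<in> Ob C" "A \<in> Ob C"
  show ?thesis unfolding hom_def
  proof (intro CollectI conjI ballI Pi_I)
    fix \<delta> assume d: "\<delta> \<in> Exts C X A"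
    then show "muL X A \<delta> \<in> carrier (extL X A)" using muL_closed o by simp
    fix \<delta>' assume d': "\<delta>' \<in> Exts C X A"
    show "muL X A (\<delta> \<otimes>\<^bsub>Ext C X A\<^esub> \<delta>') = muL X A \<delta> \<otimes>\<^bsub>extL X A\<^esub> muL X A \<delta>'" using extL_mult[of "Idt C A" "Idt C X" \<delta> \<delta>'] efrac_Idt[OF o] d d' o by simp
  qed
qed

lemma sim_zero_J:
  assumes "f \<in> Mor C" "q f = q (Zero C (Dom C f) (Cod C f))"
  shows "f \<in> J"
proof -
  have "sim f (Zero C (Dom C f) (Cod C f))" using q_eq[of f "Zero C (Dom C f) (Cod C f)"] assms by simp
  then show ?thesis using assms(1) by (simp add: sim_def)
qed

theorem fraction_ext_loc_cat: "fraction_ext C loc_cat W q muL"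
proof -
  interpret K: biadditive_Ext loc_cat by (rule biadditive_Ext_loc_cat)
  show ?thesis
  proof (rule fraction_ext.intro[OF C.weakly_extriangulated_axioms K.biadditive_Ext_axioms], rule fraction_ext_axioms.intro)
    fix X A \<delta> assume h: "X \<in> Ob C" "A \<in> Ob C" "\<delta> \<in> Exts C X A" "muL X A \<delta> = \<one>\<^bsub>Ext loc_cat X A\<^esub>"
    then have "killed X A \<delta>" using muL_eq_iff[of \<delta> X A "\<one>\<^bsub>Ext C X A\<^esub>"] keq_one by simp
    then show "\<exists>s\<in>W. Dom C s = A \<and> ExtMap C (Idt C X) s \<delta> = \<one>\<^bsub>Ext C X (Cod C s)\<^esub>"
      "\<exists>t\<in>W. Cod C t = X \<and> ExtMap C t (Idt C A) \<delta> = \<one>\<^bsub>Ext C (Dom C t) A\<^esub>" using killed_iff_pull[OF h(3,1,2)] unfolding killed_def by blast+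
  next
    fix f assume f: "f \<in> Mor C" "q f = Zero loc_cat (Dom C f) (Cod C f)"
    then have j: "f \<in> J" using sim_zero_J by simp
    obtain t where t: "t \<in> W" "Cod C t = Dom C f" "f \<cdot> t \<in> I" using j J_iff_right by blast
    then show "\<exists>t\<in>W. \<exists>N Z. \<exists>u\<in>Hom C (Dom C t) N. \<exists>v\<in>Hom C N (Cod C f).
         Cod C t = Dom C f \<and> f \<cdot> t = v \<cdot> u \<and> zero_object C Z \<and> Zero C N Z \<in> W \<and> Zero C Z N \<in> W"
      using I_null[OF t(3)] f(1) by (intro bexI[OF _ t(1)]) auto
    obtain t' where t': "t' \<in> W" "Dom C t' = Cod C f" "t' \<cdot> f \<in> I" using j by (auto simp: J_def)
    then show "\<exists>t\<in>W. \<exists>N Z. \<exists>u\<in>Hom C (Dom C f) N. \<exists>v\<in>Hom C N (Cod C t).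
         Dom C t = Cod C f \<and> t \<cdot> f = v \<cdot> u \<and> zero_object C Z \<and> Zero C N Z \<in> W \<and> Zero C Z N \<in> W"
      using I_null[OF t'(3)] f(1) by (intro bexI[OF _ t'(1)]) auto
  next
    fix A B X x y \<delta> A' B' X' x' y' \<delta>' a c
    assume t: "s_triangle C A B X x y \<delta>" "s_triangle C A' B' X' x' y' \<delta>'" and w: "a \<in> W" "c \<in> W"
      "a \<in> Hom C A A'" "c \<in> Hom C X X'" "push C X a \<delta> = pull C A' c \<delta>'"
    obtain b where b: "b \<in> W" "b \<in> Hom C B B'" "Add C (b \<cdot> x) (Neg C (x' \<cdot> a)) \<in> I" "Add C (c \<cdot> y) (Neg C (y' \<cdot> b)) \<in> I" using middle[OF t w] by blast
    note m = C.s_triangle_simps[OF t(1)] C.s_triangle_simps[OF t(2)]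
    note wm = w(3,4)[unfolded Hom_iff] b(2)[unfolded Hom_iff]
    have "sim (b \<cdot> x) (x' \<cdot> a)" "sim (c \<cdot> y) (y' \<cdot> b)" using b(3,4) m wm by (auto intro!: sim_ideal)
    then have "q b \<star> q x = q x' \<star> q a" "q c \<star> q y = q y' \<star> q b"
      using sim_q[of "b \<cdot> x" "x' \<cdot> a"] sim_q[of "c \<cdot> y" "y' \<cdot> b"] m wm by (simp_all add: q_Cmp)
    then show "\<exists>b. isomorphism loc_cat b \<and> b \<in> Hom loc_cat B B' \<and> b \<cdot>\<^bsub>loc_cat\<^esub> q x = q x' \<cdot>\<^bsub>loc_cat\<^esub> q a \<and> q c \<cdot>\<^bsub>loc_cat\<^esub> q y = q y' \<cdot>\<^bsub>loc_cat\<^esub> b"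
      using b(1) wm by (intro exI[of _ "q b"]) (simp add: Hom_iff)
  next
    fix f g assume "f \<in> Mor C" "g \<in> Mor C" "Dom C f = Dom C g" "Cod C f = Cod C g"
    then show "q (Add C f g) = Add loc_cat (q f) (q g)" by (simp add: q_addL)
  next
    fix \<phi> assume "\<phi> \<in> Mor loc_cat"
    then show "\<exists>s\<in>W. \<exists>f\<in>Mor C. Dom C f = Dom loc_cat \<phi> \<and> Dom C s = Cod loc_cat \<phi> \<and> Cod C f = Cod C s \<and> q s \<cdot>\<^bsub>loc_cat\<^esub> \<phi> = q f"
      "\<exists>s\<in>W. \<exists>f\<in>Mor C. Cod C f = Cod loc_cat \<phi> \<and> Cod C s = Dom loc_cat \<phi> \<and> Dom C f = Dom C s \<and> \<phi> \<cdot>\<^bsub>loc_cat\<^esub> q s = q f"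
      using frac_left[of \<phi>] frac_right[of \<phi>] by simp_all
  next
    fix X A \<epsilon> assume "X \<in> Ob C" "A \<in> Ob C" "\<epsilon> \<in> Exts loc_cat X A"
    then show "\<exists>s\<in>W. \<exists>t\<in>W. \<exists>\<delta>\<in>Exts C (Dom C t) (Cod C s). Dom C s = A \<and> Cod C t = X \<and>
          ExtMap loc_cat (q t) (q s) \<epsilon> = muL (Dom C t) (Cod C s) \<delta>" using muL_surj[of \<epsilon> X A] by simp
  next
    fix s t assume "s \<in> W" "t \<in> W" "Cod C s = Dom C t"
    then show "t \<cdot> s \<in> W" by (rule W_Cmp)
  qed (simp_all add: q_Hom q_Cmp muL_hom muL_ExtMap Real_loc_cat del: q_simps)
qed

end

section \<open>Fractions in the category of zigzags\<close>

context category
begin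

lemma loc_functor_Hom: "S \<subseteq> Mor C ==> f \<in> Mor C
    ==> mor_map (loc_functor C S) f \<in> Hom (localization C S) (Dom C f) (Cod C f)"
  using loc_functor_functor[OF category_axioms] by (simp add: is_functor_def loc_functor_def)

lemma loc_functor_Idt: "S \<subseteq> Mor C ==> X \<in> Ob C ==> mor_map (loc_functor C S) (Idt C X) = Idt (localization C S) X"
proof -
  assume S: "S \<subseteq> Mor C" and X: "X \<in> Ob C"
  have "\<forall>X\<in>Ob C. mor_map (loc_functor C S) (Idt C X) = Idt (localization C S) (obj_map (loc_functor C S) X)"
    using loc_functor_functor[OF category_axioms S] unfolding is_functor_def by blast
  then show ?thesis using X by (simp add: loc_functor_def)
qed

lemma loc_functor_Cmp: "S \<subseteq> Mor C ==> f \<in> Mor C ==> g \<in> Mor C ==> Cod C f = Dom C g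
    ==> mor_map (loc_functor C S) (g \<cdot> f) = mor_map (loc_functor C S) g \<cdot>\<^bsub>localization C S\<^esub> mor_map (loc_functor C S) f"
proof -
  assume S: "S \<subseteq> Mor C" and "f \<in> Mor C" "g \<in> Mor C" "Cod C f = Dom C g"
  then have "f \<in> Hom C (Dom C f) (Cod C f)" "g \<in> Hom C (Cod C f) (Cod C g)" by (auto simp: Hom_iff)
  then show ?thesis using loc_functor_functor[OF category_axioms S] unfolding is_functor_def by blast
qed

end

locale zigzag_calculus = ideal_calculus C W I
  for C :: "('o, 'm, 'e) ext_cat" (structure) and W I :: "'m set" +
  fixes S :: "'m set"
  assumes S_W: "s \<in> S ==> s \<in> W"
    and q_W_iso: "s \<in> W ==> isomorphism (localization C S) (mor_map (loc_functor C S) s)"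
    and q_ideal: "f \<in> Mor C ==> g \<in> Mor C ==> Dom C f = Dom C g ==> Cod C f = Cod C g ==> Add C f (Neg C g) \<in> I
      ==> mor_map (loc_functor C S) f = mor_map (loc_functor C S) g"
begin

abbreviation L :: "('o, ('o, 'm) loc_mor) cat"
  where "L \<equiv> localization C S"

abbreviation q :: "'m => ('o, 'm) loc_mor"
  where "q \<equiv> mor_map (loc_functor C S)"

lemma S_Mor: "S \<subseteq> Mor C" using S_W by auto

lemmas q_Hom = C.loc_functor_Hom[OF S_Mor] and q_Idt = C.loc_functor_Idt[OF S_Mor] and q_Cmp = C.loc_functor_Cmp[OF S_Mor]

text \<open>Read a word as a composite in the localization: \<open>rep w f s\<close> expresses \<open>q s [w] = q f\<close> by congruences in \<open>C\<close>
  alone. A forward letter \<open>g\<close> is split off by enlarging \<open>s\<close> to \<open>u s\<close> until \<open>u f\<close> factors through \<open>g\<close>, and a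
  formal inverse of \<open>t\<close> is absorbed into \<open>f\<close>. The predicate is constant on classes of zigzags, so that it detects
  which morphisms of \<open>C\<close> are identified.\<close>

primrec rep :: "('m + 'm) list => 'm => 'm => bool" where
  "rep [] f s = sim f s"
| "rep (x # w) f s = (case x of
     Inl g => (\<exists>u\<in>W. \<exists>h\<in>Mor C. Dom C u = Cod C s \<and> Dom C h = Cod C g \<and> Cod C h = Cod C u \<and> rep w h (u \<cdot> s) \<and> sim (u \<cdot> f) (h \<cdot> g))
   | Inr t => rep w (f \<cdot> t) s)"

lemma rep_InlI:
  "u \<in> W ==> h \<in> Mor C ==> Dom C u = Cod C s ==> Dom C h = Cod C g ==> Cod C h = Cod C u
   ==> rep w h (u \<cdot> s) ==> sim (u \<cdot> f) (h \<cdot> g) ==> rep (Inl g # w) f s" by auto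

lemma rep_resp:
  assumes "zigzag C S X w Y" "f \<in> Hom C X Z" "f' \<in> Hom C X Z" "s \<in> W" "s' \<in> W" "s \<in> Hom C Y Z" "s' \<in> Hom C Y Z"
    "sim f f'" "sim s s'" "rep w f s"
  shows "rep w f' s'" using assms
proof (induction arbitrary: f f' s s' Z rule: zigzag.induct)
  case (zigzag_Nil X)
  then show ?case using sim_trans sim_sym by (metis rep.simps(1))
next
  case (zigzag_fwd g w Y)
  note m = zigzag_fwd.prems(1,2,5,6)[unfolded Hom_iff]
  obtain u h where u: "u \<in> W" "h \<in> Mor C" "Dom C u = Cod C s" "Dom C h = Cod C g" "Cod C h = Cod C u" "rep w h (u \<cdot> s)" "sim (u \<cdot> f) (h \<cdot> g)"
    using zigzag_fwd.prems(9) by auto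
  have "rep w h (u \<cdot> s')"
  proof (rule zigzag_fwd.IH)
    show "rep w h (u \<cdot> s)" "sim h h" "sim (u \<cdot> s) (u \<cdot> s')" using u sim_refl sim_left[OF zigzag_fwd.prems(8), of u] m by auto
    show "u \<cdot> s \<in> W" "u \<cdot> s' \<in> W" using W_Cmp zigzag_fwd.prems(3,4) u m by auto
  qed (use u m in \<open>auto simp: Hom_iff\<close>)
  moreover have "sim (u \<cdot> f') (h \<cdot> g)" using sim_trans[OF sim_sym[OF sim_left[OF zigzag_fwd.prems(7), of u]] u(7)] u m by auto
  ultimately show ?case using u m by auto
next
  case (zigzag_bwd t w Y)
  note m = zigzag_bwd.prems(1,2,5,6)[unfolded Hom_iff]
  have t: "t \<in> Mor C" using zigzag_bwd.hyps(1) S_Mor by auto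
  have "rep w (f' \<cdot> t) s'" by (rule zigzag_bwd.IH[of "f \<cdot> t" Z "f' \<cdot> t" s])
      (use zigzag_bwd.prems m t sim_right[OF zigzag_bwd.prems(7), of t] in \<open>auto simp: Hom_iff\<close>)
  then show ?case by simp
qed

text \<open>Representations may be enlarged and reduced by members of \<open>W\<close>; in the case of a forward letter the two
  enlargements have a common refinement.\<close>

lemma rep_scale:
  assumes "zigzag C S X w Y" "f \<in> Hom C X Z" "s \<in> W" "s \<in> Hom C Y Z" "u \<in> W" "Dom C u = Z"
  shows "rep w (u \<cdot> f) (u \<cdot> s) \<longleftrightarrow> rep w f s" using assms
proof (induction arbitrary: f s u Z rule: zigzag.induct)
  case (zigzag_Nil X)
  note m = zigzag_Nil.prems(1,3)[unfolded Hom_iff]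
  show ?case using sim_left[of f s u] sim_cancel_left[of u f s] zigzag_Nil.prems m by auto
next
  case (zigzag_fwd g w Y)
  note m = zigzag_fwd.prems(1,3)[unfolded Hom_iff]
  note su = zigzag_fwd.prems(2,4,5)
  have g: "g \<in> Mor C" by fact
  show ?case
  proof
    assume "rep (Inl g # w) (u \<cdot> f) (u \<cdot> s)"
    then obtain v h where v: "v \<in> W" "h \<in> Mor C" "Dom C v = Cod C u" "Dom C h = Cod C g" "Cod C h = Cod C v" "rep w h (v \<cdot> u \<cdot> s)" "sim (v \<cdot> u \<cdot> f) (h \<cdot> g)"
      using m su by auto
    show "rep (Inl g # w) f s" by (rule rep_InlI[of "v \<cdot> u" h]) (use v m su W_Cmp[of u v] in simp_all)
  next
    assume "rep (Inl g # w) f s"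
    then obtain v h where v: "v \<in> W" "h \<in> Mor C" "Dom C v = Z" "Dom C h = Cod C g" "Cod C h = Cod C v" "rep w h (v \<cdot> s)" "sim (v \<cdot> f) (h \<cdot> g)"
      using m by auto
    obtain a b where a: "a \<in> W" "b \<in> W" "Dom C a = Cod C u" "Dom C b = Cod C v" "Cod C a = Cod C b" "sim (a \<cdot> u) (b \<cdot> v)"
      using common_W_left[of u v] su v by auto
    have vs: "v \<cdot> s \<in> W" using W_Cmp[OF su(1) v(1)] v(3) m by simp
    have 1: "rep w (b \<cdot> h) (b \<cdot> v \<cdot> s)" using zigzag_fwd.IH[of h "Cod C v" "v \<cdot> s" b] v a vs m by (simp add: Hom_iff)
    have us: "u \<cdot> s \<in> W" using W_Cmp[OF su(1,2)] su(3) m by simp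
    have 2: "rep w (b \<cdot> h) (a \<cdot> u \<cdot> s)"
    proof (rule rep_resp[OF zigzag_fwd.hyps(2) _ _ _ _ _ _ _ _ 1, of "Cod C b"])
      show "b \<cdot> v \<cdot> s \<in> W" using W_Cmp[OF vs a(2)] a v m by simp
      show "a \<cdot> u \<cdot> s \<in> W" using W_Cmp[OF us a(1)] a su m by simp
      show "sim (b \<cdot> h) (b \<cdot> h)" by (rule sim_refl) (use a v in auto)
      show "sim (b \<cdot> v \<cdot> s) (a \<cdot> u \<cdot> s)" using sim_right[OF sim_sym[OF a(6)], of s] a v su m by simp
    qed (use a v su m in \<open>auto simp: Hom_iff\<close>)
    have "sim (a \<cdot> u \<cdot> f) (b \<cdot> v \<cdot> f)" using sim_right[OF a(6), of f] a v su m by simp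
    moreover have "sim (b \<cdot> v \<cdot> f) (b \<cdot> h \<cdot> g)" using sim_left[OF v(7), of b] a v su m g by simp
    ultimately have 3: "sim (a \<cdot> u \<cdot> f) ((b \<cdot> h) \<cdot> g)" using sim_trans a v g by simp
    show "rep (Inl g # w) (u \<cdot> f) (u \<cdot> s)" by (rule rep_InlI[of a "b \<cdot> h"]) (use 2 3 a v su m in simp_all)
  qed
next
  case (zigzag_bwd t w Y)
  note m = zigzag_bwd.prems(1,3)[unfolded Hom_iff]
  have t: "t \<in> Mor C" using zigzag_bwd.hyps(1) S_Mor by auto
  show ?case using zigzag_bwd.IH[of "f \<cdot> t" Z s u] zigzag_bwd.prems m t by (simp add: Hom_iff)
qed

text \<open>Each of the four rules leaves the predicate unchanged. The rule for \<open>t\<close> followed by its inverse uses the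
  Ore condition, and the rule for the inverse followed by \<open>t\<close> uses cancellation.\<close>

lemma rep_reduct:
  assumes "reduct C S l r" and z: "zigzag C S X (l @ b) Y" "zigzag C S X (r @ b) Y"
    and f: "f \<in> Hom C X Z" and s: "s \<in> W" "s \<in> Hom C Y Z"
  shows "rep (l @ b) f s \<longleftrightarrow> rep (r @ b) f s"
proof -
  note m = f[unfolded Hom_iff] s(2)[unfolded Hom_iff]
  have Z: "Z \<in> Ob C" "X \<in> Ob C" "Y \<in> Ob C" using m by auto
  show ?thesis using assms(1)
  proof cases
    case (reduct_Cmp g A B h D)
    note gh = reduct_Cmp(3,4)[unfolded Hom_iff]
    have zb: "zigzag C S D b Y" and X: "X = A" using z(1) reduct_Cmp(1) gh by (auto elim!: zigzag_fwdE)
    show ?thesis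
    proof
      assume "rep (l @ b) f s"
      then obtain u k v k' where u: "u \<in> W" "k \<in> Mor C" "Dom C u = Cod C s" "Dom C k = B" "Cod C k = Cod C u" "sim (u \<cdot> f) (k \<cdot> g)"
        and v: "v \<in> W" "k' \<in> Mor C" "Dom C v = Cod C (u \<cdot> s)" "Dom C k' = D" "Cod C k' = Cod C v" "rep b k' (v \<cdot> u \<cdot> s)" "sim (v \<cdot> k) (k' \<cdot> h)"
        unfolding reduct_Cmp(1) using gh by auto
      have v3: "Dom C v = Cod C u" using v(3) u m s by simp
      have "sim (v \<cdot> u \<cdot> f) (v \<cdot> k \<cdot> g)" using sim_left[OF u(6), of v] u v3 v m gh by simp
      moreover have "sim (v \<cdot> k \<cdot> g) (k' \<cdot> h \<cdot> g)" using sim_right[OF v(7), of g] u v3 v gh by simp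
      ultimately have uk: "sim (v \<cdot> u \<cdot> f) (k' \<cdot> h \<cdot> g)" by (rule sim_trans)
      have "v \<cdot> u \<in> W" using W_Cmp u v v3 by simp
      note vu = this uk
      show "rep (r @ b) f s" unfolding reduct_Cmp(2) append.simps by (rule rep_InlI[of "v \<cdot> u" k']) (use u v v3 vu m s gh in simp_all)
    next
      assume "rep (r @ b) f s"
      then obtain u k where u: "u \<in> W" "k \<in> Mor C" "Dom C u = Cod C s" "Dom C k = D" "Cod C k = Cod C u" "rep b k (u \<cdot> s)" "sim (u \<cdot> f) (k \<cdot> h \<cdot> g)"
        unfolding reduct_Cmp(2) using gh by auto
      have "sim (k \<cdot> h) (k \<cdot> h)" by (rule sim_refl) (use u gh in auto)
      note kh = this
      have kh: "rep ([Inl h] @ b) (k \<cdot> h) (u \<cdot> s)" unfolding append.simps by (rule rep_InlI[of "Idt C (Cod C u)" k]) (use u gh m s kh in simp_all)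
      show "rep (l @ b) f s" unfolding reduct_Cmp(1) append.simps by (rule rep_InlI[of u "k \<cdot> h"]) (use u gh m kh in simp_all)
    qed
  next
    case (reduct_Idt A)
    have X: "X = A" using z(1) reduct_Idt by (auto elim!: zigzag_fwdE)
    have zb: "zigzag C S X b Y" using z(2) reduct_Idt(2) by simp
    show ?thesis
    proof
      assume "rep (l @ b) f s"
      then obtain u k where u: "u \<in> W" "k \<in> Mor C" "Dom C u = Cod C s" "Dom C k = A" "Cod C k = Cod C u" "rep b k (u \<cdot> s)" "sim (u \<cdot> f) (k \<cdot> Idt C A)"
        unfolding reduct_Idt(1) using reduct_Idt(3) by auto
      have us: "u \<cdot> s \<in> W" using W_Cmp u s m by simp
      have "rep b (u \<cdot> f) (u \<cdot> s)" by (rule rep_resp[OF zb _ _ us us _ _ _ _ u(6), of "Cod C u"])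
          (use u m X s sim_sym[OF u(7)] sim_refl[of "u \<cdot> s"] in \<open>auto simp: Hom_iff\<close>)
      then show "rep (r @ b) f s" using rep_scale[OF zb f s u(1)] u(3) m unfolding reduct_Idt(2) by simp
    next
      assume r: "rep (r @ b) f s"
      show "rep (l @ b) f s" unfolding reduct_Idt(1) append.simps
        by (rule rep_InlI[of "Idt C Z" f]) (use m X Z r reduct_Idt(2) sim_refl[of f] in simp_all)
    qed
  next
    case (reduct_inv1 t)
    have t: "t \<in> W" "t \<in> Mor C" using reduct_inv1 S_W by auto
    have X: "X = Dom C t" using z(1) reduct_inv1 by (auto elim!: zigzag_fwdE)
    have zb: "zigzag C S X b Y" using z(2) reduct_inv1(2) by simp
    show ?thesis
    proof
      assume "rep (l @ b) f s"
      then obtain u k where u: "u \<in> W" "k \<in> Mor C" "Dom C u = Cod C s" "Dom C k = Cod C t" "Cod C k = Cod C u" "rep b (k \<cdot> t) (u \<cdot> s)" "sim (u \<cdot> f) (k \<cdot> t)"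
        unfolding reduct_inv1(1) by auto
      have us: "u \<cdot> s \<in> W" using W_Cmp u s m by simp
      have "rep b (u \<cdot> f) (u \<cdot> s)" by (rule rep_resp[OF zb _ _ us us _ _ _ _ u(6), of "Cod C u"])
          (use u m X s t sim_sym[OF u(7)] sim_refl[of "u \<cdot> s"] in \<open>auto simp: Hom_iff\<close>)
      then show "rep (r @ b) f s" using rep_scale[OF zb f s u(1)] u(3) m unfolding reduct_inv1(2) by simp
    next
      assume r: "rep (r @ b) f s"
      obtain u k where u: "u \<in> W" "k \<in> Mor C" "Dom C u = Cod C f" "Dom C k = Cod C t" "Cod C u = Cod C k" "sim (u \<cdot> f) (k \<cdot> t)"
        using Ore_left_sim[OF t(1), of f] m X by auto
      have us: "u \<cdot> s \<in> W" using W_Cmp u s m by simp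
      have r': "rep b (u \<cdot> f) (u \<cdot> s)" using rep_scale[OF zb f s u(1)] u(3) m r unfolding reduct_inv1(2) by simp
      have "rep b (k \<cdot> t) (u \<cdot> s)" by (rule rep_resp[OF zb _ _ us us _ _ u(6) _ r', of "Cod C u"])
          (use u m X s t sim_refl[of "u \<cdot> s"] in \<open>auto simp: Hom_iff\<close>)
      note kt = this
      show "rep (l @ b) f s" unfolding reduct_inv1(1) append.simps by (rule rep_InlI[of u k]) (use u m X t kt in simp_all)
    qed
  next
    case (reduct_inv2 t)
    have t: "t \<in> W" "t \<in> Mor C" using reduct_inv2 S_W by auto
    have X: "X = Cod C t" using z(1) reduct_inv2 by (auto elim!: zigzag_bwdE)
    have zb: "zigzag C S X b Y" using z(2) reduct_inv2(2) by simp
    show ?thesis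
    proof
      assume "rep (l @ b) f s"
      then obtain u k where u: "u \<in> W" "k \<in> Mor C" "Dom C u = Cod C s" "Dom C k = Cod C t" "Cod C k = Cod C u" "rep b k (u \<cdot> s)" "sim (u \<cdot> f \<cdot> t) (k \<cdot> t)"
        unfolding reduct_inv2(1) using m t X by auto
      have "sim (u \<cdot> f) k" by (rule sim_cancel_right[OF _ t(1)]) (use u m X t in auto)
      note us = W_Cmp[OF s(1) u(1)] and fk = this
      have us: "u \<cdot> s \<in> W" using W_Cmp u s m by simp
      have "rep b (u \<cdot> f) (u \<cdot> s)" by (rule rep_resp[OF zb _ _ us us _ _ _ _ u(6), of "Cod C u"])
          (use u m X s t sim_sym[OF fk] sim_refl[of "u \<cdot> s"] in \<open>auto simp: Hom_iff\<close>)
      then show "rep (r @ b) f s" using rep_scale[OF zb f s u(1)] u(3) m unfolding reduct_inv2(2) by simp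
    next
      assume r: "rep (r @ b) f s"
      have "rep (Inl t # b) (f \<cdot> t) s" by (rule rep_InlI[of "Idt C Z" f]) (use m X Z t r reduct_inv2(2) sim_refl[of "f \<cdot> t"] in simp_all)
      then show "rep (l @ b) f s" unfolding reduct_inv2(1) by simp
    qed
  qed
qed

lemma rep_context:
  assumes "reduct C S l r" "zigzag C S X (a @ l @ b) Y" "zigzag C S X (a @ r @ b) Y" "f \<in> Hom C X Z" "s \<in> W" "s \<in> Hom C Y Z"
  shows "rep (a @ l @ b) f s \<longleftrightarrow> rep (a @ r @ b) f s" using assms(2-)
proof (induction a arbitrary: X f s Z)
  case Nil
  then show ?case using rep_reduct[OF assms(1)] by simp
next
  case (Cons x a)
  note m = Cons.prems(3,5)[unfolded Hom_iff]
  show ?case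
  proof (cases x)
    case (Inl g)
    have z: "zigzag C S (Cod C g) (a @ l @ b) Y" "zigzag C S (Cod C g) (a @ r @ b) Y" "X = Dom C g" "g \<in> Mor C"
      using Cons.prems(1,2) Inl by (auto elim!: zigzag_fwdE)
    have "rep (a @ l @ b) h (u \<cdot> s) \<longleftrightarrow> rep (a @ r @ b) h (u \<cdot> s)"
      if "u \<in> W" "h \<in> Mor C" "Dom C u = Cod C s" "Dom C h = Cod C g" "Cod C h = Cod C u" for u h
      by (rule Cons.IH[OF z(1,2), of h "Cod C u"]) (use that m Cons.prems W_Cmp[OF Cons.prems(4) that(1)] in \<open>auto simp: Hom_iff\<close>)
    then show ?thesis unfolding Inl by auto
  next
    case (Inr t)
    have z: "zigzag C S (Dom C t) (a @ l @ b) Y" "zigzag C S (Dom C t) (a @ r @ b) Y" "X = Cod C t" "t \<in> S"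
      using Cons.prems(1,2) Inr by (auto elim!: zigzag_bwdE)
    have "rep (a @ l @ b) (f \<cdot> t) s \<longleftrightarrow> rep (a @ r @ b) (f \<cdot> t) s"
      by (rule Cons.IH[OF z(1,2), of _ Z]) (use m z Cons.prems S_Mor in \<open>auto simp: Hom_iff\<close>)
    then show ?thesis unfolding Inr by simp
  qed
qed

lemma rep_class:
  assumes "w' \<in> zz_class C S X w Y" "f \<in> Hom C X Z" "s \<in> W" "s \<in> Hom C Y Z"
  shows "rep w' f s \<longleftrightarrow> rep w f s"
proof -
  have st: "rep v f s \<longleftrightarrow> rep v' f s" if "(v, v') \<in> zz_step C S X Y" for v v' using that rep_context[OF _ _ _ assms(2-4)] unfolding zz_step_def by auto
  have "(w, w') \<in> (zz_step C S X Y \<union> (zz_step C S X Y)\<inverse>)\<^sup>*" using assms(1) by (simp add: zz_class_def)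
  then show ?thesis by (induction rule: rtrancl_induct) (use st in auto)
qed

lemma sim_imp_q: "sim f g ==> q f = q g"
proof -
  assume "sim f g"
  then have h: "f \<in> Mor C" "g \<in> Mor C" "Dom C f = Dom C g" "Cod C f = Cod C g" "Add C f (Neg C g) \<in> J" by (auto simp: sim_def)
  then obtain t where t: "t \<in> W" "Dom C t = Cod C f" "t \<cdot> Add C f (Neg C g) \<in> I" by (auto simp: J_def)
  interpret L: category L by (rule localization_category[OF C.category_axioms S_Mor])
  have "q (t \<cdot> f) = q (t \<cdot> g)" by (rule q_ideal) (use t h in auto)
  then have e: "q t \<cdot>\<^bsub>L\<^esub> q f = q t \<cdot>\<^bsub>L\<^esub> q g" using q_Cmp t h by simp
  show "q f = q g" by (rule L.isomorphism_cancel_left[OF q_W_iso[OF t(1)] e]) (use q_Hom[of f] q_Hom[of g] q_Hom[of t] h t in \<open>auto simp: Hom_iff\<close>)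
qed

lemma q_imp_sim:
  assumes "f \<in> Hom C X Y" "g \<in> Hom C X Y" "q f = q g"
  shows "sim f g"
proof -
  note m = assms(1,2)[unfolded Hom_iff]
  have Y: "Y \<in> Ob C" using m by auto
  have "[Inl f] \<in> zz_class C S X [Inl g] Y" using assms(3) zz_class_self[of "[Inl f]" C S X Y] m by (simp add: loc_functor_def)
  then have e: "rep [Inl f] f (Idt C Y) \<longleftrightarrow> rep [Inl g] f (Idt C Y)" by (rule rep_class) (use m Y in \<open>auto simp: Hom_iff\<close>)
  have "rep [Inl f] f (Idt C Y)" using m Y sim_refl[of f] sim_refl[of "Idt C Y"] by (auto intro!: bexI[of _ "Idt C Y"])
  then obtain u h where u: "u \<in> W" "h \<in> Mor C" "Dom C u = Y" "Dom C h = Y" "Cod C h = Cod C u" "sim h (u \<cdot> Idt C Y)" "sim (u \<cdot> f) (h \<cdot> g)"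
    using e m Y by auto
  have "sim h u" using u by simp
  then have "sim (h \<cdot> g) (u \<cdot> g)" using sim_right[of h u g] m u by simp
  then have "sim (u \<cdot> f) (u \<cdot> g)" by (rule sim_trans[OF u(7)])
  then show ?thesis by (rule sim_cancel_left[OF _ u(1)]) (use m u in auto)
qed

text \<open>A formal inverse at the front of the word is moved past the numerator by the Ore condition.\<close>

lemma zigzag_frac_left:
  assumes "zigzag C S X w Y"
  shows "\<exists>s\<in>W. \<exists>f\<in>Mor C. Dom C f = X \<and> Dom C s = Y \<and> Cod C f = Cod C s \<and> q s \<cdot>\<^bsub>L\<^esub> (X, zz_class C S X w Y, Y) = q f" using assms
proof (induction rule: zigzag.induct)
  case (zigzag_Nil X)
  interpret L: category L by (rule localization_category[OF C.category_axioms S_Mor])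
  have "q (Idt C X) \<cdot>\<^bsub>L\<^esub> (X, zz_class C S X [] X, X) = q (Idt C X)"
    using L.Cmp_Idt[of "q (Idt C X)" X] q_Idt[OF zigzag_Nil] q_Hom[of "Idt C X"] zigzag_Nil by (simp add: Hom_iff)
  then show ?case using zigzag_Nil by (intro bexI[of _ "Idt C X"] bexI[of _ "Idt C X"]) auto
next
  case (zigzag_fwd g w Y)
  interpret L: category L by (rule localization_category[OF C.category_axioms S_Mor])
  obtain s f where s: "s \<in> W" "f \<in> Mor C" "Dom C f = Cod C g" "Dom C s = Y" "Cod C f = Cod C s"
    "q s \<cdot>\<^bsub>L\<^esub> (Cod C g, zz_class C S (Cod C g) w Y, Y) = q f" using zigzag_fwd.IH by blast
  have z: "zigzag C S (Dom C g) [Inl g] (Cod C g)" by (rule zigzag_single(1)[OF C.category_axioms zigzag_fwd.hyps(1)])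
  have e: "(Dom C g, zz_class C S (Dom C g) (Inl g # w) Y, Y) = (Cod C g, zz_class C S (Cod C g) w Y, Y) \<cdot>\<^bsub>L\<^esub> q g"
    using Cmp_localization[OF z zigzag_fwd.hyps(2)] by (simp add: loc_functor_def)
  have h: "(Cod C g, zz_class C S (Cod C g) w Y, Y) \<in> Hom L (Cod C g) Y" using zigzag_fwd.hyps(2) by (auto simp: Hom_localization)
  have "q s \<cdot>\<^bsub>L\<^esub> (Cod C g, zz_class C S (Cod C g) w Y, Y) \<cdot>\<^bsub>L\<^esub> q g = q f \<cdot>\<^bsub>L\<^esub> q g"
    unfolding s(6)[symmetric] using q_Hom[of g] q_Hom[of s] h s(1,4) zigzag_fwd.hyps(1) L.Cmp_assoc by (metis W_Mor)
  also have "... = q (f \<cdot> g)" using q_Cmp[of g f] s zigzag_fwd.hyps(1) by simp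
  finally show ?case unfolding e using s(1-5) zigzag_fwd.hyps(1) by (intro bexI[of _ s] bexI[of _ "f \<cdot> g"]) auto
next
  case (zigzag_bwd t w Y)
  interpret L: category L by (rule localization_category[OF C.category_axioms S_Mor])
  obtain s f where s: "s \<in> W" "f \<in> Mor C" "Dom C f = Dom C t" "Dom C s = Y" "Cod C f = Cod C s"
    "q s \<cdot>\<^bsub>L\<^esub> (Dom C t, zz_class C S (Dom C t) w Y, Y) = q f" using zigzag_bwd.IH by blast
  have t: "t \<in> W" "t \<in> Mor C" using zigzag_bwd.hyps(1) S_W by auto
  let ?i = "(Cod C t, zz_class C S (Cod C t) [Inr t] (Dom C t), Dom C t)" and ?w = "(Dom C t, zz_class C S (Dom C t) w Y, Y)"
  have z: "zigzag C S (Cod C t) [Inr t] (Dom C t)" by (rule zigzag_single(2)[OF C.category_axioms S_Mor zigzag_bwd.hyps(1)])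
  have e: "(Cod C t, zz_class C S (Cod C t) (Inr t # w) Y, Y) = ?w \<cdot>\<^bsub>L\<^esub> ?i" using Cmp_localization[OF z zigzag_bwd.hyps(2)] by simp
  have "inverse_pair L (q t) ?i" by (rule loc_functor_inverse[OF C.category_axioms S_Mor zigzag_bwd.hyps(1)])
  then have i: "?i = inv_mor L (q t)" using inverse_pair_unique[OF L.category_axioms _ L.inverse_pair_inv_mor[OF q_W_iso[OF t(1)]]] by blast
  note it = q_W_iso[OF t(1)]
  obtain u k where u: "u \<in> W" "k \<in> Mor C" "Dom C u = Cod C f" "Dom C k = Cod C t" "Cod C u = Cod C k" "sim (u \<cdot> f) (k \<cdot> t)"
    using Ore_left_sim[OF t(1), of f] s by auto
  have qm: "q x \<in> Mor L" "Dom L (q x) = Dom C x" "Cod L (q x) = Cod C x" if "x \<in> Mor C" for x using q_Hom[OF that] by (auto simp: Hom_iff)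
  have h: "?w \<in> Mor L" "Dom L ?w = Dom C t" "Cod L ?w = Y" using zigzag_bwd.hyps(2) by (auto simp: localization_def)
  have us: "u \<cdot> s \<in> W" using W_Cmp u s by simp
  have "q (u \<cdot> s) \<cdot>\<^bsub>L\<^esub> ?w \<cdot>\<^bsub>L\<^esub> ?i = q u \<cdot>\<^bsub>L\<^esub> (q s \<cdot>\<^bsub>L\<^esub> ?w) \<cdot>\<^bsub>L\<^esub> ?i"
    unfolding i using q_Cmp[of s u] s(1-5) u(1-5) t h(1) h(2,3) qm it by (simp del: localization_simps)
  also have "... = (q u \<cdot>\<^bsub>L\<^esub> q f) \<cdot>\<^bsub>L\<^esub> ?i" unfolding s(6) i using s(1-5) u(1-5) t qm it by (simp del: localization_simps)
  also have "q u \<cdot>\<^bsub>L\<^esub> q f = q k \<cdot>\<^bsub>L\<^esub> q t" using sim_imp_q[OF u(6)] q_Cmp[of f u] q_Cmp[of t k] s(1-5) u(1-5) t by simp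
  also have "(q k \<cdot>\<^bsub>L\<^esub> q t) \<cdot>\<^bsub>L\<^esub> ?i = q k" unfolding i using u(1-5) t qm it by (simp del: localization_simps)
  finally show ?case unfolding e using s(1-5) u(1-5) t us by (intro bexI[OF _ us] bexI[of _ k]) auto
qed

theorem ideal_localization_zigzag: "ideal_localization C W I L q"
proof -
  interpret L: category L by (rule localization_category[OF C.category_axioms S_Mor])
  have qm: "q x \<in> Mor L" "Dom L (q x) = Dom C x" "Cod L (q x) = Cod C x" if "x \<in> Mor C" for x using q_Hom[OF that] by (auto simp: Hom_iff)
  have fl: "\<exists>s\<in>W. \<exists>f\<in>Mor C. Dom C f = Dom L \<phi> \<and> Dom C s = Cod L \<phi> \<and> Cod C f = Cod C s \<and> q s \<cdot>\<^bsub>L\<^esub> \<phi> = q f" if p: "\<phi> \<in> Mor L" for \<phi>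
  proof -
    obtain X w Y where "\<phi> = (X, zz_class C S X w Y, Y)" "zigzag C S X w Y" using p by (auto simp: localization_def)
    then show ?thesis using zigzag_frac_left[of X w Y] by simp
  qed
  have fr: "\<exists>s\<in>W. \<exists>f\<in>Mor C. Cod C f = Cod L \<phi> \<and> Cod C s = Dom L \<phi> \<and> Dom C f = Dom C s \<and> \<phi> \<cdot>\<^bsub>L\<^esub> q s = q f" if p: "\<phi> \<in> Mor L" for \<phi>
  proof -
    obtain s f where s: "s \<in> W" "f \<in> Mor C" "Dom C f = Dom L \<phi>" "Dom C s = Cod L \<phi>" "Cod C f = Cod C s" "q s \<cdot>\<^bsub>L\<^esub> \<phi> = q f" using fl[OF p] by blast
    obtain t g where t: "t \<in> W" "g \<in> Mor C" "Cod C t = Dom C f" "Cod C g = Dom C s" "Dom C t = Dom C g" "sim (f \<cdot> t) (s \<cdot> g)"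
      using Ore_right_sim[OF s(1), of f] s by auto
    have "q s \<cdot>\<^bsub>L\<^esub> \<phi> \<cdot>\<^bsub>L\<^esub> q t = (q s \<cdot>\<^bsub>L\<^esub> \<phi>) \<cdot>\<^bsub>L\<^esub> q t" using p qm s(1-5) t(1-5) by (simp del: localization_simps)
    also have "... = q s \<cdot>\<^bsub>L\<^esub> q g" unfolding s(6) using sim_imp_q[OF t(6)] q_Cmp[of t f] q_Cmp[of g s] s(1-5) t(1-5) by simp
    finally have "\<phi> \<cdot>\<^bsub>L\<^esub> q t = q g" by (rule L.isomorphism_cancel_left[OF q_W_iso[OF s(1)]]) (use p qm s(1-5) t(1-5) in auto)
    then show ?thesis using s t by (intro bexI[of _ t] bexI[of _ g]) auto
  qed
  show ?thesis
  proof (rule ideal_localization.intro[OF ideal_calculus_axioms L.category_axioms], rule ideal_localization_axioms.intro)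
    fix f g assume "f \<in> Mor C" "g \<in> Mor C" "Dom C f = Dom C g" "Cod C f = Cod C g"
    then show "q f = q g \<longleftrightarrow> sim f g" using sim_imp_q[of f g] q_imp_sim[of f "Dom C g" "Cod C g" g] by (auto simp: Hom_iff)
  qed (use fl fr q_Hom q_Idt q_Cmp q_W_iso in auto)
qed

end

section \<open>The ideal quotient and the class of denominators\<close>

locale localizable = C: weakly_extriangulated C
  for C :: "('o, 'm, 'e) ext_cat" (structure) +
  fixes S :: "'m set"
  assumes M0: "M0 C S" and MR1: "MR1 C S" and MR2: "MR2 C S" and MR3: "MR3 C S"
begin

abbreviation B :: "('o, 'm set) cat" where "B \<equiv> Cbar C S"
abbreviation b :: "'m => 'm set" where "b \<equiv> bar C S"

definition I :: "'m set"
  where "I = {f \<in> Mor C. factors_through C (null_objects C S) f}"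

definition W :: "'m set"
  where "W = {f \<in> Mor C. b f \<in> Sbar C S}"

lemma S_Mor: "S \<subseteq> Mor C" and S_iso: "isomorphism C f ==> f \<in> S" using M0 by (simp_all add: M0_def)

lemma S_sum:
  assumes "f \<in> S" "g \<in> S" "biproduct C (Dom C f) (Dom C g) P i1 i2 p1 p2" "biproduct C (Cod C f) (Cod C g) R j1 j2 q1 q2"
  shows "Add C (j1 \<cdot> f \<cdot> p1) (j2 \<cdot> g \<cdot> p2) \<in> S"
proof -
  have "f \<in> S \<inter> Hom C (Dom C f) (Cod C f)" "g \<in> S \<inter> Hom C (Dom C g) (Cod C g)" using assms(1,2) S_Mor by (auto simp: Hom_iff)
  then show ?thesis using M0 assms(3,4) unfolding M0_def by blast
qed

lemma null_Ob: "N \<in> null_objects C S ==> N \<in> Ob C" by (simp add: null_objects_def)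

lemma zero_object_null: "zero_object C Z ==> Z \<in> null_objects C S"
proof -
  assume z: "zero_object C Z"
  then have "Z \<in> Ob C" "Zero C Z Z = Idt C Z" using C.zero_object_iff by auto
  then have "Zero C Z Z \<in> S" using S_iso[of "Idt C Z"] by simp
  then show ?thesis using z \<open>Z \<in> Ob C\<close> by (auto simp: null_objects_def)
qed

text \<open>\<open>P \<rightarrow> Y \<oplus> Z\<close> is the sum of \<open>M \<rightarrow> Y\<close> and \<open>N \<rightarrow> Z\<close>, and a sum of zero objects is zero. This makes the morphisms
  through null objects closed under addition.\<close>

lemma null_biproduct:
  assumes "M \<in> null_objects C S" "N \<in> null_objects C S" and P: "biproduct C M N P i1 i2 p1 p2"
  shows "P \<in> null_objects C S"
proof -
  obtain Y Z where Y: "zero_object C Y" "Zero C M Y \<in> S" "Zero C Y M \<in> S" and Z: "zero_object C Z" "Zero C N Z \<in> S" "Zero C Z N \<in> S"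
    using assms(1,2) by (auto simp: null_objects_def)
  note o = C.zero_object_Ob[OF Y(1)] C.zero_object_Ob[OF Z(1)] null_Ob[OF assms(1)] null_Ob[OF assms(2)]
  obtain R j1 j2 q1 q2 where R: "biproduct C Y Z R j1 j2 q1 q2" using C.ex_biproduct o by blast
  note p = C.biproduct_simps[OF P] and r = C.biproduct_simps[OF R]
  have "j1 = Zero C Y R" "j2 = Zero C Z R" using C.zero_object_Zero(2)[OF Y(1), of j1] C.zero_object_Zero(2)[OF Z(1), of j2] r by simp_all
  then have "Idt C R = Zero C R R" using r(1-15,20) by (metis C.Add_Zero(1) C.Cmp_Zero(1) C.Zero_simps)
  then have zR: "zero_object C R" using C.zero_object_iff r by simp
  have "Add C (j1 \<cdot> Zero C M Y \<cdot> p1) (j2 \<cdot> Zero C N Z \<cdot> p2) \<in> S" by (rule S_sum[OF Y(2) Z(2)]) (use P R o in simp_all)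
  then have 1: "Zero C P R \<in> S" using p(1-15) r(1-15) o by simp
  have "Add C (i1 \<cdot> Zero C Y M \<cdot> q1) (i2 \<cdot> Zero C Z N \<cdot> q2) \<in> S" by (rule S_sum[OF Y(3) Z(3)]) (use P R o in simp_all)
  then have 2: "Zero C R P \<in> S" using p(1-15) r(1-15) o by simp
  show ?thesis using zR 1 2 p by (auto simp: null_objects_def)
qed

lemma I_iff: "f \<in> I \<longleftrightarrow> (\<exists>N\<in>null_objects C S. \<exists>u v. u \<in> Mor C \<and> v \<in> Mor C \<and> Cod C u = N \<and> Dom C v = N \<and> f = v \<cdot> u)"
proof
  assume "f \<in> I"
  then obtain N u v where "N \<in> null_objects C S" "u \<in> Hom C (Dom C f) N" "v \<in> Hom C N (Cod C f)" "f = v \<cdot> u"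
    unfolding I_def factors_through_def by blast
  then show "\<exists>N\<in>null_objects C S. \<exists>u v. u \<in> Mor C \<and> v \<in> Mor C \<and> Cod C u = N \<and> Dom C v = N \<and> f = v \<cdot> u" unfolding Hom_iff by blast
next
  assume "\<exists>N\<in>null_objects C S. \<exists>u v. u \<in> Mor C \<and> v \<in> Mor C \<and> Cod C u = N \<and> Dom C v = N \<and> f = v \<cdot> u"
  then obtain N u v where h: "N \<in> null_objects C S" "u \<in> Mor C" "v \<in> Mor C" "Cod C u = N" "Dom C v = N" "f = v \<cdot> u" by blast
  show "f \<in> I" unfolding I_def factors_through_def h(6)
    by (intro CollectI conjI bexI[OF _ h(1)] bexI[of _ v] bexI[of _ u] refl) (use h(1-5) in \<open>simp_all add: Hom_iff\<close>)
qed

sublocale I: additive_ideal C I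
proof (rule additive_ideal.intro[OF C.additive_category_axioms], rule additive_ideal_axioms.intro)
  show "f \<in> I ==> f \<in> Mor C" for f by (simp add: I_def)
  show "Zero C X Y \<in> I" if "X \<in> Ob C" "Y \<in> Ob C" for X Y
  proof -
    obtain Z where Z: "zero_object C Z" using C.ex_zero_object by blast
    note o = C.zero_object_Ob[OF Z]
    have "Zero C Z Y \<cdot> Zero C X Z = Zero C X Y" using o that by simp
    then show ?thesis unfolding I_iff using zero_object_null[OF Z] o that by (intro bexI[of _ Z] exI[of _ "Zero C X Z"] exI[of _ "Zero C Z Y"]) auto
  qed
  show "Add C f g \<in> I" if fg: "f \<in> I" "g \<in> I" "Dom C f = Dom C g" "Cod C f = Cod C g" for f g
  proof -
    obtain M u v where f: "M \<in> null_objects C S" "u \<in> Mor C" "v \<in> Mor C" "Cod C u = M" "Dom C v = M" "f = v \<cdot> u" using fg(1) unfolding I_iff by blast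
    obtain N u' v' where g: "N \<in> null_objects C S" "u' \<in> Mor C" "v' \<in> Mor C" "Cod C u' = N" "Dom C v' = N" "g = v' \<cdot> u'"
      using fg(2) unfolding I_iff by blast
    obtain P i1 i2 p1 p2 where P: "biproduct C M N P i1 i2 p1 p2" using C.ex_biproduct null_Ob f(1) g(1) by blast
    note p = C.biproduct_simps[OF P]
    have d: "Dom C u = Dom C u'" "Cod C v = Cod C v'" using fg(3,4) f g by auto
    have "Add C (v \<cdot> p1) (v' \<cdot> p2) \<cdot> Add C (i1 \<cdot> u) (i2 \<cdot> u') = Add C (v \<cdot> u) (v' \<cdot> u')" using p f(2-5) g(2-5) d by simp
    then show ?thesis unfolding I_iff f(6) g(6) using null_biproduct[OF f(1) g(1) P] p f(2-5) g(2-5) d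
      by (intro bexI[of _ P] exI[of _ "Add C (i1 \<cdot> u) (i2 \<cdot> u')"] exI[of _ "Add C (v \<cdot> p1) (v' \<cdot> p2)"]) auto
  qed
  show "Neg C f \<in> I" if fI: "f \<in> I" for f
  proof -
    obtain M u v where f: "M \<in> null_objects C S" "u \<in> Mor C" "v \<in> Mor C" "Cod C u = M" "Dom C v = M" "f = v \<cdot> u" using fI unfolding I_iff by blast
    then have e: "Neg C f = Neg C v \<cdot> u" by simp
    show ?thesis unfolding I_iff e by (intro bexI[of _ M] exI[of _ u] exI[of _ "Neg C v"]) (use f(1-5) in simp_all)
  qed
  show "g \<cdot> f \<in> I" if fI: "f \<in> I" and gf: "g \<in> Mor C" "Cod C f = Dom C g" for f g
  proof -
    obtain M u v where f: "M \<in> null_objects C S" "u \<in> Mor C" "v \<in> Mor C" "Cod C u = M" "Dom C v = M" "f = v \<cdot> u" using fI unfolding I_iff by blast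
    then have e: "g \<cdot> f = (g \<cdot> v) \<cdot> u" "Cod C v = Dom C g" using gf by simp_all
    show ?thesis unfolding I_iff e(1) by (intro bexI[of _ M] exI[of _ u] exI[of _ "g \<cdot> v"]) (use e(2) f(1-5) gf in simp_all)
  qed
  show "g \<cdot> f \<in> I" if fI: "g \<in> I" and gf: "f \<in> Mor C" "Cod C f = Dom C g" for f g
  proof -
    obtain M u v where f: "M \<in> null_objects C S" "u \<in> Mor C" "v \<in> Mor C" "Cod C u = M" "Dom C v = M" "g = v \<cdot> u" using fI unfolding I_iff by blast
    then have e: "g \<cdot> f = v \<cdot> u \<cdot> f" "Cod C f = Dom C u" using gf by simp_all
    show ?thesis unfolding I_iff e(1) by (intro bexI[of _ M] exI[of _ "u \<cdot> f"] exI[of _ v]) (use e(2) f(1-5) gf in simp_all)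
  qed
qed

lemma bar_eq: "f \<in> Mor C ==> b f = {g. I.eqv g f}" unfolding bar_def ideal_class_def I.eqv_def unfolding I_def by (auto simp: Hom_iff)

lemma bar_eq_iff: "f \<in> Mor C ==> g \<in> Mor C ==> b f = b g \<longleftrightarrow> I.eqv f g"
proof -
  assume h: "f \<in> Mor C" "g \<in> Mor C"
  have "f \<in> b f" using h I.eqv_refl by (simp add: bar_eq)
  then show ?thesis using I.eqv_sym I.eqv_trans h unfolding bar_eq[OF h(1)] bar_eq[OF h(2)] by blast
qed

lemma Cbar_Dom: "f \<in> Mor C ==> Dom B (b f) = Dom C f" "f \<in> Mor C ==> Cod B (b f) = Cod C f"
proof -
  assume f: "f \<in> Mor C"
  have 1: "f \<in> b f" using I.eqv_refl[OF f] f by (simp add: bar_eq)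
  have 2: "\<forall>g\<in>b f. Dom C g = Dom C f \<and> Cod C g = Cod C f" using f by (auto simp: bar_eq I.eqv_def)
  have "Dom C ` b f = {Dom C f}" "Cod C ` b f = {Cod C f}" using 1 2 by blast+
  then show "Dom B (b f) = Dom C f" "Cod B (b f) = Cod C f" by (simp_all add: Cbar_def ideal_quotient_def)
qed

lemma Cbar_Cmp: "f \<in> Mor C ==> g \<in> Mor C ==> Cod C f = Dom C g ==> b g \<cdot>\<^bsub>B\<^esub> b f = b (g \<cdot> f)"
proof -
  assume h: "f \<in> Mor C" "g \<in> Mor C" "Cod C f = Dom C g"
  have e: "b (g' \<cdot> f') = b (g \<cdot> f)" if a: "I.eqv g' g" "I.eqv f' f" for g' f'
  proof -
    have m: "f' \<in> Mor C" "g' \<in> Mor C" "Dom C f' = Dom C f" "Cod C f' = Cod C f" "Dom C g' = Dom C g" "Cod C g' = Cod C g"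
      using a by (auto simp: I.eqv_def)
    have "I.eqv (g' \<cdot> f') (g' \<cdot> f)" by (rule I.eqv_left) (use a m h in auto)
    moreover have "I.eqv (g' \<cdot> f) (g \<cdot> f)" by (rule I.eqv_right) (use a m h in auto)
    ultimately have "I.eqv (g' \<cdot> f') (g \<cdot> f)" by (rule I.eqv_trans)
    then show ?thesis using bar_eq_iff m h by simp
  qed
  have "b g \<cdot>\<^bsub>B\<^esub> b f = (\<Union>g'\<in>b g. \<Union>f'\<in>b f. b (g' \<cdot> f'))" by (simp add: Cbar_def ideal_quotient_def bar_def)
  also have "... = (\<Union>g'\<in>b g. \<Union>f'\<in>b f. b (g \<cdot> f))" by (intro SUP_cong refl e) (use h in \<open>auto simp: bar_eq\<close>)
  also have "... = b (g \<cdot> f)" using I.eqv_refl[OF h(1)] I.eqv_refl[OF h(2)] bar_eq[OF h(1)] bar_eq[OF h(2)] by auto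
  finally show ?thesis .
qed

lemma Cbar_Mor: "Mor B = b ` Mor C" and Cbar_Idt: "Idt B X = b (Idt C X)" and Cbar_Ob: "Ob B = Ob C"
  by (simp_all add: Cbar_def ideal_quotient_def bar_def)

lemma Cbar_Hom: "\<beta> \<in> Hom B X Y \<longleftrightarrow> (\<exists>f\<in>Hom C X Y. \<beta> = b f)"
proof
  assume "\<beta> \<in> Hom B X Y"
  then obtain f where "f \<in> Mor C" "\<beta> = b f" "Dom B \<beta> = X" "Cod B \<beta> = Y" unfolding Hom_iff Cbar_Mor by blast
  then show "\<exists>f\<in>Hom C X Y. \<beta> = b f" using Cbar_Dom by (intro bexI[of _ f]) (simp_all add: Hom_iff)
next
  assume "\<exists>f\<in>Hom C X Y. \<beta> = b f"
  then show "\<beta> \<in> Hom B X Y" using Cbar_Dom by (auto simp: Hom_iff Cbar_Mor)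
qed

lemma bar_Hom: "f \<in> Hom C X Y ==> b f \<in> Hom B X Y" using Cbar_Hom by blast

lemma W_Sbar: "\<beta> \<in> Sbar C S ==> \<exists>w\<in>W. \<beta> = b w" using MR2 unfolding MR2_def multiplicative_system_def Cbar_Mor W_def by auto

lemma W_Mor: "s \<in> W ==> s \<in> Mor C" by (simp add: W_def)

lemma category_Cbar: "category B"
proof
  fix \<beta> assume "\<beta> \<in> Mor B"
  then obtain f where "f \<in> Mor C" "\<beta> = b f" unfolding Cbar_Mor by blast
  then show "Dom B \<beta> \<in> Ob B" "Cod B \<beta> \<in> Ob B" using Cbar_Dom by (simp_all add: Cbar_Ob)
next
  show "X \<in> Ob B ==> Idt B X \<in> Hom B X X" for X using bar_Hom[of "Idt C X" X X] by (simp add: Cbar_Idt Cbar_Ob Hom_iff)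
next
  fix \<alpha> \<beta> X Y Z assume "\<alpha> \<in> Hom B X Y" "\<beta> \<in> Hom B Y Z"
  then obtain f g where "f \<in> Hom C X Y" "\<alpha> = b f" "g \<in> Hom C Y Z" "\<beta> = b g" unfolding Cbar_Hom by blast
  then show "\<beta> \<cdot>\<^bsub>B\<^esub> \<alpha> \<in> Hom B X Z" using bar_Hom[of "g \<cdot> f" X Z] by (simp add: Hom_iff Cbar_Cmp)
next
  fix \<alpha> X Y assume "\<alpha> \<in> Hom B X Y"
  then obtain f where "f \<in> Hom C X Y" "\<alpha> = b f" unfolding Cbar_Hom by blast
  then show "Idt B Y \<cdot>\<^bsub>B\<^esub> \<alpha> = \<alpha>" "\<alpha> \<cdot>\<^bsub>B\<^esub> Idt B X = \<alpha>" by (auto simp: Hom_iff Cbar_Cmp Cbar_Idt)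
next
  fix \<alpha> \<beta> \<gamma> X Y Z V assume "\<alpha> \<in> Hom B X Y" "\<beta> \<in> Hom B Y Z" "\<gamma> \<in> Hom B Z V"
  then obtain f g h where "f \<in> Hom C X Y" "\<alpha> = b f" "g \<in> Hom C Y Z" "\<beta> = b g" "h \<in> Hom C Z V" "\<gamma> = b h" unfolding Cbar_Hom by blast
  then show "(\<gamma> \<cdot>\<^bsub>B\<^esub> \<beta>) \<cdot>\<^bsub>B\<^esub> \<alpha> = \<gamma> \<cdot>\<^bsub>B\<^esub> \<beta> \<cdot>\<^bsub>B\<^esub> \<alpha>" by (simp add: Hom_iff Cbar_Cmp)
qed

lemma S_W: "s \<in> S ==> s \<in> W"
proof -
  assume s: "s \<in> S"
  then have m: "s \<in> Mor C" using S_Mor by auto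
  interpret B: category B by (rule category_Cbar)
  have "b s = b (Idt C (Cod C s)) \<cdot>\<^bsub>B\<^esub> b s \<cdot>\<^bsub>B\<^esub> b (Idt C (Dom C s))" using m by (simp add: Cbar_Cmp)
  moreover have "isomorphism B (b (Idt C X))" if "X \<in> Ob C" for X using B.isomorphism_Idt[of X] that by (simp add: Cbar_Ob Cbar_Idt)
  ultimately have "b s \<in> Sbar C S" unfolding Sbar_def using s m Cbar_Dom
    by (intro CollectI exI[of _ "b (Idt C (Cod C s))"] exI[of _ s] exI[of _ "b (Idt C (Dom C s))"]) simp
  then show ?thesis using m by (simp add: W_def)
qed

lemma eqv_if_bar: "Add C f (Neg C g) \<in> I" if "b f = b g" "f \<in> Mor C" "g \<in> Mor C" using that bar_eq_iff I.eqv_def by blast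

theorem ideal_calculus: "ideal_calculus C W I"
proof (rule ideal_calculus.intro[OF C.weakly_extriangulated_axioms], rule ideal_calculus_axioms.intro)
  note ms = MR2[unfolded MR2_def multiplicative_system_def]
  note m3 = conjunct2[OF conjunct2[OF conjunct2[OF ms]]]
  note ore_l = conjunct1[OF m3] and ore_r = conjunct1[OF conjunct2[OF m3]] and canc = conjunct2[OF conjunct2[OF m3]]
  show "s \<in> W ==> s \<in> Mor C" for s by (rule W_Mor)
  show "Idt C X \<in> W" if "X \<in> Ob C" for X using S_W S_iso C.isomorphism_Idt[OF that] by blast
  show "t \<cdot> s \<in> W" if "s \<in> W" "t \<in> W" "Cod C s = Dom C t" for s t
  proof -
    have "b t \<cdot>\<^bsub>B\<^esub> b s \<in> Sbar C S" using ms that Cbar_Dom unfolding closed_under_comp_def W_def by auto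
    then show ?thesis using that by (simp add: W_def Cbar_Cmp)
  qed
  note two = MR1[unfolded MR1_def two_out_of_three_def, rule_format]
  show "g \<in> W" if "f \<in> W" "g \<in> Mor C" "Cod C f = Dom C g" "g \<cdot> f \<in> W" for f g
    using two[of "b f" "Dom C f" "Cod C f" "b g" "Cod C g"] that bar_Hom[of f "Dom C f" "Cod C f"] bar_Hom[of g "Cod C f" "Cod C g"]
    by (simp add: W_def Cbar_Cmp Hom_iff)
  show "f \<in> W" if "f \<in> Mor C" "g \<in> W" "Cod C f = Dom C g" "g \<cdot> f \<in> W" for f g
    using two[of "b f" "Dom C f" "Cod C f" "b g" "Cod C g"] that bar_Hom[of f "Dom C f" "Cod C f"] bar_Hom[of g "Cod C f" "Cod C g"]
    by (simp add: W_def Cbar_Cmp Hom_iff)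
  show "g \<in> W" if "f \<in> W" "g \<in> Mor C" "Dom C f = Dom C g" "Cod C f = Cod C g" "Add C f (Neg C g) \<in> I" for f g
    using bar_eq_iff[of f g] that by (simp add: W_def I.eqv_def)
  show "\<exists>s'\<in>W. \<exists>f'\<in>Mor C. Dom C s' = Cod C f \<and> Dom C f' = Cod C s \<and> Cod C s' = Cod C f' \<and> Add C (s' \<cdot> f) (Neg C (f' \<cdot> s)) \<in> I"
    if h: "s \<in> W" "f \<in> Mor C" "Dom C s = Dom C f" for s f
  proof -
    have 0: "b s \<in> Sbar C S \<inter> Hom B (Dom C f) (Cod C s)" "b f \<in> Hom B (Dom C f) (Cod C f)"
      using h bar_Hom[of s] bar_Hom[of f] by (auto simp: W_def Hom_iff)
    obtain Y' \<sigma> \<phi> where 1: "\<sigma> \<in> Sbar C S" "\<sigma> \<in> Hom B (Cod C f) Y'" "\<phi> \<in> Hom B (Cod C s) Y'" "\<sigma> \<cdot>\<^bsub>B\<^esub> b f = \<phi> \<cdot>\<^bsub>B\<^esub> b s"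
      using ore_l[THEN spec, THEN spec, THEN spec, THEN bspec, OF 0(1), THEN bspec, OF 0(2)] by (elim exE bexE IntE)
    obtain s' f' where 2: "s' \<in> Hom C (Cod C f) Y'" "\<sigma> = b s'" "f' \<in> Hom C (Cod C s) Y'" "\<phi> = b f'"
      using Cbar_Hom[THEN iffD1, OF 1(2)] Cbar_Hom[THEN iffD1, OF 1(3)] by blast
    have "Add C (s' \<cdot> f) (Neg C (f' \<cdot> s)) \<in> I" by (rule eqv_if_bar) (use 1 2 h W_Mor[OF h(1)] in \<open>simp_all add: Hom_iff Cbar_Cmp\<close>)
    then show ?thesis using 1(1) 2 by (intro bexI[of _ s'] bexI[of _ f']) (auto simp: W_def Hom_iff)
  qed
  show "\<exists>s'\<in>W. \<exists>f'\<in>Mor C. Cod C s' = Dom C f \<and> Cod C f' = Dom C s \<and> Dom C s' = Dom C f' \<and> Add C (f \<cdot> s') (Neg C (s \<cdot> f')) \<in> I"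
    if h: "s \<in> W" "f \<in> Mor C" "Cod C s = Cod C f" for s f
  proof -
    have 0: "b s \<in> Sbar C S \<inter> Hom B (Dom C s) (Cod C f)" "b f \<in> Hom B (Dom C f) (Cod C f)"
      using h bar_Hom[of s] bar_Hom[of f] by (auto simp: W_def Hom_iff)
    obtain Y' \<sigma> \<phi> where 1: "\<sigma> \<in> Sbar C S" "\<sigma> \<in> Hom B Y' (Dom C f)" "\<phi> \<in> Hom B Y' (Dom C s)" "b f \<cdot>\<^bsub>B\<^esub> \<sigma> = b s \<cdot>\<^bsub>B\<^esub> \<phi>"
      using ore_r[THEN spec, THEN spec, THEN spec, THEN bspec, OF 0(1), THEN bspec, OF 0(2)] by (elim exE bexE IntE)
    obtain s' f' where 2: "s' \<in> Hom C Y' (Dom C f)" "\<sigma> = b s'" "f' \<in> Hom C Y' (Dom C s)" "\<phi> = b f'"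
      using Cbar_Hom[THEN iffD1, OF 1(2)] Cbar_Hom[THEN iffD1, OF 1(3)] by blast
    have "Add C (f \<cdot> s') (Neg C (s \<cdot> f')) \<in> I" by (rule eqv_if_bar) (use 1 2 h W_Mor[OF h(1)] in \<open>simp_all add: Hom_iff Cbar_Cmp\<close>)
    then show ?thesis using 1(1) 2 by (intro bexI[of _ s'] bexI[of _ f']) (auto simp: W_def Hom_iff)
  qed
  have zero: "f \<in> I \<longleftrightarrow> b f = b (Zero C (Dom C f) (Cod C f))" if "f \<in> Mor C" for f
    using bar_eq_iff[of f "Zero C (Dom C f) (Cod C f)"] that by (simp add: I.eqv_def)
  have can: "(\<exists>s\<in>W. Cod C s = Dom C f \<and> f \<cdot> s \<in> I) \<longleftrightarrow> (\<exists>t\<in>W. Dom C t = Cod C f \<and> t \<cdot> f \<in> I)" if f: "f \<in> Mor C" for f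
  proof -
    let ?X = "Dom C f" and ?Y = "Cod C f"
    have 1: "b f \<in> Hom B ?X ?Y" "b (Zero C ?X ?Y) \<in> Hom B ?X ?Y" by (rule bar_Hom; use f in \<open>simp add: Hom_iff\<close>)+
    have "(\<exists>s\<in>W. Cod C s = ?X \<and> f \<cdot> s \<in> I) \<longleftrightarrow> (\<exists>\<sigma>\<in>Sbar C S. Cod B \<sigma> = ?X \<and> b f \<cdot>\<^bsub>B\<^esub> \<sigma> = b (Zero C ?X ?Y) \<cdot>\<^bsub>B\<^esub> \<sigma>)"
    proof
      assume "\<exists>s\<in>W. Cod C s = ?X \<and> f \<cdot> s \<in> I"
      then obtain s where "s \<in> W" "Cod C s = ?X" "f \<cdot> s \<in> I" by blast
      then show "\<exists>\<sigma>\<in>Sbar C S. Cod B \<sigma> = ?X \<and> b f \<cdot>\<^bsub>B\<^esub> \<sigma> = b (Zero C ?X ?Y) \<cdot>\<^bsub>B\<^esub> \<sigma>"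
        using zero[of "f \<cdot> s"] f W_Mor[of s] by (intro bexI[of _ "b s"]) (simp_all add: Cbar_Cmp Cbar_Dom W_def)
    next
      assume "\<exists>\<sigma>\<in>Sbar C S. Cod B \<sigma> = ?X \<and> b f \<cdot>\<^bsub>B\<^esub> \<sigma> = b (Zero C ?X ?Y) \<cdot>\<^bsub>B\<^esub> \<sigma>"
      then obtain \<sigma> where s: "\<sigma> \<in> Sbar C S" "Cod B \<sigma> = ?X" "b f \<cdot>\<^bsub>B\<^esub> \<sigma> = b (Zero C ?X ?Y) \<cdot>\<^bsub>B\<^esub> \<sigma>" by blast
      obtain s where "s \<in> W" "\<sigma> = b s" using W_Sbar[OF s(1)] by blast
      note s = this s(2,3)[unfolded this(2)]
      show "\<exists>s\<in>W. Cod C s = ?X \<and> f \<cdot> s \<in> I" using zero[of "f \<cdot> s"] f s W_Mor[of s] by (intro bexI[of _ s]) (simp_all add: Cbar_Cmp Cbar_Dom)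
    qed
    also have "... \<longleftrightarrow> (\<exists>\<tau>\<in>Sbar C S. Dom B \<tau> = ?Y \<and> \<tau> \<cdot>\<^bsub>B\<^esub> b f = \<tau> \<cdot>\<^bsub>B\<^esub> b (Zero C ?X ?Y))" using bspec[OF bspec[OF spec[OF spec[OF canc]] 1(1)] 1(2)] .
    also have "... \<longleftrightarrow> (\<exists>t\<in>W. Dom C t = Cod C f \<and> t \<cdot> f \<in> I)"
    proof
      assume "\<exists>t\<in>W. Dom C t = ?Y \<and> t \<cdot> f \<in> I"
      then obtain t where "t \<in> W" "Dom C t = ?Y" "t \<cdot> f \<in> I" by blast
      then show "\<exists>\<tau>\<in>Sbar C S. Dom B \<tau> = ?Y \<and> \<tau> \<cdot>\<^bsub>B\<^esub> b f = \<tau> \<cdot>\<^bsub>B\<^esub> b (Zero C ?X ?Y)"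
        using zero[of "t \<cdot> f"] f W_Mor[of t] by (intro bexI[of _ "b t"]) (simp_all add: Cbar_Cmp Cbar_Dom W_def)
    next
      assume "\<exists>\<tau>\<in>Sbar C S. Dom B \<tau> = ?Y \<and> \<tau> \<cdot>\<^bsub>B\<^esub> b f = \<tau> \<cdot>\<^bsub>B\<^esub> b (Zero C ?X ?Y)"
      then obtain \<tau> where t: "\<tau> \<in> Sbar C S" "Dom B \<tau> = ?Y" "\<tau> \<cdot>\<^bsub>B\<^esub> b f = \<tau> \<cdot>\<^bsub>B\<^esub> b (Zero C ?X ?Y)" by blast
      obtain t where "t \<in> W" "\<tau> = b t" using W_Sbar[OF t(1)] by blast
      note t = this t(2,3)[unfolded this(2)]
      show "\<exists>t\<in>W. Dom C t = ?Y \<and> t \<cdot> f \<in> I" using zero[of "t \<cdot> f"] f t W_Mor[of t] by (intro bexI[of _ t]) (simp_all add: Cbar_Cmp Cbar_Dom)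
    qed
    finally show ?thesis .
  qed
  show "\<exists>t\<in>W. Dom C t = Cod C f \<and> t \<cdot> f \<in> I" if "f \<in> Mor C" "s \<in> W" "Cod C s = Dom C f" "f \<cdot> s \<in> I" for f s
    by (rule iffD1[OF can[OF that(1)]], rule bexI[OF _ that(2)]) (use that in simp)
  show "\<exists>s\<in>W. Cod C s = Dom C f \<and> f \<cdot> s \<in> I" if "f \<in> Mor C" "t \<in> W" "Dom C t = Cod C f" "t \<cdot> f \<in> I" for f t
    by (rule iffD2[OF can[OF that(1)]], rule bexI[OF _ that(2)]) (use that in simp)
  show "\<exists>N Z. \<exists>u\<in>Hom C (Dom C f) N. \<exists>v\<in>Hom C N (Cod C f). f = v \<cdot> u \<and> zero_object C Z \<and> Zero C N Z \<in> W \<and> Zero C Z N \<in> W"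
    if fI: "f \<in> I" for f
  proof -
    obtain N u v where N: "N \<in> null_objects C S" "u \<in> Hom C (Dom C f) N" "v \<in> Hom C N (Cod C f)" "f = v \<cdot> u"
      using fI unfolding I_def factors_through_def by blast
    obtain Z where Z: "zero_object C Z" "Zero C N Z \<in> S" "Zero C Z N \<in> S" using N(1) by (auto simp: null_objects_def)
    show ?thesis by (rule exI[of _ N], rule exI[of _ Z], rule bexI[OF _ N(2)], rule bexI[OF _ N(3)]) (use N(4) Z(1) S_W[OF Z(2)] S_W[OF Z(3)] in blast)
  qed
  show "\<exists>f\<in>W. f \<in> Hom C E E' \<and> Add C (f \<cdot> x) (Neg C (x' \<cdot> a)) \<in> I \<and> Add C (c \<cdot> y) (Neg C (y' \<cdot> f)) \<in> I"
    if T: "s_triangle C A E X x y \<delta>" "s_triangle C A' E' X' x' y' \<delta>'" and ac: "a \<in> W" "c \<in> W" "a \<in> Hom C A A'" "c \<in> Hom C X X'"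
      "push C X a \<delta> = pull C A' c \<delta>'" for A E X x y \<delta> A' E' X' x' y' \<delta>' a c
  proof -
    have "b a \<in> Sbar C S" "b c \<in> Sbar C S" using ac by (simp_all add: W_def)
    then obtain \<beta> where 1: "\<beta> \<in> Sbar C S" "\<beta> \<in> Hom B E E'" "\<beta> \<cdot>\<^bsub>B\<^esub> b x = b x' \<cdot>\<^bsub>B\<^esub> b a" "b c \<cdot>\<^bsub>B\<^esub> b y = b y' \<cdot>\<^bsub>B\<^esub> \<beta>"
      using MR3[unfolded MR3_def, rule_format, OF ac(3,4) T ac(5)] by blast
    obtain f where f: "f \<in> Hom C E E'" "\<beta> = b f" using Cbar_Hom[THEN iffD1, OF 1(2)] by blast
    have xy: "x \<in> Hom C A E" "y \<in> Hom C E X" "x' \<in> Hom C A' E'" "y' \<in> Hom C E' X'" using T by (auto simp: s_triangle_def)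
    have "Add C (f \<cdot> x) (Neg C (x' \<cdot> a)) \<in> I" by (rule eqv_if_bar) (use 1 f xy ac in \<open>simp_all add: Hom_iff Cbar_Cmp\<close>)
    moreover have "Add C (c \<cdot> y) (Neg C (y' \<cdot> f)) \<in> I" by (rule eqv_if_bar) (use 1 f xy ac in \<open>simp_all add: Hom_iff Cbar_Cmp\<close>)
    ultimately show ?thesis using 1(1) f by (intro bexI[of _ f]) (auto simp: W_def Hom_iff)
  qed
qed (use I.I_Mor I.I_Zero I.I_Add I.I_Neg I.I_left I.I_right in blast)+

text \<open>If \<open>f = g + v u\<close> with \<open>u: X \<rightarrow> N\<close> and \<open>v: N \<rightarrow> Y\<close>, then \<open>f = (g, v)(1, u)\<close> and \<open>g = (g, v)(1, 0)\<close>, where \<open>(1, u)\<close>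
  and \<open>(1, 0)\<close> are sections of the projection \<open>X \<oplus> N \<rightarrow> X\<close>.\<close>

lemma q_ideal:
  assumes "f \<in> Mor C" "g \<in> Mor C" "Dom C f = Dom C g" "Cod C f = Cod C g" "Add C f (Neg C g) \<in> I"
  shows "mor_map (loc_functor C S) f = mor_map (loc_functor C S) g"
proof -
  let ?q = "mor_map (loc_functor C S)" and ?L = "localization C S" and ?X = "Dom C g"
  interpret L: category ?L by (rule localization_category[OF C.category_axioms S_Mor])
  note q_Hom = C.loc_functor_Hom[OF S_Mor] and q_Cmp = C.loc_functor_Cmp[OF S_Mor]
  obtain N u v where N: "N \<in> null_objects C S" "u \<in> Mor C" "v \<in> Mor C" "Cod C u = N" "Dom C v = N" "Add C f (Neg C g) = v \<cdot> u"
    using assms(5) unfolding I_iff by blast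
  obtain Z where Z: "zero_object C Z" "Zero C N Z \<in> S" using N(1) by (auto simp: null_objects_def)
  note z = C.zero_object_Ob[OF Z(1)] null_Ob[OF N(1)]
  have uv: "Dom C u = ?X" "Cod C v = Cod C g"
  proof -
    have "Dom C (v \<cdot> u) = ?X" "Cod C (v \<cdot> u) = Cod C g" unfolding N(6)[symmetric] using assms(1-4) by simp_all
    then show "Dom C u = ?X" "Cod C v = Cod C g" using N by simp_all
  qed
  have X: "?X \<in> Ob C" using assms by simp
  obtain P i1 i2 p1 p2 where P: "biproduct C ?X N P i1 i2 p1 p2" using C.ex_biproduct[of ?X N] assms z by auto
  note p = C.biproduct_simps[OF P]
  have zi: "Idt C Z = Zero C Z Z" using Z C.zero_object_iff by blast
  (* X as the biproduct of X and 0, so that p1 is the direct sum of the identity of X and N -> 0 *)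
  have bX: "biproduct C ?X Z ?X (Idt C ?X) (Zero C Z ?X) (Idt C ?X) (Zero C ?X Z)" unfolding biproduct_def using X z zi by (simp add: Hom_iff)
  have "Add C (Idt C ?X \<cdot> Idt C ?X \<cdot> p1) (Zero C Z ?X \<cdot> Zero C N Z \<cdot> p2) \<in> S"
    by (rule S_sum[OF S_iso[OF C.isomorphism_Idt[OF X]] Z(2)]) (use P bX z X in simp_all)
  then have "p1 \<in> S" using p X z by simp
  then have i: "isomorphism ?L (?q p1)" unfolding isomorphism_def using loc_functor_inverse[OF C.category_axioms S_Mor] by blast
  let ?j = "Add C i1 (i2 \<cdot> u)" and ?k = "Add C (g \<cdot> p1) (v \<cdot> p2)"
  have j: "?j \<in> Mor C" "Dom C ?j = ?X" "Cod C ?j = P" and k: "?k \<in> Mor C" "Dom C ?k = P" using p uv N assms by simp_all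
  have "?q p1 \<cdot>\<^bsub>?L\<^esub> ?q ?j = ?q p1 \<cdot>\<^bsub>?L\<^esub> ?q i1" using q_Cmp[of ?j p1] q_Cmp[of i1 p1] j p uv N X by simp
  then have e: "?q ?j = ?q i1"
    by (rule L.isomorphism_cancel_left[OF i]) (use q_Hom[of ?j] q_Hom[of i1] q_Hom[of p1] j p in \<open>simp_all add: Hom_iff\<close>)
  have "?k \<cdot> ?j = Add C g (v \<cdot> u)" using p uv N(2-5) assms(1-4) by simp
  also have "... = Add C (Add C f (Neg C g)) g" unfolding N(6)[symmetric] using assms(1-4) by (intro C.Add_comm) simp_all
  also have "... = f" using C.Add_Neg_cancel(1)[OF assms(1-4)] .
  finally have f: "?k \<cdot> ?j = f" .
  have g: "?k \<cdot> i1 = g" using p uv N(2-5) assms(1-4) by simp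
  have "?q f = ?q ?k \<cdot>\<^bsub>?L\<^esub> ?q ?j" unfolding f[symmetric] by (rule q_Cmp) (use j k in simp_all)
  also have "... = ?q (?k \<cdot> i1)" unfolding e by (rule q_Cmp[symmetric]) (use p k in simp_all)
  finally show ?thesis unfolding g .
qed

text \<open>An isomorphism of the ideal quotient is represented by a morphism that is invertible modulo the ideal,
  hence invertible after \<open>q\<close>.\<close>

lemma q_W_iso:
  assumes "s \<in> W"
  shows "isomorphism (localization C S) (mor_map (loc_functor C S) s)"
proof -
  let ?q = "mor_map (loc_functor C S)" and ?L = "localization C S"
  interpret L: category ?L by (rule localization_category[OF C.category_axioms S_Mor])
  interpret B: category B by (rule category_Cbar)
  note q_Hom = C.loc_functor_Hom[OF S_Mor] and q_Idt = C.loc_functor_Idt[OF S_Mor] and q_Cmp = C.loc_functor_Cmp[OF S_Mor]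
  have q_bar: "?q f = ?q g" if "b f = b g" "f \<in> Mor C" "g \<in> Mor C" for f g
  proof -
    have "I.eqv f g" using bar_eq_iff[OF that(2,3)] that(1) by simp
    then show ?thesis by (intro q_ideal) (simp_all add: I.eqv_def)
  qed
  have iso: "\<exists>f\<in>Mor C. \<alpha> = b f \<and> isomorphism ?L (?q f)" if i: "isomorphism B \<alpha>" for \<alpha>
  proof -
    obtain \<gamma> where g: "inverse_pair B \<alpha> \<gamma>" using i unfolding isomorphism_def by blast
    obtain f where f: "f \<in> Mor C" "\<alpha> = b f" using B.isomorphism_Mor[OF i] unfolding Cbar_Mor by blast
    obtain h where h: "h \<in> Hom C (Cod C f) (Dom C f)" "\<gamma> = b h"
      using g Cbar_Hom[of \<gamma> "Cod C f" "Dom C f"] Cbar_Dom[OF f(1)] unfolding inverse_pair_def f(2) by auto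
    note m = h(1)[unfolded Hom_iff]
    have "b (h \<cdot> f) = b (Idt C (Dom C f))" "b (f \<cdot> h) = b (Idt C (Cod C f))"
      using g f h m by (simp_all add: inverse_pair_def Cbar_Cmp Cbar_Dom Cbar_Idt)
    then have "?q (h \<cdot> f) = ?q (Idt C (Dom C f))" "?q (f \<cdot> h) = ?q (Idt C (Cod C f))" using f m by (intro q_bar; simp)+
    then have "?q h \<cdot>\<^bsub>?L\<^esub> ?q f = Idt ?L (Dom C f)" "?q f \<cdot>\<^bsub>?L\<^esub> ?q h = Idt ?L (Cod C f)" using q_Cmp q_Idt f m by simp_all
    then have "inverse_pair ?L (?q f) (?q h)" unfolding inverse_pair_def using q_Hom[OF f(1)] q_Hom[of h] m by (simp add: Hom_iff)
    then show ?thesis using f unfolding isomorphism_def by blast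
  qed
  have "b s \<in> Sbar C S" using assms by (simp add: W_def)
  then obtain \<beta> r \<alpha> where h: "b s = \<beta> \<cdot>\<^bsub>B\<^esub> b r \<cdot>\<^bsub>B\<^esub> \<alpha>" "r \<in> S" "isomorphism B \<alpha>" "isomorphism B \<beta>" "Cod B \<alpha> = Dom C r" "Dom B \<beta> = Cod C r"
    unfolding Sbar_def by blast
  obtain f g where f: "f \<in> Mor C" "\<alpha> = b f" "isomorphism ?L (?q f)" and g: "g \<in> Mor C" "\<beta> = b g" "isomorphism ?L (?q g)"
    using iso[OF h(3)] iso[OF h(4)] by blast
  have r: "r \<in> Mor C" "isomorphism ?L (?q r)"
    using h(2) S_Mor loc_functor_inverse[OF C.category_axioms S_Mor h(2)] unfolding isomorphism_def by blast+
  have e: "Cod C f = Dom C r" "Dom C g = Cod C r" using h(5,6) f g Cbar_Dom by simp_all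
  have "b s = b (g \<cdot> r \<cdot> f)" using h(1) f g r e by (simp add: Cbar_Cmp)
  then have "?q s = ?q (g \<cdot> r \<cdot> f)" using f g r e W_Mor[OF assms] by (intro q_bar) simp_all
  also have "... = ?q g \<cdot>\<^bsub>?L\<^esub> ?q r \<cdot>\<^bsub>?L\<^esub> ?q f" using q_Cmp f g r e by simp
  also have "isomorphism ?L ..." by (intro L.isomorphism_Cmp f g r) (use q_Hom f g r e in \<open>simp_all add: Hom_iff del: localization_simps\<close>)
  finally show ?thesis .
qed

lemma W_Idt: "X \<in> Ob C ==> Idt C X \<in> W" using S_W S_iso C.isomorphism_Idt by blast

text \<open>Both \<open>x\<close> and \<open>x' s\<close> lie in the span of \<open>K\<close>, so by (MR4) their composite does; a representation of it
  is an equation modulo the ideal.\<close>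

lemma span_comp:
  assumes K: "K \<subseteq> Mor C" "closed_under_comp B (Sbar_span C S K)"
    and x: "x \<in> K" "x' \<in> K" "s \<in> W" "Cod C x = Dom C s" "Cod C s = Dom C x'"
  shows "\<exists>z\<in>K. \<exists>u\<in>W. \<exists>v\<in>W. Cod C u = Dom C z \<and> Dom C v = Cod C z \<and>
    mor_map (loc_functor C S) (x' \<cdot> s \<cdot> x) = mor_map (loc_functor C S) (v \<cdot> z \<cdot> u)"
proof -
  have m: "x \<in> Mor C" "x' \<in> Mor C" "s \<in> Mor C" using K x W_Mor by auto
  have span: "b (v \<cdot> y \<cdot> u) \<in> Sbar_span C S K"
    if h: "y \<in> K" "u \<in> W" "v \<in> W" "Cod C u = Dom C y" "Dom C v = Cod C y" for y u v
  proof -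
    have m: "y \<in> Mor C" "u \<in> Mor C" "v \<in> Mor C" using h K W_Mor by auto
    then have e: "b (v \<cdot> y \<cdot> u) = b v \<cdot>\<^bsub>B\<^esub> b y \<cdot>\<^bsub>B\<^esub> b u" using h by (simp add: Cbar_Cmp)
    have "b u \<in> Sbar C S" "b v \<in> Sbar C S" "Cod B (b u) = Dom C y" "Dom B (b v) = Cod C y" using h m Cbar_Dom by (simp_all add: W_def)
    then show ?thesis unfolding Sbar_span_def e using h(1) by blast
  qed
  have 1: "b x \<in> Sbar_span C S K" and 2: "b (x' \<cdot> s) \<in> Sbar_span C S K"
    using span[of x "Idt C (Dom C x)" "Idt C (Cod C x)"] span[of x' s "Idt C (Cod C x')"] x m W_Idt[of "Dom C x"] W_Idt[of "Cod C x"] W_Idt[of "Cod C x'"] by simp_all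
  have "b (x' \<cdot> s) \<cdot>\<^bsub>B\<^esub> b x \<in> Sbar_span C S K" using K(2) 1 2 x m Cbar_Dom unfolding closed_under_comp_def by simp
  then have "b (x' \<cdot> s \<cdot> x) \<in> Sbar_span C S K" using x m by (simp add: Cbar_Cmp)
  then obtain \<beta> z \<alpha> where h: "b (x' \<cdot> s \<cdot> x) = \<beta> \<cdot>\<^bsub>B\<^esub> b z \<cdot>\<^bsub>B\<^esub> \<alpha>" "z \<in> K" "\<alpha> \<in> Sbar C S" "\<beta> \<in> Sbar C S" "Cod B \<alpha> = Dom C z" "Dom B \<beta> = Cod C z"
    unfolding Sbar_span_def by blast
  obtain u v where u: "u \<in> W" "\<alpha> = b u" and v: "v \<in> W" "\<beta> = b v" using W_Sbar[OF h(3)] W_Sbar[OF h(4)] by blast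
  have z: "z \<in> Mor C" using h(2) K by auto
  have e: "Cod C u = Dom C z" "Dom C v = Cod C z" using h(5,6) u v W_Mor Cbar_Dom by simp_all
  have "b (x' \<cdot> s \<cdot> x) = b (v \<cdot> z \<cdot> u)" unfolding h(1) u(2) v(2) using W_Mor u v z e by (simp add: Cbar_Cmp)
  then have "I.eqv (x' \<cdot> s \<cdot> x) (v \<cdot> z \<cdot> u)" using bar_eq_iff[of "x' \<cdot> s \<cdot> x" "v \<cdot> z \<cdot> u"] W_Mor u v z e m x by simp
  then have "mor_map (loc_functor C S) (x' \<cdot> s \<cdot> x) = mor_map (loc_functor C S) (v \<cdot> z \<cdot> u)" by (intro q_ideal) (simp_all add: I.eqv_def)
  then show ?thesis using h(2) u(1) v(1) e by blast
qed

sublocale zigzag_calculus C W I S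
  by (rule zigzag_calculus.intro[OF ideal_calculus], rule zigzag_calculus_axioms.intro) (use S_W q_W_iso q_ideal in blast)+

end

section \<open>Exact functors\<close>

context
  fixes C :: "('o, 'm, 'e) ext_cat" and D :: "('p, 'n, 'k) ext_cat" and F :: "('o, 'm, 'e, 'p, 'n, 'k) exact_map"
  assumes F: "exact_functor C D F"
begin

lemma exact_functor_functor: "is_functor C D F" using F by (simp add: exact_functor_def additive_functor_def)

lemma exact_functor_Ob: "X \<in> Ob C ==> obj_map F X \<in> Ob D" using exact_functor_functor by (simp add: is_functor_def)

lemma exact_functor_Mor:
  "f \<in> Mor C ==> mor_map F f \<in> Mor D" "f \<in> Mor C ==> Dom D (mor_map F f) = obj_map F (Dom C f)"
  "f \<in> Mor C ==> Cod D (mor_map F f) = obj_map F (Cod C f)" using exact_functor_functor by (auto simp: is_functor_def Hom_iff)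

lemma exact_functor_Idt: "X \<in> Ob C ==> mor_map F (Idt C X) = Idt D (obj_map F X)" using exact_functor_functor by (simp add: is_functor_def)

lemma exact_functor_Cmp:
  "f \<in> Mor C ==> g \<in> Mor C ==> Cod C f = Dom C g ==> mor_map F (g \<cdot>\<^bsub>C\<^esub> f) = mor_map F g \<cdot>\<^bsub>D\<^esub> mor_map F f"
proof -
  assume "f \<in> Mor C" "g \<in> Mor C" "Cod C f = Dom C g"
  then have "f \<in> Hom C (Dom C f) (Cod C f)" "g \<in> Hom C (Cod C f) (Cod C g)" by (auto simp: Hom_iff)
  then show ?thesis using exact_functor_functor unfolding is_functor_def by blast
qed

lemma exact_functor_Add:
  "f \<in> Mor C ==> g \<in> Mor C ==> Dom C f = Dom C g ==> Cod C f = Cod C g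
   ==> mor_map F (Add C f g) = Add D (mor_map F f) (mor_map F g)"
proof -
  assume "f \<in> Mor C" "g \<in> Mor C" "Dom C f = Dom C g" "Cod C f = Cod C g"
  then have "f \<in> Hom C (Dom C f) (Cod C f)" "g \<in> Hom C (Dom C f) (Cod C f)" by (auto simp: Hom_iff)
  then show ?thesis using F unfolding exact_functor_def additive_functor_def by blast
qed

lemma exact_functor_ext_hom:
  "X \<in> Ob C ==> A \<in> Ob C ==> ext_map F X A \<in> hom (Ext C X A) (Ext D (obj_map F X) (obj_map F A))" using F by (simp add: exact_functor_def)

lemma exact_functor_ext_closed:
  "X \<in> Ob C ==> A \<in> Ob C ==> \<delta> \<in> Exts C X A ==> ext_map F X A \<delta> \<in> Exts D (obj_map F X) (obj_map F A)"
  using exact_functor_ext_hom by (blast intro: hom_in_carrier)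

lemma exact_functor_ExtMap:
  "c \<in> Mor C ==> a \<in> Mor C ==> \<delta> \<in> Exts C (Cod C c) (Dom C a) ==>
   ext_map F (Dom C c) (Cod C a) (ExtMap C c a \<delta>) = ExtMap D (mor_map F c) (mor_map F a) (ext_map F (Cod C c) (Dom C a) \<delta>)"
proof -
  assume "c \<in> Mor C" "a \<in> Mor C" "\<delta> \<in> Exts C (Cod C c) (Dom C a)"
  then have "c \<in> Hom C (Dom C c) (Cod C c)" "a \<in> Hom C (Dom C a) (Cod C a)" "\<delta> \<in> Exts C (Cod C c) (Dom C a)" by (auto simp: Hom_iff)
  then show ?thesis using F unfolding exact_functor_def by blast
qed

lemma exact_functor_s_triangle:
  "s_triangle C A B X x y \<delta> ==>
   s_triangle D (obj_map F A) (obj_map F B) (obj_map F X) (mor_map F x) (mor_map F y) (ext_map F X A \<delta>)" using F by (simp add: exact_functor_def)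

lemma exact_functor_isomorphism: "category C ==> isomorphism C f ==> isomorphism D (mor_map F f)"
  using functor_inverse_pair[OF exact_functor_functor] unfolding isomorphism_def by blast

end

section \<open>Universality of a category of fractions\<close>

context fraction_ext
begin

lemma exact_functor_q:
  assumes "obj_map Q = (\<lambda>X. X)" "mor_map Q = q" "ext_map Q = mu"
  shows "exact_functor C L Q" unfolding exact_functor_def additive_functor_def is_functor_def assms
proof (intro conjI ballI allI impI)
  fix X Y Z f g assume "f \<in> Hom C X Y" "g \<in> Hom C Y Z"
  then show "q (g \<cdot> f) = q g \<star> q f" by (auto simp: Hom_iff q_Cmp)
next
  fix X Y f g assume "f \<in> Hom C X Y" "g \<in> Hom C X Y"
  then show "q (Add C f g) = Add L (q f) (q g)" by (auto simp: Hom_iff q_Add)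
next
  fix X X' A A' c a \<delta> assume "c \<in> Hom C X' X" "a \<in> Hom C A A'" "\<delta> \<in> Exts C X A"
  then show "mu X' A' (ExtMap C c a \<delta>) = ExtMap L (q c) (q a) (mu X A \<delta>)" by (auto simp: Hom_iff mu_ExtMap[symmetric])
qed (use q_Hom mu_hom q_s_triangle in auto)

text \<open>Two parallel morphisms have a common left denominator, hence a functor that is additive on numerators is
  additive.\<close>

lemma common_denominator:
  assumes "\<phi> \<in> Hom L X Y" "\<psi> \<in> Hom L X Y"
  shows "\<exists>s\<in>W. \<exists>f\<in>Hom C X (Cod C s). \<exists>g\<in>Hom C X (Cod C s). Dom C s = Y \<and> q s \<star> \<phi> = q f \<and> q s \<star> \<psi> = q g"
proof -
  note h = assms[unfolded Hom_iff]
  obtain s f where s: "s \<in> W" "f \<in> Mor C" "Dom C f = X" "Dom C s = Y" "Cod C f = Cod C s" "q s \<star> \<phi> = q f" using frac_left[of \<phi>] h by auto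
  have sp: "q s \<star> \<psi> \<in> Mor L" "Dom L (q s \<star> \<psi>) = X" "Cod L (q s \<star> \<psi>) = Cod C s" using s h q_simps by simp_all
  obtain t g where t: "t \<in> W" "g \<in> Mor C" "Dom C g = X" "Dom C t = Cod C s" "Cod C g = Cod C t" "q t \<star> q s \<star> \<psi> = q g"
    using frac_left[OF sp(1)] sp(2,3) by auto
  have "q (t \<cdot> s) \<star> \<phi> = q t \<star> q s \<star> \<phi>" "q (t \<cdot> s) \<star> \<psi> = q t \<star> q s \<star> \<psi>" using s(1,4) t(1,4) h q_simps q_Cmp[of s t] by simp_all
  then have "q (t \<cdot> s) \<star> \<phi> = q (t \<cdot> f)" "q (t \<cdot> s) \<star> \<psi> = q g" using s t q_Cmp[of f t] by simp_all
  then show ?thesis using s(1-5) t(1-5) W_Cmp[of s t] by (intro bexI[of _ "t \<cdot> s"] bexI[of _ "t \<cdot> f"] bexI[of _ g]) (simp_all add: Hom_iff)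
qed

end

text \<open>An exact functor \<open>F\<close> whose underlying functor has been factored through \<open>q\<close> as \<open>G\<close>. It remains to extend \<open>G\<close> to
  extensions.\<close>

locale inverting_functor = fraction_ext C L W q mu + D: weakly_extriangulated D
  for C :: "('o, 'm, 'e) ext_cat" (structure) and L :: "('o, 'n, 'k) ext_cat" and W q mu and D :: "('p, 'r, 'l) ext_cat" +
  fixes F :: "('o, 'm, 'e, 'p, 'r, 'l) exact_map" and G :: "('o, 'n, 'p, 'r) cat_map"
  assumes F: "exact_functor C D F" and G: "is_functor L D G"
    and G_Ob: "X \<in> Ob C ==> obj_map G X = obj_map F X"
    and G_q: "f \<in> Mor C ==> mor_map G (q f) = mor_map F f"
begin

abbreviation "Fo \<equiv> obj_map F"
abbreviation "Fm \<equiv> mor_map F"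
abbreviation "Gm \<equiv> mor_map G"

lemmas F_simps [simp] = exact_functor_Ob[OF F] exact_functor_Mor[OF F] exact_functor_Idt[OF F] exact_functor_ext_closed[OF F]
lemmas F_Cmp = exact_functor_Cmp[OF F]

lemma G_simps [simp]:
  "\<phi> \<in> Mor L ==> Gm \<phi> \<in> Mor D" "\<phi> \<in> Mor L ==> Dom D (Gm \<phi>) = Fo (Dom L \<phi>)" "\<phi> \<in> Mor L ==> Cod D (Gm \<phi>) = Fo (Cod L \<phi>)"
  using G G_Ob L.Dom_closed L.Cod_closed unfolding is_functor_def Hom_iff by auto

lemma G_Idt: "X \<in> Ob C ==> Gm (Idt L X) = Idt D (Fo X)" using G_q[of "Idt C X"] by simp

lemma G_Cmp: "\<phi> \<in> Mor L ==> \<psi> \<in> Mor L ==> Cod L \<phi> = Dom L \<psi> ==> Gm (\<psi> \<star> \<phi>) = Gm \<psi> \<cdot>\<^bsub>D\<^esub> Gm \<phi>"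
proof -
  assume "\<phi> \<in> Mor L" "\<psi> \<in> Mor L" "Cod L \<phi> = Dom L \<psi>"
  then have "\<phi> \<in> Hom L (Dom L \<phi>) (Cod L \<phi>)" "\<psi> \<in> Hom L (Cod L \<phi>) (Cod L \<psi>)" by (auto simp: Hom_iff)
  then show ?thesis using G unfolding is_functor_def by blast
qed

lemma G_iso: "isomorphism L \<phi> ==> isomorphism D (Gm \<phi>)" using functor_inverse_pair[OF G L.category_axioms] unfolding isomorphism_def by blast

lemma F_W [simp]: "s \<in> W ==> isomorphism D (Fm s)" using G_iso[OF q_W] G_q by simp

lemma G_additive: "additive_functor L D G" unfolding additive_functor_def
proof (intro conjI allI ballI G)
  fix X Y \<phi> \<psi> assume h0: "\<phi> \<in> Hom L X Y" "\<psi> \<in> Hom L X Y"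
  note h = h0[unfolded Hom_iff]
  obtain s f g where s: "s \<in> W" "f \<in> Hom C X (Cod C s)" "g \<in> Hom C X (Cod C s)" "Dom C s = Y" "q s \<star> \<phi> = q f" "q s \<star> \<psi> = q g"
    using common_denominator[OF h0] by blast
  note m = s(2,3)[unfolded Hom_iff]
  have 1: "Fm s \<cdot>\<^bsub>D\<^esub> Gm \<phi> = Fm f" "Fm s \<cdot>\<^bsub>D\<^esub> Gm \<psi> = Fm g"
    using G_Cmp[of \<phi> "q s"] G_Cmp[of \<psi> "q s"] G_q[of s] G_q[of f] G_q[of g] s(1,4-6) h m by simp_all
  have a: "q s \<star> Add L \<phi> \<psi> = q (Add C f g)" using q_Add[of f g] m h s by simp
  have "Fm s \<cdot>\<^bsub>D\<^esub> Gm (Add L \<phi> \<psi>) = Gm (q s \<star> Add L \<phi> \<psi>)" using G_Cmp[of "Add L \<phi> \<psi>" "q s"] G_q[of s] s(1,4) h by simp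
  also have "... = Add D (Fm f) (Fm g)" unfolding a using G_q[of "Add C f g"] exact_functor_Add[OF F, of f g] m by simp
  also have "... = Fm s \<cdot>\<^bsub>D\<^esub> Add D (Gm \<phi>) (Gm \<psi>)" using 1 h s(1,4) by simp
  finally show "Gm (Add L \<phi> \<psi>) = Add D (Gm \<phi>) (Gm \<psi>)" by (rule D.isomorphism_cancel_left[OF F_W[OF s(1)]]) (use h s(1,4) in simp_all)
qed

lemma ext_map_mu_eq:
  assumes "X \<in> Ob C" "A \<in> Ob C" "\<delta> \<in> Exts C X A" "\<delta>' \<in> Exts C X A" "mu X A \<delta> = mu X A \<delta>'"
  shows "ext_map F X A \<delta> = ext_map F X A \<delta>'"
proof -
  obtain s where s: "s \<in> W" "Dom C s = A" "ExtMap C (Idt C X) s \<delta> = ExtMap C (Idt C X) s \<delta>'" using mu_eq_push[OF assms] by blast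
  have "ExtMap D (Idt D (Fo X)) (Fm s) (ext_map F X A \<delta>) = ExtMap D (Idt D (Fo X)) (Fm s) (ext_map F X A \<delta>')"
    using exact_functor_ExtMap[OF F, of "Idt C X" s \<delta>] exact_functor_ExtMap[OF F, of "Idt C X" s \<delta>'] s assms by simp
  then show ?thesis by (rule D.ExtMap_iso_inj[rotated 4]) (use s assms in simp_all)
qed

text \<open>The denominators \<open>s\<close> and \<open>t\<close> range over all morphisms, not only over \<open>W\<close>, so that naturality of \<open>Fe\<close> in
  morphisms of \<open>C\<close> is a case of \<open>Fe_clears\<close>.\<close>

definition clears :: "'o => 'o => 'k => 'm => 'm => 'e => bool"
  where "clears X A \<epsilon> t s \<delta> \<longleftrightarrow> s \<in> Mor C \<and> t \<in> Mor C \<and> Dom C s = A \<and> Cod C t = X \<and> \<delta> \<in> Exts C (Dom C t) (Cod C s) \<and>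
     ExtMap L (q t) (q s) \<epsilon> = mu (Dom C t) (Cod C s) \<delta>"

definition Fe :: "'o => 'o => 'k => 'l"
  where "Fe X A \<epsilon> = (SOME \<zeta>. \<exists>t\<in>W. \<exists>s\<in>W. \<exists>\<delta>. clears X A \<epsilon> t s \<delta> \<and> \<zeta> \<in> Exts D (Fo X) (Fo A) \<and>
     ExtMap D (Fm t) (Fm s) \<zeta> = ext_map F (Dom C t) (Cod C s) \<delta>)"

lemma ex_clears: "X \<in> Ob C ==> A \<in> Ob C ==> \<epsilon> \<in> Exts L X A ==> \<exists>t\<in>W. \<exists>s\<in>W. \<exists>\<delta>. clears X A \<epsilon> t s \<delta>"
  using mu_surj[of X A \<epsilon>] unfolding clears_def using W_Mor by metis

lemma Fe_spec:
  assumes o: "X \<in> Ob C" "A \<in> Ob C" and e: "\<epsilon> \<in> Exts L X A"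
  shows "\<exists>t\<in>W. \<exists>s\<in>W. \<exists>\<delta>. clears X A \<epsilon> t s \<delta> \<and> Fe X A \<epsilon> \<in> Exts D (Fo X) (Fo A) \<and>
     ExtMap D (Fm t) (Fm s) (Fe X A \<epsilon>) = ext_map F (Dom C t) (Cod C s) \<delta>"
proof -
  obtain t s \<delta> where t: "t \<in> W" "s \<in> W" "clears X A \<epsilon> t s \<delta>" using ex_clears[OF assms] by blast
  then have h: "Dom C s = A" "Cod C t = X" "\<delta> \<in> Exts C (Dom C t) (Cod C s)" by (auto simp: clears_def)
  let ?z = "ExtMap D (inv_mor D (Fm t)) (inv_mor D (Fm s)) (ext_map F (Dom C t) (Cod C s) \<delta>)"
  have "?z \<in> Exts D (Fo X) (Fo A)" "ExtMap D (Fm t) (Fm s) ?z = ext_map F (Dom C t) (Cod C s) \<delta>"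
    using t h F_W[OF t(1)] F_W[OF t(2)] by simp_all
  then have "\<exists>\<zeta>. \<exists>t\<in>W. \<exists>s\<in>W. \<exists>\<delta>. clears X A \<epsilon> t s \<delta> \<and> \<zeta> \<in> Exts D (Fo X) (Fo A) \<and>
     ExtMap D (Fm t) (Fm s) \<zeta> = ext_map F (Dom C t) (Cod C s) \<delta>" using t by blast
  then show ?thesis unfolding Fe_def by (rule someI_ex)
qed

lemma Fe_closed [simp]: "X \<in> Ob C ==> A \<in> Ob C ==> \<epsilon> \<in> Exts L X A ==> Fe X A \<epsilon> \<in> Exts D (Fo X) (Fo A)" using Fe_spec by blast

text \<open>The defining equation of \<open>Fe\<close> holds for every way of clearing \<open>\<epsilon>\<close>. With commutative squares in \<open>L\<close> relating the given
  \<open>(c, a)\<close> to the chosen \<open>(t, s)\<close>, both sides become images of extensions of \<open>C\<close> that \<open>mu\<close> identifies. \<open>F\<close> identifies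
  such extensions, since they agree after pushing along some member of \<open>W\<close>.\<close>

lemma Fe_clears:
  assumes e: "X \<in> Ob C" "A \<in> Ob C" "\<epsilon> \<in> Exts L X A" and c: "clears X A \<epsilon> c a \<delta>"
  shows "ExtMap D (Fm c) (Fm a) (Fe X A \<epsilon>) = ext_map F (Dom C c) (Cod C a) \<delta>"
proof -
  have c: "a \<in> Mor C" "c \<in> Mor C" "Dom C a = A" "Cod C c = X" "\<delta> \<in> Exts C (Dom C c) (Cod C a)"
    "ExtMap L (q c) (q a) \<epsilon> = mu (Dom C c) (Cod C a) \<delta>" using c by (auto simp: clears_def)
  obtain t s \<delta>' where st: "t \<in> W" "s \<in> W" "clears X A \<epsilon> t s \<delta>'"
    and z: "ExtMap D (Fm t) (Fm s) (Fe X A \<epsilon>) = ext_map F (Dom C t) (Cod C s) \<delta>'" using Fe_spec[OF e] by blast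
  have t: "Dom C s = A" "Cod C t = X" "\<delta>' \<in> Exts C (Dom C t) (Cod C s)"
    "ExtMap L (q t) (q s) \<epsilon> = mu (Dom C t) (Cod C s) \<delta>'" using st(3) by (auto simp: clears_def)
  have "q a \<star> inv_mor L (q s) \<in> Mor L" "inv_mor L (q t) \<star> q c \<in> Mor L" using c t st by simp_all
  note fl = frac_left[OF this(1)] and fr = frac_right[OF this(2)]
  obtain s' a' where s': "s' \<in> W" "a' \<in> Mor C" "Dom C a' = Cod C s" "Dom C s' = Cod C a" "Cod C a' = Cod C s'"
    "q s' \<star> q a \<star> inv_mor L (q s) = q a'" using fl c t st by auto
  obtain t' c' where t': "t' \<in> W" "c' \<in> Mor C" "Cod C c' = Dom C t" "Cod C t' = Dom C c" "Dom C c' = Dom C t'"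
    "(inv_mor L (q t) \<star> q c) \<star> q t' = q c'" using fr c t st by auto
  have qa: "q (s' \<cdot> a) = q (a' \<cdot> s)" using q_Cmp[of a s'] q_Cmp[of s a'] s'(1-5) c(1-4) t(1,2) st(1,2) unfolding s'(6)[symmetric] by simp
  have qc: "q (c \<cdot> t') = q (t \<cdot> c')" using q_Cmp[of t' c] q_Cmp[of c' t] t'(1-5) c(1-4) t(1,2) st(1,2) unfolding t'(6)[symmetric] by simp
  have Fa: "Fm s' \<cdot>\<^bsub>D\<^esub> Fm a = Fm a' \<cdot>\<^bsub>D\<^esub> Fm s" using arg_cong[OF qa, of Gm] s'(1-5) c(1-4) t(1,2) st(1,2) by (simp add: G_q F_Cmp)
  have Fc: "Fm c \<cdot>\<^bsub>D\<^esub> Fm t' = Fm t \<cdot>\<^bsub>D\<^esub> Fm c'" using arg_cong[OF qc, of Gm] t'(1-5) c(1-4) t(1,2) st(1,2) by (simp add: G_q F_Cmp)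
  have "mu (Dom C t') (Cod C s') (ExtMap C t' s' \<delta>) = ExtMap L (q t') (q s') (ExtMap L (q c) (q a) \<epsilon>)" using mu_ExtMap[of t' s' \<delta>] t' s' c by simp
  also have "... = ExtMap L (q (c \<cdot> t')) (q (s' \<cdot> a)) \<epsilon>" using q_Cmp[of a s'] q_Cmp[of t' c] e(3) s'(1-5) t'(1-5) c(1-4) by simp
  also have "... = ExtMap L (q c') (q a') (ExtMap L (q t) (q s) \<epsilon>)"
    unfolding qa qc using q_Cmp[of s a'] q_Cmp[of c' t] e(3) s'(1-5) t'(1-5) c(1-4) t(1,2) st(1,2) by simp
  also have "... = mu (Dom C t') (Cod C s') (ExtMap C c' a' \<delta>')" using mu_ExtMap[of c' a' \<delta>'] t s'(1-5) t'(1-5) by simp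
  finally have m: "ext_map F (Dom C t') (Cod C s') (ExtMap C t' s' \<delta>) = ext_map F (Dom C t') (Cod C s') (ExtMap C c' a' \<delta>')"
    by (rule ext_map_mu_eq[rotated 4]) (use c(1-5) t(1-3) s'(1-5) t'(1-5) in simp_all)
  have Fz: "Fe X A \<epsilon> \<in> Exts D (Fo X) (Fo A)" using e by simp
  have "ExtMap D (Fm t') (Fm s') (ext_map F (Dom C c) (Cod C a) \<delta>) = ExtMap D (Fm c') (Fm a') (ext_map F (Dom C t) (Cod C s) \<delta>')"
    using exact_functor_ExtMap[OF F, of t' s' \<delta>] exact_functor_ExtMap[OF F, of c' a' \<delta>'] m c(1-5) t(1-3) s'(1-5) t'(1-5) by simp
  also have "... = ExtMap D (Fm t \<cdot>\<^bsub>D\<^esub> Fm c') (Fm a' \<cdot>\<^bsub>D\<^esub> Fm s) (Fe X A \<epsilon>)"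
    unfolding z[symmetric] using Fz c(1-5) t(1-3) s'(1-5) t'(1-5) st(1,2) by simp
  also have "... = ExtMap D (Fm t') (Fm s') (ExtMap D (Fm c) (Fm a) (Fe X A \<epsilon>))"
    unfolding Fa[symmetric] Fc[symmetric] using Fz c(1-5) t(1-3) s'(1-5) t'(1-5) st(1,2) by simp
  finally have "ext_map F (Dom C c) (Cod C a) \<delta> = ExtMap D (Fm c) (Fm a) (Fe X A \<epsilon>)"
    by (rule D.ExtMap_iso_inj[rotated 4]) (use Fz c(1-5) s'(1-5) t'(1-5) in simp_all)
  then show ?thesis by simp
qed

lemma Fe_mu: "X \<in> Ob C ==> A \<in> Ob C ==> \<delta> \<in> Exts C X A ==> Fe X A (mu X A \<delta>) = ext_map F X A \<delta>"
proof -
  assume o: "X \<in> Ob C" "A \<in> Ob C" and d: "\<delta> \<in> Exts C X A"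
  have m: "mu X A \<delta> \<in> Exts L X A" using hom_in_carrier[OF mu_hom[OF o] d] .
  have "clears X A (mu X A \<delta>) (Idt C X) (Idt C A) \<delta>" using o d m by (simp add: clears_def)
  from Fe_clears[OF o m this] show ?thesis using o m by simp
qed

lemma Fe_hom: "X \<in> Ob C ==> A \<in> Ob C ==> Fe X A \<in> hom (Ext L X A) (Ext D (Fo X) (Fo A))" unfolding hom_def
proof (intro CollectI conjI ballI Pi_I)
  assume o: "X \<in> Ob C" "A \<in> Ob C"
  fix \<epsilon> \<epsilon>' assume e: "\<epsilon> \<in> Exts L X A" "\<epsilon>' \<in> Exts L X A"
  obtain t s \<delta> where st: "t \<in> W" "s \<in> W" "clears X A \<epsilon> t s \<delta>" using ex_clears[OF o e(1)] by blast
  then have h: "Dom C s = A" "Cod C t = X" "\<delta> \<in> Exts C (Dom C t) (Cod C s)"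
    "ExtMap L (q t) (q s) \<epsilon> = mu (Dom C t) (Cod C s) \<delta>" by (auto simp: clears_def)
  have e': "ExtMap L (q t) (q s) \<epsilon>' \<in> Exts L (Dom C t) (Cod C s)" using e(2) h st by simp
  obtain t' s' \<delta>' where st': "t' \<in> W" "s' \<in> W" "clears (Dom C t) (Cod C s) (ExtMap L (q t) (q s) \<epsilon>') t' s' \<delta>'" using ex_clears[OF _ _ e'] st by auto
  then have h': "Dom C s' = Cod C s" "Cod C t' = Dom C t" "\<delta>' \<in> Exts C (Dom C t') (Cod C s')"
    "ExtMap L (q t') (q s') (ExtMap L (q t) (q s) \<epsilon>') = mu (Dom C t') (Cod C s') \<delta>'" by (auto simp: clears_def)
  let ?t = "t \<cdot> t'" and ?s = "s' \<cdot> s" and ?d = "ExtMap C t' s' \<delta>" and ?E = "Ext L X A" and ?G = "Ext C (Dom C t') (Cod C s')"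
  have W: "?t \<in> W" "?s \<in> W" and w: "Dom C ?s = A" "Cod C ?t = X" "Cod C ?s = Cod C s'" "Dom C ?t = Dom C t'" using W_Cmp st st' h h' by simp_all
  have d: "?d \<in> carrier ?G" using h h' st st' by simp
  have m0: "mu (Dom C t') (Cod C s') ?d = ExtMap L (q t') (q s') (mu (Dom C t) (Cod C s) \<delta>)" using mu_ExtMap[of t' s' \<delta>] h(1-3) h'(1,2) st st' by simp
  have m: "mu (Dom C t') (Cod C s') ?d = ExtMap L (q ?t) (q ?s) \<epsilon>"
    unfolding m0 h(4)[symmetric] using h(1-3) h'(1,2) st st' e q_Cmp[of t' t] q_Cmp[of s s'] by simp
  have m': "mu (Dom C t') (Cod C s') \<delta>' = ExtMap L (q ?t) (q ?s) \<epsilon>'"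
    using h(1-3) h'(1,2) st st' e q_Cmp[of t' t] q_Cmp[of s s'] unfolding h'(4)[symmetric] by simp
  interpret mu: group_hom ?G "Ext L (Dom C t') (Cod C s')" "mu (Dom C t') (Cod C s')"
    using mu_hom L.Ext_group C.Ext_group st st' by (simp add: group_hom_def group_hom_axioms_def)
  have c1: "clears X A \<epsilon> ?t ?s ?d" using W w d m by (simp add: clears_def)
  have c2: "clears X A \<epsilon>' ?t ?s \<delta>'" using W w h'(3) m' by (simp add: clears_def)
  have "mu (Dom C t') (Cod C s') (?d \<otimes>\<^bsub>?G\<^esub> \<delta>') = ExtMap L (q ?t) (q ?s) (\<epsilon> \<otimes>\<^bsub>?E\<^esub> \<epsilon>')"
    using mu.hom_mult[OF d h'(3)] L.ExtMap_mult[of "q ?t" "q ?s" X A \<epsilon> \<epsilon>'] W w e unfolding m m' by simp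
  then have c3: "clears X A (\<epsilon> \<otimes>\<^bsub>?E\<^esub> \<epsilon>') ?t ?s (?d \<otimes>\<^bsub>?G\<^esub> \<delta>')" using W w d h'(3) by (simp add: clears_def)
  have ee: "\<epsilon> \<otimes>\<^bsub>?E\<^esub> \<epsilon>' \<in> carrier ?E" using e o by simp
  have "ExtMap D (Fm ?t) (Fm ?s) (Fe X A (\<epsilon> \<otimes>\<^bsub>?E\<^esub> \<epsilon>')) = ext_map F (Dom C t') (Cod C s') (?d \<otimes>\<^bsub>?G\<^esub> \<delta>')" using Fe_clears[OF o ee c3] w by simp
  also have "... = ext_map F (Dom C t') (Cod C s') ?d \<otimes>\<^bsub>Ext D (Fo (Dom C t')) (Fo (Cod C s'))\<^esub> ext_map F (Dom C t') (Cod C s') \<delta>'"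
    using exact_functor_ext_hom[OF F, of "Dom C t'" "Cod C s'"] d h'(3) st' by (simp add: hom_def)
  also have "... = ExtMap D (Fm ?t) (Fm ?s) (Fe X A \<epsilon> \<otimes>\<^bsub>Ext D (Fo X) (Fo A)\<^esub> Fe X A \<epsilon>')"
    using Fe_clears[OF o e(1) c1] Fe_clears[OF o e(2) c2] D.ExtMap_mult[of "Fm ?t" "Fm ?s" "Fo X" "Fo A"] w W e o by simp
  finally show "Fe X A (\<epsilon> \<otimes>\<^bsub>?E\<^esub> \<epsilon>') = Fe X A \<epsilon> \<otimes>\<^bsub>Ext D (Fo X) (Fo A)\<^esub> Fe X A \<epsilon>'" by (rule D.ExtMap_iso_inj[rotated 4]) (use W w e o ee in simp_all)
qed simp

lemma Fe_ExtMap_q: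
  assumes c: "c \<in> Mor C" "a \<in> Mor C" and e: "\<epsilon> \<in> Exts L (Cod C c) (Dom C a)"
  shows "Fe (Dom C c) (Cod C a) (ExtMap L (q c) (q a) \<epsilon>) = ExtMap D (Fm c) (Fm a) (Fe (Cod C c) (Dom C a) \<epsilon>)"
proof -
  have ce: "ExtMap L (q c) (q a) \<epsilon> \<in> Exts L (Dom C c) (Cod C a)" using c e by simp
  obtain t s \<delta> where t: "t \<in> W" "s \<in> W" "clears (Dom C c) (Cod C a) (ExtMap L (q c) (q a) \<epsilon>) t s \<delta>" using ex_clears[OF _ _ ce] c by auto
  then have h: "Dom C s = Cod C a" "Cod C t = Dom C c" by (auto simp: clears_def)
  have "clears (Cod C c) (Dom C a) \<epsilon> (c \<cdot> t) (s \<cdot> a) \<delta>"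
    using t(1,2) t(3)[unfolded clears_def] c e q_Cmp[of t c] q_Cmp[of a s] h by (simp add: clears_def)
  from Fe_clears[OF _ _ e this] have "ExtMap D (Fm (c \<cdot> t)) (Fm (s \<cdot> a)) (Fe (Cod C c) (Dom C a) \<epsilon>) = ext_map F (Dom C t) (Cod C s) \<delta>"
    using c t h by simp
  also have "... = ExtMap D (Fm t) (Fm s) (Fe (Dom C c) (Cod C a) (ExtMap L (q c) (q a) \<epsilon>))" using Fe_clears[OF _ _ ce t(3)] c by simp
  finally have "ExtMap D (Fm t) (Fm s) (Fe (Dom C c) (Cod C a) (ExtMap L (q c) (q a) \<epsilon>))
      = ExtMap D (Fm t) (Fm s) (ExtMap D (Fm c) (Fm a) (Fe (Cod C c) (Dom C a) \<epsilon>))" using F_Cmp[of t c] F_Cmp[of a s] c t h e by simp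
  then show ?thesis by (rule D.ExtMap_iso_inj[rotated 4]) (use c t h e ce in simp_all)
qed

lemma Fe_ExtMap:
  assumes c: "\<gamma> \<in> Mor L" "\<alpha> \<in> Mor L" and e: "\<epsilon> \<in> Exts L (Cod L \<gamma>) (Dom L \<alpha>)"
  shows "Fe (Dom L \<gamma>) (Cod L \<alpha>) (ExtMap L \<gamma> \<alpha> \<epsilon>) = ExtMap D (Gm \<gamma>) (Gm \<alpha>) (Fe (Cod L \<gamma>) (Dom L \<alpha>) \<epsilon>)"
proof -
  have o: "Dom L \<gamma> \<in> Ob C" "Cod L \<gamma> \<in> Ob C" "Dom L \<alpha> \<in> Ob C" "Cod L \<alpha> \<in> Ob C" using c L.Ob_simps by auto
  obtain s a where s: "s \<in> W" "a \<in> Mor C" "Dom C a = Dom L \<alpha>" "Dom C s = Cod L \<alpha>" "Cod C a = Cod C s" "q s \<star> \<alpha> = q a"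
    using frac_left[OF c(2)] by blast
  obtain t b where t: "t \<in> W" "b \<in> Mor C" "Cod C b = Cod L \<gamma>" "Cod C t = Dom L \<gamma>" "Dom C b = Dom C t" "\<gamma> \<star> q t = q b"
    using frac_right[OF c(1)] by blast
  have g: "Fm s \<cdot>\<^bsub>D\<^esub> Gm \<alpha> = Fm a" "Gm \<gamma> \<cdot>\<^bsub>D\<^esub> Fm t = Fm b"
    using G_Cmp[of \<alpha> "q s"] G_Cmp[of "q t" \<gamma>] G_q[of s] G_q[of t] G_q[of a] G_q[of b] s t c by simp_all
  have ce: "ExtMap L \<gamma> \<alpha> \<epsilon> \<in> Exts L (Dom L \<gamma>) (Cod L \<alpha>)" using c e by simp
  have "ExtMap D (Fm t) (Fm s) (Fe (Dom L \<gamma>) (Cod L \<alpha>) (ExtMap L \<gamma> \<alpha> \<epsilon>)) = Fe (Dom C t) (Cod C s) (ExtMap L (q t) (q s) (ExtMap L \<gamma> \<alpha> \<epsilon>))"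
    using Fe_ExtMap_q[of t s "ExtMap L \<gamma> \<alpha> \<epsilon>"] s t ce by simp
  also have "ExtMap L (q t) (q s) (ExtMap L \<gamma> \<alpha> \<epsilon>) = ExtMap L (q b) (q a) \<epsilon>" unfolding s(6)[symmetric] t(6)[symmetric] using s(1-5) t(1-5) c e by simp
  also have "Fe (Dom C t) (Cod C s) ... = ExtMap D (Fm b) (Fm a) (Fe (Cod L \<gamma>) (Dom L \<alpha>) \<epsilon>)" using Fe_ExtMap_q[of b a \<epsilon>] s(1-5) t(1-5) e by simp
  also have "... = ExtMap D (Fm t) (Fm s) (ExtMap D (Gm \<gamma>) (Gm \<alpha>) (Fe (Cod L \<gamma>) (Dom L \<alpha>) \<epsilon>))" unfolding g[symmetric] using s(1-5) t(1-5) c e o by simp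
  finally show ?thesis by (rule D.ExtMap_iso_inj[rotated 4]) (use s(1-5) t(1-5) c e ce o in simp_all)
qed

definition factor :: "('o, 'n, 'k, 'p, 'r, 'l) exact_map"
  where "factor = \<lparr>obj_map = Fo, mor_map = Gm, ext_map = Fe\<rparr>"

lemma factor_s_triangle:
  assumes "s_triangle L A B X \<xi> \<eta> \<epsilon>"
  shows "s_triangle D (Fo A) (Fo B) (Fo X) (Gm \<xi>) (Gm \<eta>) (Fe X A \<epsilon>)"
proof -
  obtain A1 B1 X1 x y \<delta> \<alpha> \<beta> \<gamma> where t: "s_triangle C A1 B1 X1 x y \<delta>" "isomorphism L \<alpha>" "\<alpha> \<in> Hom L A A1"
    "isomorphism L \<beta>" "\<beta> \<in> Hom L B1 B" "isomorphism L \<gamma>" "\<gamma> \<in> Hom L X1 X"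
    "\<xi> = \<beta> \<star> q x \<star> \<alpha>" "\<eta> = \<gamma> \<star> q y \<star> inv_mor L \<beta>" "ExtMap L \<gamma> \<alpha> \<epsilon> = mu X1 A1 \<delta>"
    and e: "A \<in> Ob C" "X \<in> Ob C" "\<epsilon> \<in> Exts L X A" using assms unfolding s_triangle_L loc_tri_def by blast
  note s = C.s_triangle_simps[OF t(1)]
  note h = t(3,5,7)[unfolded Hom_iff]
  have xi: "Gm \<xi> = Gm \<beta> \<cdot>\<^bsub>D\<^esub> Fm x \<cdot>\<^bsub>D\<^esub> Gm \<alpha>" unfolding t(8) using G_Cmp G_q s h by simp
  have ib: "Gm (inv_mor L \<beta>) \<cdot>\<^bsub>D\<^esub> Gm \<beta> = Idt D (Fo B1)" using G_Cmp[of \<beta> "inv_mor L \<beta>"] G_Idt s h t(4) by simp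
  have eta: "Gm \<eta> = Gm \<gamma> \<cdot>\<^bsub>D\<^esub> Fm y \<cdot>\<^bsub>D\<^esub> Gm (inv_mor L \<beta>)" unfolding t(9) using G_Cmp G_q s h t(4) by simp
  have mh: "\<xi> \<in> Mor L" "Dom L \<xi> = A" "Cod L \<xi> = B" "\<eta> \<in> Mor L" "Dom L \<eta> = B" "Cod L \<eta> = X" using assms by (auto simp: s_triangle_def Hom_iff)
  have ia: "isomorphism D (Gm \<alpha>)" by (rule G_iso[OF t(2)])
  have x: "ExtMap D (Gm \<gamma>) (Gm \<alpha>) (Fe X A \<epsilon>) = ext_map F X1 A1 \<delta>" using Fe_ExtMap[of \<gamma> \<alpha> \<epsilon>] Fe_mu[of X1 A1 \<delta>] t(10) h e s by simp
  show ?thesis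
  proof (rule s_triangle_transport[OF D.weakly_extriangulated_axioms exact_functor_s_triangle[OF F t(1)], of "inv_mor D (Gm \<alpha>)" _ "Gm \<beta>" _ "Gm \<gamma>"])
    show "isomorphism D (inv_mor D (Gm \<alpha>))" using ia by simp
    show "isomorphism D (Gm \<beta>)" "isomorphism D (Gm \<gamma>)" using G_iso t by auto
    show "Gm \<beta> \<cdot>\<^bsub>D\<^esub> Fm x = Gm \<xi> \<cdot>\<^bsub>D\<^esub> inv_mor D (Gm \<alpha>)" unfolding xi using h s ia by simp
    show "Gm \<gamma> \<cdot>\<^bsub>D\<^esub> Fm y = Gm \<eta> \<cdot>\<^bsub>D\<^esub> Gm \<beta>" unfolding eta using h s t(4) ib by simp
    show "push D (Fo X1) (inv_mor D (Gm \<alpha>)) (ext_map F X1 A1 \<delta>) = pull D (Fo A) (Gm \<gamma>) (Fe X A \<epsilon>)"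
      unfolding x[symmetric] push_def pull_def using h s ia e by simp
  qed (use h s e mh ia in \<open>simp_all add: Hom_iff\<close>)
qed

lemma exact_functor_factor: "exact_functor L D factor" unfolding exact_functor_def
proof (intro conjI allI ballI impI)
  have "\<forall>\<phi>\<in>Mor L. Gm \<phi> \<in> Hom D (Fo (Dom L \<phi>)) (Fo (Cod L \<phi>))" by (simp add: Hom_iff)
  then show "additive_functor L D factor" using G_additive G_Ob unfolding additive_functor_def is_functor_def factor_def by simp
next
  fix X X' A A' \<gamma> \<alpha> \<epsilon> assume "\<gamma> \<in> Hom L X' X" "\<alpha> \<in> Hom L A A'" "\<epsilon> \<in> Exts L X A"
  then show "ext_map factor X' A' (ExtMap L \<gamma> \<alpha> \<epsilon>) = ExtMap D (mor_map factor \<gamma>) (mor_map factor \<alpha>) (ext_map factor X A \<epsilon>)"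
    using Fe_ExtMap[of \<gamma> \<alpha> \<epsilon>] by (auto simp: factor_def Hom_iff)
qed (use Fe_hom factor_s_triangle in \<open>simp_all add: factor_def\<close>)

lemma factor_q:
  assumes "obj_map Q = (\<lambda>X. X)" "mor_map Q = q" "ext_map Q = mu"
  shows "exact_eq C F (exact_comp factor Q)" using Fe_mu G_q by (simp add: exact_eq_def exact_comp_def factor_def assms)

lemma factor_unique:
  assumes Q: "obj_map Q = (\<lambda>X. X)" "mor_map Q = q" "ext_map Q = mu"
    and H: "exact_functor L D H" "exact_eq C F (exact_comp H Q)"
  shows "exact_eq L H factor"
proof -
  have Ho: "obj_map H X = Fo X" if "X \<in> Ob C" for X using H(2) that by (simp add: exact_eq_def exact_comp_def Q)
  have Hq: "mor_map H (q f) = Fm f" if "f \<in> Mor C" for f using H(2) that by (simp add: exact_eq_def exact_comp_def Q)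
  have Hm: "ext_map H X A (mu X A \<delta>) = ext_map F X A \<delta>" if "X \<in> Ob C" "A \<in> Ob C" "\<delta> \<in> Exts C X A" for X A \<delta>
    using H(2) that by (simp add: exact_eq_def exact_comp_def Q)
  note Hs = exact_functor_Mor[OF H(1)] exact_functor_ext_closed[OF H(1)]
  have 1: "mor_map H \<phi> = Gm \<phi>" if p: "\<phi> \<in> Mor L" for \<phi>
  proof -
    have o: "Dom L \<phi> \<in> Ob C" "Cod L \<phi> \<in> Ob C" using L.Ob_simps[OF p] by auto
    obtain s f where s: "s \<in> W" "f \<in> Mor C" "Dom C f = Dom L \<phi>" "Dom C s = Cod L \<phi>" "Cod C f = Cod C s" "q s \<star> \<phi> = q f" using frac_left[OF p] by blast
    have "Fm s \<cdot>\<^bsub>D\<^esub> mor_map H \<phi> = Fm s \<cdot>\<^bsub>D\<^esub> Gm \<phi>"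
      using exact_functor_Cmp[OF H(1), of \<phi> "q s"] G_Cmp[of \<phi> "q s"] Hq[of s] G_q[of s] Hq[of f] G_q[of f] s p by simp
    then show ?thesis by (rule D.isomorphism_cancel_left[OF F_W[OF s(1)]]) (use s p Hs Ho o in simp_all)
  qed
  have 2: "ext_map H X A \<epsilon> = Fe X A \<epsilon>" if o: "X \<in> Ob C" "A \<in> Ob C" and e: "\<epsilon> \<in> Exts L X A" for X A \<epsilon>
  proof -
    obtain t s \<delta> where st: "t \<in> W" "s \<in> W" "clears X A \<epsilon> t s \<delta>" using ex_clears[OF o e] by blast
    then have h: "Dom C s = A" "Cod C t = X" "\<delta> \<in> Exts C (Dom C t) (Cod C s)"
      "ExtMap L (q t) (q s) \<epsilon> = mu (Dom C t) (Cod C s) \<delta>" by (auto simp: clears_def)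
    have "ExtMap D (Fm t) (Fm s) (ext_map H X A \<epsilon>) = ExtMap D (Fm t) (Fm s) (Fe X A \<epsilon>)"
      using exact_functor_ExtMap[OF H(1), of "q t" "q s" \<epsilon>] Hq[of t] Hq[of s] Hm[of "Dom C t" "Cod C s" \<delta>]
        Fe_clears[OF o e st(3)] h st(1,2) e by simp
    then show ?thesis by (rule D.ExtMap_iso_inj[rotated 4]) (use h st(1,2) e o Hs(4)[of X A \<epsilon>] Ho in simp_all)
  qed
  show ?thesis unfolding exact_eq_def using 1 2 Ho by (simp add: factor_def)
qed

end

context fraction_ext
begin

text \<open>The components do not change, because \<open>Q\<close> is the identity on objects; both conditions are checked after
  cancelling the denominators.\<close>

lemma factor_nat_trans:
  fixes D :: "('p, 'r, 'l) ext_cat"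
  assumes D: "weakly_extriangulated D" and Q: "obj_map Q = (\<lambda>X. X)" "mor_map Q = q" "ext_map Q = mu"
    and F: "exact_functor L D F'" "exact_eq C F (exact_comp F' Q)" and G: "exact_functor L D G'" "exact_eq C G (exact_comp G' Q)"
    and eta: "exact_nat_trans C D F G \<eta>"
  shows "exact_nat_trans L D F' G' \<eta>"
proof -
  interpret D: weakly_extriangulated D by fact
  note [simp] = exact_functor_Ob[OF F(1)] exact_functor_Mor[OF F(1)] exact_functor_ext_closed[OF F(1)]
    exact_functor_Ob[OF G(1)] exact_functor_Mor[OF G(1)] exact_functor_ext_closed[OF G(1)] q_simps
  have e: "obj_map F X = obj_map F' X" "obj_map G X = obj_map G' X" if "X \<in> Ob C" for X
    using F(2) G(2) that by (simp_all add: exact_eq_def exact_comp_def Q)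
  have m: "mor_map F f = mor_map F' (q f)" "mor_map G f = mor_map G' (q f)" if "f \<in> Mor C" for f
    using F(2) G(2) that by (simp_all add: exact_eq_def exact_comp_def Q)
  have x: "ext_map F X A \<delta> = ext_map F' X A (mu X A \<delta>)" "ext_map G X A \<delta> = ext_map G' X A (mu X A \<delta>)"
    if "X \<in> Ob C" "A \<in> Ob C" "\<delta> \<in> Exts C X A" for X A \<delta> using F(2) G(2) that by (simp_all add: exact_eq_def exact_comp_def Q)
  have n: "\<eta> X \<in> Mor D" "Dom D (\<eta> X) = obj_map F' X" "Cod D (\<eta> X) = obj_map G' X" if "X \<in> Ob C" for X
    using eta that e[OF that] by (simp_all add: exact_nat_trans_def Hom_iff)
  have nat: "\<eta> (Cod C f) \<cdot>\<^bsub>D\<^esub> mor_map F' (q f) = mor_map G' (q f) \<cdot>\<^bsub>D\<^esub> \<eta> (Dom C f)" if f: "f \<in> Mor C" for f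
  proof -
    have "f \<in> Hom C (Dom C f) (Cod C f)" using f by (simp add: Hom_iff)
    then have "\<eta> (Cod C f) \<cdot>\<^bsub>D\<^esub> mor_map F f = mor_map G f \<cdot>\<^bsub>D\<^esub> \<eta> (Dom C f)" using eta unfolding exact_nat_trans_def by blast
    then show ?thesis using m f by simp
  qed
  have iF: "isomorphism D (mor_map F' (q s))" "isomorphism D (mor_map G' (q s))" if "s \<in> W" for s
    using exact_functor_isomorphism[OF F(1) L.category_axioms q_W[OF that]] exact_functor_isomorphism[OF G(1) L.category_axioms q_W[OF that]] by auto
  show ?thesis unfolding exact_nat_trans_def
  proof (intro conjI ballI allI)
    fix X Y \<phi> assume "\<phi> \<in> Hom L X Y"
    then have p: "\<phi> \<in> Mor L" "Dom L \<phi> = X" "Cod L \<phi> = Y" "X \<in> Ob C" "Y \<in> Ob C" using L.Hom_Ob[of \<phi> X Y] by (auto simp: Hom_iff)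
    obtain s f where s: "s \<in> W" "f \<in> Mor C" "Dom C f = X" "Dom C s = Y" "Cod C f = Cod C s" "q s \<star> \<phi> = q f" using frac_left[OF p(1)] p by blast
    have sf: "mor_map F' (q s) \<cdot>\<^bsub>D\<^esub> mor_map F' \<phi> = mor_map F' (q f)" "mor_map G' (q s) \<cdot>\<^bsub>D\<^esub> mor_map G' \<phi> = mor_map G' (q f)"
      using exact_functor_Cmp[OF F(1), of \<phi> "q s"] exact_functor_Cmp[OF G(1), of \<phi> "q s"] s p by simp_all
    have "mor_map G' (q s) \<cdot>\<^bsub>D\<^esub> \<eta> Y \<cdot>\<^bsub>D\<^esub> mor_map F' \<phi> = (mor_map G' (q s) \<cdot>\<^bsub>D\<^esub> \<eta> Y) \<cdot>\<^bsub>D\<^esub> mor_map F' \<phi>" using s(1,4) p n by simp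
    also have "... = \<eta> (Cod C s) \<cdot>\<^bsub>D\<^esub> mor_map F' (q s) \<cdot>\<^bsub>D\<^esub> mor_map F' \<phi>"
      unfolding s(4)[symmetric] nat[OF W_Mor[OF s(1)], symmetric] using s(1,4) p n by simp
    also have "... = mor_map G' (q s) \<cdot>\<^bsub>D\<^esub> mor_map G' \<phi> \<cdot>\<^bsub>D\<^esub> \<eta> X" unfolding sf(1) using nat[OF s(2)] sf(2)[symmetric] s(1-5) p n by simp
    finally show "\<eta> Y \<cdot>\<^bsub>D\<^esub> mor_map F' \<phi> = mor_map G' \<phi> \<cdot>\<^bsub>D\<^esub> \<eta> X" by (rule D.isomorphism_cancel_left[OF iF(2)[OF s(1)]]) (use s(1-5) p n in simp_all)
  next
    fix X A \<epsilon> assume h: "X \<in> Ob L" "A \<in> Ob L" "\<epsilon> \<in> Exts L X A"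
    obtain s t \<delta> where s: "s \<in> W" "t \<in> W" "\<delta> \<in> Exts C (Dom C t) (Cod C s)" "Dom C s = A" "Cod C t = X"
      "ExtMap L (q t) (q s) \<epsilon> = mu (Dom C t) (Cod C s) \<delta>" using mu_surj[of X A \<epsilon>] h by auto
    let ?f = "ext_map F' X A \<epsilon>" and ?g = "ext_map G' X A \<epsilon>" and ?X = "Dom C t" and ?A = "Cod C s"
    have c: "?f \<in> Exts D (obj_map F' X) (obj_map F' A)" "?g \<in> Exts D (obj_map G' X) (obj_map G' A)" using h by simp_all
    have fg: "ExtMap D (mor_map F' (q t)) (mor_map F' (q s)) ?f = ext_map F ?X ?A \<delta>"
      "ExtMap D (mor_map G' (q t)) (mor_map G' (q s)) ?g = ext_map G ?X ?A \<delta>"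
      using exact_functor_ExtMap[OF F(1), of "q t" "q s" \<epsilon>] exact_functor_ExtMap[OF G(1), of "q t" "q s" \<epsilon>] x[of ?X ?A \<delta>] s h by simp_all
    have p: "push D (obj_map F ?X) (\<eta> ?A) (ext_map F ?X ?A \<delta>) = pull D (obj_map G ?A) (\<eta> ?X) (ext_map G ?X ?A \<delta>)"
      using eta s unfolding exact_nat_trans_def by simp
    have "ExtMap D (mor_map F' (q t)) (mor_map G' (q s)) (push D (obj_map F' X) (\<eta> A) ?f)
        = ExtMap D (mor_map F' (q t)) (mor_map G' (q s) \<cdot>\<^bsub>D\<^esub> \<eta> A) ?f" unfolding push_def using s(1-5) h n c by simp
    also have "... = ExtMap D (Idt D (obj_map F' ?X)) (\<eta> ?A) (ExtMap D (mor_map F' (q t)) (mor_map F' (q s)) ?f)" using nat[of s] s(1-5) h n c by simp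
    also have "... = ExtMap D (\<eta> ?X) (Idt D (obj_map G' ?A)) (ExtMap D (mor_map G' (q t)) (mor_map G' (q s)) ?g)"
      using p s(1-5) e unfolding fg push_def pull_def by simp
    also have "... = ExtMap D (mor_map F' (q t)) (mor_map G' (q s)) (pull D (obj_map G' A) (\<eta> X) ?g)"
      unfolding pull_def using nat[of t] s(1-5) h n c by simp
    finally show "push D (obj_map F' X) (\<eta> A) ?f = pull D (obj_map G' A) (\<eta> X) ?g"
      by (rule D.ExtMap_iso_inj[rotated 4]) (use s(1-5) h n c iF in \<open>simp_all add: push_def pull_def\<close>)
  qed (use n in \<open>simp add: Hom_iff\<close>)
qed

theorem universal:
  fixes D :: "('p, 'r, 'l) ext_cat"
  assumes D: "weakly_extriangulated D" and Q: "obj_map Q = (\<lambda>X. X)" "mor_map Q = q" "ext_map Q = mu"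
    and ext: "\<And>F :: ('o, 'm, 'p, 'r) cat_map. is_functor C D F ==> inverts D F S ==>
      \<exists>G :: ('o, 'n, 'p, 'r) cat_map. is_functor L D G \<and> (\<forall>X\<in>Ob C. obj_map G X = obj_map F X) \<and> (\<forall>f\<in>Mor C. mor_map G (q f) = mor_map F f)"
  shows "universal_for C S L Q D" unfolding universal_for_def
proof (intro conjI allI impI)
  fix F :: "('o, 'm, 'e, 'p, 'r, 'l) exact_map" assume F: "exact_functor C D F \<and> inverts D F S"
  then have "is_functor C D (cat_map.truncate F)" "inverts D (cat_map.truncate F) S"
    using exact_functor_functor[of C D F] by (simp_all add: is_functor_def inverts_def cat_map.truncate_def)
  then obtain G :: "('o, 'n, 'p, 'r) cat_map" where "is_functor L D G" "\<forall>X\<in>Ob C. obj_map G X = obj_map F X" "\<forall>f\<in>Mor C. mor_map G (q f) = mor_map F f"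
    using ext[of "cat_map.truncate F"] by (auto simp: cat_map.truncate_def)
  then interpret inverting_functor C L W q mu D F G
    using D F by (intro inverting_functor.intro fraction_ext_axioms inverting_functor_axioms.intro) auto
  show "\<exists>F'. is_factorization C Q L D F F' \<and> (\<forall>F''. is_factorization C Q L D F F'' --> exact_eq L F'' F')"
    unfolding is_factorization_def using exact_functor_factor factor_q[OF Q] factor_unique[OF Q] by blast
next
  fix F G F' G' \<eta>
  assume h: "exact_functor C D F \<and> inverts D F S \<and> exact_functor C D G \<and> inverts D G S \<and>
    is_factorization C Q L D F F' \<and> is_factorization C Q L D G G' \<and> exact_nat_trans C D F G \<eta>"
  then have "exact_nat_trans L D F' G' \<eta>" unfolding is_factorization_def by (intro factor_nat_trans[OF D Q]) blast+
  then show "\<exists>\<eta>'. exact_nat_trans L D F' G' \<eta>' \<and> (\<forall>X\<in>Ob C. \<eta> X = \<eta>' (obj_map Q X)) \<and>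
      (\<forall>\<eta>''. exact_nat_trans L D F' G' \<eta>'' \<and> (\<forall>X\<in>Ob C. \<eta> X = \<eta>'' (obj_map Q X)) --> (\<forall>Y\<in>Ob L. \<eta>'' Y = \<eta>' Y))" by (intro exI[of _ \<eta>]) (simp add: Q)
qed

end

section \<open>Uniqueness of universal exact functors\<close>

lemma exact_functor_id: "exact_functor C C exact_id" by (simp add: exact_functor_def additive_functor_def is_functor_def exact_id_def Hom_iff hom_def)

lemma exact_functor_comp:
  assumes C: "category C" and F: "exact_functor C D F" and G: "exact_functor D E G"
  shows "exact_functor C E (exact_comp G F)" unfolding exact_functor_def additive_functor_def is_functor_def
proof (intro conjI allI ballI impI)
  note [simp] = exact_functor_Ob[OF F] exact_functor_Mor[OF F] exact_functor_Idt[OF F] exact_functor_ext_closed[OF F]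
    exact_functor_Ob[OF G] exact_functor_Mor[OF G] exact_functor_Idt[OF G] exact_functor_ext_closed[OF G] exact_comp_def
  show "mor_map (exact_comp G F) (g \<cdot>\<^bsub>C\<^esub> f) = mor_map (exact_comp G F) g \<cdot>\<^bsub>E\<^esub> mor_map (exact_comp G F) f"
    if "f \<in> Hom C X Y" "g \<in> Hom C Y Z" for X Y Z f g
    using that exact_functor_Cmp[OF F, of f g] exact_functor_Cmp[OF G, of "mor_map F f" "mor_map F g"] by (simp add: Hom_iff)
  show "mor_map (exact_comp G F) (Add C f g) = Add E (mor_map (exact_comp G F) f) (mor_map (exact_comp G F) g)"
    if "f \<in> Hom C X Y" "g \<in> Hom C X Y" for X Y f g
    using that exact_functor_Add[OF F, of f g] exact_functor_Add[OF G, of "mor_map F f" "mor_map F g"] by (simp add: Hom_iff)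
  show "ext_map (exact_comp G F) X A \<in> hom (Ext C X A) (Ext E (obj_map (exact_comp G F) X) (obj_map (exact_comp G F) A))"
    if "X \<in> Ob C" "A \<in> Ob C" for X A using exact_functor_ext_hom[OF F that] exact_functor_ext_hom[OF G, of "obj_map F X" "obj_map F A"] that
    unfolding hom_def by (auto simp: Pi_iff)
  show "ext_map (exact_comp G F) X' A' (ExtMap C c a \<delta>)
      = ExtMap E (mor_map (exact_comp G F) c) (mor_map (exact_comp G F) a) (ext_map (exact_comp G F) X A \<delta>)"
    if "c \<in> Hom C X' X" "a \<in> Hom C A A'" "\<delta> \<in> Exts C X A" for X X' A A' c a \<delta>
    using that exact_functor_ExtMap[OF F, of c a \<delta>] exact_functor_ExtMap[OF G, of "mor_map F c" "mor_map F a" "ext_map F X A \<delta>"]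
      category.Dom_closed[OF C] category.Cod_closed[OF C] by (auto simp: Hom_iff)
  show "s_triangle E (obj_map (exact_comp G F) A) (obj_map (exact_comp G F) B) (obj_map (exact_comp G F) X)
      (mor_map (exact_comp G F) x) (mor_map (exact_comp G F) y) (ext_map (exact_comp G F) X A \<delta>)"
    if "s_triangle C A B X x y \<delta>" for A B X x y \<delta> using exact_functor_s_triangle[OF G exact_functor_s_triangle[OF F that]] by simp
qed (auto simp: exact_comp_def Hom_iff exact_functor_Ob[OF F] exact_functor_Mor[OF F] exact_functor_Idt[OF F]
    exact_functor_Ob[OF G] exact_functor_Mor[OF G] exact_functor_Idt[OF G])

lemma exact_eq_sym: "exact_eq C F G ==> exact_eq C G F" by (simp add: exact_eq_def)

lemma exact_eq_trans: "exact_eq C F G ==> exact_eq C G H ==> exact_eq C F H" by (simp add: exact_eq_def)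

lemma exact_eq_comp_left: "exact_eq D G G' ==> exact_functor C D F ==> exact_eq C (exact_comp G F) (exact_comp G' F)"
  using exact_functor_Ob[of C D F] exact_functor_Mor[of C D F] exact_functor_ext_closed[of C D F] by (simp add: exact_eq_def exact_comp_def)

lemma exact_eq_comp_right: "exact_eq C F F' ==> exact_eq C (exact_comp G F) (exact_comp G F')" by (simp add: exact_eq_def exact_comp_def)

lemma exact_comp_assoc: "exact_comp H (exact_comp G F) = exact_comp (exact_comp H G) F" by (simp add: exact_comp_def)

lemma exact_comp_id [simp]: "exact_comp exact_id F = F" "exact_comp F exact_id = F" by (simp_all add: exact_comp_def exact_id_def)

lemma universal_factor:
  assumes "universal_for C S W Q D" "exact_functor C D F" "inverts D F S"
  shows "\<exists>G. exact_functor W D G \<and> exact_eq C F (exact_comp G Q)" using assms unfolding universal_for_def is_factorization_def by blast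

lemma universal_factor_unique:
  assumes "universal_for C S W Q D" "exact_functor C D F" "inverts D F S"
    "exact_functor W D G" "exact_eq C F (exact_comp G Q)" "exact_functor W D H" "exact_eq C F (exact_comp H Q)"
  shows "exact_eq W G H"
proof -
  obtain K where "\<forall>F''. is_factorization C Q W D F F'' --> exact_eq W F'' K" using assms(1-3) unfolding universal_for_def by blast
  then have "exact_eq W G K" "exact_eq W H K" using assms(4-) unfolding is_factorization_def by blast+
  then show ?thesis using exact_eq_sym exact_eq_trans by blast
qed

text \<open>Uniqueness of universal objects. Each functor must be universal for tests by both targets.\<close>

lemma universal_iso:
  assumes c: "category W" "category D" and Q: "exact_functor C W Q" "inverts W Q S" and F: "exact_functor C D F" "inverts D F S"
    and W: "universal_for C S W Q W" "universal_for C S W Q D" and D: "universal_for C S D F W" "universal_for C S D F D"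
  shows "\<exists>H. exact_iso W D H \<and> exact_eq C F (exact_comp H Q)"
proof -
  obtain H where H: "exact_functor W D H" "exact_eq C F (exact_comp H Q)" using universal_factor[OF W(2) F] by blast
  obtain G where G: "exact_functor D W G" "exact_eq C Q (exact_comp G F)" using universal_factor[OF D(1) Q] by blast
  have "exact_eq C Q (exact_comp (exact_comp G H) Q)" using exact_eq_trans[OF G(2) exact_eq_comp_right[OF H(2), of G]] by (simp add: exact_comp_assoc)
  then have 1: "exact_eq W (exact_comp G H) exact_id"
    by (rule universal_factor_unique[OF W(1) Q exact_functor_comp[OF c(1) H(1) G(1)] _ exact_functor_id]) (simp add: exact_eq_def)
  have "exact_eq C F (exact_comp (exact_comp H G) F)" using exact_eq_trans[OF H(2) exact_eq_comp_right[OF G(2), of H]] by (simp add: exact_comp_assoc)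
  then have 2: "exact_eq D (exact_comp H G) exact_id"
    by (rule universal_factor_unique[OF D(2) F exact_functor_comp[OF c(2) G(1) H(1)] _ exact_functor_id]) (simp add: exact_eq_def)
  show ?thesis using H G(1) 1 2 unfolding exact_iso_def by blast
qed

lemma exact_nat_trans_comp:
  assumes "exact_nat_trans W D F G \<eta>" "exact_functor V W H"
  shows "exact_nat_trans V D (exact_comp F H) (exact_comp G H) (\<lambda>X. \<eta> (obj_map H X))" unfolding exact_nat_trans_def
proof (intro conjI ballI allI)
  fix X Y f assume "f \<in> Hom V X Y"
  then have "mor_map H f \<in> Hom W (obj_map H X) (obj_map H Y)" using exact_functor_Mor[OF assms(2)] by (simp add: Hom_iff)
  then show "\<eta> (obj_map H Y) \<cdot>\<^bsub>D\<^esub> mor_map (exact_comp F H) f = mor_map (exact_comp G H) f \<cdot>\<^bsub>D\<^esub> \<eta> (obj_map H X)"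
    using assms(1) unfolding exact_nat_trans_def by (simp add: exact_comp_def)
qed (use assms(1) exact_functor_Ob[OF assms(2)] exact_functor_ext_closed[OF assms(2)] in \<open>simp_all add: exact_nat_trans_def exact_comp_def\<close>)

lemma exact_nat_trans_cong:
  assumes "exact_nat_trans W D F G \<eta>" "exact_eq W F F'" "exact_eq W G G'" and c: "category W"
  shows "exact_nat_trans W D F' G' \<eta>"
proof -
  have "Y \<in> Ob W \<and> X \<in> Ob W \<and> f \<in> Mor W" if "f \<in> Hom W X Y" for f X Y
    using that category.Dom_closed[OF c] category.Cod_closed[OF c] by (auto simp: Hom_iff)
  then show ?thesis using assms(1-3) unfolding exact_nat_trans_def exact_eq_def by auto
qed

lemma universal_transport:
  assumes V: "universal_for C S V P D" and i: "exact_iso V W H" and Q: "exact_eq C Q (exact_comp H P)"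
    and ex: "exact_functor C V P" and c: "category V" "category W"
  shows "universal_for C S W Q D"
proof -
  obtain K where H: "exact_functor V W H" and K: "exact_functor W V K"
    and KH: "exact_eq V (exact_comp K H) exact_id" and HK: "exact_eq W (exact_comp H K) exact_id" using i unfolding exact_iso_def by blast
  have P: "exact_eq C P (exact_comp K Q)" using exact_eq_trans[OF exact_eq_comp_right[OF Q, of K]] exact_eq_comp_left[OF KH ex(1)]
    by (metis exact_comp_assoc exact_comp_id(1) exact_eq_sym)
  have down: "exact_functor V D (exact_comp G H) \<and> exact_eq C F (exact_comp (exact_comp G H) P)"
    if "exact_functor W D G" "exact_eq C F (exact_comp G Q)" for F G
    using exact_functor_comp[OF c(1) H that(1)] exact_eq_trans[OF that(2) exact_eq_comp_right[OF Q, of G]] by (simp add: exact_comp_assoc)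
  have GHK: "exact_eq W (exact_comp (exact_comp G H) K) G" for G using exact_eq_comp_right[OF HK, of G] by (simp add: exact_comp_assoc)
  show ?thesis unfolding universal_for_def
  proof (intro conjI allI impI)
    fix F assume F: "exact_functor C D F \<and> inverts D F S"
    obtain G where G: "exact_functor V D G" "exact_eq C F (exact_comp G P)" using universal_factor[OF V] F by blast
    have 1: "is_factorization C Q W D F (exact_comp G K)" unfolding is_factorization_def
      using exact_functor_comp[OF c(2) K G(1)] exact_eq_trans[OF G(2) exact_eq_comp_right[OF P, of G]] by (simp add: exact_comp_assoc)
    have 2: "exact_eq W G' (exact_comp G K)" if "is_factorization C Q W D F G'" for G'
    proof -
      have d: "exact_functor V D (exact_comp G' H)" "exact_eq C F (exact_comp (exact_comp G' H) P)"
        using down that unfolding is_factorization_def by blast+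
      have "exact_eq V (exact_comp G' H) G" using universal_factor_unique[OF V _ _ d G] F by blast
      from exact_eq_comp_left[OF this K] show ?thesis using exact_eq_trans[OF exact_eq_sym[OF GHK]] by blast
    qed
    show "\<exists>F'. is_factorization C Q W D F F' \<and> (\<forall>F''. is_factorization C Q W D F F'' --> exact_eq W F'' F')" using 1 2 by blast
  next
    fix F G F' G' \<eta>
    assume h: "exact_functor C D F \<and> inverts D F S \<and> exact_functor C D G \<and> inverts D G S \<and>
      is_factorization C Q W D F F' \<and> is_factorization C Q W D G G' \<and> exact_nat_trans C D F G \<eta>"
    have f: "is_factorization C P V D F (exact_comp F' H)" "is_factorization C P V D G (exact_comp G' H)"
      using down h unfolding is_factorization_def by blast+
    have "\<exists>\<theta>. exact_nat_trans V D (exact_comp F' H) (exact_comp G' H) \<theta> \<and> (\<forall>X\<in>Ob C. \<eta> X = \<theta> (obj_map P X)) \<and>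
        (\<forall>\<eta>''. exact_nat_trans V D (exact_comp F' H) (exact_comp G' H) \<eta>'' \<and> (\<forall>X\<in>Ob C. \<eta> X = \<eta>'' (obj_map P X))
          --> (\<forall>Y\<in>Ob V. \<eta>'' Y = \<theta> Y))"
      by (rule conjunct2[OF V[unfolded universal_for_def], THEN spec, THEN spec, THEN spec, THEN spec, THEN spec, THEN mp, of F G _ _ \<eta>])
        (use f h in simp)
    then obtain \<theta> where t: "exact_nat_trans V D (exact_comp F' H) (exact_comp G' H) \<theta>" "\<forall>X\<in>Ob C. \<eta> X = \<theta> (obj_map P X)"
      and u: "\<And>\<eta>''. exact_nat_trans V D (exact_comp F' H) (exact_comp G' H) \<eta>'' ==> \<forall>X\<in>Ob C. \<eta> X = \<eta>'' (obj_map P X)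
        ==> \<forall>Y\<in>Ob V. \<eta>'' Y = \<theta> Y" by blast
    let ?t = "\<lambda>Y. \<theta> (obj_map K Y)"
    have KQ: "obj_map P X = obj_map K (obj_map Q X)" "obj_map Q X = obj_map H (obj_map P X)" if "X \<in> Ob C" for X
      using P Q that by (simp_all add: exact_eq_def exact_comp_def)
    have 1: "exact_nat_trans W D F' G' ?t" by (rule exact_nat_trans_cong[OF exact_nat_trans_comp[OF t(1) K] GHK GHK c(2)])
    have 2: "\<forall>X\<in>Ob C. \<eta> X = ?t (obj_map Q X)" using t(2) KQ(1) by simp
    have 3: "\<eta>'' Y = ?t Y" if e: "exact_nat_trans W D F' G' \<eta>''" "\<forall>X\<in>Ob C. \<eta> X = \<eta>'' (obj_map Q X)" and Y: "Y \<in> Ob W" for \<eta>'' Y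
    proof -
      have "\<forall>Z\<in>Ob V. \<eta>'' (obj_map H Z) = \<theta> Z" by (rule u[OF exact_nat_trans_comp[OF e(1) H]]) (use e(2) KQ(2) in simp)
      then have "\<eta>'' (obj_map H (obj_map K Y)) = ?t Y" using exact_functor_Ob[OF K Y] by blast
      moreover have "obj_map H (obj_map K Y) = Y" using HK Y by (simp add: exact_eq_def exact_comp_def exact_id_def)
      ultimately show ?thesis by simp
    qed
    show "\<exists>\<eta>'. exact_nat_trans W D F' G' \<eta>' \<and> (\<forall>X\<in>Ob C. \<eta> X = \<eta>' (obj_map Q X)) \<and>
        (\<forall>\<eta>''. exact_nat_trans W D F' G' \<eta>'' \<and> (\<forall>X\<in>Ob C. \<eta> X = \<eta>'' (obj_map Q X)) --> (\<forall>Y\<in>Ob W. \<eta>'' Y = \<eta>' Y))"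
      using 1 2 3 by (intro exI[of _ ?t]) blast
  qed
qed

text \<open>Inflations and deflations are preserved in both directions, so their composites can be formed in \<open>V\<close>.\<close>

lemma extriangulated_iso:
  assumes V: "extriangulated V" and W: "weakly_extriangulated W" and i: "exact_iso V W H"
  shows "extriangulated W"
proof -
  obtain K where H: "exact_functor V W H" and K: "exact_functor W V K" and HK: "exact_eq W (exact_comp H K) exact_id"
    using i unfolding exact_iso_def by blast
  interpret W: weakly_extriangulated W by fact
  interpret V: extriangulated V by fact
  have infl: "inflation W f ==> inflation V (mor_map K f)" "deflation W f ==> deflation V (mor_map K f)"
    "inflation V k ==> inflation W (mor_map H k)" "deflation V k ==> deflation W (mor_map H k)" for f k
    using exact_functor_s_triangle[OF K] exact_functor_s_triangle[OF H] unfolding inflation_def deflation_def by blast+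
  have m: "f \<in> Mor W" if "inflation W f \<or> deflation W f" for f using that unfolding inflation_def deflation_def s_triangle_def Hom_iff by blast
  have e: "mor_map H (mor_map K g \<cdot>\<^bsub>V\<^esub> mor_map K f) = g \<cdot>\<^bsub>W\<^esub> f" if "f \<in> Mor W" "g \<in> Mor W" "Cod W f = Dom W g" for f g
    using exact_functor_Cmp[OF K that, symmetric] HK that by (simp add: exact_eq_def exact_comp_def exact_id_def)
  have "inflation W (g \<cdot>\<^bsub>W\<^esub> f)" if "inflation W f" "inflation W g" "Cod W f = Dom W g" for f g
    using infl(3)[OF V.C4[OF infl(1)[OF that(1)] infl(1)[OF that(2)]]] e that m exact_functor_Mor[OF K] by simp
  moreover have "deflation W (g \<cdot>\<^bsub>W\<^esub> f)" if "deflation W f" "deflation W g" "Cod W f = Dom W g" for f g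
    using infl(4)[OF V.C4'[OF infl(2)[OF that(1)] infl(2)[OF that(2)]]] e that m exact_functor_Mor[OF K] by simp
  ultimately show ?thesis by (intro extriangulated.intro extriangulated_axioms.intro W)
qed

section \<open>The localization of an extriangulated category\<close>

lemma isomorphism_truncate: "isomorphism (cat.truncate W) f \<longleftrightarrow> isomorphism W f"
  by (simp add: isomorphism_def inverse_pair_def Hom_def cat.truncate_def)

lemma ext_localization_inverts:
  assumes "ext_localization C S W Q" "category C" "S \<subseteq> Mor C"
  shows "inverts W Q S"
proof -
  have "cat_map.truncate Q = loc_functor C S" using assms(1) by (simp add: ext_localization_def)
  from arg_cong[OF this, of mor_map] have q: "mor_map Q = mor_map (loc_functor C S)" by (simp add: cat_map.truncate_def)
  have "isomorphism (localization C S) (mor_map (loc_functor C S) s)" if "s \<in> S" for s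
    using loc_functor_inverse[OF assms(2,3) that] unfolding isomorphism_def by blast
  moreover have "cat.truncate W = localization C S" using assms(1) by (simp add: ext_localization_def)
  ultimately show ?thesis unfolding inverts_def q using isomorphism_truncate by metis
qed

context localizable
begin

sublocale loc: ideal_localization C W I L q by (rule ideal_localization_zigzag)

sublocale frac: fraction_ext C loc.loc_cat W q loc.muL by (rule loc.fraction_ext_loc_cat)

definition Q0 :: "('o, 'm, 'e, 'o, ('o, 'm) loc_mor, ('o, 'm, 'e) loc_ext) exact_map"
  where "Q0 = \<lparr>obj_map = (\<lambda>X. X), mor_map = q, ext_map = loc.muL\<rparr>"

lemma Q0_simps: "obj_map Q0 = (\<lambda>X. X)" "mor_map Q0 = q" "ext_map Q0 = loc.muL" by (simp_all add: Q0_def)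

lemma exact_functor_Q0: "exact_functor C loc.loc_cat Q0" by (rule frac.exact_functor_q[OF Q0_simps])

lemma universal_loc_cat:
  fixes D :: "('p, 'n, 'k) ext_cat"
  assumes "weakly_extriangulated D"
  shows "universal_for C S loc.loc_cat Q0 D"
proof (rule frac.universal[OF assms Q0_simps])
  interpret D: weakly_extriangulated D by fact
  fix F :: "('o, 'm, 'p, 'n) cat_map" assume F: "is_functor C D F" "inverts D F S"
  have e: "is_functor loc.loc_cat D G = is_functor L D G" for G :: "('o, ('o, 'm) loc_mor, 'p, 'n) cat_map" by (simp add: is_functor_def)
  obtain G :: "('o, ('o, 'm) loc_mor, 'p, 'n) cat_map" where "is_functor L D G"
    "\<forall>X\<in>Ob C. obj_map G (obj_map (loc_functor C S) X) = obj_map F X" "\<forall>f\<in>Mor C. mor_map G (q f) = mor_map F f"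
    using localization_universal[OF C.category_axioms S_Mor D.category_axioms F] by blast
  then show "\<exists>G :: ('o, ('o, 'm) loc_mor, 'p, 'n) cat_map. is_functor loc.loc_cat D G \<and>
      (\<forall>X\<in>Ob C. obj_map G X = obj_map F X) \<and> (\<forall>f\<in>Mor C. mor_map G (q f) = mor_map F f)" unfolding e by (intro exI[of _ G]) (simp add: loc_functor_def)
qed

theorem ext_localization_loc_cat: "ext_localization C S loc.loc_cat Q0" unfolding ext_localization_def
proof (intro conjI allI impI)
  show "cat.truncate loc.loc_cat = L" by (simp add: cat.truncate_def)
  show "cat_map.truncate Q0 = loc_functor C S" by (simp add: cat_map.truncate_def Q0_def loc_functor_def)
qed (use frac.weakly_extriangulated_L exact_functor_Q0 universal_loc_cat in blast)+

text \<open>The statement about deflations is the one about inflations for the opposite categories.\<close>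

theorem extriangulated_loc_cat:
  assumes "MR4 C S"
  shows "extriangulated loc.loc_cat"
proof -
  let ?V = "loc.loc_cat"
  let ?O = "opposite C"
  have c: "closed_under_comp B (Sbar_span C S {x. inflation C x})" "closed_under_comp B (Sbar_span C S {y. deflation C y})"
    using assms by (simp_all add: MR4_def)
  have m: "{x. inflation C x} \<subseteq> Mor C" "{y. deflation C y} \<subseteq> Mor C" unfolding inflation_def deflation_def s_triangle_def Hom_iff by blast+
  have span: "\<exists>z\<in>K. \<exists>u\<in>W. \<exists>v\<in>W. Cod C u = Dom C z \<and> Dom C v = Cod C z \<and>
      q x' \<cdot>\<^bsub>L\<^esub> q s \<cdot>\<^bsub>L\<^esub> q x = q v \<cdot>\<^bsub>L\<^esub> q z \<cdot>\<^bsub>L\<^esub> q u"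
    if K: "K \<subseteq> Mor C" "closed_under_comp B (Sbar_span C S K)"
      and x: "x \<in> K" "x' \<in> K" "s \<in> W" "Cod C x = Dom C s" "Cod C s = Dom C x'" for K x x' s
  proof -
    obtain z u v where z: "z \<in> K" "u \<in> W" "v \<in> W" "Cod C u = Dom C z" "Dom C v = Cod C z"
      and e: "q (x' \<cdot> s \<cdot> x) = q (v \<cdot> z \<cdot> u)" using span_comp[OF K x] by blast
    have n: "x \<in> Mor C" "x' \<in> Mor C" "s \<in> Mor C" "z \<in> Mor C" "u \<in> Mor C" "v \<in> Mor C" using K(1) x(1-3) z(1-3) W_Mor by blast+
    have "q (x' \<cdot> s \<cdot> x) = q x' \<cdot>\<^bsub>L\<^esub> q s \<cdot>\<^bsub>L\<^esub> q x" "q (v \<cdot> z \<cdot> u) = q v \<cdot>\<^bsub>L\<^esub> q z \<cdot>\<^bsub>L\<^esub> q u"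
      using q_Cmp[of "s \<cdot> x" x'] q_Cmp[of x s] q_Cmp[of "z \<cdot> u" v] q_Cmp[of u z] n x(4,5) z(4,5) C.Cmp_simps by metis+
    then show ?thesis using z e by metis
  qed
  have "inflation ?V (g \<cdot>\<^bsub>?V\<^esub> f)" if "inflation ?V f" "inflation ?V g" "Cod ?V f = Dom ?V g" for f g
  proof (rule frac.inflation_L_comp[OF _ that])
    fix x x' s assume "inflation C x" "inflation C x'" "s \<in> W" "Cod C x = Dom C s" "Cod C s = Dom C x'"
    then obtain z u v where z: "inflation C z" "u \<in> W" "v \<in> W" "Cod C u = Dom C z" "Dom C v = Cod C z"
      "q x' \<cdot>\<^bsub>L\<^esub> q s \<cdot>\<^bsub>L\<^esub> q x = q v \<cdot>\<^bsub>L\<^esub> q z \<cdot>\<^bsub>L\<^esub> q u" using span[OF m(1) c(1), of x x' s] by auto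
    then show "\<exists>z \<phi> \<psi>. inflation C z \<and> isomorphism ?V \<phi> \<and> isomorphism ?V \<psi> \<and> Cod ?V \<phi> = Dom C z \<and>
        Dom ?V \<psi> = Cod C z \<and> q x' \<cdot>\<^bsub>?V\<^esub> q s \<cdot>\<^bsub>?V\<^esub> q x = \<psi> \<cdot>\<^bsub>?V\<^esub> q z \<cdot>\<^bsub>?V\<^esub> \<phi>"
      using frac.q_simps frac.q_W by (intro exI[of _ z] exI[of _ "q u"] exI[of _ "q v"]) (simp del: localization_simps)
  qed
  moreover have "deflation ?V (g \<cdot>\<^bsub>?V\<^esub> f)"
    if h: "deflation ?V f" "deflation ?V g" "Cod ?V f = Dom ?V g" for f g
  proof -
    interpret o: fraction_ext "opposite C" "opposite ?V" W q "\<lambda>X A. loc.muL A X" by (rule frac.opposite_fraction_ext)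
    note io = inflation_opposite[OF C.category_axioms] inflation_opposite[OF frac.L.category_axioms]
    have "inflation (opposite ?V) (f \<cdot>\<^bsub>opposite ?V\<^esub> g)"
    proof (rule o.inflation_L_comp)
      fix x x' s assume "inflation ?O x" "inflation ?O x'" "s \<in> W"
        "Cod ?O x = Dom ?O s" "Cod ?O s = Dom ?O x'"
      then have x: "deflation C x" "deflation C x'" "s \<in> W" "Cod C x' = Dom C s" "Cod C s = Dom C x" by (simp_all add: io)
      then obtain z u v where z: "deflation C z" "u \<in> W" "v \<in> W" "Cod C u = Dom C z" "Dom C v = Cod C z"
        "q x \<cdot>\<^bsub>L\<^esub> q s \<cdot>\<^bsub>L\<^esub> q x' = q v \<cdot>\<^bsub>L\<^esub> q z \<cdot>\<^bsub>L\<^esub> q u" using span[OF m(2) c(2), of x' x s] by auto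
      have "x \<in> Mor C" "x' \<in> Mor C" "z \<in> Mor C" using x z m by auto
      then have "(q x \<cdot>\<^bsub>L\<^esub> q s) \<cdot>\<^bsub>L\<^esub> q x' = (q v \<cdot>\<^bsub>L\<^esub> q z) \<cdot>\<^bsub>L\<^esub> q u"
        using z x frac.q_simps W_Mor loc.L.Cmp_assoc_simp by (simp del: localization_simps)
      then show "\<exists>z \<phi> \<psi>. inflation ?O z \<and> isomorphism (opposite ?V) \<phi> \<and> isomorphism (opposite ?V) \<psi> \<and>
          Cod (opposite ?V) \<phi> = Dom ?O z \<and> Dom (opposite ?V) \<psi> = Cod ?O z \<and>
          q x' \<cdot>\<^bsub>opposite ?V\<^esub> q s \<cdot>\<^bsub>opposite ?V\<^esub> q x = \<psi> \<cdot>\<^bsub>opposite ?V\<^esub> q z \<cdot>\<^bsub>opposite ?V\<^esub> \<phi>"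
        using z o.q_W frac.q_simps W_Mor by (intro exI[of _ z] exI[of _ "q v"] exI[of _ "q u"]) (simp add: io del: localization_simps)
    qed (use h in \<open>simp_all add: io\<close>)
    then show ?thesis by (simp add: io)
  qed
  ultimately show ?thesis by (intro extriangulated.intro extriangulated_axioms.intro frac.weakly_extriangulated_L)
qed

end

theorem theorem3p5:
  fixes C :: "('o, 'm, 'e) ext_cat" and S :: "'m set"
  assumes "extriangulated C" and "M0 C S"
    and "MR1 C S" and "MR2 C S" and "MR3 C S"
  shows
    "(\<exists>W Q. ext_localization C S W Q) \<and>
     (\<forall>W Q. ext_localization C S W Q \<longrightarrow>
        (\<forall>D :: ('p, 'n, 'k) ext_cat. weakly_extriangulated D \<longrightarrow> universal_for C S W Q D) \<and>
        (\<forall>(D :: ('p, 'n, 'k) ext_cat) F.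
           weakly_extriangulated D \<and> exact_functor C D F \<and> inverts D F S \<and>
           (\<forall>D' :: ('p, 'n, 'k) ext_cat. weakly_extriangulated D' \<longrightarrow> universal_for C S D F D') \<and>
           (\<forall>D' :: ('o, ('o, 'm) loc_mor, ('o, 'm, 'e) loc_ext) ext_cat.
              weakly_extriangulated D' \<longrightarrow> universal_for C S D F D') \<longrightarrow>
           (\<exists>H. exact_iso W D H \<and> exact_eq C F (exact_comp H Q))) \<and>
        (MR4 C S \<longrightarrow> extriangulated W))"
proof -
  interpret C: extriangulated C by fact
  interpret localizable C S
    by (rule localizable.intro[OF C.weakly_extriangulated_axioms], rule localizable_axioms.intro) fact+
  let ?V = "loc.loc_cat"
  have V: "weakly_extriangulated ?V" by (rule frac.weakly_extriangulated_L)
  have iV: "inverts ?V Q0 S" by (rule ext_localization_inverts[OF ext_localization_loc_cat C.category_axioms S_Mor])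
  show ?thesis
  proof (intro conjI allI impI)
    show "\<exists>W Q. ext_localization C S W Q" using ext_localization_loc_cat by blast
  next
    fix W Q assume l: "ext_localization C S W Q"
    then have W: "weakly_extriangulated W" and Q: "exact_functor C W Q"
      and u: "\<And>D :: ('o, ('o, 'm) loc_mor, ('o, 'm, 'e) loc_ext) ext_cat. weakly_extriangulated D \<Longrightarrow> universal_for C S W Q D"
      by (simp_all add: ext_localization_def)
    interpret W: weakly_extriangulated W by fact
    have iW: "inverts W Q S" by (rule ext_localization_inverts[OF l C.category_axioms S_Mor])
    obtain H where H: "exact_iso ?V W H" "exact_eq C Q (exact_comp H Q0)"
      using universal_iso[OF frac.L.category_axioms W.category_axioms exact_functor_Q0 iV Q iW universal_loc_cat[OF V] universal_loc_cat[OF W] u[OF V] u[OF W]] by blast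
    show univ: "universal_for C S W Q D" if "weakly_extriangulated D" for D :: "('p, 'n, 'k) ext_cat"
      by (rule universal_transport[OF universal_loc_cat[OF that] H exact_functor_Q0 frac.L.category_axioms W.category_axioms])
    show "\<exists>H. exact_iso W D H \<and> exact_eq C F (exact_comp H Q)"
      if h: "weakly_extriangulated D \<and> exact_functor C D F \<and> inverts D F S \<and>
           (\<forall>D' :: ('p, 'n, 'k) ext_cat. weakly_extriangulated D' \<longrightarrow> universal_for C S D F D') \<and>
           (\<forall>D' :: ('o, ('o, 'm) loc_mor, ('o, 'm, 'e) loc_ext) ext_cat.
              weakly_extriangulated D' \<longrightarrow> universal_for C S D F D')" for D :: "('p, 'n, 'k) ext_cat" and F
    proof (rule universal_iso[OF W.category_axioms _ Q iW _ _ u[OF W] univ])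
      show "category D" using h weakly_extriangulated.axioms(1) biadditive_Ext.axioms(1) additive_category.axioms(1) by blast
      show "exact_functor C D F" "inverts D F S" "weakly_extriangulated D" using h by auto
      show "universal_for C S D F W" "universal_for C S D F D" using h W by blast+
    qed
    show "extriangulated W" if "MR4 C S"
      by (rule extriangulated_iso[OF extriangulated_loc_cat[OF that] W H(1)])
  qed
qed

end
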